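(* Let $\mathcal G\in\mathbf G_{\mathrm{fin}}$ be a metric graph with edge set $\mathcal E$ and vertex set $\mathcal V$, and let $p>2$. Let $(W_n),(\rho_n)\subseteq L^\infty(\mathcal G)$ be such that: (i) there exists $\bar W\in\mathbb R$ such that $|W_n(x)|\le \bar W$ for almost all $x\in\mathcal G$ and all $n\in\mathbb N$; (ii) there exists $b>0$ such that $0\le\rho_n(x)\le b$ for almost all $x\in\mathcal G$ and all $n\in\mathbb N$; (iii) there exists $a\in(0,b)$ such that for every edge $e\in\mathcal E$, either $\rho_n\ge a$ a.e. on $e$ for all $n\in\mathbb N$, or $\rho_n\equiv0$ on $e$ for all $n\in\mathbb N$. Let $(\lambda_n)\subseteq\mathbb R$ and let $(u_n)\subseteq H^1(\mathcal G)\setminus\{0\}$ be such that, for each $n$, $u_n$ is a solution of $$\begin{cases}-u_n''+W_n(x)u_n+\lambda_nu_n=\rho_n(x)|u_n|^{p-2}u_n&\text{on every edge } e\in\mathcal E,\\ u_n\text{ is continuous on }\mathcal G,\\ \sum_{e\succ v}\frac{d u_{n,e}}{dx}(v)=0&\text{at every vertex }v\in\mathcal V.\end{cases}$$ Assume that $\lim_{n\to\infty}\lambda_n=+\infty$ and that, for some constant $m^*$, the Morse indices satisfy $\mathrm m(u_n)\le m^*$ for all $n$. Then, passing if necessary to subsequences, there exist a number $m\in\{1,\dots,m^*\}$, sequences of points $(x_n^1),\dots,(x_n^m)$ in $\mathcal G$ and sequences of positive numbers $(R_n^1),\dots,(R_n^m)$ with $R_n^i\to+\infty$ for each $i$, such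 that $$\forall i\ne j,\quad \lambda_n^{1/2}\,\mathrm{dist}(x_n^i,x_n^j)\to+\infty,$$ $$\forall i,\quad |u_n(x_n^i)|=\max_{B(x_n^i,\,R_n^i\lambda_n^{-1/2})}|u_n|\to+\infty.$$ Moreover, there exists a constant $C>0$ such that, for all $n$ and all $x\in\mathcal G$, $$|u_n(x)|\le C\lambda_n^{1/(p-2)}\exp\bigl(-\tfrac12\lambda_n^{1/2}d_n(x)\bigr),\qquad\text{where } d_n(x):=\min_{1\le i\le m}\mathrm{dist}(x,x_n^i).$$ Finally, for all $q\ge1$, $$\lim_{n\to\infty}\lambda_n^{\frac12-\frac{q}{p-2}}\int_{\mathcal G}|u_n|^q\,dx\in(0,+\infty).$$
   Context: Metric graphs: $\mathcal G=(\mathcal E,\mathcal V)$ with edges $\mathcal E$ and vertices $\mathcal V$; each bounded edge $e$ is identified with an interval $[0,\ell_e]$ and each unbounded edge (half-line) with $[0,+\infty)$. $\mathbf G$ is the class of metric graphs that are connected, have at most countably many edges, all of whose vertices are adjacent to finitely many edges, and for which the infimum of the lengths of all edges is positive. $\mathbf G_{\mathrm{fin}}$ is the class of graphs in $\mathbf G$ with finitely many vertices and edges. $\mathrm{dist}$ is the shortest path distance on $\mathcal G$, and $B(x_0,r)=\{x\in\mathcal G\mid\mathrm{dist}(x,x_0)<r\}$. $u_e$ is the restriction of $u$ to the edge $e$. $H^1(\mathcal G)$ is the space of continuous $u:\mathcal G\to\mathbb R$ with $u_e\in H^1(0,\ell_e)$ for every edge (with $\ell_e=+\infty$ for half-lines)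 and $\|u\|_{H^1(\mathcal G)}^2=\sum_e(\|u_e'\|_{L^2(e)}^2+\|u_e\|_{L^2(e)}^2)<\infty$. $C_c(\mathcal G)$ is the space of continuous functions with compact support in $\mathcal G$. The notation $e\succ v$ means that the edge $e$ is incident to $v$, and $\frac{du_e}{dx}(v)$ is the derivative along $e$ at $v$ directed away from $v$ (Kirchhoff condition). Solutions are understood in the weak sense: $\int_{\mathcal G}(u_n'\varphi'+(W_n+\lambda_n)u_n\varphi)\,dx=\int_{\mathcal G}\rho_n|u_n|^{p-2}u_n\varphi\,dx$ for all $\varphi\in H^1(\mathcal G)\cap C_c(\mathcal G)$. The Morse index $\mathrm m(u_n)$ is the maximal dimension $m$ (or $+\infty$ if there is no maximal integer) of a subspace $X\subset H^1(\mathcal G)\cap C_c(\mathcal G)$ such that for all $\varphi\in X\setminus\{0\}$, $$\int_{\mathcal G}\bigl(|\varphi'|^2+(W_n+\lambda_n)\varphi^2-(p-1)\rho_n|u_n|^{p-2}\varphi^2\bigr)dx<0.$$ *)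

theory Defs
  imports "HOL-Analysis.Analysis" "HOL-Library.Function_Algebras"
begin

instantiation "fun" :: (type, real_vector) real_vector
begin

definition "scaleR c f = (\<lambda>x. c *\<^sub>R f x)"

instance
  by standard (auto simp: scaleR_fun_def fun_eq_iff algebra_simps)

end

section \<open>Metric graphs\<close>

text \<open>An edge \<open>e\<close> is parametrised by \<open>[0, len e]\<close> if its length is finite and by \<open>[0, \<infinity>)\<close>
  otherwise; \<open>src e\<close> is the vertex at \<open>0\<close> and \<open>tgt e\<close> the vertex at \<open>len e\<close>. For a half-line
  there is no second vertex and \<open>tgt e\<close> is ignored. Loops and multiple edges are allowed.\<close>

record ('v, 'e) metric_graph =
  verts :: "'v set"
  edges :: "'e set"
  src :: "'e \<Rightarrow> 'v"
  tgt :: "'e \<Rightarrow> 'v"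
  len :: "'e \<Rightarrow> ereal"

datatype ('v, 'e) gpoint = Vertex 'v | Inner 'e real

definition edge_int :: "('v, 'e) metric_graph \<Rightarrow> 'e \<Rightarrow> real set" where
  "edge_int G e = {t. 0 < t \<and> ereal t < len G e}"

definition edge_dom :: "('v, 'e) metric_graph \<Rightarrow> 'e \<Rightarrow> real set" where
  "edge_dom G e = {t. 0 \<le> t \<and> ereal t \<le> len G e}"

text \<open>\<open>pt G e t\<close> is the point of \<open>G\<close> with coordinate \<open>t\<close> on the edge \<open>e\<close>.\<close>

definition pt :: "('v, 'e) metric_graph \<Rightarrow> 'e \<Rightarrow> real \<Rightarrow> ('v, 'e) gpoint" where
  "pt G e t = (if t = 0 then Vertex (src G e)
     else if ereal t = len G e then Vertex (tgt G e) else Inner e t)"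

definition points :: "('v, 'e) metric_graph \<Rightarrow> ('v, 'e) gpoint set" where
  "points G = Vertex ` verts G \<union> {Inner e t | e t. e \<in> edges G \<and> t \<in> edge_int G e}"

definition incident :: "('v, 'e) metric_graph \<Rightarrow> 'e \<Rightarrow> 'v \<Rightarrow> bool" where
  "incident G e v \<longleftrightarrow> src G e = v \<or> (len G e < \<infinity> \<and> tgt G e = v)"

text \<open>\<open>walk G x y L\<close>: there is a path from \<open>x\<close> to \<open>y\<close> of length \<open>L\<close>, made of finitely many
  segments each of which lies on one edge.\<close>

inductive walk :: "('v, 'e) metric_graph \<Rightarrow> ('v, 'e) gpoint \<Rightarrow> ('v, 'e) gpoint \<Rightarrow> real \<Rightarrow> bool"
  for G where
  walk_refl: "x \<in> points G \<Longrightarrow> walk G x x 0"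
| walk_step: "walk G x (pt G e s) L \<Longrightarrow> e \<in> edges G \<Longrightarrow> s \<in> edge_dom G e \<Longrightarrow> t \<in> edge_dom G e
    \<Longrightarrow> walk G x (pt G e t) (L + \<bar>t - s\<bar>)"

text \<open>The value \<open>0\<close> outside \<open>points G\<close> is only there because the locale \<open>Metric_space\<close> asks
  for non-negativity on the whole type.\<close>

definition gdist :: "('v, 'e) metric_graph \<Rightarrow> ('v, 'e) gpoint \<Rightarrow> ('v, 'e) gpoint \<Rightarrow> real" where
  "gdist G x y = (if x \<in> points G \<and> y \<in> points G then Inf {L. walk G x y L} else 0)"

definition is_metric_graph :: "('v, 'e) metric_graph \<Rightarrow> bool" where
  "is_metric_graph G \<longleftrightarrow> edges G \<noteq> {} \<and>
     (\<forall>e\<in>edges G. 0 < len G e \<and> src G e \<in> verts G \<and> (len G e < \<infinity> \<longrightarrow> tgt G e \<in> verts G))"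

definition class_G :: "('v, 'e) metric_graph \<Rightarrow> bool" where
  "class_G G \<longleftrightarrow> is_metric_graph G
     \<and> (\<forall>x\<in>points G. \<forall>y\<in>points G. \<exists>L. walk G x y L)
     \<and> countable (edges G)
     \<and> (\<forall>v\<in>verts G. finite {e \<in> edges G. incident G e v})
     \<and> 0 < (INF e\<in>edges G. len G e)"

definition class_G_fin :: "('v, 'e) metric_graph \<Rightarrow> bool" where
  "class_G_fin G \<longleftrightarrow> class_G G \<and> finite (verts G) \<and> finite (edges G)"

abbreviation gball :: "('v, 'e) metric_graph \<Rightarrow> ('v, 'e) gpoint \<Rightarrow> real \<Rightarrow> ('v, 'e) gpoint set" where
  "gball G \<equiv> Metric_space.mball (points G) (gdist G)"

abbreviation gtopology :: "('v, 'e) metric_graph \<Rightarrow> ('v, 'e) gpoint topology" where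
  "gtopology G \<equiv> Metric_space.mtopology (points G) (gdist G)"

subsection \<open>The path distance is a metric\<close>

lemma pt_in_points:
  assumes "is_metric_graph G" "e \<in> edges G" "t \<in> edge_dom G e"
  shows "pt G e t \<in> points G"
  using assms
  by (auto simp: pt_def points_def is_metric_graph_def edge_dom_def edge_int_def order_less_le)

lemma walk_nonneg: "walk G x y L \<Longrightarrow> 0 \<le> L"
  by (induction rule: walk.induct) auto

lemma walk_points: "walk G x y L \<Longrightarrow> is_metric_graph G \<Longrightarrow> x \<in> points G \<and> y \<in> points G"
  by (induction rule: walk.induct) (auto intro: pt_in_points)

lemma walk_trans: "walk G y z M \<Longrightarrow> walk G x y L \<Longrightarrow> walk G x z (L + M)"
proof (induction arbitrary: L rule: walk.induct)
  case (walk_step y e s M t)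
  then show ?case
    using walk.walk_step[of G x e s "L + M" t] by (simp add: add.assoc)
qed simp

lemma walk_sym: "walk G x y L \<Longrightarrow> is_metric_graph G \<Longrightarrow> walk G y x L"
proof (induction rule: walk.induct)
  case (walk_step x e s L t)
  have "walk G (pt G e t) (pt G e s) (0 + \<bar>s - t\<bar>)"
    using walk_step by (intro walk.walk_step walk.walk_refl pt_in_points) auto
  from walk_trans[OF _ this, of x L] walk_step show ?case
    by (simp add: abs_minus_commute add.commute)
qed (simp add: walk.walk_refl)

lemma walk_lipschitz:
  assumes "walk G x y L"
    and "\<And>e s t. e \<in> edges G \<Longrightarrow> s \<in> edge_dom G e \<Longrightarrow> t \<in> edge_dom G e
           \<Longrightarrow> \<bar>f (pt G e t) - f (pt G e s)\<bar> \<le> \<bar>t - s\<bar>"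
  shows "\<bar>f y - f x\<bar> \<le> (L::real)"
  using assms(1)
proof (induction rule: walk.induct)
  case (walk_step x e s L t)
  then show ?case using assms(2)[of e s t] by linarith
qed simp

lemma Metric_space_gdist:
  assumes "class_G G"
  shows "Metric_space (points G) (gdist G)"
proof -
  have G: "is_metric_graph G" and conn: "\<And>x y. x \<in> points G \<Longrightarrow> y \<in> points G \<Longrightarrow> {L. walk G x y L} \<noteq> {}"
    and inf: "0 < (INF e\<in>edges G. len G e)"
    using assms by (auto simp: class_G_def)
  have bdd: "bdd_below {L. walk G x y L}" for x y
    by (rule bdd_belowI[of _ 0]) (auto intro: walk_nonneg)
  have gdist: "gdist G x y = Inf {L. walk G x y L}" if "x \<in> points G" "y \<in> points G" for x y
    using that by (simp add: gdist_def)
  have nonneg: "0 \<le> gdist G x y" for x y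
    unfolding gdist_def using conn by (auto intro!: cInf_greatest intro: walk_nonneg)
  have sym: "walk G x y L \<longleftrightarrow> walk G y x L" for x y L
    using walk_sym G by blast
  have self: "gdist G x x = 0" if "x \<in> points G" for x
    using nonneg[of x x] cInf_lower[OF _ bdd, of 0 x x] walk_refl[OF that]
    by (force simp: gdist that)
  have tri: "gdist G x z \<le> gdist G x y + gdist G y z"
    if p: "x \<in> points G" "y \<in> points G" "z \<in> points G" for x y z
  proof (rule field_le_epsilon)
    fix e :: real assume "0 < e"
    obtain L where L: "walk G x y L" "L < gdist G x y + e/2"
      using cInf_lessD[OF conn[OF p(1,2)], of "gdist G x y + e/2"] \<open>0 < e\<close>
      using p by (auto simp: gdist)
    obtain M where M: "walk G y z M" "M < gdist G y z + e/2"
      using cInf_lessD[OF conn[OF p(2,3)], of "gdist G y z + e/2"] \<open>0 < e\<close>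
      using p by (auto simp: gdist)
    have "gdist G x z \<le> L + M"
      unfolding gdist[OF p(1,3)] by (rule cInf_lower[OF _ bdd]) (use walk_trans[OF M(1) L(1)] in simp)
    then show "gdist G x z \<le> gdist G x y + gdist G y z + e" using L M by simp
  qed
  have sep: "0 < gdist G x y" if xy: "x \<in> points G" "y \<in> points G" "x \<noteq> y" for x y
  proof -
    have "\<exists>f::('a, 'b) gpoint \<Rightarrow> real. f x = 0 \<and> 0 < f y \<and>
       (\<forall>e s t. e \<in> edges G \<longrightarrow> s \<in> edge_dom G e \<longrightarrow> t \<in> edge_dom G e
           \<longrightarrow> \<bar>f (pt G e t) - f (pt G e s)\<bar> \<le> \<bar>t - s\<bar>)"
    proof (cases x)
      case (Vertex v)
      obtain d where d: "0 < d" "ereal d < (INF e\<in>edges G. len G e)"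
        using ereal_dense2[OF inf] by auto
      have le: "ereal d < len G e" if "e \<in> edges G" for e
        using d(2) INF_lower[OF that, of "len G"] by (meson less_le_trans)
      define h where "h e t = min d (min (if src G e = v then t else d)
         (if len G e < \<infinity> \<and> tgt G e = v then real_of_ereal (len G e) - t else d))" for e t
      define f where "f z = (case z of Vertex w \<Rightarrow> if w = v then 0 else d | Inner e t \<Rightarrow> h e t)" for z
      have fh: "f (pt G e t) = h e t" if "e \<in> edges G" "t \<in> edge_dom G e" for e t
        using le[OF that(1)] that(2) \<open>0 < d\<close>
        by (cases "len G e") (auto simp: f_def h_def pt_def edge_dom_def)
      have "t < real_of_ereal (len G e)" if "t \<in> edge_int G e" "len G e \<noteq> \<infinity>" for e t
        using that by (cases "len G e") (auto simp: edge_int_def)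
      then have "0 < f y"
        using xy Vertex \<open>0 < d\<close>
        by (cases y) (auto simp: f_def h_def points_def edge_int_def)
      moreover have "\<bar>h e t - h e s\<bar> \<le> \<bar>t - s\<bar>" for e t s
        unfolding h_def by (auto simp: min_def)
      ultimately show ?thesis
        using fh Vertex by (intro exI[of _ f]) (auto simp: f_def)
    next
      case (Inner e0 t0)
      then have e0: "e0 \<in> edges G" and t0: "0 < t0" "ereal t0 < len G e0"
        using xy by (auto simp: points_def edge_int_def)
      define c where "c = (if len G e0 = \<infinity> then t0 else min t0 (real_of_ereal (len G e0) - t0))"
      have c: "0 < c" "c \<le> t0" and c': "\<And>r. len G e0 = ereal r \<Longrightarrow> c \<le> r - t0"
        using t0 by (cases "len G e0"; auto simp: c_def)+
      define f where "f z = (case z of Vertex w \<Rightarrow> c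
         | Inner e t \<Rightarrow> if e = e0 then min c \<bar>t - t0\<bar> else c)" for z :: "('a, 'b) gpoint"
      have f0: "f (pt G e0 t) = min c \<bar>t - t0\<bar>" if "t \<in> edge_dom G e0" for t
        using c c'[of t] t0 that by (auto simp: f_def pt_def edge_dom_def)
      have f1: "f (pt G e t) = c" if "e \<noteq> e0" for e t
        using that by (auto simp: f_def pt_def)
      have "\<bar>f (pt G e t) - f (pt G e s)\<bar> \<le> \<bar>t - s\<bar>"
        if "s \<in> edge_dom G e" "t \<in> edge_dom G e" for e s t
        using that f0 f1 by (cases "e = e0") (auto simp: min_def)
      moreover have "0 < f y"
        using xy Inner c by (cases y) (auto simp: f_def)
      ultimately show ?thesis
        using Inner c by (intro exI[of _ f]) (auto simp: f_def)
    qed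
    then obtain f :: "('a, 'b) gpoint \<Rightarrow> real" where f: "f x = 0" "0 < f y"
      and lip: "\<And>e s t. e \<in> edges G \<Longrightarrow> s \<in> edge_dom G e \<Longrightarrow> t \<in> edge_dom G e
           \<Longrightarrow> \<bar>f (pt G e t) - f (pt G e s)\<bar> \<le> \<bar>t - s\<bar>"
      by blast
    have "f y \<le> gdist G x y"
      unfolding gdist[OF xy(1,2)]
      using walk_lipschitz[where f = f, OF _ lip] f conn[OF xy(1,2)]
      by (intro cInf_greatest) fastforce+
    with f show ?thesis by simp
  qed
  show ?thesis
  proof
    show "gdist G x y = 0 \<longleftrightarrow> x = y" if "x \<in> points G" "y \<in> points G" for x y
      using self sep that by (metis less_irrefl)
  qed (use nonneg tri in \<open>auto simp: gdist_def sym\<close>)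
qed

section \<open>Function spaces\<close>

text \<open>The Sobolev space on an open interval \<open>I\<close>, with weak derivatives tested against
  \<open>C\<^sup>1\<close> functions with compact support in \<open>I\<close>.\<close>

definition C1c :: "real set \<Rightarrow> (real \<Rightarrow> real) set" where
  "C1c I = {\<phi>. (\<forall>t. \<phi> differentiable (at t)) \<and> continuous_on UNIV (deriv \<phi>)
     \<and> compact (closure {t. \<phi> t \<noteq> 0}) \<and> closure {t. \<phi> t \<noteq> 0} \<subseteq> I}"

definition L2_on :: "real set \<Rightarrow> (real \<Rightarrow> real) set" where
  "L2_on I = {f. set_borel_measurable lebesgue I f \<and> set_integrable lebesgue I (\<lambda>t. (f t)\<^sup>2)}"

definition is_weak_deriv :: "real set \<Rightarrow> (real \<Rightarrow> real) \<Rightarrow> (real \<Rightarrow> real) \<Rightarrow> bool" where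
  "is_weak_deriv I f g \<longleftrightarrow>
     (\<forall>\<phi>\<in>C1c I. (LINT t:I|lebesgue. f t * deriv \<phi> t) = - (LINT t:I|lebesgue. g t * \<phi> t))"

definition H1_on :: "real set \<Rightarrow> (real \<Rightarrow> real) set" where
  "H1_on I = {f \<in> L2_on I. \<exists>g\<in>L2_on I. is_weak_deriv I f g}"

definition wderiv :: "real set \<Rightarrow> (real \<Rightarrow> real) \<Rightarrow> real \<Rightarrow> real" where
  "wderiv I f = (SOME g. g \<in> L2_on I \<and> is_weak_deriv I f g)"

text \<open>Functions on \<open>G\<close> are functions on points; \<open>on_edge G u e\<close> is the restriction \<open>u\<^sub>e\<close> in the
  coordinate of \<open>e\<close>. Since the vertices form a null set, measure theory on \<open>G\<close> is Lebesgue
  measure on the open edges.\<close>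

definition on_edge :: "('v, 'e) metric_graph \<Rightarrow> (('v, 'e) gpoint \<Rightarrow> real) \<Rightarrow> 'e \<Rightarrow> real \<Rightarrow> real" where
  "on_edge G u e = (\<lambda>t. u (pt G e t))"

definition AE_edge :: "('v, 'e) metric_graph \<Rightarrow> 'e \<Rightarrow> (('v, 'e) gpoint \<Rightarrow> bool) \<Rightarrow> bool" where
  "AE_edge G e P \<longleftrightarrow> (AE t in lebesgue. t \<in> edge_int G e \<longrightarrow> P (pt G e t))"

definition AE_graph :: "('v, 'e) metric_graph \<Rightarrow> (('v, 'e) gpoint \<Rightarrow> bool) \<Rightarrow> bool" where
  "AE_graph G P \<longleftrightarrow> (\<forall>e\<in>edges G. AE_edge G e P)"

definition Linf :: "('v, 'e) metric_graph \<Rightarrow> (('v, 'e) gpoint \<Rightarrow> real) set" where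
  "Linf G = {f. (\<forall>e\<in>edges G. set_borel_measurable lebesgue (edge_int G e) (on_edge G f e))
     \<and> (\<exists>C. AE_graph G (\<lambda>x. \<bar>f x\<bar> \<le> C))}"

text \<open>Integration over \<open>G\<close> of a family of functions on the edges (a family rather than a
  function on \<open>G\<close>, so that \<open>u'\<close> can occur in the integrand).\<close>

definition gintegrable :: "('v, 'e) metric_graph \<Rightarrow> ('e \<Rightarrow> real \<Rightarrow> real) \<Rightarrow> bool" where
  "gintegrable G F \<longleftrightarrow> (\<forall>e\<in>edges G. set_integrable lebesgue (edge_int G e) (F e))
     \<and> (\<lambda>e. LINT t:edge_int G e|lebesgue. \<bar>F e t\<bar>) summable_on edges G"

definition gintegral :: "('v, 'e) metric_graph \<Rightarrow> ('e \<Rightarrow> real \<Rightarrow> real) \<Rightarrow> real" where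
  "gintegral G F = (\<Sum>\<^sub>\<infinity>e\<in>edges G. LINT t:edge_int G e|lebesgue. F e t)"

definition gderiv :: "('v, 'e) metric_graph \<Rightarrow> (('v, 'e) gpoint \<Rightarrow> real) \<Rightarrow> 'e \<Rightarrow> real \<Rightarrow> real" where
  "gderiv G u e = wderiv (edge_int G e) (on_edge G u e)"

text \<open>A function \<open>G \<rightarrow> \<real>\<close> is represented by its extension by \<open>0\<close> outside \<open>points G\<close>, so that
  equality and the vector space structure are those of the function type.\<close>

definition H1 :: "('v, 'e) metric_graph \<Rightarrow> (('v, 'e) gpoint \<Rightarrow> real) set" where
  "H1 G = {u. (\<forall>x. x \<notin> points G \<longrightarrow> u x = 0)
     \<and> continuous_map (gtopology G) euclideanreal u
     \<and> (\<forall>e\<in>edges G. on_edge G u e \<in> H1_on (edge_int G e))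
     \<and> gintegrable G (\<lambda>e t. (gderiv G u e t)\<^sup>2 + (on_edge G u e t)\<^sup>2)}"

definition Cc :: "('v, 'e) metric_graph \<Rightarrow> (('v, 'e) gpoint \<Rightarrow> real) set" where
  "Cc G = {u. (\<forall>x. x \<notin> points G \<longrightarrow> u x = 0)
     \<and> continuous_map (gtopology G) euclideanreal u
     \<and> compactin (gtopology G) (gtopology G closure_of {x \<in> points G. u x \<noteq> 0})}"

section \<open>The equation and the Morse index\<close>

text \<open>Weak form of \<open>- u'' + W u + lam u = \<rho> |u|\<^sup>p\<^sup>-\<^sup>2 u\<close> with continuity and the Kirchhoff
  condition at the vertices.\<close>

definition weak_solution :: "('v, 'e) metric_graph \<Rightarrow> real \<Rightarrow> (('v, 'e) gpoint \<Rightarrow> real) \<Rightarrow>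
    (('v, 'e) gpoint \<Rightarrow> real) \<Rightarrow> real \<Rightarrow> (('v, 'e) gpoint \<Rightarrow> real) \<Rightarrow> bool" where
  "weak_solution G p W \<rho> lam u \<longleftrightarrow> u \<in> H1 G \<and>
     (\<forall>\<phi>\<in>H1 G \<inter> Cc G.
        gintegral G (\<lambda>e t. gderiv G u e t * gderiv G \<phi> e t
            + (on_edge G W e t + lam) * on_edge G u e t * on_edge G \<phi> e t)
      = gintegral G (\<lambda>e t. on_edge G \<rho> e t * \<bar>on_edge G u e t\<bar> powr (p - 2)
            * on_edge G u e t * on_edge G \<phi> e t))"

definition morse_form :: "('v, 'e) metric_graph \<Rightarrow> real \<Rightarrow> (('v, 'e) gpoint \<Rightarrow> real) \<Rightarrow>
    (('v, 'e) gpoint \<Rightarrow> real) \<Rightarrow> real \<Rightarrow> (('v, 'e) gpoint \<Rightarrow> real) \<Rightarrow>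
    (('v, 'e) gpoint \<Rightarrow> real) \<Rightarrow> real" where
  "morse_form G p W \<rho> lam u \<phi> =
     gintegral G (\<lambda>e t. (gderiv G \<phi> e t)\<^sup>2 + (on_edge G W e t + lam) * (on_edge G \<phi> e t)\<^sup>2
        - (p - 1) * on_edge G \<rho> e t * \<bar>on_edge G u e t\<bar> powr (p - 2) * (on_edge G \<phi> e t)\<^sup>2)"

text \<open>The dimension \<open>m\<close> of \<open>X\<close> is expressed by a basis \<open>B\<close>, because \<open>dim\<close> is \<open>0\<close> on
  infinite-dimensional spaces. Such spaces need not be listed: they have subspaces of every
  finite dimension, which makes the supremum \<open>\<infinity>\<close>.\<close>

definition morse_index :: "('v, 'e) metric_graph \<Rightarrow> real \<Rightarrow> (('v, 'e) gpoint \<Rightarrow> real) \<Rightarrow>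
    (('v, 'e) gpoint \<Rightarrow> real) \<Rightarrow> real \<Rightarrow> (('v, 'e) gpoint \<Rightarrow> real) \<Rightarrow> enat" where
  "morse_index G p W \<rho> lam u = Sup {enat m | m. \<exists>X B. subspace X \<and> X \<subseteq> H1 G \<inter> Cc G
     \<and> finite B \<and> independent B \<and> span B = X \<and> card B = m
     \<and> (\<forall>\<phi>\<in>X - {0}. morse_form G p W \<rho> lam u \<phi> < 0)}"

end

theory Submission
  imports Defs "HOL-Real_Asymp.Real_Asymp" "HOL-Complex_Analysis.Great_Picard"
begin

text \<open>
  The argument is variational; no blow-up limit is taken. Write \<open>\<lambda>\<close> for \<open>\<lambda>\<^sub>n\<close> and \<open>u\<close> for \<open>u\<^sub>n\<close>. If \<open>\<lambda>\<close> were
  negligible against \<open>(sup |u|) powr (p - 2)\<close>, then \<open>u\<close>, rescaled near an almost maximal point on an edge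
  with \<open>\<rho> \<ge> a\<close>, would be a oscillation with many zeros, and each nodal piece is a
  direction in which the quadratic form is negative, contradicting the bound on the Morse index. On edges
  with \<open>\<rho> = 0\<close> a maximum principle takes over. Hence \<open>|u| \<le> M \<lambda> powr (1 / (p - 2))\<close>.

  A point where \<open>|u| \<ge> \<delta> \<lambda> powr (1 / (p - 2))\<close> yields a negative direction \<open>u \<eta>\<close>, where \<open>\<eta>\<close> is an exponential
  of the distance cut off at scale \<open>1 / sqrt \<lambda>\<close>. Directions belonging to well separated points have
  disjoint supports, so a maximal family of peaks whose rescaled distances diverge has at most \<open>m\<^sup>*\<close>
  members, and every such point lies within distance \<open>K / sqrt \<lambda>\<close> of one of them. Moving each peak to a
  nearby maximum gives the points \<open>x\<^sub>n\<^sup>i\<close>.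

  Away from the peaks the effective potential is at least a multiple of \<open>\<lambda>\<close>. Testing with \<open>u \<eta>\<^sup>2\<close> for the
  Agmon-type weight \<open>\<eta> = 1 / (\<kappa> + (\<Sum>i. exp (- sqrt \<lambda> dist(x\<^sub>n\<^sup>i, \<cdot>) / 2)))\<close> and letting \<open>\<kappa> \<rightarrow> 0\<close> gives the
  exponential decay. The decay makes the rescaled \<open>L\<^sup>q\<close> integrals bounded and equi-Lipschitz in \<open>q\<close>, so a
  diagonal subsequence makes them converge for all \<open>q \<ge> 1\<close>; the lower bound for \<open>q = p\<close>, which comes from
  the equation, interpolates to all \<open>q\<close> and keeps the limits positive.
\<close>

section \<open>Sobolev functions on an open interval\<close>

text \<open>The coefficients vary with \<open>n\<close> without converging, so each estimate
  concerns a single solution, with constants depending only on the graph, \<open>p\<close>,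
  \<open>a\<close>, \<open>b\<close>, \<open>Wbar\<close> and the Morse bound. They are only
  bounded, so \<open>u''\<close> exists merely almost everywhere; the equation is used as a formula
  for increments of \<open>u'\<close> on edges and as a weak identity for \<open>u\<close> times a
  weight, where the vertex conditions need no unfolding. Energy bounds become pointwise by a Sobolev
  inequality at the length scale \<open>1 / sqrt \<lambda>\<close>; edges must be longer than
  \<open>2 / sqrt \<lambda>\<close>, which the positive infimum of the lengths provides for large
  \<open>\<lambda>\<close>.

  The decay rate 1/2 is a budget: below the height from which peaks are counted the effective
  potential is at least \<open>\<lambda> / 2\<close>; a weight with logarithmic derivative at most
  \<open>sqrt \<lambda> / 2\<close> spends \<open>\<lambda> / 4\<close>, and
  \<open>\<lambda> / 4\<close> is left for the Sobolev inequality. Normalised to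
  \<open>[0, 1]\<close>, \<open>|u|\<close> has a power 1/2 that still decays integrably, and this
  one integral dominates all powers \<open>q \<ge> 1\<close>.\<close>

lemma set_borel_measurable_lebesgue_on:
  fixes f :: "real \<Rightarrow> real"
  shows "I \<in> sets lebesgue \<Longrightarrow> set_borel_measurable lebesgue I f \<longleftrightarrow> f \<in> borel_measurable (lebesgue_on I)"
  unfolding set_borel_measurable_def by (subst borel_measurable_restrict_space_iff[of I lebesgue]) (simp_all add: mult.commute)

lemma set_integrable_lebesgue_on:
  fixes f :: "real \<Rightarrow> real"
  shows "I \<in> sets lebesgue \<Longrightarrow> set_integrable lebesgue I f \<longleftrightarrow> integrable (lebesgue_on I) f"
  by (simp add: set_integrable_eq)

lemma set_integral_lebesgue_on:
  fixes f :: "real \<Rightarrow> real"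
  shows "I \<in> sets lebesgue \<Longrightarrow> (LINT t:I|lebesgue. f t) = integral\<^sup>L (lebesgue_on I) f"
  unfolding set_lebesgue_integral_def by (subst integral_restrict_space) auto

lemma AE_lebesgue_on:
  "I \<in> sets lebesgue \<Longrightarrow> (AE t in lebesgue. t \<in> I \<longrightarrow> P t) \<longleftrightarrow> (AE t in lebesgue_on I. P t)"
  by (simp add: AE_restrict_space_iff)

lemma L2_on_lebesgue_on:
  assumes "I \<in> sets lebesgue"
  shows "f \<in> L2_on I \<longleftrightarrow> f \<in> borel_measurable (lebesgue_on I) \<and> integrable (lebesgue_on I) (\<lambda>t. (f t)\<^sup>2)"
  unfolding L2_on_def using assms
  by (simp add: set_borel_measurable_lebesgue_on set_integrable_lebesgue_on)

lemma L2_on_mult_integrable: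
  assumes I: "I \<in> sets lebesgue" and "f \<in> L2_on I" "g \<in> L2_on I"
  shows "integrable (lebesgue_on I) (\<lambda>t. f t * g t)"
proof -
  have [measurable]: "f \<in> borel_measurable (lebesgue_on I)" "g \<in> borel_measurable (lebesgue_on I)"
    and i: "integrable (lebesgue_on I) (\<lambda>t. (f t)\<^sup>2)" "integrable (lebesgue_on I) (\<lambda>t. (g t)\<^sup>2)"
    using assms by (auto simp: L2_on_lebesgue_on)
  have "\<bar>x * y\<bar> \<le> x\<^sup>2 + y\<^sup>2" for x y :: real
  proof -
    have "0 \<le> \<bar>x\<bar> * \<bar>y\<bar>" by simp
    then show ?thesis using sum_squares_bound[of "\<bar>x\<bar>" "\<bar>y\<bar>"] unfolding abs_mult power2_abs by linarith
  qed
  then show ?thesis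
    by (intro Bochner_Integration.integrable_bound[OF Bochner_Integration.integrable_add[OF i]]) auto
qed

lemma L2_on_add:
  assumes I: "I \<in> sets lebesgue" and "f \<in> L2_on I" "g \<in> L2_on I"
  shows "(\<lambda>t. f t + g t) \<in> L2_on I"
  using assms L2_on_mult_integrable[OF assms]
  by (auto simp: L2_on_lebesgue_on power2_sum mult.assoc intro!: Bochner_Integration.integrable_add)

lemma L2_on_bounded_mult:
  assumes I: "I \<in> sets lebesgue" and f: "f \<in> L2_on I" and h: "h \<in> borel_measurable (lebesgue_on I)"
    and C: "AE t in lebesgue_on I. \<bar>h t\<bar> \<le> C"
  shows "(\<lambda>t. f t * h t) \<in> L2_on I"
proof -
  have m: "f \<in> borel_measurable (lebesgue_on I)" and i: "integrable (lebesgue_on I) (\<lambda>t. C\<^sup>2 * (f t)\<^sup>2)"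
    using assms by (auto simp: L2_on_lebesgue_on)
  note [measurable] = m h
  have "integrable (lebesgue_on I) (\<lambda>t. (f t * h t)\<^sup>2)"
    using C by (intro Bochner_Integration.integrable_bound[OF i])
      (auto simp: power_mult_distrib mult.commute[of "C\<^sup>2"] elim!: eventually_mono intro!: mult_left_mono abs_le_square_iff[THEN iffD1])
  then show ?thesis using I by (auto simp: L2_on_lebesgue_on)
qed

lemma L2_on_cmult: "I \<in> sets lebesgue \<Longrightarrow> f \<in> L2_on I \<Longrightarrow> (\<lambda>t. c * f t) \<in> L2_on I"
  by (auto simp: L2_on_lebesgue_on power_mult_distrib)

lemma L2_on_zero: "I \<in> sets lebesgue \<Longrightarrow> (\<lambda>t. 0) \<in> L2_on I"
  by (auto simp: L2_on_lebesgue_on)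

lemma L2_on_sum:
  assumes "I \<in> sets lebesgue" "\<And>i. i \<in> A \<Longrightarrow> f i \<in> L2_on I"
  shows "(\<lambda>t. \<Sum>i\<in>A. f i t) \<in> L2_on I"
  using assms(2)
  by (induction A rule: infinite_finite_induct) (auto intro: L2_on_add[OF assms(1)] L2_on_zero[OF assms(1)])

lemma L2_on_cong:
  "(\<And>t. t \<in> I \<Longrightarrow> f t = g t) \<Longrightarrow> f \<in> L2_on I \<longleftrightarrow> g \<in> L2_on I"
proof -
  assume "\<And>t. t \<in> I \<Longrightarrow> f t = g t"
  then have "(\<lambda>t. indicator I t *\<^sub>R f t) = (\<lambda>t. indicator I t *\<^sub>R g t)"
    "(\<lambda>t. indicator I t *\<^sub>R (f t)\<^sup>2) = (\<lambda>t. indicator I t *\<^sub>R (g t)\<^sup>2)"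
    by (auto simp: fun_eq_iff indicator_def)
  then show ?thesis
    by (simp add: L2_on_def set_borel_measurable_def set_integrable_def)
qed

lemma set_integral_support:
  fixes F :: "real \<Rightarrow> real"
  assumes "J \<subseteq> I" "\<And>t. t \<in> I - J \<Longrightarrow> F t = 0"
  shows "(LINT t:I|lebesgue. F t) = (LINT t:J|lebesgue. F t)"
  unfolding set_lebesgue_integral_def
  by (rule Bochner_Integration.integral_cong) (use assms in \<open>auto simp: indicator_def\<close>)

text \<open>Square integrability becomes integrability by multiplying with the constant 1, which is
  square integrable because \<open>{s..t}\<close> is bounded.\<close>

lemma L2_on_absolutely_integrable:
  assumes I: "I \<in> sets lebesgue" and g: "g \<in> L2_on I" and st: "{s..t} \<subseteq> I"
  shows "g absolutely_integrable_on {s..t}"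
proof -
  have J: "{s..t} \<in> sets lebesgue" by simp
  have "g \<in> borel_measurable (lebesgue_on {s..t})" 
    using g I st by (auto simp: L2_on_lebesgue_on intro: measurable_restrict_mono)
  moreover have "set_integrable lebesgue {s..t} (\<lambda>r. (g r)\<^sup>2)"
    using g st by (auto simp: L2_on_def intro: set_integrable_subset)
  ultimately have "g \<in> L2_on {s..t}"
    by (simp add: L2_on_lebesgue_on[OF J] set_integrable_lebesgue_on[OF J])
  moreover have "(\<lambda>r. 1) \<in> L2_on {s..t}"
    by (simp add: L2_on_lebesgue_on[OF J])
  ultimately have "integrable (lebesgue_on {s..t}) (\<lambda>r. g r * 1)"
    by (rule L2_on_mult_integrable[OF J])
  then show ?thesis by (simp add: set_integrable_lebesgue_on[OF J])
qed

section \<open>Cut-offs built from squared positive parts\<close>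

lemma has_derivative_sqr_pos_part:
  "((\<lambda>x::real. (max 0 x)\<^sup>2 / 2) has_real_derivative max 0 x) (at x)"
proof (cases "x = 0")
  case True
  have "((\<lambda>y. (max 0 y)\<^sup>2 / 2 / y) \<longlongrightarrow> 0) (at (0::real))"
  proof (rule Lim_null_comparison)
    show "\<forall>\<^sub>F y in at (0::real). norm ((max 0 y)\<^sup>2 / 2 / y) \<le> \<bar>y\<bar>"
      by (rule always_eventually) (auto simp: max_def power2_eq_square)
    show "((\<lambda>y. \<bar>y\<bar>) \<longlongrightarrow> 0) (at (0::real))" by (auto intro!: tendsto_eq_intros)
  qed
  then show ?thesis using True by (simp add: has_field_derivative_iff)
next
  case False
  then consider "x > 0" | "x < 0" by linarith
  then show ?thesis
  proof cases
    case 1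
    have "((\<lambda>x::real. x\<^sup>2 / 2) has_real_derivative x) (at x)"
      by (auto intro!: derivative_eq_intros)
    then have "((\<lambda>x::real. (max 0 x)\<^sup>2 / 2) has_real_derivative x) (at x)"
      by (rule has_field_derivative_transform_within_open[where S="{0<..}"]) (use 1 in auto)
    then show ?thesis using 1 by simp
  next
    case 2
    have "((\<lambda>x::real. 0) has_real_derivative 0) (at x)" by simp
    then have "((\<lambda>x::real. (max 0 x)\<^sup>2 / 2) has_real_derivative 0) (at x)"
      by (rule has_field_derivative_transform_within_open[where S="{..<0}"]) (use 2 in auto)
    then show ?thesis using 2 by simp
  qed
qed

text \<open>A \<open>C\<^sup>1\<close> transition from \<open>0\<close> on \<open>(-\<infinity>, 0]\<close> to \<open>1\<close> on \<open>[2, \<infinity>)\<close>, whose derivative is a tent.\<close>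

definition ramp :: "real \<Rightarrow> real" where
  "ramp x = (max 0 x)\<^sup>2 / 2 - 2 * ((max 0 (x - 1))\<^sup>2 / 2) + (max 0 (x - 2))\<^sup>2 / 2"

definition tent :: "real \<Rightarrow> real" where
  "tent x = max 0 x - 2 * max 0 (x - 1) + max 0 (x - 2)"

lemma ramp_deriv: "(ramp has_real_derivative tent x) (at x)"
  unfolding ramp_def[abs_def] tent_def
  by (rule derivative_eq_intros has_derivative_sqr_pos_part DERIV_chain'[OF _ has_derivative_sqr_pos_part] refl | simp)+

lemma ramp_0: "x \<le> 0 \<Longrightarrow> ramp x = 0" and ramp_2: "2 \<le> x \<Longrightarrow> ramp x = 1"
  by (auto simp: ramp_def max_def power2_eq_square field_simps)

lemma tent_nonneg: "0 \<le> tent x" and tent_0: "x \<le> 0 \<or> 2 \<le> x \<Longrightarrow> tent x = 0"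
  by (auto simp: tent_def max_def)

lemma ramp_bounds: "0 \<le> ramp x" "ramp x \<le> 1"
proof -
  have "mono ramp"
    by (rule monoI, rule DERIV_nonneg_imp_nondecreasing) (use ramp_deriv tent_nonneg in blast)+
  then show "0 \<le> ramp x" "ramp x \<le> 1"
    using monoD[of ramp "min x 0" x] monoD[of ramp x "max x 2"] ramp_0[of "min x 0"] ramp_2[of "max x 2"]
    by auto
qed

lemma continuous_tent [continuous_intros]:
  "continuous_on S f \<Longrightarrow> continuous_on S (\<lambda>x. tent (f x))"
  unfolding tent_def by (intro continuous_intros)

lemma continuous_ramp [continuous_intros]:
  "continuous_on S f \<Longrightarrow> continuous_on S (\<lambda>x. ramp (f x))"
  unfolding ramp_def by (intro continuous_intros) auto

lemma ramp_scaled_deriv: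
  assumes "h > 0"
  shows "((\<lambda>r. ramp ((r - s) / h)) has_real_derivative tent ((r - s) / h) / h) (at r)"
proof -
  have "((\<lambda>r. (r - s) / h) has_real_derivative 1 / h) (at r)"
    using assms by (auto intro!: derivative_eq_intros)
  from DERIV_chain'[OF this ramp_deriv] show ?thesis by simp
qed

text \<open>The kernel \<open>tent ((r - s) / h) / h\<close> is an approximate identity:
  nonnegative, of mass one, and supported in \<open>[s, s + 2 h]\<close>. It lies to the right of
  \<open>s\<close>, so continuity of \<open>f\<close> on an interval that starts at \<open>s\<close>
  is enough.\<close>

lemma tent_average_tendsto:
  fixes f :: "real \<Rightarrow> real"
  assumes f: "continuous_on {s..c} f" and sc: "s < c"
    and h: "\<And>n::nat. 0 < h n" "\<And>n. s + 2 * h n \<le> c" "h \<longlonglongrightarrow> 0"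
  shows "(\<lambda>n. integral {s..c} (\<lambda>r. f r * (tent ((r - s) / h n) / h n))) \<longlonglongrightarrow> f s"
proof (rule LIMSEQ_I)
  fix e :: real assume "0 < e"
  obtain d where d: "d > 0" "\<And>r. r \<in> {s..c} \<Longrightarrow> \<bar>r - s\<bar> < d \<Longrightarrow> \<bar>f r - f s\<bar> < e/2"
    using f \<open>0 < e\<close> sc unfolding continuous_on_iff dist_real_def
    by (metis atLeastAtMost_iff half_gt_zero less_eq_real_def)
  obtain N where N: "\<And>n. n \<ge> N \<Longrightarrow> h n < d / 2"
    using order_tendstoD(2)[OF h(3), of "d/2"] d(1) unfolding eventually_sequentially by auto
  have "norm (integral {s..c} (\<lambda>r. f r * (tent ((r - s) / h n) / h n)) - f s) < e" if "n \<ge> N" for n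
  proof -
    let ?w = "\<lambda>r. tent ((r - s) / h n) / h n"
    have hn: "h n > 0" "s + 2 * h n \<le> c" using h by auto
    have "((?w) has_integral (ramp ((c - s) / h n) - ramp ((s - s) / h n))) {s..c}"
      using sc has_vector_derivative_at_within[OF ramp_scaled_deriv[OF hn(1), unfolded has_real_derivative_iff_has_vector_derivative]]
      by (intro fundamental_theorem_of_calculus less_imp_le)
    moreover have "2 \<le> (c - s) / h n" using hn by (simp add: field_simps)
    ultimately have w: "(?w has_integral 1) {s..c}" by (simp add: ramp_0 ramp_2)
    have cw: "continuous_on {s..c} ?w" using hn by (intro continuous_intros) auto
    have i1: "(\<lambda>r. f r * ?w r) integrable_on {s..c}" "(\<lambda>r. f s * ?w r) integrable_on {s..c}"
      by (intro integrable_continuous_interval continuous_intros f cw)+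
    have "integral {s..c} (\<lambda>r. f r * ?w r) - f s = integral {s..c} (\<lambda>r. f r * ?w r - f s * ?w r)"
      using w i1 by (subst integral_diff) (auto dest: integral_unique)
    moreover have "norm (integral {s..c} (\<lambda>r. f r * ?w r - f s * ?w r)) \<le> integral {s..c} (\<lambda>r. e / 2 * ?w r)"
    proof (rule integral_norm_bound_integral)
      show "(\<lambda>r. f r * ?w r - f s * ?w r) integrable_on {s..c}" using i1 by (rule integrable_diff)
      show "(\<lambda>r. e / 2 * ?w r) integrable_on {s..c}"
        by (intro integrable_continuous_interval continuous_intros cw)
      fix r assume r: "r \<in> {s..c}"
      show "norm (f r * ?w r - f s * ?w r) \<le> e / 2 * ?w r"
      proof (cases "r < s + 2 * h n")
        case True
        then have "\<bar>f r - f s\<bar> \<le> e/2" using d(2)[OF r] N[OF that] r by fastforce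
        moreover have "0 \<le> ?w r" using hn tent_nonneg by auto
        ultimately have "\<bar>f r - f s\<bar> * ?w r \<le> e/2 * ?w r" by (rule mult_right_mono)
        moreover have "norm (f r * ?w r - f s * ?w r) = \<bar>f r - f s\<bar> * ?w r"
          using \<open>0 \<le> ?w r\<close> by (metis abs_mult abs_of_nonneg left_diff_distrib real_norm_def)
        ultimately show ?thesis by simp
      next
        case False
        then have "2 \<le> (r - s) / h n" using hn by (simp add: field_simps)
        then show ?thesis by (simp add: tent_0)
      qed
    qed
    moreover have "integral {s..c} (\<lambda>r. e / 2 * ?w r) = e / 2"
      using w by (auto dest: integral_unique)
    ultimately have "norm (integral {s..c} (\<lambda>r. f r * ?w r) - f s) \<le> e / 2" by metis
    then show ?thesis using \<open>0 < e\<close> by linarith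
  qed
  then show "\<exists>N. \<forall>n\<ge>N. norm (integral {s..c} (\<lambda>r. f r * (tent ((r - s) / h n) / h n)) - f s) < e"
    by blast
qed


section \<open>Weak derivatives versus classical derivatives\<close>

lemma interval_subset:
  fixes I :: "real set"
  assumes "is_interval I" "s \<in> I" "t \<in> I"
  shows "{s..t} \<subseteq> I"
proof
  fix r assume "r \<in> {s..t}"
  then show "r \<in> I" using mem_is_interval_1_I[OF assms, of r] by simp
qed

text \<open>The test function is the difference of two ramps of width \<open>2 * h n\<close> based
  at \<open>s\<close> and \<open>t\<close>. Its derivative is a difference of approximate
  identities, so one side of the weak identity tends to \<open>f s - f t\<close>; the test function
  itself tends to the indicator of \<open>{s<..t}\<close>, so the other side tends to minus the
  integral of \<open>g\<close>.\<close>

lemma weak_deriv_FTC: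
  fixes I :: "real set"
  assumes I: "open I" "is_interval I" and f: "continuous_on I f" and g: "g \<in> L2_on I"
    and w: "is_weak_deriv I f g" and st: "s \<in> I" "t \<in> I" "s < t"
  shows "(g has_integral (f t - f s)) {s..t}"
proof -
  \<comment> \<open>Both ramps rise to the right of their base points, so room beyond
    \<open>t\<close> is needed; \<open>2 * h n \<le> c - t\<close> lets them level off before
    \<open>c\<close>.\<close>
  obtain e where e: "e > 0" "cball t e \<subseteq> I" using I st open_contains_cball by blast
  define c where "c = t + e"
  have c: "c \<in> I" "t < c" using e by (auto simp: c_def dist_real_def subset_iff)
  have sub: "{s..c} \<subseteq> I" "{s..t} \<subseteq> I" "{t..c} \<subseteq> I" by (intro interval_subset I st c)+
  have Im: "I \<in> sets lebesgue" using I by simp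
  define h where "h n = (c - t) / (2 * (real n + 1))" for n
  have h: "0 < h n" "t + 2 * h n \<le> c" "s + 2 * h n \<le> c" for n
  proof -
    show "0 < h n" using c by (auto simp: h_def)
    have "2 * h n \<le> c - t" using c unfolding h_def by (simp add: field_simps mult_right_mono)
    then show "t + 2 * h n \<le> c" "s + 2 * h n \<le> c" using st by auto
  qed
  have h0: "h \<longlonglongrightarrow> 0"
    unfolding h_def using c by real_asymp
  define \<phi> where "\<phi> n r = ramp ((r - s) / h n) - ramp ((r - t) / h n)" for n r
  define \<phi>' where "\<phi>' n r = tent ((r - s) / h n) / h n - tent ((r - t) / h n) / h n" for n r
  have d: "(\<phi> n has_real_derivative \<phi>' n r) (at r)" for n r
    unfolding \<phi>_def[abs_def] \<phi>'_def by (intro DERIV_diff ramp_scaled_deriv h)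
  have deriv: "deriv (\<phi> n) = \<phi>' n" for n using DERIV_imp_deriv[OF d] by blast
  have sup: "\<phi> n r = 0" "\<phi>' n r = 0" if "r \<notin> {s..c}" for n r
  proof -
    have "(r - s) / h n \<le> 0 \<and> (r - t) / h n \<le> 0 \<or> (r - s) / h n \<ge> 2 \<and> (r - t) / h n \<ge> 2"
      using that h[of n] st by (auto simp: field_simps)
    then show "\<phi> n r = 0" "\<phi>' n r = 0" by (auto simp: \<phi>_def \<phi>'_def ramp_0 ramp_2 tent_0)
  qed
  have "\<phi> n \<in> C1c I" for n
  proof -
    have "closure {r. \<phi> n r \<noteq> 0} \<subseteq> {s..c}" using sup(1) by (intro closure_minimal) (blast, simp)
    moreover from this have "compact (closure {r. \<phi> n r \<noteq> 0})"
      by (metis closed_closure compact_Icc compact_eq_bounded_closed bounded_subset)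
    moreover have "continuous_on UNIV (\<phi>' n)"
      unfolding \<phi>'_def[abs_def] using h[of n] by (intro continuous_intros) auto
    moreover have "\<phi> n differentiable (at r)" for r using d real_differentiable_def by blast
    ultimately show ?thesis
      unfolding C1c_def using sub by (auto simp: deriv)
  qed
  then have eq: "(LINT r:I|lebesgue. f r * \<phi>' n r) = - (LINT r:I|lebesgue. g r * \<phi> n r)" for n
    using w unfolding is_weak_deriv_def by (auto simp: deriv[symmetric])
  have cf: "continuous_on {s..c} f" using f sub continuous_on_subset by blast
  define T where "T x n r = f r * (tent ((r - x) / h n) / h n)" for x n r
  have T: "continuous_on {s..c} (T x n)" for x n
    unfolding T_def using h[of n] by (intro continuous_intros cf) auto
  have lhs: "(LINT r:I|lebesgue. f r * \<phi>' n r) = integral {s..c} (T s n) - integral {t..c} (T t n)" for n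
  proof -
    have "(LINT r:I|lebesgue. f r * \<phi>' n r) = (LINT r:{s..c}|lebesgue. f r * \<phi>' n r)"
      by (rule set_integral_support) (use sub sup in auto)
    also have "\<dots> = (LINT r:{s..c}|lebesgue. T s n r - T t n r)"
      by (simp add: T_def \<phi>'_def right_diff_distrib)
    also have "(LINT r:{s..c}|lebesgue. T s n r - T t n r) = integral {s..c} (\<lambda>r. T s n r - T t n r)"
      by (intro set_lebesgue_integral_eq_integral(2) absolutely_integrable_continuous_real continuous_intros T)
    also have "\<dots> = integral {s..c} (T s n) - integral {s..c} (T t n)"
      by (intro integral_diff integrable_continuous_interval T)
    also have "integral {s..c} (T t n) = integral {s..t} (T t n) + integral {t..c} (T t n)"
      using st c by (intro Henstock_Kurzweil_Integration.integral_combine[symmetric] integrable_continuous_interval T) auto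
    also have "integral {s..t} (T t n) = integral {s..t} (\<lambda>_. 0)"
      by (intro integral_cong) (use h[of n] in \<open>auto simp: T_def tent_0 field_simps\<close>)
    finally show ?thesis by simp
  qed
  have l1: "(\<lambda>n. integral {s..c} (T s n)) \<longlonglongrightarrow> f s"
    unfolding T_def by (rule tent_average_tendsto[OF cf]) (use st c h h0 in auto)
  have l2: "(\<lambda>n. integral {t..c} (T t n)) \<longlonglongrightarrow> f t"
    unfolding T_def by (rule tent_average_tendsto) (use c h h0 continuous_on_subset[OF f sub(3)] in auto)
  have gi: "g absolutely_integrable_on {s..c}" "g absolutely_integrable_on {s..t}"
    using L2_on_absolutely_integrable[OF Im g] sub by auto
  have gi': "integrable (lebesgue_on {s..c}) g" using gi by (simp add: set_integrable_lebesgue_on)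
  have lim: "(\<lambda>n. integral\<^sup>L (lebesgue_on {s..c}) (\<lambda>r. g r * \<phi> n r))
      \<longlonglongrightarrow> integral\<^sup>L (lebesgue_on {s..c}) (\<lambda>r. g r * indicator {s<..t} r)"
  proof (rule integral_dominated_convergence[where w="\<lambda>r. \<bar>g r\<bar>"])
    have [measurable]: "g \<in> borel_measurable (lebesgue_on {s..c})" using gi' by blast
    have "\<phi> n \<in> borel_measurable (lebesgue_on {s..c})" for n
      by (intro continuous_imp_measurable_on_sets_lebesgue)
        (auto simp: \<phi>_def[abs_def] intro!: continuous_intros less_imp_neq[OF h(1), symmetric])
    then show "(\<lambda>r. g r * \<phi> n r) \<in> borel_measurable (lebesgue_on {s..c})" for n by simp
    show "(\<lambda>r. g r * indicator {s<..t} r) \<in> borel_measurable (lebesgue_on {s..c})"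
      by (intro borel_measurable_times borel_measurable_indicator) (use c in \<open>auto simp: sets_restrict_space_iff\<close>)
    show "integrable (lebesgue_on {s..c}) (\<lambda>r. \<bar>g r\<bar>)" using gi' by simp
    have "\<bar>\<phi> n r\<bar> \<le> 1" for n r
      using ramp_bounds[of "(r - s) / h n"] ramp_bounds[of "(r - t) / h n"] by (auto simp: \<phi>_def)
    then show "AE r in lebesgue_on {s..c}. norm (g r * \<phi> n r) \<le> \<bar>g r\<bar>" for n
      by (auto simp: abs_mult intro!: mult_left_le)
    have one: "(\<lambda>n. ramp ((r - x) / h n)) \<longlonglongrightarrow> (if x < r then 1 else 0)" for r x
    proof (cases "x < r")
      case True
      have "\<forall>\<^sub>F n in sequentially. h n < (r - x) / 2" using order_tendstoD(2)[OF h0, of "(r - x)/2"] True by auto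
      then have "\<forall>\<^sub>F n in sequentially. ramp ((r - x) / h n) = 1"
        by eventually_elim (use h(1) in \<open>auto intro!: ramp_2 simp: field_simps\<close>)
      then show ?thesis using True by (auto intro: tendsto_eventually)
    next
      case False
      then have "ramp ((r - x) / h n) = 0" for n using h(1)[of n] by (intro ramp_0) (auto simp: field_simps)
      then show ?thesis using False by simp
    qed
    have "(\<lambda>n. \<phi> n r) \<longlonglongrightarrow> indicator {s<..t} r" for r
      unfolding \<phi>_def using tendsto_diff[OF one[of r s] one[of r t]] st
      by (auto simp: indicator_def split: if_splits)
    then show "AE r in lebesgue_on {s..c}. (\<lambda>n. g r * \<phi> n r) \<longlonglongrightarrow> g r * indicator {s<..t} r"
      by (intro AE_I2 tendsto_mult tendsto_const)
  qed
  have rhs: "(LINT r:I|lebesgue. g r * \<phi> n r) = integral\<^sup>L (lebesgue_on {s..c}) (\<lambda>r. g r * \<phi> n r)" for n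
    by (subst set_integral_support[OF sub(1)]) (use sup in \<open>auto simp: set_integral_lebesgue_on\<close>)
  have "(\<lambda>n. - integral\<^sup>L (lebesgue_on {s..c}) (\<lambda>r. g r * \<phi> n r)) \<longlonglongrightarrow> f s - f t"
    using tendsto_diff[OF l1 l2] unfolding lhs[symmetric] eq rhs .
  then have "f s - f t = - integral\<^sup>L (lebesgue_on {s..c}) (\<lambda>r. g r * indicator {s<..t} r)"
    using lim LIMSEQ_unique tendsto_minus by blast
  also have "integral\<^sup>L (lebesgue_on {s..c}) (\<lambda>r. g r * indicator {s<..t} r) = (LINT r:{s..c}|lebesgue. g r * indicator {s<..t} r)"
    by (simp add: set_integral_lebesgue_on)
  also have "\<dots> = (LINT r:{s..t}|lebesgue. g r * indicator {s<..t} r)"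
    by (rule set_integral_support) (use c in auto)
  also have "\<dots> = (LINT r:{s..t}|lebesgue. g r)"
    unfolding set_lebesgue_integral_def
  proof (rule integral_cong_AE)
    have "AE r in lebesgue. r \<noteq> s"
      by (metis AE_completion AE_lborel_singleton)
    then show "AE r in lebesgue. indicat_real {s..t} r *\<^sub>R (g r * indicator {s<..t} r) = indicat_real {s..t} r *\<^sub>R g r"
      by eventually_elim (auto simp: indicator_def)
    show "(\<lambda>r. indicat_real {s..t} r *\<^sub>R g r) \<in> borel_measurable lebesgue"
      using gi(2) by (auto simp: set_integrable_def)
    then have "(\<lambda>r. indicat_real {s..t} r *\<^sub>R g r * indicator {s<..t} r) \<in> borel_measurable lebesgue"
      by (intro borel_measurable_times borel_measurable_indicator) auto
    then show "(\<lambda>r. indicat_real {s..t} r *\<^sub>R (g r * indicator {s<..t} r)) \<in> borel_measurable lebesgue"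
      by (simp add: mult.assoc)
  qed
  also have "\<dots> = integral {s..t} g" using gi by (intro set_lebesgue_integral_eq_integral)
  finally show ?thesis using gi(2) unfolding absolutely_integrable_on_def
    by (simp add: has_integral_integrable_integral)
qed

text \<open>By Lebesgue differentiation the averages of \<open>g\<close> over
  \<open>[x, x + h]\<close> converge to \<open>g x\<close> off a null set, and these averages
  vanish. The differentiation theorem is applied to \<open>g\<close> cut down to a compact
  \<open>[a, b]\<close>, because \<open>g\<close> is only locally integrable on \<open>I\<close>;
  countably many such intervals exhaust \<open>I\<close>.\<close>

lemma integral_zero_imp_AE_zero:
  fixes I :: "real set" and g :: "real \<Rightarrow> real"
  assumes I: "open I" "is_interval I" and g: "\<And>s t. {s..t} \<subseteq> I \<Longrightarrow> g integrable_on {s..t}"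
    and z: "\<And>s t. s \<in> I \<Longrightarrow> t \<in> I \<Longrightarrow> s < t \<Longrightarrow> integral {s..t} g = 0"
  shows "AE t in lebesgue_on I. g t = 0"
proof -
  have Im: "I \<in> sets lebesgue" using I by simp
  have "AE t in lebesgue_on {a..b}. g t = 0" if ab: "{a..b} \<subseteq> I" for a b
  proof -
    define f where "f r = (if r \<in> {a..b} then g r else 0)" for r
    have gi: "g integrable_on {a..b}" by (rule g[OF ab])
    have fi: "f integrable_on cbox c d" for c d
    proof -
      have "f integrable_on UNIV" unfolding f_def[abs_def] using gi by (simp only: integrable_restrict_UNIV)
      then show ?thesis by (rule integrable_on_subcbox) simp
    qed
    obtain N where N: "negligible N" "\<And>x e. \<lbrakk>x \<notin> N; 0 < e\<rbrakk>
            \<Longrightarrow> \<exists>d>0. \<forall>h. 0 < h \<and> h < d \<longrightarrow>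
                  norm (integral (cbox x (x + h *\<^sub>R One)) f /\<^sub>R h ^ DIM(real) - f x) < e"
      using integrable_ccontinuous_explicit[of f, OF fi] by blast
    have "g x = 0" if x: "x \<in> {a..b} - (N \<union> {b})" for x
    proof -
      have "\<bar>f x\<bar> < e" if "e > 0" for e
      proof -
        have "x \<notin> N" using x by simp
        from N(2)[OF this that] obtain d where d: "d > 0"
          "\<forall>h. 0 < h \<and> h < d \<longrightarrow> norm (integral (cbox x (x + h *\<^sub>R One)) f /\<^sub>R h ^ DIM(real) - f x) < e"
          by (elim exE conjE)
        \<comment> \<open>The bound \<open>h \<le> b - x\<close> keeps the average inside
          \<open>[a, b]\<close>, where \<open>f\<close> and \<open>g\<close> agree. This is why
          \<open>b\<close> joins the exceptional set.\<close>
        define h where "h = min (d/2) (b - x)"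
        have h: "0 < h" "h < d" "x + h \<le> b" using x d by (auto simp: h_def)
        have "integral {x..x+h} f = integral {x..x+h} g"
          by (rule integral_cong) (use x h in \<open>auto simp: f_def\<close>)
        also have "\<dots> = 0" by (rule z) (use x h ab in auto)
        finally show ?thesis using d(2)[rule_format, of h] h(1,2) by simp
      qed
      then have "f x = 0" by (metis abs_0_eq abs_ge_zero less_irrefl order_less_le)
      then show ?thesis using x by (auto simp: f_def)
    qed
    moreover
    have "N \<union> {b} \<in> null_sets lebesgue" using N(1) by (simp add: negligible_iff_null_sets[symmetric])
    then have "AE x in lebesgue. x \<notin> N \<union> {b}" by (rule AE_not_in)
    ultimately have "AE x in lebesgue. x \<in> {a..b} \<longrightarrow> g x = 0" by (rule_tac eventually_mono) auto
    then show ?thesis by (subst AE_lebesgue_on[symmetric]) auto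
  qed
  moreover have "\<exists>D. countable D \<and> I = (\<Union>(a,b)\<in>D. {a..b})"
    using open_countable_Union_open_box[of I] I(1) open_countable_Union_open_cbox[of I]
  proof -
    obtain \<D> where D: "countable \<D>" "\<D> \<subseteq> Pow I" "\<And>X. X \<in> \<D> \<Longrightarrow> \<exists>a b. X = cbox a b" "\<Union>\<D> = I"
      using open_countable_Union_open_cbox[OF I(1)] by metis
    then obtain A B where AB: "\<And>X. X \<in> \<D> \<Longrightarrow> X = {A X..B X}" by (metis interval_cbox)
    have "I = (\<Union>(a,b)\<in>(\<lambda>X. (A X, B X)) ` \<D>. {a..b})" using D AB by force
    then show ?thesis using D(1) by blast
  qed
  ultimately obtain D where D: "countable D" "I = (\<Union>(a,b)\<in>D. {a..b})"
      and ae': "\<And>a b. {a..b} \<subseteq> I \<Longrightarrow> AE t in lebesgue_on {a..b}. g t = 0"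
    by blast
  have ae: "AE t in lebesgue. t \<in> {a..b} \<longrightarrow> g t = 0" if "{a..b} \<subseteq> I" for a b
    using ae'[OF that] by (subst AE_lebesgue_on) simp_all
  have "AE t in lebesgue. t \<in> {fst x..snd x} \<longrightarrow> g t = 0" if "x \<in> D" for x
    by (rule ae) (use D(2) that in force)
  then have "AE t in lebesgue. \<forall>x\<in>D. t \<in> {fst x..snd x} \<longrightarrow> g t = 0"
    by (subst AE_ball_countable[OF D(1)]) blast
  then have "AE t in lebesgue. t \<in> I \<longrightarrow> g t = 0"
    by eventually_elim (use D(2) in force)
  then show ?thesis by (simp add: AE_lebesgue_on[OF Im])
qed

lemma weak_deriv_unique:
  fixes I :: "real set"
  assumes I: "open I" "is_interval I" and f: "continuous_on I f"
    and g: "g1 \<in> L2_on I" "is_weak_deriv I f g1" "g2 \<in> L2_on I" "is_weak_deriv I f g2"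
  shows "AE t in lebesgue_on I. g1 t = g2 t"
proof -
  have Im: "I \<in> sets lebesgue" using I by simp
  have "AE t in lebesgue_on I. g1 t + (-1) * g2 t = 0"
  proof (rule integral_zero_imp_AE_zero[OF I])
    show "(\<lambda>t. g1 t + (-1) * g2 t) integrable_on {s..t}" if "{s..t} \<subseteq> I" for s t
      using L2_on_absolutely_integrable[OF Im L2_on_add[OF Im g(1) L2_on_cmult[OF Im g(3), of "-1"]] that]
      unfolding absolutely_integrable_on_def by (rule conjunct1)
    show "integral {s..t} (\<lambda>r. g1 r + (-1) * g2 r) = 0" if "s \<in> I" "t \<in> I" "s < t" for s t
      using has_integral_diff[OF weak_deriv_FTC[OF I f g(1,2) that] weak_deriv_FTC[OF I f g(3,4) that]]
      by (simp add: integral_unique)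
  qed
  then show ?thesis by simp
qed

text \<open>Integration by parts on a compact interval around the support of the test function. At
  finitely many points the fundamental theorem asks for continuity only, which admits piecewise
  smooth functions such as hats and distances.\<close>

lemma classical_weak_deriv:
  fixes I :: "real set"
  assumes I: "open I" "is_interval I" and f: "continuous_on I f" and g: "g \<in> L2_on I"
    and S: "finite S" and d: "\<And>t. t \<in> I - S \<Longrightarrow> (f has_real_derivative g t) (at t)"
  shows "is_weak_deriv I f g"
  unfolding is_weak_deriv_def
proof
  fix \<phi> assume \<phi>: "\<phi> \<in> C1c I"
  have Im: "I \<in> sets lebesgue" using I by simp
  have dif: "(\<phi> has_real_derivative deriv \<phi> t) (at t)" for t
    using \<phi> by (auto simp: C1c_def DERIV_deriv_iff_real_differentiable)
  have c\<phi>: "continuous_on A \<phi>" for A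
    using dif by (intro DERIV_continuous_on[where D="deriv \<phi>"]) (auto intro: has_field_derivative_at_within)
  have c\<phi>': "continuous_on A (deriv \<phi>)" for A
    using \<phi> by (auto simp: C1c_def intro: continuous_on_subset)
  define K where "K = closure {t. \<phi> t \<noteq> 0}"
  have subK: "{t. \<phi> t \<noteq> 0} \<subseteq> K" unfolding K_def by (rule closure_subset)
  have K: "compact K" "K \<subseteq> I" using \<phi> by (auto simp: C1c_def K_def)
  have clK: "closed K" by (simp add: K_def)
  have out: "\<phi> t = 0" "deriv \<phi> t = 0" if "t \<notin> K" for t
  proof -
    show "\<phi> t = 0" using that subK clK by auto
    have "((\<lambda>_. 0) has_real_derivative 0) (at t)" by simp
    then have "(\<phi> has_real_derivative 0) (at t)"
      by (rule has_field_derivative_transform_within_open[where S="- K"])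
        (use that subK clK in auto)
    then show "deriv \<phi> t = 0" by (rule DERIV_imp_deriv)
  qed
  show "(LINT t:I|lebesgue. f t * deriv \<phi> t) = - (LINT t:I|lebesgue. g t * \<phi> t)"
  proof (cases "K = {}")
    case True
    then show ?thesis using out by simp
  next
    case False
    obtain a where a: "a \<in> K" "\<forall>t\<in>K. a \<le> t"
      using compact_attains_inf[OF K(1) False] by blast
    obtain b where b: "b \<in> K" "\<forall>t\<in>K. t \<le> b"
      using compact_attains_sup[OF K(1) False] by blast
    have ab: "a \<in> K" "b \<in> K" "\<And>t. t \<in> K \<Longrightarrow> a \<le> t \<and> t \<le> b"
      using a b by blast+
    have mem: "a \<in> I" "b \<in> I" using ab(1,2) K(2) by blast+
    obtain e where e: "e > 0" "cball a e \<subseteq> I" using I(1) mem(1) open_contains_cball by blast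
    obtain e' where e': "e' > 0" "cball b e' \<subseteq> I" using I(1) mem(2) open_contains_cball by blast
    define s t where "s = a - e" and "t = b + e'"
    have "s \<in> I" "t \<in> I" using e e' by (auto simp: s_def t_def dist_real_def subset_iff)
    then have st: "{s..t} \<subseteq> I" by (rule interval_subset[OF I(2)])
    have stK: "r \<in> K \<Longrightarrow> s < r \<and> r < t" for r
      using ab(3)[of r] e(1) e'(1) by (auto simp: s_def t_def)
    then have st': "K \<subseteq> {s<..<t}" by auto
    have "s \<le> t" using stK[OF ab(1)] by simp
    have cf: "continuous_on {s..t} f" using f st continuous_on_subset by blast
    have gi: "g absolutely_integrable_on {s..t}" by (rule L2_on_absolutely_integrable[OF Im g st])
    have i1: "(\<lambda>r. f r * deriv \<phi> r) absolutely_integrable_on {s..t}"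
      by (intro absolutely_integrable_continuous_real continuous_intros cf c\<phi>')
    have i2: "(\<lambda>r. g r * \<phi> r) absolutely_integrable_on {s..t}"
    proof -
      have "bounded (\<phi> ` {s..t})" by (intro compact_imp_bounded compact_continuous_image c\<phi>) simp
      then have "(\<lambda>r. \<phi> r * g r) absolutely_integrable_on {s..t}"
        by (intro absolutely_integrable_bounded_measurable_product_real gi continuous_imp_measurable_on_sets_lebesgue c\<phi>) auto
      then show ?thesis by (simp add: mult.commute)
    qed
    have "((\<lambda>r. f r * deriv \<phi> r + g r * \<phi> r) has_integral (f t * \<phi> t - f s * \<phi> s)) {s..t}"
    proof (rule fundamental_theorem_of_calculus_strong[OF S \<open>s \<le> t\<close>])
      show "continuous_on {s..t} (\<lambda>r. f r * \<phi> r)" by (intro continuous_intros cf c\<phi>)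
      fix r assume "r \<in> {s..t} - S"
      then have "(f has_real_derivative g r) (at r)" using d st by blast
      from DERIV_mult[OF this dif] show "((\<lambda>r. f r * \<phi> r) has_vector_derivative f r * deriv \<phi> r + g r * \<phi> r) (at r)"
        by (simp add: has_real_derivative_iff_has_vector_derivative[symmetric] mult.commute add.commute)
    qed
    moreover have "\<phi> t = 0" "\<phi> s = 0" by (rule out; use st' in force)+
    ultimately have "integral {s..t} (\<lambda>r. f r * deriv \<phi> r + g r * \<phi> r) = 0" by (simp add: integral_unique)
    then have "integral {s..t} (\<lambda>r. f r * deriv \<phi> r) + integral {s..t} (\<lambda>r. g r * \<phi> r) = 0"
      using i1 i2 absolutely_integrable_on_def by (subst (asm) integral_add) blast+
    then have "(LINT r:{s..t}|lebesgue. f r * deriv \<phi> r) = - (LINT r:{s..t}|lebesgue. g r * \<phi> r)"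
      using set_lebesgue_integral_eq_integral(2)[OF i1] set_lebesgue_integral_eq_integral(2)[OF i2] by simp
    moreover have zero: "\<phi> r = 0" "deriv \<phi> r = 0" if "r \<in> I - {s..t}" for r
      using that stK[of r] out[of r] by fastforce+
    have "(LINT r:I|lebesgue. f r * deriv \<phi> r) = (LINT r:{s..t}|lebesgue. f r * deriv \<phi> r)"
      "(LINT r:I|lebesgue. g r * \<phi> r) = (LINT r:{s..t}|lebesgue. g r * \<phi> r)"
      by (rule set_integral_support[OF st], simp add: zero)+
    ultimately show ?thesis by simp
  qed
qed

text \<open>Regularity for \<open>u'' = k\<close> with \<open>k\<close> merely bounded and
  integrable. A repeated integral \<open>U\<close> of \<open>k\<close> has the same divided second
  differences as \<open>u\<close>, since both are integrals of \<open>k\<close> against the hat with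
  nodes \<open>s\<close>, \<open>m\<close>, \<open>t\<close>. Hence \<open>u - U\<close> is affine,
  and \<open>u\<close> inherits a derivative whose increments are integrals of \<open>k\<close>. The
  hat is written with positive parts to match the kernel of \<open>U\<close>.\<close>

lemma hat_slope_regularity:
  fixes u k :: "real \<Rightarrow> real"
  defines "hat \<equiv> \<lambda>s m t r. (max 0 (t - r) - max 0 (m - r)) / (t - m) - (max 0 (m - r) - max 0 (s - r)) / (m - s)"
  assumes ab: "\<alpha> < \<beta>" and ki: "k integrable_on {\<alpha>..\<beta>}" and kB: "\<And>r. r \<in> {\<alpha>..\<beta>} \<Longrightarrow> \<bar>k r\<bar> \<le> B"
    and eq: "\<And>s m t. \<alpha> \<le> s \<Longrightarrow> s < m \<Longrightarrow> m < t \<Longrightarrow> t \<le> \<beta> \<Longrightarrow>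
      (u t - u m) / (t - m) - (u m - u s) / (m - s) = integral {\<alpha>..\<beta>} (\<lambda>r. k r * hat s m t r)"
  shows "\<exists>g. (\<forall>t\<in>{\<alpha><..<\<beta>}. (u has_real_derivative g t) (at t)) \<and>
    (\<forall>s t. \<alpha> \<le> s \<longrightarrow> s \<le> t \<longrightarrow> t \<le> \<beta> \<longrightarrow> (k has_integral (g t - g s)) {s..t})"
proof -
  define K where "K t = integral {\<alpha>..t} k" for t
  \<comment> \<open>Cauchy's formula for the repeated integral of \<open>k\<close>, so that
    \<open>K\<close> is the derivative of \<open>U\<close>.\<close>
  define U where "U t = integral {\<alpha>..\<beta>} (\<lambda>r. k r * max 0 (t - r))" for t
  have "k \<in> borel_measurable (lebesgue_on {\<alpha>..\<beta>})" using ki by (rule integrable_imp_measurable)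
  moreover have "(\<lambda>_. B) integrable_on {\<alpha>..\<beta>}" by (rule integrable_const_ivl)
  ultimately have kai: "k absolutely_integrable_on {\<alpha>..\<beta>}"
    using kB by (intro measurable_bounded_by_integrable_imp_absolutely_integrable[where g="\<lambda>_. B"]) auto
  have prod: "(\<lambda>r. k r * w r) integrable_on {\<alpha>..\<beta>}" if "continuous_on {\<alpha>..\<beta>} w" for w
  proof -
    have "bounded (w ` {\<alpha>..\<beta>})" by (intro compact_imp_bounded compact_continuous_image that) simp
    then have "(\<lambda>r. w r * k r) absolutely_integrable_on {\<alpha>..\<beta>}"
      by (intro absolutely_integrable_bounded_measurable_product_real kai continuous_imp_measurable_on_sets_lebesgue that) auto
    then show ?thesis by (simp add: mult.commute absolutely_integrable_on_def)
  qed
  have B0: "0 \<le> B" using kB[of \<alpha>] ab by (auto intro: order_trans[OF abs_ge_zero])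
  have ksub: "k integrable_on {s..t}" if "\<alpha> \<le> s" "t \<le> \<beta>" for s t
    using ki that by (auto intro: integrable_subinterval_real)
  have Kdiff: "(k has_integral (K t - K s)) {s..t}" if "\<alpha> \<le> s" "s \<le> t" "t \<le> \<beta>" for s t
  proof -
    have "K s + integral {s..t} k = K t"
      unfolding K_def using that by (intro Henstock_Kurzweil_Integration.integral_combine ksub) auto
    then show ?thesis using ksub[of s t] that by (simp add: has_integral_integrable_integral)
  qed
  have Kb: "\<bar>K t - K s\<bar> \<le> B * (t - s)" if "\<alpha> \<le> s" "s \<le> t" "t \<le> \<beta>" for s t
    using has_integral_bound_real[OF B0 _ Kdiff[OF that], of "{}"] that kB by auto
  have Udiff: "\<bar>U t - U s - (t - s) * K s\<bar> \<le> B * (t - s) * (t - s)" if st: "\<alpha> \<le> s" "s \<le> t" "t \<le> \<beta>" for s t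
  proof -
    let ?w = "\<lambda>r. k r * (max 0 (t - r) - max 0 (s - r))"
    have i: "?w integrable_on {\<alpha>..\<beta>}" by (intro prod continuous_intros)
    have "U t - U s = integral {\<alpha>..\<beta>} ?w"
      unfolding U_def right_diff_distrib by (subst integral_diff) (auto intro!: prod continuous_intros)
    also have "\<dots> = integral {\<alpha>..s} ?w + (integral {s..t} ?w + integral {t..\<beta>} ?w)"
      using st i by (simp add: Henstock_Kurzweil_Integration.integral_combine integrable_subinterval_real[OF i])
    also have "integral {t..\<beta>} ?w = integral {t..\<beta>} (\<lambda>_. 0)" by (rule integral_cong) (use st in auto)
    also have "integral {\<alpha>..s} ?w = integral {\<alpha>..s} (\<lambda>r. k r * (t - s))" by (rule integral_cong) (use st in auto)
    also have "\<dots> = (t - s) * K s" unfolding K_def by simp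
    finally have "U t - U s - (t - s) * K s = integral {s..t} ?w" by simp
    also have "\<bar>\<dots>\<bar> \<le> B * (t - s) * (t - s)"
    proof -
      have "\<bar>?w r\<bar> \<le> B * (t - s)" if "r \<in> {s..t}" for r
        using kB[of r] that st by (auto simp: abs_mult intro!: mult_mono)
      then show ?thesis
        using has_integral_bound_real[of "B * (t - s)" "{}" ?w "integral {s..t} ?w" s t] st B0
          integrable_integral[OF integrable_subinterval_real[OF i, of s t]] by auto
    qed
    finally show ?thesis .
  qed
  have Ub: "\<bar>U y - U x - (y - x) * K x\<bar> \<le> 2 * B * (y - x)\<^sup>2" if "x \<in> {\<alpha>..\<beta>}" "y \<in> {\<alpha>..\<beta>}" for x y
  proof (cases "x \<le> y")
    case True
    then have "\<bar>U y - U x - (y - x) * K x\<bar> \<le> B * (y - x)\<^sup>2" using Udiff[of x y] that by (simp add: power2_eq_square mult.assoc)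
    also have "\<dots> \<le> 2 * (B * (y - x)\<^sup>2)" using B0 by simp
    finally show ?thesis by (simp add: mult.assoc)
  next
    case False
    then have yx: "\<alpha> \<le> y" "y \<le> x" "x \<le> \<beta>" using that by auto
    have "\<bar>(x - y) * (K x - K y)\<bar> \<le> (x - y) * (B * (x - y))"
      unfolding abs_mult using Kb[OF yx] yx by (auto intro!: mult_mono)
    moreover have "U y - U x - (y - x) * K x = (x - y) * (K x - K y) - (U x - U y - (x - y) * K y)"
      by (simp add: algebra_simps)
    ultimately have "\<bar>U y - U x - (y - x) * K x\<bar> \<le> (x - y) * (B * (x - y)) + B * (x - y) * (x - y)"
      using Udiff[OF yx] by linarith
    also have "\<dots> = 2 * B * (y - x)\<^sup>2" by (simp add: power2_eq_square algebra_simps)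
    finally show ?thesis .
  qed
  have UD: "(U has_real_derivative K x) (at x)" if x: "x \<in> {\<alpha><..<\<beta>}" for x
  proof -
    have "((\<lambda>h. (U (x + h) - U x) / h) \<longlongrightarrow> K x) (at 0)"
    proof (rule Lim_transform2)
      show "((\<lambda>h. K x) \<longlongrightarrow> K x) (at 0)" by simp
      show "((\<lambda>h. K x - (U (x + h) - U x) / h) \<longlongrightarrow> 0) (at 0)"
      proof (rule Lim_null_comparison)
        show "((\<lambda>h. 2 * B * \<bar>h\<bar>) \<longlongrightarrow> 0) (at 0)" by (auto intro!: tendsto_eq_intros)
        have "\<forall>\<^sub>F h in at (0::real). h \<in> {\<alpha> - x<..<\<beta> - x}"
          using x by (intro eventually_at_in_open') auto
        moreover have "\<forall>\<^sub>F h in at (0::real). h \<noteq> 0" by (simp add: eventually_at_filter)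
        ultimately show "\<forall>\<^sub>F h in at 0. norm (K x - (U (x + h) - U x) / h) \<le> 2 * B * \<bar>h\<bar>"
        proof eventually_elim
          case (elim h)
          have "K x - (U (x + h) - U x) / h = - (U (x + h) - U x - h * K x) / h"
            using elim by (simp add: field_simps)
          also have "\<bar>\<dots>\<bar> \<le> 2 * B * h\<^sup>2 / \<bar>h\<bar>"
            using Ub[of x "x + h"] elim x by (auto simp: abs_divide intro!: divide_right_mono)
          also have "\<dots> = 2 * B * \<bar>h\<bar>" using elim by (simp add: power2_eq_square field_simps abs_mult_self_eq)
          finally show ?case by simp
        qed
      qed
    qed
    then show ?thesis by (simp add: DERIV_def)
  qed
  \<comment> \<open>Slope of the affine function \<open>u - U\<close>, read off at the two ends.
    Below, the second difference with nodes \<open>\<alpha>\<close>, \<open>x\<close>,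
    \<open>\<beta>\<close> pins down its value at each inner point.\<close>
  define c where "c = ((u \<beta> - U \<beta>) - (u \<alpha> - U \<alpha>)) / (\<beta> - \<alpha>)"
  have slope_U: "(U t - U m) / (t - m) - (U m - U s) / (m - s) = integral {\<alpha>..\<beta>} (\<lambda>r. k r * hat s m t r)" for s m t
  proof -
    have "integral {\<alpha>..\<beta>} (\<lambda>r. k r * hat s m t r) = integral {\<alpha>..\<beta>} (\<lambda>r.
        (k r * max 0 (t - r) - k r * max 0 (m - r)) / (t - m) - (k r * max 0 (m - r) - k r * max 0 (s - r)) / (m - s))"
      unfolding hat_def by (rule integral_cong) (simp add: right_diff_distrib)
    also have "\<dots> = integral {\<alpha>..\<beta>} (\<lambda>r. (k r * max 0 (t - r) - k r * max 0 (m - r)) / (t - m)) -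
       integral {\<alpha>..\<beta>} (\<lambda>r. (k r * max 0 (m - r) - k r * max 0 (s - r)) / (m - s))"
      by (intro integral_diff integrable_on_divide integrable_diff prod continuous_intros)
    also have "\<dots> = (U t - U m) / (t - m) - (U m - U s) / (m - s)"
      unfolding U_def by (simp add: integral_diff[OF prod prod] continuous_intros)
    finally show ?thesis by simp
  qed
  have aff: "u x = U x + (u \<alpha> - U \<alpha>) + c * (x - \<alpha>)" if x: "x \<in> {\<alpha><..<\<beta>}" for x
  proof -
    have "(u \<beta> - u x) / (\<beta> - x) - (u x - u \<alpha>) / (x - \<alpha>) = (U \<beta> - U x) / (\<beta> - x) - (U x - U \<alpha>) / (x - \<alpha>)"
      using eq[of \<alpha> x \<beta>] slope_U[of \<beta> x \<alpha>] x by simp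
    then have "((u \<beta> - U \<beta>) - (u x - U x)) / (\<beta> - x) = ((u x - U x) - (u \<alpha> - U \<alpha>)) / (x - \<alpha>)"
      by (simp add: diff_divide_distrib)
    then have "((u \<beta> - U \<beta>) - (u x - U x)) * (x - \<alpha>) = ((u x - U x) - (u \<alpha> - U \<alpha>)) * (\<beta> - x)"
      using x by (simp add: frac_eq_eq)
    then have "(u x - U x - (u \<alpha> - U \<alpha>)) * (\<beta> - \<alpha>) = ((u \<beta> - U \<beta>) - (u \<alpha> - U \<alpha>)) * (x - \<alpha>)"
      by (simp add: algebra_simps)
    then have "u x - U x - (u \<alpha> - U \<alpha>) = c * (x - \<alpha>)"
      unfolding c_def using ab by (simp add: field_simps)
    then show ?thesis by simp
  qed
  show ?thesis
  proof (intro exI[of _ "\<lambda>t. K t + c"] conjI ballI allI impI)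
    fix t assume t: "t \<in> {\<alpha><..<\<beta>}"
    have "((\<lambda>x. U x + (u \<alpha> - U \<alpha>) + c * (x - \<alpha>)) has_real_derivative K t + c) (at t)"
      by (auto intro!: derivative_eq_intros UD[OF t])
    then show "(u has_real_derivative K t + c) (at t)"
      by (rule has_field_derivative_transform_within_open[where S="{\<alpha><..<\<beta>}"]) (use t aff in auto)
  qed (use Kdiff in auto)
qed

section \<open>Oscillation of solutions with large amplitude\<close>

text \<open>\<open>v\<close> stands for a solution rescaled to have sup-norm at most \<open>1\<close>, \<open>g\<close> for its derivative; the second
  derivative enters only through bounds on the increments of \<open>g\<close>, because the coefficients are merely bounded.\<close>

definition osc_system :: "real \<Rightarrow> real \<Rightarrow> real \<Rightarrow> real \<Rightarrow> real \<Rightarrow> (real \<Rightarrow> real) \<Rightarrow> (real \<Rightarrow> real) \<Rightarrow> bool" where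
  "osc_system a p B \<epsilon> X v g \<longleftrightarrow>
     (\<forall>y\<in>{0..X}. (v has_real_derivative g y) (at y) \<and> \<bar>v y\<bar> \<le> 1) \<and>
     (\<forall>s\<in>{0..X}. \<forall>t\<in>{s..X}. \<bar>g t - g s\<bar> \<le> B * (t - s) \<and>
        (\<forall>\<tau>\<ge>0. \<forall>\<sigma>\<in>{-1, 1}. (\<forall>y\<in>{s..t}. \<tau> \<le> \<sigma> * v y) \<longrightarrow> \<sigma> * (g t - g s) \<le> (\<epsilon> - a * \<tau> powr (p - 1)) * (t - s)))"

lemma osc_system_uminus:
  assumes "osc_system a p B \<epsilon> X v g" shows "osc_system a p B \<epsilon> X (\<lambda>y. - v y) (\<lambda>y. - g y)"
proof -
  have neg: "-1 * (- x - - y) = 1 * (x - y)" "1 * (- x - - y) = -1 * (x - y)" for x y :: real by auto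
  show ?thesis
    unfolding osc_system_def
  proof (intro conjI ballI allI impI)
    fix s t \<tau> \<sigma> :: real
    assume s: "s \<in> {0..X}" "t \<in> {s..X}" "0 \<le> \<tau>" "\<sigma> \<in> {-1, 1}" "\<forall>y\<in>{s..t}. \<tau> \<le> \<sigma> * - v y"
    then have "- \<sigma> \<in> {-1, 1}" "\<forall>y\<in>{s..t}. \<tau> \<le> - \<sigma> * v y" by auto
    then have "- \<sigma> * (g t - g s) \<le> (\<epsilon> - a * \<tau> powr (p - 1)) * (t - s)"
      using assms s unfolding osc_system_def by blast
    then show "\<sigma> * (- g t - - g s) \<le> (\<epsilon> - a * \<tau> powr (p - 1)) * (t - s)" by (simp add: algebra_simps)
  qed (use assms in \<open>auto simp: osc_system_def abs_minus_commute intro!: derivative_eq_intros\<close>)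
qed

lemma osc_mvt:
  assumes "osc_system a p B \<epsilon> X v g" "0 \<le> s" "s < t" "t \<le> X"
  obtains \<xi> where "s < \<xi>" "\<xi> < t" "v t - v s = (t - s) * g \<xi>"
  using MVT2[of s t v g] assms unfolding osc_system_def by auto

text \<open>Suppose \<open>v\<close> stays positive on a window of length \<open>T\<close>. Its
  derivative then rises by at most \<open>\<epsilon> * T\<close>, so \<open>v\<close> is nearly
  concave, and comparison with a chord keeps it above \<open>\<eta> / 4\<close> on the first half.
  There the derivative falls at rate at least \<open>\<sigma>\<close>, half of the restoring force
  at that height. With \<open>L = T / 2\<close>, two increments of \<open>v\<close> over
  \<open>L / 3\<close> then differ by \<open>\<sigma> * L\<^sup>2 / 9\<close> or more, but values in
  \<open>[0, 1]\<close> allow a difference of at most two; this is the origin of the 18 in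
  \<open>T\<close>.\<close>

lemma osc_hits_zero:
  fixes \<eta> a p B \<epsilon> :: real
  defines "\<sigma> \<equiv> a * (\<eta> / 4) powr (p - 1) / 2"
  defines "T \<equiv> 2 * (sqrt (18 / \<sigma>) + 1)"
  assumes a: "a > 0" and \<eta>: "0 < \<eta>"
    and \<epsilon>: "0 \<le> \<epsilon>" "\<epsilon> \<le> \<sigma>" "\<epsilon> * T\<^sup>2 \<le> \<eta> / 4"
    and osc: "osc_system a p B \<epsilon> X v g" and y0: "0 \<le> y0" "y0 + T \<le> X" "\<eta> \<le> v y0"
  shows "\<exists>z\<in>{y0..y0 + T}. v z = 0"
proof (rule ccontr)
  assume nz: "\<not> ?thesis"
  have \<sigma>: "\<sigma> > 0" unfolding \<sigma>_def using a \<eta> by simp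
  have T: "T > 2" unfolding T_def using \<sigma> by simp
  have dv: "(v has_real_derivative g y) (at y)" "\<bar>v y\<bar> \<le> 1" if "y \<in> {0..X}" for y
    using osc that unfolding osc_system_def by auto
  have cv: "continuous_on {0..X} v"
    using dv(1) by (intro DERIV_continuous_on) (auto intro: has_field_derivative_at_within)
  have pos: "v y > 0" if "y \<in> {y0..y0 + T}" for y
  proof (rule ccontr)
    assume "\<not> v y > 0"
    then have "\<exists>x\<ge>y0. x \<le> y \<and> v x = 0"
      using y0 \<eta> that by (intro IVT2') (auto intro: continuous_on_subset[OF cv])
    with nz that show False by auto
  qed
  have gd: "g t - g s \<le> (\<epsilon> - a * \<tau> powr (p - 1)) * (t - s)"
    if "0 \<le> \<tau>" "y0 \<le> s" "s \<le> t" "t \<le> y0 + T" "\<And>y. y \<in> {s..t} \<Longrightarrow> \<tau> \<le> v y" for s t \<tau>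
  proof -
    have "s \<in> {0..X}" "t \<in> {s..X}" "\<forall>y\<in>{s..t}. \<tau> \<le> 1 * v y" using that y0 by auto
    then have "1 * (g t - g s) \<le> (\<epsilon> - a * \<tau> powr (p - 1)) * (t - s)"
      using osc \<open>0 \<le> \<tau>\<close> unfolding osc_system_def by blast
    then show ?thesis by simp
  qed
  define L where "L = T / 2"
  have L: "L > 1" "y0 + L \<le> y0 + T" using T by (auto simp: L_def)
  have low: "\<eta> / 4 \<le> v (y0 + y)" if y: "y \<in> {0..L}" for y
  proof (cases "y = 0")
    case True then show ?thesis using y0 \<eta> by simp
  next
    case False
    then have y: "0 < y" "y \<le> T / 2" using y by (auto simp: L_def)
    obtain \<xi>1 where x1: "y0 < \<xi>1" "\<xi>1 < y0 + y" "v (y0 + y) - v y0 = y * g \<xi>1"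
      using osc_mvt[OF osc, of y0 "y0 + y"] y y0 T by auto
    obtain \<xi>2 where x2: "y0 + y < \<xi>2" "\<xi>2 < y0 + T" "v (y0 + T) - v (y0 + y) = (T - y) * g \<xi>2"
      using osc_mvt[OF osc, of "y0 + y" "y0 + T"] y y0 T by auto
    \<comment> \<open>The threshold is zero here, and \<open>0 powr (p - 1)\<close> is zero:
      positivity alone limits the growth of the derivative.\<close>
    have "g \<xi>2 - g \<xi>1 \<le> (\<epsilon> - a * 0 powr (p - 1)) * (\<xi>2 - \<xi>1)"
      using x1 x2 pos by (intro gd) (auto intro: less_imp_le)
    also have "\<dots> \<le> \<epsilon> * T" using x1 x2 \<epsilon> by (auto intro!: mult_left_mono)
    finally have "(T - y) * g \<xi>2 \<le> (T - y) * (g \<xi>1 + \<epsilon> * T)" using y by (intro mult_left_mono) auto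
    then have "0 < v (y0 + y) + (T - y) * (g \<xi>1 + \<epsilon> * T)" using x2(3) pos[of "y0 + T"] T by auto
    then have "0 < y * (v (y0 + y) + (T - y) * (g \<xi>1 + \<epsilon> * T))" using y by simp
    also have "\<dots> = y * v (y0 + y) + (T - y) * (y * g \<xi>1) + y * (T - y) * \<epsilon> * T" by (simp add: algebra_simps)
    also have "\<dots> = T * v (y0 + y) - (T - y) * v y0 + y * (T - y) * \<epsilon> * T"
      unfolding x1(3)[symmetric] by (simp add: algebra_simps)
    finally have "(T - y) * v y0 < T * v (y0 + y) + y * (T - y) * \<epsilon> * T" by simp
    moreover have "T / 2 * \<eta> \<le> (T - y) * v y0" using y y0 \<eta> T by (intro mult_mono) auto
    moreover have "y * (T - y) * \<epsilon> * T \<le> T * T * \<epsilon> * T" using y T \<epsilon> by (intro mult_right_mono mult_mono) auto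
    ultimately have "T * (\<eta> / 2) < T * (v (y0 + y) + \<epsilon> * T\<^sup>2)" by (simp add: algebra_simps power2_eq_square)
    then have "\<eta> / 2 < v (y0 + y) + \<epsilon> * T\<^sup>2" using T by simp
    then show ?thesis using \<epsilon> by simp
  qed
  \<comment> \<open>The first and the last third of the half window are compared, so that the two
    mean value points are at least \<open>L / 3\<close> apart.\<close>
  obtain \<xi>1 where x1: "y0 < \<xi>1" "\<xi>1 < y0 + L / 3" "v (y0 + L / 3) - v y0 = L / 3 * g \<xi>1"
    using osc_mvt[OF osc, of y0 "y0 + L / 3"] L y0 by auto
  obtain \<xi>2 where x2: "y0 + 2 * L / 3 < \<xi>2" "\<xi>2 < y0 + L" "v (y0 + L) - v (y0 + 2 * L / 3) = L / 3 * g \<xi>2"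
    using osc_mvt[OF osc, of "y0 + 2 * L / 3" "y0 + L"] L y0 by (auto simp: algebra_simps)
  have "g \<xi>2 - g \<xi>1 \<le> (\<epsilon> - a * (\<eta> / 4) powr (p - 1)) * (\<xi>2 - \<xi>1)"
  proof (rule gd)
    fix y assume "y \<in> {\<xi>1..\<xi>2}"
    then show "\<eta> / 4 \<le> v y" using low[of "y - y0"] x1 x2 by auto
  qed (use x1 x2 L \<eta> in auto)
  also have "\<dots> = - (2 * \<sigma> - \<epsilon>) * (\<xi>2 - \<xi>1)" by (simp add: \<sigma>_def)
  also have "\<dots> \<le> - \<sigma> * (L / 3)"
  proof -
    have "\<sigma> * (L / 3) \<le> (2 * \<sigma> - \<epsilon>) * (\<xi>2 - \<xi>1)" using \<epsilon> \<sigma> x1 x2 L by (intro mult_mono) auto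
    then show ?thesis unfolding mult_minus_left by linarith
  qed
  finally have "L / 3 * (g \<xi>2 - g \<xi>1) \<le> L / 3 * (- \<sigma> * (L / 3))" using L by (intro mult_left_mono) auto
  then have "(v (y0 + L) - v (y0 + 2 * L / 3)) - (v (y0 + L / 3) - v y0) \<le> - \<sigma> * L\<^sup>2 / 9"
    using x1(3) x2(3) by (simp add: right_diff_distrib power2_eq_square mult.left_commute)
  moreover have "v (y0 + L) > 0" "v (y0 + 2 * L / 3) \<le> 1" "v (y0 + L / 3) \<le> 1" "v y0 > 0"
    using pos[of "y0 + L"] pos[of y0] dv(2)[of "y0 + 2 * L / 3"] dv(2)[of "y0 + L / 3"] L y0 T by auto
  ultimately have "\<sigma> * L\<^sup>2 < 18" by simp
  moreover have "18 \<le> \<sigma> * L\<^sup>2"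
  proof -
    have "sqrt (18 / \<sigma>) \<le> L" by (simp add: L_def T_def)
    then have "(sqrt (18 / \<sigma>))\<^sup>2 \<le> L\<^sup>2" using \<sigma> by (intro power_mono) auto
    then have "18 / \<sigma> \<le> L\<^sup>2" using \<sigma> by simp
    then show ?thesis using \<sigma> by (simp add: field_simps)
  qed
  ultimately show False by simp
qed

text \<open>Up to its first zero after \<open>y0\<close> the function is positive and nearly
  concave, so it arrives there with slope at most \<open>- \<kappa>\<close>. The slope changes by at
  most \<open>B\<close> per unit length and so stays below \<open>- \<kappa> / 2\<close> over the
  distance \<open>d\<close>, which carries \<open>\<bar>v\<bar>\<close> up to \<open>\<eta>'\<close>
  on the far side. The step can thus be repeated with \<open>\<eta>'\<close> in place of
  \<open>\<eta>\<close>; negative starting values are handled by reflection.\<close>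

lemma osc_step:
  fixes \<eta> a p B :: real
  assumes a: "a > 0" and B: "B \<ge> 1" and \<eta>: "0 < \<eta>" "\<eta> \<le> 1"
  shows "\<exists>T>0. \<exists>\<epsilon>0>0. \<exists>\<eta>'>0. \<eta>' \<le> 1 \<and> (\<forall>v g X \<epsilon> y0. osc_system a p B \<epsilon> X v g \<longrightarrow> 0 \<le> \<epsilon> \<longrightarrow> \<epsilon> \<le> \<epsilon>0 \<longrightarrow> 0 \<le> y0 \<longrightarrow>
     y0 + T \<le> X \<longrightarrow> \<eta> \<le> \<bar>v y0\<bar> \<longrightarrow> (\<exists>z y1. y0 < z \<and> z < y1 \<and> y1 \<le> y0 + T \<and> v z = 0 \<and> \<eta>' \<le> \<bar>v y1\<bar>))"
proof -
  define \<sigma> where "\<sigma> = a * (\<eta> / 4) powr (p - 1) / 2"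
  define T where "T = 2 * (sqrt (18 / \<sigma>) + 1)"
  define \<epsilon>0 where "\<epsilon>0 = min \<sigma> (\<eta> / 4 / T\<^sup>2)"
  define \<kappa> where "\<kappa> = \<eta> / (2 * T)"
  define d where "d = \<kappa> / (2 * B)"
  define \<eta>' where "\<eta>' = \<kappa> / 2 * d"
  have \<sigma>: "\<sigma> > 0" unfolding \<sigma>_def using a \<eta> by simp
  have T: "T \<ge> 2" unfolding T_def using \<sigma> by simp
  have \<kappa>: "0 < \<kappa>" "\<kappa> \<le> 1" unfolding \<kappa>_def using \<eta> T by (auto simp: field_simps)
  have d: "0 < d" "d \<le> 1" unfolding d_def using \<kappa> B by (auto simp: field_simps)
  have e0: "\<epsilon>0 > 0" unfolding \<epsilon>0_def using \<sigma> \<eta> T by auto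
  have pos_case: "\<exists>z y1. y0 < z \<and> z < y1 \<and> y1 \<le> y0 + (T + 1) \<and> v z = 0 \<and> \<eta>' \<le> \<bar>v y1\<bar>"
    if osc: "osc_system a p B \<epsilon> X v g" and \<epsilon>: "0 \<le> \<epsilon>" "\<epsilon> \<le> \<epsilon>0" and y0: "0 \<le> y0" "y0 + (T + 1) \<le> X" "\<eta> \<le> v y0"
    for v g X \<epsilon> y0
  proof -
    have e1: "\<epsilon> \<le> \<sigma>" using \<epsilon> by (simp add: \<epsilon>0_def)
    have e2: "\<epsilon> * T\<^sup>2 \<le> \<eta> / 4" using \<epsilon> T by (simp add: \<epsilon>0_def field_simps)
    have dv: "(v has_real_derivative g y) (at y)" if "y \<in> {0..X}" for y
      using osc that unfolding osc_system_def by auto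
    have cv: "continuous_on {0..X} v"
      using dv by (intro DERIV_continuous_on) (auto intro: has_field_derivative_at_within)
    have "\<exists>z\<in>{y0..y0 + T}. v z = 0"
      using osc_hits_zero[of a \<eta> \<epsilon> p B X v g y0, folded \<sigma>_def, folded T_def, OF a \<eta>(1) \<epsilon>(1) e1 e2 osc] y0 by auto
    then obtain z0 where z0: "z0 \<in> {y0..y0 + T}" "v z0 = 0" by blast
    define Z where "Z = {y0..y0 + T} \<inter> v -` {0}"
    have "closed Z" unfolding Z_def
      by (rule continuous_closed_preimage) (use y0 T in \<open>auto intro: continuous_on_subset[OF cv]\<close>)
    then have "compact Z" unfolding Z_def using compact_Int_closed[of "{y0..y0+T}" Z] by (auto simp: Z_def Int_absorb1)
    moreover have "Z \<noteq> {}" using z0 by (auto simp: Z_def)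
    \<comment> \<open>It has to be the first zero: positivity before it is what controls the
      derivative up to \<open>z\<close>.\<close>
    ultimately obtain z where z: "z \<in> Z" "\<And>y. y \<in> Z \<Longrightarrow> z \<le> y" using compact_attains_inf by metis
    have vz: "v z = 0" "z \<le> y0 + T" "y0 < z" using z(1) y0 \<eta> by (auto simp: Z_def order_less_le)
    have pos: "v y > 0" if "y \<in> {y0..<z}" for y
    proof (rule ccontr)
      assume "\<not> v y > 0"
      then have "\<exists>x\<ge>y0. x \<le> y \<and> v x = 0"
        using y0 \<eta> that vz by (intro IVT2') (auto intro: continuous_on_subset[OF cv])
      then show False using z(2) that vz by (force simp: Z_def)
    qed
    obtain \<xi> where xi: "y0 < \<xi>" "\<xi> < z" "v z - v y0 = (z - y0) * g \<xi>"
      using osc_mvt[OF osc, of y0 z] vz y0 by auto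
    have "T * g \<xi> \<le> - \<eta>"
    proof -
      have "(z - y0) * g \<xi> \<le> - \<eta>" using xi(3) vz y0 by simp
      moreover from this have "g \<xi> < 0" using vz \<eta> by (smt (verit) mult_nonneg_nonneg)
      then have "T * g \<xi> \<le> (z - y0) * g \<xi>" using vz by (intro mult_right_mono_neg) auto
      ultimately show ?thesis by simp
    qed
    moreover have gz: "g z - g \<xi> \<le> \<epsilon> * T"
    proof -
      have m: "\<xi> \<in> {0..X}" "z \<in> {\<xi>..X}" using xi vz y0 by auto
      have "\<forall>y\<in>{\<xi>..z}. 0 \<le> 1 * v y"
      proof
        fix y assume "y \<in> {\<xi>..z}"
        then show "0 \<le> 1 * v y" using pos[of y] vz xi by (cases "y = z") auto
      qed
      then have "1 * (g z - g \<xi>) \<le> (\<epsilon> - a * 0 powr (p - 1)) * (z - \<xi>)"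
        using osc m unfolding osc_system_def by blast
      also have "\<dots> \<le> \<epsilon> * T" using xi vz \<epsilon> by (auto intro!: mult_left_mono)
      finally show ?thesis by simp
    qed
    have "T * g z \<le> T * g \<xi> + T * (\<epsilon> * T)" using gz T by (simp add: distrib_left[symmetric])
    ultimately have "T * g z \<le> - \<eta> / 2" using e2 \<eta> by (simp add: power2_eq_square algebra_simps)
    then have gzk: "g z \<le> - \<kappa>" unfolding \<kappa>_def using T by (simp add: field_simps)
    obtain \<zeta> where ze: "z < \<zeta>" "\<zeta> < z + d" "v (z + d) - v z = d * g \<zeta>"
      using osc_mvt[OF osc, of z "z + d"] vz y0 d by auto
    have "z \<in> {0..X}" "\<zeta> \<in> {z..X}" using ze vz y0 d by auto
    then have "\<bar>g \<zeta> - g z\<bar> \<le> B * (\<zeta> - z)" using osc unfolding osc_system_def by blast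
    also have "\<dots> \<le> B * d" using ze B by (intro mult_left_mono) auto
    also have "\<dots> = \<kappa> / 2" using B by (simp add: d_def)
    finally have "g \<zeta> \<le> - \<kappa> / 2" using gzk by linarith
    then have "d * g \<zeta> \<le> d * (- \<kappa> / 2)" using d by (intro mult_left_mono) auto
    then have "\<eta>' \<le> \<bar>v (z + d)\<bar>" using ze(3) vz unfolding \<eta>'_def by (simp add: mult.commute)
    then show ?thesis using vz d by (intro exI[of _ z] exI[of _ "z + d"]) auto
  qed
  have T1: "T + 1 > 0" using T by simp
  have e'0: "\<eta>' > 0" unfolding \<eta>'_def using \<kappa> d by simp
  have "\<kappa> / 2 * d \<le> 1 * 1" using \<kappa> d by (intro mult_mono) auto
  then have e'1: "\<eta>' \<le> 1" by (simp add: \<eta>'_def)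
  show ?thesis
  proof (rule exI[of _ "T + 1"], rule conjI[OF T1], rule exI[of _ \<epsilon>0], rule conjI[OF e0],
      rule exI[of _ \<eta>'], rule conjI[OF e'0], rule conjI[OF e'1], intro allI impI)
    fix v g :: "real \<Rightarrow> real" and X \<epsilon> y0
    assume h: "osc_system a p B \<epsilon> X v g" "0 \<le> \<epsilon>" "\<epsilon> \<le> \<epsilon>0" "0 \<le> y0" "y0 + (T + 1) \<le> X" "\<eta> \<le> \<bar>v y0\<bar>"
    show "\<exists>z y1. y0 < z \<and> z < y1 \<and> y1 \<le> y0 + (T + 1) \<and> v z = 0 \<and> \<eta>' \<le> \<bar>v y1\<bar>"
    proof (cases "v y0 \<ge> 0")
      case True then show ?thesis using pos_case[OF h(1-5)] h(6) by simp
    next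
      case False then show ?thesis using pos_case[OF osc_system_uminus[OF h(1)] h(2-5)] h(6) by simp
    qed
  qed
qed

text \<open>Iteration of \<open>osc_step\<close>. The threshold changes at each step, hence the
  induction over arbitrary \<open>\<eta>\<close>. The landing point of each step lies between
  consecutive zeros and shows that the nodal piece there is not trivial; \<open>N + 1\<close> zeros
  give \<open>N\<close> pieces.\<close>

lemma osc_many_zeros:
  fixes \<eta> a p B :: real
  assumes a: "a > 0" and B: "B \<ge> 1" and \<eta>: "0 < \<eta>" "\<eta> \<le> 1"
  shows "\<exists>T>0. \<exists>\<epsilon>0>0. \<forall>v g X \<epsilon> y0. osc_system a p B \<epsilon> X v g \<longrightarrow> 0 \<le> \<epsilon> \<longrightarrow> \<epsilon> \<le> \<epsilon>0 \<longrightarrow> 0 \<le> y0 \<longrightarrow>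
     y0 + T \<le> X \<longrightarrow> \<eta> \<le> \<bar>v y0\<bar> \<longrightarrow> (\<exists>z::nat \<Rightarrow> real. (\<forall>i\<le>N. y0 < z i \<and> z i \<le> y0 + T \<and> v (z i) = 0) \<and>
       (\<forall>i<N. \<exists>y. z i < y \<and> y < z (Suc i) \<and> v y \<noteq> 0))"
  using \<eta>
proof (induction N arbitrary: \<eta>)
  case 0
  obtain T \<epsilon>0 \<eta>' where *: "T > 0" "\<epsilon>0 > 0" "\<eta>' > 0" "\<And>v g X \<epsilon> y0. osc_system a p B \<epsilon> X v g \<Longrightarrow> 0 \<le> \<epsilon> \<Longrightarrow> \<epsilon> \<le> \<epsilon>0 \<Longrightarrow> 0 \<le> y0 \<Longrightarrow>
     y0 + T \<le> X \<Longrightarrow> \<eta> \<le> \<bar>v y0\<bar> \<Longrightarrow> (\<exists>z y1. y0 < z \<and> z < y1 \<and> y1 \<le> y0 + T \<and> v z = 0 \<and> \<eta>' \<le> \<bar>v y1\<bar>)"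
    using osc_step[OF a B 0, of p] by blast
  show ?case
  proof (rule exI[of _ T], rule conjI[OF *(1)], rule exI[of _ \<epsilon>0], rule conjI[OF *(2)], intro allI impI)
    fix v g :: "real \<Rightarrow> real" and X \<epsilon> y0
    assume "osc_system a p B \<epsilon> X v g" "0 \<le> \<epsilon>" "\<epsilon> \<le> \<epsilon>0" "0 \<le> y0" "y0 + T \<le> X" "\<eta> \<le> \<bar>v y0\<bar>"
    from *(4)[OF this] obtain z where "y0 < z" "z \<le> y0 + T" "v z = 0" by force
    then show "\<exists>z::nat \<Rightarrow> real. (\<forall>i\<le>0. y0 < z i \<and> z i \<le> y0 + T \<and> v (z i) = 0) \<and>
       (\<forall>i<0. \<exists>y. z i < y \<and> y < z (Suc i) \<and> v y \<noteq> 0)" by (intro exI[of _ "\<lambda>_. z"]) auto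
  qed
next
  case (Suc N)
  obtain T \<epsilon>0 \<eta>' where *: "T > 0" "\<epsilon>0 > 0" "\<eta>' > 0" "\<eta>' \<le> 1" "\<And>v g X \<epsilon> y0. osc_system a p B \<epsilon> X v g \<Longrightarrow> 0 \<le> \<epsilon> \<Longrightarrow> \<epsilon> \<le> \<epsilon>0 \<Longrightarrow> 0 \<le> y0 \<Longrightarrow>
     y0 + T \<le> X \<Longrightarrow> \<eta> \<le> \<bar>v y0\<bar> \<Longrightarrow> (\<exists>z y1. y0 < z \<and> z < y1 \<and> y1 \<le> y0 + T \<and> v z = 0 \<and> \<eta>' \<le> \<bar>v y1\<bar>)"
    using osc_step[OF a B Suc.prems, of p] by blast
  obtain T' \<epsilon>1 where **: "T' > 0" "\<epsilon>1 > 0" "\<And>v g X \<epsilon> y0. osc_system a p B \<epsilon> X v g \<Longrightarrow> 0 \<le> \<epsilon> \<Longrightarrow> \<epsilon> \<le> \<epsilon>1 \<Longrightarrow> 0 \<le> y0 \<Longrightarrow>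
     y0 + T' \<le> X \<Longrightarrow> \<eta>' \<le> \<bar>v y0\<bar> \<Longrightarrow> (\<exists>z::nat \<Rightarrow> real. (\<forall>i\<le>N. y0 < z i \<and> z i \<le> y0 + T' \<and> v (z i) = 0) \<and>
       (\<forall>i<N. \<exists>y. z i < y \<and> y < z (Suc i) \<and> v y \<noteq> 0))"
    using Suc.IH[OF *(3,4)] by blast
  have T2: "T + T' > 0" "min \<epsilon>0 \<epsilon>1 > 0" using * ** by auto
  show ?case
  proof (rule exI[of _ "T + T'"], rule conjI[OF T2(1)], rule exI[of _ "min \<epsilon>0 \<epsilon>1"], rule conjI[OF T2(2)], intro allI impI)
    fix v g :: "real \<Rightarrow> real" and X \<epsilon> y0
    assume h: "osc_system a p B \<epsilon> X v g" "0 \<le> \<epsilon>" "\<epsilon> \<le> min \<epsilon>0 \<epsilon>1" "0 \<le> y0" "y0 + (T + T') \<le> X" "\<eta> \<le> \<bar>v y0\<bar>"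
    then obtain z0 y1 where z0: "y0 < z0" "z0 < y1" "y1 \<le> y0 + T" "v z0 = 0" "\<eta>' \<le> \<bar>v y1\<bar>"
      using *(5)[OF h(1,2) _ h(4) _ h(6)] ** by auto
    then obtain z :: "nat \<Rightarrow> real" where z: "\<And>i. i \<le> N \<Longrightarrow> y1 < z i \<and> z i \<le> y1 + T' \<and> v (z i) = 0"
       "\<And>i. i < N \<Longrightarrow> \<exists>y. z i < y \<and> y < z (Suc i) \<and> v y \<noteq> 0"
      using **(3)[OF h(1,2), of y1] h * by auto
    have "v y1 \<noteq> 0" using z0 * by auto
    show "\<exists>z::nat \<Rightarrow> real. (\<forall>i\<le>Suc N. y0 < z i \<and> z i \<le> y0 + (T + T') \<and> v (z i) = 0) \<and>
       (\<forall>i<Suc N. \<exists>y. z i < y \<and> y < z (Suc i) \<and> v y \<noteq> 0)"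
    proof (intro exI[of _ "case_nat z0 z"] conjI allI impI)
      fix i assume "i < Suc N"
      then show "\<exists>y. case_nat z0 z i < y \<and> y < case_nat z0 z (Suc i) \<and> v y \<noteq> 0"
        using z0 z(1)[of 0] z(2) \<open>v y1 \<noteq> 0\<close> by (cases i) auto
    qed (use z z0 ** in \<open>force split: nat.split\<close>)+
  qed
qed

section \<open>The distance along an edge\<close>

text \<open>The derivative is the pointwise limit of difference quotients with step
  \<open>1 / real (Suc n)\<close>, which eventually stay in the open set \<open>I\<close>. The
  finitely many exceptional values are added as indicator terms.\<close>

lemma has_derivative_measurable:
  fixes I :: "real set" and f d :: "real \<Rightarrow> real"
  assumes I: "open I" and f: "continuous_on I f" and S: "finite S"
    and d: "\<And>t. t \<in> I - S \<Longrightarrow> (f has_real_derivative d t) (at t)"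
  shows "d \<in> borel_measurable (lebesgue_on I)"
proof -
  define F where "F t = indicator I t * f t" for t
  have "(\<lambda>t. indicator I t *\<^sub>R f t) \<in> borel_measurable borel"
    using I f by (intro borel_measurable_continuous_on_indicator) auto
  then have F[measurable]: "F \<in> borel_measurable borel" unfolding F_def by simp
  define q where "q n t = indicator (I - S) t * ((F (t + 1 / real (Suc n)) - F t) / (1 / real (Suc n)))" for n t
  have IS: "open (I - S)" using I S by (intro open_Diff finite_imp_closed)
  have [measurable]: "I - S \<in> sets borel" using IS by simp
  have "(\<lambda>t. indicator (I - S) t * d t) \<in> borel_measurable borel"
  proof (rule borel_measurable_LIMSEQ_real)
    show "q n \<in> borel_measurable borel" for n unfolding q_def by measurable
    show "(\<lambda>n. q n t) \<longlonglongrightarrow> indicator (I - S) t * d t" for t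
    proof (cases "t \<in> I - S")
      case True
      have *: "((\<lambda>h. (f (t + h) - f t) / h) \<longlongrightarrow> d t) (at 0)"
        using d[OF True] by (simp add: DERIV_def)
      have lim: "filterlim (\<lambda>n. 1 / real (Suc n)) (at 0) sequentially"
        unfolding filterlim_at using LIMSEQ_Suc[OF lim_1_over_n[where 'a=real]] by auto
      have "(\<lambda>n. (f (t + 1 / real (Suc n)) - f t) / (1 / real (Suc n))) \<longlonglongrightarrow> d t"
        by (rule filterlim_compose[OF * lim])
      moreover have "\<forall>\<^sub>F n in sequentially. (f (t + 1 / real (Suc n)) - f t) / (1 / real (Suc n)) = q n t"
      proof -
        have "(\<lambda>n. t + 1 / real (Suc n)) \<longlonglongrightarrow> t + 0"
          by (intro tendsto_add tendsto_const LIMSEQ_Suc lim_1_over_n)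
        then have "\<forall>\<^sub>F n in sequentially. t + 1 / real (Suc n) \<in> I"
          using topological_tendstoD[of _ t sequentially I] I True by simp
        then show ?thesis
          by eventually_elim (use True in \<open>simp add: q_def F_def\<close>)
      qed
      ultimately have "(\<lambda>n. q n t) \<longlonglongrightarrow> d t" by (rule Lim_transform_eventually)
      then show ?thesis using True by simp
    qed (auto simp: q_def)
  qed
  then have "(\<lambda>t. indicator (I - S) t * d t + (\<Sum>s\<in>S. d s * indicator {s} t)) \<in> borel_measurable borel"
    by (intro borel_measurable_add borel_measurable_sum borel_measurable_times[OF borel_measurable_const borel_measurable_indicator]) auto
  then have "(\<lambda>t. indicator (I - S) t * d t + (\<Sum>s\<in>S. d s * indicator {s} t)) \<in> borel_measurable (lebesgue_on I)"
    by (intro measurable_restrict_space1 measurable_completion) simp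
  moreover have "indicator (I - S) t * d t + (\<Sum>s\<in>S. d s * indicator {s} t) = d t" if "t \<in> I" for t
  proof -
    have "(\<Sum>s\<in>S. d s * indicator {s} t) = (\<Sum>s\<in>S. if t = s then d s else 0)"
      by (intro sum.cong) (auto simp: indicator_def)
    also have "\<dots> = (if t \<in> S then d t else 0)" using S by simp
    finally show ?thesis using that by (auto simp: indicator_def)
  qed
  ultimately show ?thesis
    by (subst measurable_cong[where g="\<lambda>t. indicator (I - S) t * d t + (\<Sum>s\<in>S. d s * indicator {s} t)"]) simp_all
qed

lemma differentiable_min_real:
  fixes f h :: "real \<Rightarrow> real"
  assumes f: "f differentiable (at t)" and h: "h differentiable (at t)" and ne: "f t \<noteq> h t"
  shows "(\<lambda>x. min (f x) (h x)) differentiable (at t)"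
proof -
  have *: "(\<lambda>x. min (f x) (h x)) differentiable (at t)"
    if f: "f differentiable (at t)" and h: "h differentiable (at t)" and less: "f t < h t" for f h :: "real \<Rightarrow> real"
  proof -
    have "isCont (\<lambda>x. h x - f x) t"
      using differentiable_imp_continuous_within f h by (intro continuous_intros) blast+
    then have "\<forall>\<^sub>F x in at t. 0 < h x - f x"
      using order_tendstoD(1)[of "\<lambda>x. h x - f x" "h t - f t" "at t" 0] less by (simp add: isCont_def)
    then have "\<forall>\<^sub>F x in nhds t. min (f x) (h x) = f x"
      using less by (subst eventually_nhds_conv_at) (auto elim: eventually_mono)
    moreover obtain D where "(f has_real_derivative D) (at t)" using f by (auto simp: real_differentiable_def)
    ultimately have "((\<lambda>x. min (f x) (h x)) has_real_derivative D) (at t)"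
      by (subst DERIV_cong_ev[OF refl _ refl])
    then show ?thesis by (auto simp: real_differentiable_def)
  qed
  show ?thesis
  proof (cases "f t < h t")
    case False
    then have "h t < f t" using ne by simp
    from *[OF h f this] show ?thesis by (simp add: min.commute)
  qed (use * f h in blast)
qed

lemma Lipschitz_deriv_bound:
  fixes f :: "real \<Rightarrow> real"
  assumes D: "(f has_real_derivative D) (at t)" and U: "open U" "t \<in> U"
    and L: "\<And>s. s \<in> U \<Longrightarrow> \<bar>f s - f t\<bar> \<le> K * \<bar>s - t\<bar>"
  shows "\<bar>D\<bar> \<le> K"
proof -
  have "((\<lambda>s. (f s - f t) / (s - t)) \<longlongrightarrow> D) (at t)" using D by (simp add: has_field_derivative_iff)
  then have "((\<lambda>s. \<bar>(f s - f t) / (s - t)\<bar>) \<longlongrightarrow> \<bar>D\<bar>) (at t)" by (rule tendsto_rabs)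
  moreover have "\<forall>\<^sub>F s in at t. \<bar>(f s - f t) / (s - t)\<bar> \<le> K"
    using eventually_at_in_open[OF U] by eventually_elim (use L in \<open>auto simp: abs_divide divide_le_eq\<close>)
  ultimately show ?thesis using tendsto_upperbound trivial_limit_at by blast
qed

locale fin_graph =
  fixes G :: "('v, 'e) metric_graph"
  assumes fin: "class_G_fin G"
begin

lemma class_G: "class_G G" and is_metric_graph: "is_metric_graph G"
  and finite_edges: "finite (edges G)" and edges_nonempty: "edges G \<noteq> {}"
  using fin by (auto simp: class_G_fin_def class_G_def is_metric_graph_def)

sublocale gm: Metric_space "points G" "gdist G"
  using class_G by (rule Metric_space_gdist)

definition elen :: "'e \<Rightarrow> real" where "elen e = real_of_ereal (len G e)"

section \<open>Edges, points and walks\<close>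

lemma edge_cases:
  assumes "e \<in> edges G"
  obtains "len G e = \<infinity>" "edge_int G e = {0<..}" "edge_dom G e = {0..}"
  | "len G e = ereal (elen e)" "0 < elen e" "edge_int G e = {0<..<elen e}" "edge_dom G e = {0..elen e}"
proof -
  have "0 < len G e" using assms is_metric_graph by (auto simp: is_metric_graph_def)
  then show ?thesis
    using that by (cases "len G e") (auto simp: edge_int_def edge_dom_def elen_def greaterThanLessThan_def atLeastAtMost_def)
qed

lemma edge_int_open: "open (edge_int G e)"
proof -
  have "edge_int G e = {0<..} \<inter> (if len G e = \<infinity> then UNIV else if len G e = -\<infinity> then {} else {..<elen e})"
    by (cases "len G e") (auto simp: edge_int_def elen_def)
  then show ?thesis by (simp add: open_Int)
qed

lemma edge_int_interval: "is_interval (edge_int G e)"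
  unfolding is_interval_1 edge_int_def
  by (auto intro: le_less_trans simp del: ereal_less_eq) (meson ereal_less_eq(3) le_less_trans)

lemma edge_int_measurable [simp]: "edge_int G e \<in> sets lebesgue"
  using edge_int_open by simp

lemma edge_int_subset_dom: "edge_int G e \<subseteq> edge_dom G e"
  by (auto simp: edge_int_def edge_dom_def)

lemma pt_Inner: "t \<in> edge_int G e \<Longrightarrow> pt G e t = Inner e t"
  by (auto simp: pt_def edge_int_def)

lemma pt_points: "e \<in> edges G \<Longrightarrow> t \<in> edge_dom G e \<Longrightarrow> pt G e t \<in> points G"
  by (rule pt_in_points[OF is_metric_graph])

lemma length_lower_bound: obtains l where "l > 0" "\<And>e. e \<in> edges G \<Longrightarrow> ereal l < len G e"
proof -
  have "0 < (INF e\<in>edges G. len G e)" using class_G by (simp add: class_G_def)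
  then obtain d where "0 < ereal d" "ereal d < (INF e\<in>edges G. len G e)" using ereal_dense2 by blast
  then show ?thesis using that[of d] less_INF_D by (metis ereal_less(2))
qed

lemma gdist_le_walk: "walk G x y L \<Longrightarrow> gdist G x y \<le> L"
  unfolding gdist_def using walk_points[OF _ is_metric_graph]
  by (auto intro!: cInf_lower bdd_belowI[of _ 0] walk_nonneg)

lemma gdist_pt_le:
  assumes "e \<in> edges G" "s \<in> edge_dom G e" "t \<in> edge_dom G e"
  shows "gdist G (pt G e s) (pt G e t) \<le> \<bar>t - s\<bar>"
  using walk.walk_step[OF walk.walk_refl[OF pt_points[OF assms(1,2)]] assms] gdist_le_walk by fastforce

lemma gdist_greatest:
  assumes "x \<in> points G" "y \<in> points G" "\<And>L. walk G x y L \<Longrightarrow> c \<le> L"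
  shows "c \<le> gdist G x y"
proof -
  have "{L. walk G x y L} \<noteq> {}" using class_G assms by (auto simp: class_G_def)
  then show ?thesis using assms by (auto simp: gdist_def intro: cInf_greatest)
qed

text \<open>Increments along single edges add up along a walk, and the distance is the infimum of
  the lengths of walks.\<close>

lemma Lipschitz_on_edges:
  assumes "\<And>e s t. e \<in> edges G \<Longrightarrow> s \<in> edge_dom G e \<Longrightarrow> t \<in> edge_dom G e
           \<Longrightarrow> \<bar>f (pt G e t) - f (pt G e s)\<bar> \<le> K * \<bar>t - s\<bar>"
    and K: "K > 0" and xy: "x \<in> points G" "y \<in> points G"
  shows "\<bar>f y - f x\<bar> \<le> K * gdist G x (y::('v, 'e) gpoint)"
proof -
  have "\<bar>f y / K - f x / K\<bar> \<le> gdist G x y"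
  proof (rule gdist_greatest[OF xy])
    fix L assume "walk G x y L"
    then show "\<bar>f y / K - f x / K\<bar> \<le> L"
    proof (rule walk_lipschitz[where f="\<lambda>x. f x / K"])
      fix e s t assume "e \<in> edges G" "s \<in> edge_dom G e" "t \<in> edge_dom G e"
      from assms(1)[OF this] show "\<bar>f (pt G e t) / K - f (pt G e s) / K\<bar> \<le> \<bar>t - s\<bar>"
        using K by (simp add: diff_divide_distrib[symmetric] abs_divide divide_le_eq mult.commute)
    qed
  qed
  then show ?thesis using K by (simp add: diff_divide_distrib[symmetric] abs_divide divide_le_eq mult.commute)
qed

text \<open>For a vertex this uses connectedness: the last segment of a walk that leads to it from
  the beginning of some edge lies on an edge through it. A walk without segments means that the
  vertex is that beginning.\<close>

lemma point_on_edge: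
  assumes "x \<in> points G"
  obtains e t where "e \<in> edges G" "t \<in> edge_dom G e" "x = pt G e t"
proof (cases x)
  case (Inner e t)
  then have "e \<in> edges G" "t \<in> edge_int G e" using assms by (auto simp: points_def)
  then show ?thesis using that[of e t] edge_int_subset_dom[of e] Inner by (auto simp: pt_Inner)
next
  case (Vertex v)
  obtain e where e: "e \<in> edges G" using edges_nonempty by auto
  have "0 \<in> edge_dom G e" using e by (cases rule: edge_cases) auto
  then have p: "pt G e 0 \<in> points G" using e pt_points by blast
  then obtain L where "walk G (pt G e 0) x L" using class_G assms unfolding class_G_def by blast
  then show ?thesis
  proof cases
    case walk_refl
    then show ?thesis using that \<open>0 \<in> edge_dom G e\<close> e by blast
  next
    case (walk_step e' s L t)
    then show ?thesis using that by blast
  qed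
qed

lemma src_pt: "Vertex (src G e) = pt G e 0" by (simp add: pt_def)

lemma tgt_pt: "e \<in> edges G \<Longrightarrow> len G e = ereal (elen e) \<Longrightarrow> Vertex (tgt G e) = pt G e (elen e)"
  using is_metric_graph by (auto simp: pt_def is_metric_graph_def)

text \<open>Length of the best route from \<open>x\<close> to the coordinate \<open>t\<close> that
  arrives through an end vertex of \<open>e\<close>. A half-line has one such vertex.\<close>

definition bdist :: "('v, 'e) gpoint \<Rightarrow> 'e \<Rightarrow> real \<Rightarrow> real" where
  "bdist x e t = (if len G e = \<infinity> then gdist G x (Vertex (src G e)) + t
     else min (gdist G x (Vertex (src G e)) + t) (gdist G x (Vertex (tgt G e)) + (elen e - t)))"

text \<open>For \<open>x\<close> inside \<open>e\<close> the direct segment competes with the routes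
  through the end vertices.\<close>

definition edist :: "('v, 'e) gpoint \<Rightarrow> 'e \<Rightarrow> real \<Rightarrow> real" where
  "edist x e t = (case x of Vertex v \<Rightarrow> bdist x e t
     | Inner e' t0 \<Rightarrow> if e' = e then min (bdist x e t) \<bar>t - t0\<bar> else bdist x e t)"

lemma bdist_ge:
  assumes "e \<in> edges G" "t \<in> edge_dom G e"
  shows "len G e = \<infinity> \<Longrightarrow> t \<le> bdist x e t" and "len G e \<noteq> \<infinity> \<Longrightarrow> min t (elen e - t) \<le> bdist x e t"
  using gm.nonneg[of x "Vertex (src G e)"] gm.nonneg[of x "Vertex (tgt G e)"]
  by (auto simp: bdist_def min_def simp del: gm.nonneg)

lemma bdist_nonneg:
  assumes "e \<in> edges G" "t \<in> edge_dom G e" shows "0 \<le> bdist x e t"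
proof (cases "len G e = \<infinity>")
  case True
  then show ?thesis using bdist_ge(1)[OF assms] assms by (force simp: edge_dom_def intro: order_trans)
next
  case False
  have "0 \<le> t \<and> t \<le> elen e" using assms(1) by (cases rule: edge_cases) (use assms False in auto)
  then show ?thesis using bdist_ge(2)[OF assms False, of x] by (auto simp: min_def split: if_splits)
qed

text \<open>The upper bound is the triangle inequality. For the lower bound, \<open>f\<close>
  follows the claimed formula on \<open>e\<close> and the true distance elsewhere; it is 1-Lipschitz
  along every edge and vanishes at \<open>x\<close>, so no walk is shorter than its increment. The
  two prescriptions must agree at the ends of \<open>e\<close>, which is the content of
  \<open>e0\<close> and \<open>el\<close>.\<close>

lemma gdist_edge:
  assumes x: "x \<in> points G" and e: "e \<in> edges G" and t: "t \<in> edge_dom G e"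
  shows "gdist G x (pt G e t) = edist x e t"
proof (rule antisym)
  have d0: "0 \<in> edge_dom G e" using e by (cases rule: edge_cases) auto
  have tri: "gdist G x (pt G e t) \<le> gdist G x (pt G e s) + \<bar>t - s\<bar>" if "s \<in> edge_dom G e" "t \<in> edge_dom G e" for s t
    using gm.triangle[of x "pt G e s" "pt G e t"] x gdist_pt_le[OF e that] pt_points[OF e] that by force
  have dl: "len G e = ereal (elen e) \<and> elen e \<in> edge_dom G e" if "len G e \<noteq> \<infinity>"
    using e that by (cases rule: edge_cases) auto
  have b: "gdist G x (pt G e t) \<le> bdist x e t" if "t \<in> edge_dom G e" for t
  proof (cases "len G e = \<infinity>")
    case True
    then show ?thesis using tri[OF d0 that] that by (simp add: bdist_def src_pt edge_dom_def)
  next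
    case False
    then show ?thesis using tri[OF d0 that] tri[OF _ that, of "elen e"] that dl[OF False]
      by (auto simp: bdist_def src_pt tgt_pt[OF e] edge_dom_def)
  qed
  have i: "x = Inner e t0 \<Longrightarrow> t0 \<in> edge_int G e \<and> t0 \<in> edge_dom G e" for t0
    using x edge_int_subset_dom by (auto simp: points_def)
  show "gdist G x (pt G e t) \<le> edist x e t"
  proof -
    have "gdist G x (pt G e t) \<le> \<bar>t - t0\<bar>" if "x = Inner e t0" for t0
      using gdist_pt_le[OF e _ t, of t0] i[OF that] that by (simp add: pt_Inner)
    then show ?thesis using b[OF t] by (auto simp: edist_def split: gpoint.split)
  qed
  define f where "f y = (case y of Vertex v \<Rightarrow> gdist G x y | Inner e' t \<Rightarrow> if e' = e then edist x e t else gdist G x y)" for y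
  have nn: "0 \<le> gdist G x y" for y by simp
  have e0: "edist x e 0 = gdist G x (pt G e 0)"
  proof -
    have "bdist x e 0 = gdist G x (pt G e 0)"
      using tri[OF _ d0, of "elen e"] dl nn by (auto simp: bdist_def src_pt tgt_pt[OF e] edge_dom_def)
    moreover have "gdist G x (pt G e 0) \<le> \<bar>0 - t0\<bar>" if "x = Inner e t0" for t0
      using gdist_pt_le[OF e _ d0, of t0] i[OF that] that by (simp add: pt_Inner)
    ultimately show ?thesis by (auto simp: edist_def split: gpoint.split)
  qed
  have el: "edist x e (elen e) = gdist G x (pt G e (elen e))" if fin: "len G e \<noteq> \<infinity>"
  proof -
    have "bdist x e (elen e) = gdist G x (pt G e (elen e))"
      using tri[OF d0, of "elen e"] dl[OF fin] fin by (auto simp: bdist_def src_pt tgt_pt[OF e] edge_dom_def)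
    moreover have "gdist G x (pt G e (elen e)) \<le> \<bar>elen e - t0\<bar>" if "x = Inner e t0" for t0
      using gdist_pt_le[OF e, of t0 "elen e"] dl[OF fin] i[OF that] that by (simp add: pt_Inner)
    ultimately show ?thesis by (auto simp: edist_def split: gpoint.split)
  qed
  have fe: "f (pt G e t) = edist x e t" if "t \<in> edge_dom G e" for t
  proof -
    have "t = 0 \<or> len G e = ereal t \<and> t \<noteq> 0 \<or> t \<in> edge_int G e"
      using that by (cases "len G e") (auto simp: edge_dom_def edge_int_def)
    then consider "t = 0" | "len G e = ereal t" "t \<noteq> 0" | "t \<in> edge_int G e" by blast
    then show ?thesis
    proof cases
      case 1 then show ?thesis using e0 by (simp add: f_def pt_def)
    next
      case 2 then have "t = elen e" by (simp add: elen_def)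
      then show ?thesis using el 2 by (simp add: f_def pt_def)
    next
      case 3 then show ?thesis by (simp add: f_def pt_Inner)
    qed
  qed
  have fe': "f (pt G e' t) = gdist G x (pt G e' t)" if "e' \<noteq> e" for e' t
    using that by (auto simp: f_def pt_def)
  have lipe: "\<bar>edist x e t - edist x e s\<bar> \<le> \<bar>t - s\<bar>" for s t
  proof -
    have b: "\<bar>bdist x e t - bdist x e s\<bar> \<le> \<bar>t - s\<bar>"
    proof (cases "len G e = \<infinity>")
      case False
      then show ?thesis unfolding bdist_def by (simp only: if_False)
    qed (simp add: bdist_def)
    show ?thesis
    proof (cases x)
      case (Inner e' t0)
      have "\<bar>min (bdist x e t) \<bar>t - t0\<bar> - min (bdist x e s) \<bar>s - t0\<bar>\<bar> \<le> \<bar>t - s\<bar>"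
        using b by linarith
      then show ?thesis using b Inner by (cases "e' = e") (simp_all add: edist_def)
    qed (use b in \<open>simp add: edist_def\<close>)
  qed
  have fx: "f x = 0"
  proof (cases x)
    case (Inner e' t0)
    show ?thesis
    proof (cases "e' = e")
      case True
      have "0 \<le> bdist x e t0" using i[of t0] Inner True by (intro bdist_nonneg[OF e]) simp
      then show ?thesis using Inner True by (simp add: f_def edist_def)
    qed (use Inner x in \<open>simp add: f_def\<close>)
  qed (use x in \<open>simp add: f_def\<close>)
  have "\<bar>f (pt G e t) - f x\<bar> \<le> gdist G x (pt G e t)"
  proof (rule gdist_greatest[OF x pt_points[OF e t]])
    fix L assume "walk G x (pt G e t) L"
    then show "\<bar>f (pt G e t) - f x\<bar> \<le> L"
    proof (rule walk_lipschitz)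
      fix e' s t assume h: "e' \<in> edges G" "s \<in> edge_dom G e'" "t \<in> edge_dom G e'"
      show "\<bar>f (pt G e' t) - f (pt G e' s)\<bar> \<le> \<bar>t - s\<bar>"
      proof (cases "e' = e")
        case True then show ?thesis using h fe lipe by simp
      next
        case False
        have p: "pt G e' s \<in> points G" "pt G e' t \<in> points G" using h pt_points by auto
        show ?thesis
          using gm.triangle[OF x p(1) p(2)] gm.triangle[OF x p(2) p(1)] gdist_pt_le[OF h] gm.commute[of "pt G e' s" "pt G e' t"]
          by (simp add: fe'[OF False])
      qed
    qed
  qed
  then show "edist x e t \<le> gdist G x (pt G e t)" using fe[OF t] fx by simp
qed

text \<open>The exceptional points are \<open>x\<close> itself and those where two competing routes
  have equal length. Elsewhere one affine expression wins locally.\<close>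

lemma gdist_edge_differentiable:
  assumes x: "x \<in> points G" and e: "e \<in> edges G"
  shows "\<exists>S. finite S \<and> (\<forall>t\<in>edge_int G e - S. (\<lambda>t. gdist G x (pt G e t)) differentiable (at t))"
proof -
  define A B where "A = gdist G x (Vertex (src G e))" and "B = gdist G x (Vertex (tgt G e))"
  have AB: "0 \<le> A" "0 \<le> B" by (auto simp: A_def B_def)
  define S0 where "S0 = {(B + elen e - A) / 2}"
  have bd: "bdist x e differentiable (at t)" if "t \<notin> S0" for t
  proof (cases "len G e = \<infinity>")
    case True then show ?thesis by (simp add: bdist_def[abs_def])
  next
    case False
    have "(\<lambda>t. min (A + t) (B + (elen e - t))) differentiable (at t)"
      by (rule differentiable_min_real) (use that in \<open>auto simp: S0_def field_simps\<close>)
    then show ?thesis using False by (simp add: bdist_def[abs_def] A_def B_def)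
  qed
  have "\<exists>S. finite S \<and> (\<forall>t\<in>edge_int G e - S. edist x e differentiable (at t))"
  proof (cases "\<exists>t0. x = Inner e t0")
    case False
    then have "edist x e = bdist x e" by (auto simp: edist_def fun_eq_iff split: gpoint.split)
    then show ?thesis using bd by (intro exI[of _ S0]) (auto simp: S0_def)
  next
    case True
    then obtain t0 where t0: "x = Inner e t0" by blast
    then have int: "t0 \<in> edge_int G e" using x by (auto simp: points_def)
    define S where "S = {t0, (t0 - A) / 2, (B + elen e + t0) / 2} \<union> S0"
    have "edist x e differentiable (at t)" if t: "t \<in> edge_int G e - S" for t
    proof -
      have "(\<lambda>t. \<bar>t - t0\<bar>) differentiable (at t)"
      proof -
        have "(\<lambda>t. min (t - t0) (t0 - t)) differentiable (at t)"
          using t by (intro differentiable_min_real) (auto simp: S_def)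
        then have "(\<lambda>t. - min (t - t0) (t0 - t)) differentiable (at t)" by (rule differentiable_minus)
        moreover have "(\<lambda>t. - min (t - t0) (t0 - t)) = (\<lambda>t. \<bar>t - t0\<bar>)" by (auto simp: fun_eq_iff)
        ultimately show ?thesis by simp
      qed
      moreover have "bdist x e t \<noteq> \<bar>t - t0\<bar>"
        using e int t AB by (cases rule: edge_cases)
          (auto simp: bdist_def A_def[symmetric] B_def[symmetric] S_def S0_def abs_if min_def field_simps split: if_splits)
      ultimately have "(\<lambda>t. min (bdist x e t) \<bar>t - t0\<bar>) differentiable (at t)"
        using bd[of t] t by (intro differentiable_min_real) (auto simp: S_def)
      then show ?thesis using t0 by (simp add: edist_def[abs_def])
    qed
    then show ?thesis by (intro exI[of _ S]) (auto simp: S_def S0_def)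
  qed
  then obtain S where S: "finite S" "\<And>t. t \<in> edge_int G e - S \<Longrightarrow> edist x e differentiable (at t)" by blast
  have "(\<lambda>t. gdist G x (pt G e t)) differentiable (at t)" if t: "t \<in> edge_int G e - S" for t
  proof -
    obtain D where "(edist x e has_real_derivative D) (at t)" using S(2)[OF t] by (auto simp: real_differentiable_def)
    then have "((\<lambda>t. gdist G x (pt G e t)) has_real_derivative D) (at t)"
      by (rule has_field_derivative_transform_within_open[OF _ edge_int_open[of e]])
        (use t gdist_edge[OF x e subsetD[OF edge_int_subset_dom]] in auto)
    then show ?thesis by (auto simp: real_differentiable_def)
  qed
  with S(1) show ?thesis by blast
qed

section \<open>Continuity, compact balls and compact support\<close>

lemma continuous_map_gtopology:
  "continuous_map (gtopology G) euclideanreal f \<longleftrightarrow>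
    (\<forall>a\<in>points G. \<forall>\<epsilon>>0. \<exists>\<delta>>0. \<forall>x\<in>points G. gdist G a x < \<delta> \<longrightarrow> \<bar>f x - f a\<bar> < \<epsilon>)"
  using gm.metric_continuous_map[OF Met_TC.Metric_space_axioms, of f]
  by (simp add: dist_real_def abs_minus_commute) blast

lemma Lipschitz_continuous_map:
  assumes "\<And>x y. x \<in> points G \<Longrightarrow> y \<in> points G \<Longrightarrow> \<bar>f y - f x\<bar> \<le> K * gdist G x y"
  shows "continuous_map (gtopology G) euclideanreal f"
  unfolding continuous_map_gtopology
proof (intro ballI allI impI)
  fix a \<epsilon> :: _ assume a: "a \<in> points G" and \<epsilon>: "(\<epsilon>::real) > 0"
  have "\<bar>f x - f a\<bar> < \<epsilon>" if "x \<in> points G" "gdist G a x < \<epsilon> / (\<bar>K\<bar> + 1)" for x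
  proof -
    have "\<bar>f x - f a\<bar> \<le> K * gdist G a x" using assms a that by blast
    also have "\<dots> \<le> (\<bar>K\<bar> + 1) * gdist G a x" by (intro mult_right_mono) auto
    also have "\<dots> < \<epsilon>" using that by (simp add: pos_less_divide_eq mult.commute add_pos_nonneg)
    finally show ?thesis .
  qed
  then show "\<exists>\<delta>>0. \<forall>x\<in>points G. gdist G a x < \<delta> \<longrightarrow> \<bar>f x - f a\<bar> < \<epsilon>"
    using \<epsilon> by (intro exI[of _ "\<epsilon> / (\<bar>K\<bar> + 1)"]) (auto simp: add_nonneg_pos)
qed

lemma gdist_Lipschitz:
  assumes "x \<in> points G" "y \<in> points G" "z \<in> points G"
  shows "\<bar>gdist G x z - gdist G x y\<bar> \<le> gdist G y z"
  using gm.triangle[of x y z] gm.triangle[of x z y] assms gm.commute[of y z] by linarith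

lemma continuous_map_gdist:
  assumes "x \<in> points G" shows "continuous_map (gtopology G) euclideanreal (gdist G x)"
  by (rule Lipschitz_continuous_map[where K=1]) (use gdist_Lipschitz assms in simp)

lemma continuous_on_edge:
  assumes "continuous_map (gtopology G) euclideanreal f" "e \<in> edges G"
  shows "continuous_on (edge_dom G e) (on_edge G f e)"
  unfolding continuous_on_iff dist_real_def
proof (intro ballI allI impI)
  fix s \<epsilon> :: real assume s: "s \<in> edge_dom G e" and \<epsilon>: "\<epsilon> > 0"
  obtain \<delta> where d: "\<delta> > 0" "\<forall>x\<in>points G. gdist G (pt G e s) x < \<delta> \<longrightarrow> \<bar>f x - f (pt G e s)\<bar> < \<epsilon>"
    using assms pt_points[OF assms(2) s] \<epsilon> unfolding continuous_map_gtopology by blast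
  show "\<exists>d>0. \<forall>x'\<in>edge_dom G e. \<bar>x' - s\<bar> < d \<longrightarrow> \<bar>on_edge G f e x' - on_edge G f e s\<bar> < \<epsilon>"
    using d gdist_pt_le[OF assms(2) s] pt_points[OF assms(2)]
    by (intro exI[of _ \<delta>]) (auto simp: on_edge_def intro: le_less_trans)
qed

lemma continuous_map_pt:
  assumes "e \<in> edges G"
  shows "continuous_map (top_of_set (edge_dom G e)) (gtopology G) (pt G e)"
  unfolding gm.continuous_map_to_metric
proof (intro ballI allI impI)
  fix s \<epsilon> :: real assume "s \<in> topspace (top_of_set (edge_dom G e))" and \<epsilon>: "\<epsilon> > 0"
  then have s: "s \<in> edge_dom G e" by simp
  show "\<exists>U. openin (top_of_set (edge_dom G e)) U \<and> s \<in> U \<and> (\<forall>y\<in>U. pt G e y \<in> gball G (pt G e s) \<epsilon>)"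
    using s \<epsilon> gdist_pt_le[OF assms s] pt_points[OF assms]
    by (intro exI[of _ "edge_dom G e \<inter> ball s \<epsilon>"])
      (force simp: openin_open gm.in_mball dist_real_def abs_minus_commute)
qed

lemma halfline_distance:
  assumes "x \<in> points G" "e \<in> edges G" "len G e = \<infinity>" "t \<in> edge_dom G e"
  obtains c where "\<And>t. t \<in> edge_dom G e \<Longrightarrow> t - c \<le> gdist G x (pt G e t)"
proof -
  have "t - (case x of Vertex v \<Rightarrow> 0 | Inner e' t0 \<Rightarrow> \<bar>t0\<bar>) \<le> gdist G x (pt G e t)" if "t \<in> edge_dom G e" for t
  proof -
    have "t \<le> bdist x e t" "0 \<le> t" using bdist_ge(1)[OF assms(2) that assms(3)] that by (auto simp: edge_dom_def)
    then show ?thesis using gdist_edge[OF assms(1,2) that]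
      by (cases x) (auto simp: edist_def)
  qed
  then show ?thesis using that by blast
qed

lemma bounded_edge_part:
  assumes x: "x \<in> points G" and e: "e \<in> edges G"
  shows "compact {t \<in> edge_dom G e. gdist G x (pt G e t) \<le> r}"
proof -
  have dc: "closed (edge_dom G e)" using e by (cases rule: edge_cases) auto
  have "closed (edge_dom G e \<inter> (\<lambda>t. gdist G x (pt G e t)) -` {..r})"
    using continuous_on_edge[OF continuous_map_gdist[OF x] e] dc
    by (intro continuous_closed_preimage) (auto simp: on_edge_def)
  moreover have "bounded {t \<in> edge_dom G e. gdist G x (pt G e t) \<le> r}"
    using e
  proof (cases rule: edge_cases)
    case 1
    obtain c where c: "\<And>t. t \<in> edge_dom G e \<Longrightarrow> t - c \<le> gdist G x (pt G e t)"
      using halfline_distance[OF x e 1(1), of 0] 1 by auto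
    have "{t \<in> edge_dom G e. gdist G x (pt G e t) \<le> r} \<subseteq> {0..r + c}" using c 1(3) by force
    then show ?thesis using bounded_subset bounded_closed_interval by blast
  next
    case 2
    then have "{t \<in> edge_dom G e. gdist G x (pt G e t) \<le> r} \<subseteq> {0..elen e}" by blast
    then show ?thesis using bounded_subset bounded_closed_interval by blast
  qed
  moreover have "{t \<in> edge_dom G e. gdist G x (pt G e t) \<le> r} = edge_dom G e \<inter> (\<lambda>t. gdist G x (pt G e t)) -` {..r}" by blast
  ultimately show ?thesis by (metis compact_eq_bounded_closed)
qed

lemma closed_ball_finite_union:
  "{y \<in> points G. gdist G x y \<le> r} = (\<Union>e\<in>edges G. pt G e ` {t \<in> edge_dom G e. gdist G x (pt G e t) \<le> r})"
proof (intro set_eqI iffI)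
  fix y assume y: "y \<in> {y \<in> points G. gdist G x y \<le> r}"
  then obtain e t where "e \<in> edges G" "t \<in> edge_dom G e" "y = pt G e t" using point_on_edge by blast
  then show "y \<in> (\<Union>e\<in>edges G. pt G e ` {t \<in> edge_dom G e. gdist G x (pt G e t) \<le> r})" using y by blast
qed (use pt_points in blast)


text \<open>Each of the finitely many edges meets the ball in the image of a compact set of
  coordinates; on a half-line this holds because the distance from \<open>x\<close> grows without
  bound.\<close>

lemma compact_closed_ball:
  assumes x: "x \<in> points G"
  shows "compactin (gtopology G) {y \<in> points G. gdist G x y \<le> r}"
  unfolding closed_ball_finite_union
proof (rule compactin_Union)
  fix T assume "T \<in> (\<lambda>e. pt G e ` {t \<in> edge_dom G e. gdist G x (pt G e t) \<le> r}) ` edges G"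
  then obtain e where e: "e \<in> edges G" and T: "T = pt G e ` {t \<in> edge_dom G e. gdist G x (pt G e t) \<le> r}" by blast
  show "compactin (gtopology G) T"
    unfolding T by (rule image_compactin[OF _ continuous_map_pt[OF e]])
      (use bounded_edge_part[OF x e] in \<open>auto simp: compactin_subtopology\<close>)
qed (use finite_edges in simp)

text \<open>Closed balls are compact, so a bounded support is as good as a compact one.\<close>

lemma bounded_support_Cc:
  assumes "\<And>y. y \<notin> points G \<Longrightarrow> \<phi> y = 0" "continuous_map (gtopology G) euclideanreal \<phi>"
    and x: "x \<in> points G" and supp: "\<And>y. y \<in> points G \<Longrightarrow> \<phi> y \<noteq> 0 \<Longrightarrow> gdist G x y \<le> r"
  shows "\<phi> \<in> Cc G"
proof -
  let ?S = "{x \<in> points G. \<phi> x \<noteq> 0}"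
  have b: "gm.mcball x r = {y \<in> points G. gdist G x y \<le> r}" using x by (auto simp: gm.mcball_def)
  have "?S \<subseteq> gm.mcball x r" using supp b by auto
  then have "gtopology G closure_of ?S \<subseteq> gm.mcball x r"
    by (rule closure_of_minimal) (rule gm.closedin_mcball)
  then have "compactin (gtopology G) (gtopology G closure_of ?S)"
    using closed_compactin[OF compact_closed_ball[OF x, of r] _ closedin_closure_of] b by simp
  then show ?thesis using assms by (simp add: Cc_def)
qed

text \<open>The last stretch of a route inside \<open>e\<close> starts at an end of \<open>e\<close>
  or at \<open>x\<close>, so the distance is at least that to one of three coordinates. Where such a
  starting point is missing, \<open>c1\<close> or \<open>c2\<close> is an arbitrary nonnegative
  number, which only weakens the bound.\<close>

lemma gdist_edge_lower:
  assumes x: "x \<in> points G" and e: "e \<in> edges G"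
  obtains c1 c2 where "c1 \<ge> 0" "c2 \<ge> 0"
    "\<And>t. t \<in> edge_int G e \<Longrightarrow> min t (min \<bar>t - c1\<bar> \<bar>t - c2\<bar>) \<le> gdist G x (pt G e t)"
proof -
  define c1 where "c1 = (if len G e = \<infinity> then 0 else elen e)"
  define c2 where "c2 = (case x of Vertex v \<Rightarrow> 0 | Inner e' t0 \<Rightarrow> t0)"
  have "min t (min \<bar>t - c1\<bar> \<bar>t - c2\<bar>) \<le> gdist G x (pt G e t)" if t: "t \<in> edge_int G e" for t
  proof -
    have td: "t \<in> edge_dom G e" using t edge_int_subset_dom by blast
    have "min t \<bar>t - c1\<bar> \<le> bdist x e t"
    proof (cases "len G e = \<infinity>")
      case True
      then show ?thesis using bdist_ge(1)[OF e td True, of x] by simp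
    next
      case False
      have "t \<le> elen e" using e td False by (cases rule: edge_cases) auto
      then have "\<bar>t - c1\<bar> = elen e - t" using False by (simp add: c1_def)
      then show ?thesis using bdist_ge(2)[OF e td False, of x] by simp
    qed
    moreover have "gdist G x (pt G e t) = edist x e t"
      using gdist_edge[OF x e] t edge_int_subset_dom by blast
    moreover have "edist x e t = bdist x e t \<or> edist x e t = min (bdist x e t) \<bar>t - c2\<bar>"
      by (cases x) (auto simp: edist_def c2_def)
    moreover have "min a (min b c) \<le> D" if "min a b \<le> B" "D = B \<or> D = min B c" for a b c B D :: real
      using that by (auto simp: min_le_iff_disj)
    ultimately show ?thesis by metis
  qed
  moreover have "c1 \<ge> 0" unfolding c1_def using e by (cases rule: edge_cases) auto
  moreover have "c2 \<ge> 0" unfolding c2_def using x by (cases x) (auto simp: points_def edge_int_def)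
  ultimately show ?thesis using that by blast
qed

end

section \<open>Integrals of exponentials of the distance\<close>

lemma exp_dist_integral:
  fixes \<kappa> c :: real
  assumes \<kappa>: "\<kappa> > 0" and c: "c \<ge> 0"
  shows "integrable (lebesgue_on {0..}) (\<lambda>t. exp (- \<kappa> * \<bar>t - c\<bar>))"
    and "integral\<^sup>L (lebesgue_on {0..}) (\<lambda>t. exp (- \<kappa> * \<bar>t - c\<bar>)) \<le> 2 / \<kappa>"
proof -
  have "((\<lambda>t. exp (\<kappa> * c) * exp (- \<kappa> * t)) has_integral exp (\<kappa> * c) * (exp (- \<kappa> * c) / \<kappa>)) {c..}"
    by (intro has_integral_mult_right has_integral_exp_minus_to_infinity \<kappa>)
  then have 1: "((\<lambda>t. exp (- \<kappa> * \<bar>t - c\<bar>)) has_integral 1 / \<kappa>) {c..}"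
    by (rule has_integral_eq_rhs[OF has_integral_eq, rotated])
      (auto simp: mult_exp_exp algebra_simps exp_minus exp_diff divide_inverse)
  have "((\<lambda>t. exp (- \<kappa> * (c - t))) has_integral (exp (- \<kappa> * (c - c)) / \<kappa> - exp (- \<kappa> * (c - 0)) / \<kappa>)) {0..c}"
    using \<kappa> c by (intro fundamental_theorem_of_calculus)
      (auto intro!: derivative_eq_intros simp: has_real_derivative_iff_has_vector_derivative[symmetric])
  then have 2: "((\<lambda>t. exp (- \<kappa> * \<bar>t - c\<bar>)) has_integral (1 / \<kappa> - exp (- \<kappa> * c) / \<kappa>)) {0..c}"
    by (rule has_integral_eq_rhs[OF has_integral_eq, rotated]) auto
  have U: "{0..c} \<union> {c..} = {0..}" using c by auto
  have "{0..c} \<inter> {c..} = {c}" using c by auto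
  then have "negligible ({0..c} \<inter> {c..})" by simp
  from has_integral_Un[OF 2 1 this] have hi: "((\<lambda>t. exp (- \<kappa> * \<bar>t - c\<bar>)) has_integral (1 / \<kappa> - exp (- \<kappa> * c) / \<kappa> + 1 / \<kappa>)) {0..}"
    unfolding U .
  then have "(\<lambda>t. exp (- \<kappa> * \<bar>t - c\<bar>)) absolutely_integrable_on {0..}"
    by (intro nonnegative_absolutely_integrable_1) auto
  then show i: "integrable (lebesgue_on {0..}) (\<lambda>t. exp (- \<kappa> * \<bar>t - c\<bar>))"
    by (simp add: set_integrable_lebesgue_on)
  have "integral\<^sup>L (lebesgue_on {0..}) (\<lambda>t. exp (- \<kappa> * \<bar>t - c\<bar>)) = 1 / \<kappa> - exp (- \<kappa> * c) / \<kappa> + 1 / \<kappa>"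
    using lebesgue_integral_eq_integral[OF i] integral_unique[OF hi] by simp
  also have "\<dots> \<le> 2 / \<kappa>" using \<kappa> by (simp add: field_simps)
  finally show "integral\<^sup>L (lebesgue_on {0..}) (\<lambda>t. exp (- \<kappa> * \<bar>t - c\<bar>)) \<le> 2 / \<kappa>" .
qed

context fin_graph
begin

text \<open>Each of the three starting points from \<open>gdist_edge_lower\<close> contributes at
  most \<open>2 / \<kappa>\<close>. The bound does not depend on the length of the edge and so stays
  sharp in order when \<open>\<kappa>\<close> is of size \<open>sqrt lam\<close>.\<close>

lemma edge_exp_integral:
  assumes x: "x \<in> points G" and e: "e \<in> edges G" and \<kappa>: "\<kappa> > 0"
  shows "integrable (lebesgue_on (edge_int G e)) (\<lambda>t. exp (- \<kappa> * gdist G x (pt G e t)))"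
    and "integral\<^sup>L (lebesgue_on (edge_int G e)) (\<lambda>t. exp (- \<kappa> * gdist G x (pt G e t))) \<le> 6 / \<kappa>"
proof -
  let ?f = "\<lambda>t. exp (- \<kappa> * gdist G x (pt G e t))"
  obtain c1 c2 where c: "c1 \<ge> 0" "c2 \<ge> 0"
    "\<And>t. t \<in> edge_int G e \<Longrightarrow> min t (min \<bar>t - c1\<bar> \<bar>t - c2\<bar>) \<le> gdist G x (pt G e t)"
    using gdist_edge_lower[OF x e] by metis
  define h where "h c t = exp (- \<kappa> * \<bar>t - c\<bar>)" for c t :: real
  have sub: "edge_int G e \<subseteq> {0..}" by (auto simp: edge_int_def)
  have hi: "integrable (lebesgue_on (edge_int G e)) (h c)" and hI: "integral\<^sup>L (lebesgue_on (edge_int G e)) (h c) \<le> 2 / \<kappa>"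
    if "c \<ge> 0" for c
  proof -
    have i: "set_integrable lebesgue {0..} (h c)" using exp_dist_integral(1)[OF \<kappa> that] by (simp add: set_integrable_lebesgue_on h_def[abs_def])
    then have i': "set_integrable lebesgue (edge_int G e) (h c)" by (rule set_integrable_subset) (use sub in auto)
    then show "integrable (lebesgue_on (edge_int G e)) (h c)" by (simp add: set_integrable_lebesgue_on)
    have "(LINT t:edge_int G e|lebesgue. h c t) \<le> (LINT t:{0..}|lebesgue. h c t)"
      unfolding set_lebesgue_integral_def using i i' sub
      by (intro integral_mono) (auto simp: set_integrable_def indicator_def h_def)
    also have "\<dots> \<le> 2 / \<kappa>" using exp_dist_integral(2)[OF \<kappa> that] by (simp add: set_integral_lebesgue_on h_def)
    finally show "integral\<^sup>L (lebesgue_on (edge_int G e)) (h c) \<le> 2 / \<kappa>" by (simp add: set_integral_lebesgue_on)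
  qed
  have le: "?f t \<le> h 0 t + h c1 t + h c2 t" if t: "t \<in> edge_int G e" for t
  proof -
    have "t > 0" using t by (simp add: edge_int_def)
    consider "t \<le> gdist G x (pt G e t)" | "\<bar>t - c1\<bar> \<le> gdist G x (pt G e t)" | "\<bar>t - c2\<bar> \<le> gdist G x (pt G e t)"
      using c(3)[OF t] by linarith
    then have "?f t \<le> h 0 t \<or> ?f t \<le> h c1 t \<or> ?f t \<le> h c2 t"
      using \<kappa> \<open>t > 0\<close> by cases (auto simp: h_def)
    moreover have "0 \<le> h 0 t" "0 \<le> h c1 t" "0 \<le> h c2 t" by (simp_all add: h_def)
    ultimately show ?thesis by linarith
  qed
  have i3: "integrable (lebesgue_on (edge_int G e)) (\<lambda>t. h 0 t + h c1 t + h c2 t)"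
    using hi c by auto
  have "continuous_on (edge_int G e) ?f"
    using continuous_on_subset[OF continuous_on_edge[OF continuous_map_gdist[OF x] e] edge_int_subset_dom]
    by (intro continuous_intros) (simp add: on_edge_def)
  then have m: "?f \<in> borel_measurable (lebesgue_on (edge_int G e))"
    by (rule continuous_imp_measurable_on_sets_lebesgue) simp
  show i: "integrable (lebesgue_on (edge_int G e)) ?f"
    by (rule Bochner_Integration.integrable_bound[OF i3 m]) (use le in \<open>auto intro!: AE_I2 order_trans[OF _ abs_ge_self]\<close>)
  have "integral\<^sup>L (lebesgue_on (edge_int G e)) ?f \<le> integral\<^sup>L (lebesgue_on (edge_int G e)) (\<lambda>t. h 0 t + h c1 t + h c2 t)"
    by (rule integral_mono[OF i i3]) (use le in auto)
  also have "\<dots> = integral\<^sup>L (lebesgue_on (edge_int G e)) (h 0) + integral\<^sup>L (lebesgue_on (edge_int G e)) (h c1) +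
      integral\<^sup>L (lebesgue_on (edge_int G e)) (h c2)"
    using hi c by simp
  also have "\<dots> \<le> 6 / \<kappa>" using hI[of 0] hI[OF c(1)] hI[OF c(2)] by (simp add: field_simps)
  finally show "integral\<^sup>L (lebesgue_on (edge_int G e)) ?f \<le> 6 / \<kappa>" .
qed

end

section \<open>Integrals and Sobolev functions on a finite graph\<close>

context fin_graph
begin

abbreviation edge_measure :: "'e \<Rightarrow> real measure" where
  "edge_measure e \<equiv> lebesgue_on (edge_int G e)"

definition gint :: "('e \<Rightarrow> real \<Rightarrow> real) \<Rightarrow> real" where
  "gint F = (\<Sum>e\<in>edges G. integral\<^sup>L (edge_measure e) (F e))"

definition gintble :: "('e \<Rightarrow> real \<Rightarrow> real) \<Rightarrow> bool" where
  "gintble F \<longleftrightarrow> (\<forall>e\<in>edges G. integrable (edge_measure e) (F e))"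

lemma gintegral_gint: "gintegral G F = gint F"
  unfolding gintegral_def gint_def using finite_edges
  by (simp add: infsum_finite set_integral_lebesgue_on)

lemma gintegrable_gintble: "gintegrable G F \<longleftrightarrow> gintble F"
  unfolding gintegrable_def gintble_def using finite_edges
  by (simp add: summable_on_finite set_integrable_lebesgue_on)

lemma gintble_add: "gintble F \<Longrightarrow> gintble H \<Longrightarrow> gintble (\<lambda>e t. F e t + H e t)"
  and gintble_diff: "gintble F \<Longrightarrow> gintble H \<Longrightarrow> gintble (\<lambda>e t. F e t - H e t)"
  and gintble_cmult: "gintble F \<Longrightarrow> gintble (\<lambda>e t. c * F e t)"
  by (auto simp: gintble_def)

lemma gint_add: "gintble F \<Longrightarrow> gintble H \<Longrightarrow> gint (\<lambda>e t. F e t + H e t) = gint F + gint H"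
  and gint_diff: "gintble F \<Longrightarrow> gintble H \<Longrightarrow> gint (\<lambda>e t. F e t - H e t) = gint F - gint H"
  and gint_cmult: "gint (\<lambda>e t. c * F e t) = c * gint F"
  by (auto simp: gintble_def gint_def sum.distrib sum_subtractf sum_distrib_left)

lemma gint_cong_AE:
  assumes "\<And>e. e \<in> edges G \<Longrightarrow> F e \<in> borel_measurable (edge_measure e)"
    "\<And>e. e \<in> edges G \<Longrightarrow> H e \<in> borel_measurable (edge_measure e)"
    "\<And>e. e \<in> edges G \<Longrightarrow> AE t in edge_measure e. F e t = H e t"
  shows "gint F = gint H"
  unfolding gint_def using assms by (intro sum.cong integral_cong_AE) auto

lemma gint_cong:
  assumes "\<And>e t. e \<in> edges G \<Longrightarrow> t \<in> edge_int G e \<Longrightarrow> F e t = H e t"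
  shows "gint F = gint H"
  unfolding gint_def using assms by (intro sum.cong Bochner_Integration.integral_cong) auto

lemma gint_mono_AE:
  assumes "gintble F" "gintble H"
    "\<And>e. e \<in> edges G \<Longrightarrow> AE t in edge_measure e. F e t \<le> H e t"
  shows "gint F \<le> gint H"
  unfolding gint_def using assms by (intro sum_mono integral_mono_AE) (auto simp: gintble_def)

lemma gint_nonneg:
  assumes "\<And>e t. e \<in> edges G \<Longrightarrow> t \<in> edge_int G e \<Longrightarrow> 0 \<le> F e t"
  shows "0 \<le> gint F"
  unfolding gint_def by (intro sum_nonneg Bochner_Integration.integral_nonneg) (use assms in auto)

lemma edge_integral_le_gint:
  assumes "e \<in> edges G" "\<And>e t. e \<in> edges G \<Longrightarrow> t \<in> edge_int G e \<Longrightarrow> 0 \<le> F e t"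
  shows "integral\<^sup>L (edge_measure e) (F e) \<le> gint F"
  unfolding gint_def using finite_edges assms
  by (intro member_le_sum) (auto intro!: Bochner_Integration.integral_nonneg)

lemma gintble_bound:
  assumes "gintble H" "\<And>e. e \<in> edges G \<Longrightarrow> F e \<in> borel_measurable (edge_measure e)"
    "\<And>e. e \<in> edges G \<Longrightarrow> AE t in edge_measure e. \<bar>F e t\<bar> \<le> H e t"
  shows "gintble F"
  unfolding gintble_def
proof
  fix e assume e: "e \<in> edges G"
  have H: "integrable (edge_measure e) (H e)" using assms(1) e by (simp add: gintble_def)
  show "integrable (edge_measure e) (F e)"
    by (rule Bochner_Integration.integrable_bound[OF H assms(2)[OF e]])
      (use assms(3)[OF e] in \<open>auto elim!: eventually_mono\<close>)
qed

lemma gintble_L2: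
  assumes "\<And>e. e \<in> edges G \<Longrightarrow> F e \<in> L2_on (edge_int G e)" "\<And>e. e \<in> edges G \<Longrightarrow> H e \<in> L2_on (edge_int G e)"
  shows "gintble (\<lambda>e t. F e t * H e t)"
  unfolding gintble_def using assms by (auto intro: L2_on_mult_integrable)

text \<open>A function on \<open>G\<close> together with its classical edge derivative, which may be missing at finitely many
  points of each edge.\<close>

definition gpair :: "(('v, 'e) gpoint \<Rightarrow> real) \<Rightarrow> ('e \<Rightarrow> real \<Rightarrow> real) \<Rightarrow> bool" where
  "gpair \<phi> \<phi>' \<longleftrightarrow> (\<forall>x. x \<notin> points G \<longrightarrow> \<phi> x = 0) \<and> continuous_map (gtopology G) euclideanreal \<phi> \<and>
     (\<forall>e\<in>edges G. on_edge G \<phi> e \<in> L2_on (edge_int G e) \<and> \<phi>' e \<in> L2_on (edge_int G e) \<and>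
       (\<exists>S. finite S \<and> (\<forall>t\<in>edge_int G e - S. (on_edge G \<phi> e has_real_derivative \<phi>' e t) (at t))))"

definition gweight :: "real \<Rightarrow> (('v, 'e) gpoint \<Rightarrow> real) \<Rightarrow> ('e \<Rightarrow> real \<Rightarrow> real) \<Rightarrow> bool" where
  "gweight C \<eta> \<eta>' \<longleftrightarrow> continuous_map (gtopology G) euclideanreal \<eta> \<and> (\<forall>x\<in>points G. \<bar>\<eta> x\<bar> \<le> C) \<and>
     (\<forall>e\<in>edges G. (\<forall>t\<in>edge_int G e. \<bar>\<eta>' e t\<bar> \<le> C) \<and>
       (\<exists>S. finite S \<and> (\<forall>t\<in>edge_int G e - S. (on_edge G \<eta> e has_real_derivative \<eta>' e t) (at t))))"

lemma pt_int_points: "e \<in> edges G \<Longrightarrow> t \<in> edge_int G e \<Longrightarrow> pt G e t \<in> points G"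
  using pt_points edge_int_subset_dom by blast

lemma continuous_on_edge_int:
  "continuous_map (gtopology G) euclideanreal f \<Longrightarrow> e \<in> edges G \<Longrightarrow> continuous_on (edge_int G e) (on_edge G f e)"
  using continuous_on_edge continuous_on_subset edge_int_subset_dom by blast

lemma on_edge_measurable:
  "continuous_map (gtopology G) euclideanreal f \<Longrightarrow> e \<in> edges G \<Longrightarrow> on_edge G f e \<in> borel_measurable (edge_measure e)"
  by (intro continuous_imp_measurable_on_sets_lebesgue continuous_on_edge_int) auto

section \<open>Classical edge derivatives as weak derivatives\<close>

lemma gpair_weak_deriv:
  assumes "gpair \<phi> \<phi>'" "e \<in> edges G"
  shows "is_weak_deriv (edge_int G e) (on_edge G \<phi> e) (\<phi>' e)"
proof -
  obtain S where "finite S" "\<forall>t\<in>edge_int G e - S. (on_edge G \<phi> e has_real_derivative \<phi>' e t) (at t)"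
    using assms unfolding gpair_def by blast
  then show ?thesis using assms continuous_on_edge_int[of \<phi> e]
    by (intro classical_weak_deriv[OF edge_int_open edge_int_interval]) (auto simp: gpair_def)
qed

text \<open>\<open>wderiv\<close> is a choice among weak derivatives; uniqueness almost everywhere
  makes the choice immaterial.\<close>

lemma wderiv_AE:
  assumes "continuous_on (edge_int G e) f" "g \<in> L2_on (edge_int G e)" "is_weak_deriv (edge_int G e) f g"
  shows "AE t in edge_measure e. wderiv (edge_int G e) f t = g t"
    and "wderiv (edge_int G e) f \<in> L2_on (edge_int G e)" "is_weak_deriv (edge_int G e) f (wderiv (edge_int G e) f)"
proof -
  have *: "wderiv (edge_int G e) f \<in> L2_on (edge_int G e) \<and> is_weak_deriv (edge_int G e) f (wderiv (edge_int G e) f)"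
    unfolding wderiv_def by (rule someI[of _ g]) (use assms in blast)
  then show "AE t in edge_measure e. wderiv (edge_int G e) f t = g t"
    using assms by (intro weak_deriv_unique[OF edge_int_open edge_int_interval]) auto
  show "wderiv (edge_int G e) f \<in> L2_on (edge_int G e)" "is_weak_deriv (edge_int G e) f (wderiv (edge_int G e) f)"
    using * by auto
qed

lemma gpair_gderiv:
  assumes "gpair \<phi> \<phi>'" "e \<in> edges G"
  shows "AE t in edge_measure e. gderiv G \<phi> e t = \<phi>' e t" and "gderiv G \<phi> e \<in> borel_measurable (edge_measure e)"
  unfolding gderiv_def
  using wderiv_AE[OF continuous_on_edge_int _ gpair_weak_deriv[OF assms]] assms
  by (auto simp: gpair_def L2_on_lebesgue_on)

lemma gpair_H1:
  assumes "gpair \<phi> \<phi>'" shows "\<phi> \<in> H1 G"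
proof -
  have "gderiv G \<phi> e \<in> L2_on (edge_int G e)" if "e \<in> edges G" for e
    unfolding gderiv_def
    using wderiv_AE[OF continuous_on_edge_int _ gpair_weak_deriv[OF assms that]] assms that
    by (auto simp: gpair_def)
  then have "gintble (\<lambda>e t. (gderiv G \<phi> e t)\<^sup>2 + (on_edge G \<phi> e t)\<^sup>2)"
    using assms by (auto simp: gintble_def gpair_def L2_on_lebesgue_on)
  moreover have "on_edge G \<phi> e \<in> H1_on (edge_int G e)" if "e \<in> edges G" for e
    using gpair_weak_deriv[OF assms that] assms that by (auto simp: H1_on_def gpair_def)
  ultimately show ?thesis using assms by (auto simp: H1_def gpair_def gintegrable_gintble)
qed

lemma gpair_L2: "gpair \<phi> \<phi>' \<Longrightarrow> e \<in> edges G \<Longrightarrow> on_edge G \<phi> e \<in> L2_on (edge_int G e)"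
  "gpair \<phi> \<phi>' \<Longrightarrow> e \<in> edges G \<Longrightarrow> \<phi>' e \<in> L2_on (edge_int G e)"
  by (auto simp: gpair_def)

lemma gpair_measurable: 
  assumes "gpair \<phi> \<phi>'" "e \<in> edges G"
  shows "on_edge G \<phi> e \<in> borel_measurable (edge_measure e)" "\<phi>' e \<in> borel_measurable (edge_measure e)"
  using gpair_L2[OF assms] by (auto simp: L2_on_lebesgue_on)

lemma gweight_measurable:
  assumes "gweight C \<eta> \<eta>'" "e \<in> edges G"
  shows "on_edge G \<eta> e \<in> borel_measurable (edge_measure e)" "\<eta>' e \<in> borel_measurable (edge_measure e)"
proof -
  show "on_edge G \<eta> e \<in> borel_measurable (edge_measure e)"
    using assms by (intro on_edge_measurable) (auto simp: gweight_def)
  obtain S where "finite S" "\<forall>t\<in>edge_int G e - S. (on_edge G \<eta> e has_real_derivative \<eta>' e t) (at t)"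
    using assms unfolding gweight_def by blast
  then show "\<eta>' e \<in> borel_measurable (edge_measure e)"
    using assms by (intro has_derivative_measurable[OF edge_int_open continuous_on_edge_int[of \<eta>]]) (auto simp: gweight_def)
qed

lemma gweight_bound:
  assumes "gweight C \<eta> \<eta>'" "e \<in> edges G" "t \<in> edge_int G e"
  shows "\<bar>on_edge G \<eta> e t\<bar> \<le> C" "\<bar>\<eta>' e t\<bar> \<le> C"
  using assms pt_int_points by (auto simp: gweight_def on_edge_def)

lemma gpair_mult_gweight:
  assumes \<phi>: "gpair \<phi> \<phi>'" and \<eta>: "gweight C \<eta> \<eta>'"
  shows "gpair (\<lambda>x. \<phi> x * \<eta> x) (\<lambda>e t. \<phi>' e t * on_edge G \<eta> e t + on_edge G \<phi> e t * \<eta>' e t)"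
  unfolding gpair_def
proof (intro conjI ballI allI impI)
  show "\<phi> x * \<eta> x = 0" if "x \<notin> points G" for x using that \<phi> by (simp add: gpair_def)
  show "continuous_map (gtopology G) euclideanreal (\<lambda>x. \<phi> x * \<eta> x)"
    using \<phi> \<eta> by (intro continuous_map_real_mult) (auto simp: gpair_def gweight_def)
  fix e assume e: "e \<in> edges G"
  have [simp]: "on_edge G (\<lambda>x. \<phi> x * \<eta> x) e = (\<lambda>t. on_edge G \<phi> e t * on_edge G \<eta> e t)"
    by (simp add: on_edge_def)
  show "on_edge G (\<lambda>x. \<phi> x * \<eta> x) e \<in> L2_on (edge_int G e)"
    using gpair_L2[OF \<phi> e] gweight_bound[OF \<eta> e] gweight_measurable[OF \<eta> e]
    by (auto intro!: L2_on_bounded_mult[where C=C])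
  show "(\<lambda>t. \<phi>' e t * on_edge G \<eta> e t + on_edge G \<phi> e t * \<eta>' e t) \<in> L2_on (edge_int G e)"
    using gpair_L2[OF \<phi> e] gweight_bound[OF \<eta> e] gweight_measurable[OF \<eta> e]
    by (auto intro!: L2_on_add L2_on_bounded_mult[where C=C])
  obtain S where S: "finite S" "\<forall>t\<in>edge_int G e - S. (on_edge G \<eta> e has_real_derivative \<eta>' e t) (at t)"
    using \<eta> e unfolding gweight_def by blast
  obtain T where T: "finite T" "\<forall>t\<in>edge_int G e - T. (on_edge G \<phi> e has_real_derivative \<phi>' e t) (at t)"
    using \<phi> e unfolding gpair_def by blast
  show "\<exists>S. finite S \<and> (\<forall>t\<in>edge_int G e - S. (on_edge G (\<lambda>x. \<phi> x * \<eta> x) e has_real_derivative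
      \<phi>' e t * on_edge G \<eta> e t + on_edge G \<phi> e t * \<eta>' e t) (at t))"
  proof (intro exI[of _ "S \<union> T"] conjI ballI)
    fix t assume t: "t \<in> edge_int G e - (S \<union> T)"
    then have "(on_edge G \<phi> e has_real_derivative \<phi>' e t) (at t)" "(on_edge G \<eta> e has_real_derivative \<eta>' e t) (at t)"
      using S T by auto
    from DERIV_mult[OF this] have "((\<lambda>t. on_edge G \<phi> e t * on_edge G \<eta> e t) has_real_derivative
      \<phi>' e t * on_edge G \<eta> e t + \<eta>' e t * on_edge G \<phi> e t) (at t)" .
    then show "(on_edge G (\<lambda>x. \<phi> x * \<eta> x) e has_real_derivative
      \<phi>' e t * on_edge G \<eta> e t + on_edge G \<phi> e t * \<eta>' e t) (at t)"
      unfolding on_edge_def by (simp add: mult.commute)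
  qed (use S T in auto)
qed

lemma gpair_sum:
  assumes "finite A" "\<And>i. i \<in> A \<Longrightarrow> gpair (\<phi> i) (\<phi>' i)"
  shows "gpair (\<lambda>x. \<Sum>i\<in>A. c i * \<phi> i x) (\<lambda>e t. \<Sum>i\<in>A. c i * \<phi>' i e t)"
  unfolding gpair_def
proof (intro conjI ballI allI impI)
  show "(\<Sum>i\<in>A. c i * \<phi> i x) = 0" if "x \<notin> points G" for x
    using that assms by (simp add: gpair_def)
  show "continuous_map (gtopology G) euclideanreal (\<lambda>x. \<Sum>i\<in>A. c i * \<phi> i x)"
    using assms by (intro continuous_map_sum continuous_map_real_mult) (auto simp: gpair_def)
  fix e assume e: "e \<in> edges G"
  have [simp]: "on_edge G (\<lambda>x. \<Sum>i\<in>A. c i * \<phi> i x) e = (\<lambda>t. \<Sum>i\<in>A. c i * on_edge G (\<phi> i) e t)"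
    by (simp add: on_edge_def)
  show "on_edge G (\<lambda>x. \<Sum>i\<in>A. c i * \<phi> i x) e \<in> L2_on (edge_int G e)"
    "(\<lambda>t. \<Sum>i\<in>A. c i * \<phi>' i e t) \<in> L2_on (edge_int G e)"
    using gpair_L2[OF assms(2) e] by (auto intro!: L2_on_sum L2_on_cmult)
  have "\<forall>i\<in>A. \<exists>S. finite S \<and> (\<forall>t\<in>edge_int G e - S. (on_edge G (\<phi> i) e has_real_derivative \<phi>' i e t) (at t))"
    using assms e unfolding gpair_def by blast
  then obtain S where S: "\<forall>i\<in>A. finite (S i) \<and> (\<forall>t\<in>edge_int G e - S i. (on_edge G (\<phi> i) e has_real_derivative \<phi>' i e t) (at t))"
    by metis
  show "\<exists>S. finite S \<and> (\<forall>t\<in>edge_int G e - S. (on_edge G (\<lambda>x. \<Sum>i\<in>A. c i * \<phi> i x) e has_real_derivative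
      (\<Sum>i\<in>A. c i * \<phi>' i e t)) (at t))"
    using S assms(1) by (intro exI[of _ "\<Union>i\<in>A. S i"] conjI ballI) (auto intro!: DERIV_sum DERIV_cmult)
qed

section \<open>Construction of weights\<close>

lemma gweight_const: "gweight \<bar>c\<bar> (\<lambda>x. c) (\<lambda>e t. 0)"
  by (auto simp: gweight_def on_edge_def)

lemma gweight_sum:
  assumes "finite A" "\<And>i. i \<in> A \<Longrightarrow> gweight (C i) (\<eta> i) (\<eta>' i)"
  shows "gweight (\<Sum>i\<in>A. C i) (\<lambda>x. \<Sum>i\<in>A. \<eta> i x) (\<lambda>e t. \<Sum>i\<in>A. \<eta>' i e t)"
  unfolding gweight_def
proof (intro conjI ballI allI impI)
  show "continuous_map (gtopology G) euclideanreal (\<lambda>x. \<Sum>i\<in>A. \<eta> i x)"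
    using assms by (intro continuous_map_sum) (auto simp: gweight_def)
  show "\<bar>\<Sum>i\<in>A. \<eta> i x\<bar> \<le> (\<Sum>i\<in>A. C i)" if "x \<in> points G" for x
    using assms that by (intro order_trans[OF sum_abs] sum_mono) (auto simp: gweight_def)
  fix e assume e: "e \<in> edges G"
  show "\<bar>\<Sum>i\<in>A. \<eta>' i e t\<bar> \<le> (\<Sum>i\<in>A. C i)" if "t \<in> edge_int G e" for t
    using assms that e by (intro order_trans[OF sum_abs] sum_mono) (auto simp: gweight_def)
  have [simp]: "on_edge G (\<lambda>x. \<Sum>i\<in>A. \<eta> i x) e = (\<lambda>t. \<Sum>i\<in>A. on_edge G (\<eta> i) e t)"
    by (simp add: on_edge_def)
  have "\<forall>i\<in>A. \<exists>S. finite S \<and> (\<forall>t\<in>edge_int G e - S. (on_edge G (\<eta> i) e has_real_derivative \<eta>' i e t) (at t))"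
    using assms e unfolding gweight_def by blast
  then obtain S where S: "\<forall>i\<in>A. finite (S i) \<and> (\<forall>t\<in>edge_int G e - S i. (on_edge G (\<eta> i) e has_real_derivative \<eta>' i e t) (at t))"
    by metis
  show "\<exists>S. finite S \<and> (\<forall>t\<in>edge_int G e - S. (on_edge G (\<lambda>x. \<Sum>i\<in>A. \<eta> i x) e has_real_derivative
      (\<Sum>i\<in>A. \<eta>' i e t)) (at t))"
    using S assms(1) by (intro exI[of _ "\<Union>i\<in>A. S i"] conjI ballI) (auto intro!: DERIV_sum)
qed

lemma continuous_map_compose_real:
  assumes "continuous_map X euclideanreal f" "continuous_on K h" "f ` topspace X \<subseteq> K"
  shows "continuous_map X euclideanreal (\<lambda>x. h (f x))"
proof -
  have "continuous_map X (top_of_set K) f" using assms by (auto simp: continuous_map_in_subtopology)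
  moreover have "continuous_map (top_of_set K) euclideanreal h" using assms by simp
  ultimately show ?thesis using continuous_map_compose[of X "top_of_set K" f euclideanreal h] by (simp add: o_def)
qed

lemma gweight_compose:
  assumes \<eta>: "gweight C \<eta> \<eta>'" and r: "\<And>x. x \<in> points G \<Longrightarrow> a \<le> \<eta> x \<and> \<eta> x \<le> b"
    and h: "\<And>y. a \<le> y \<Longrightarrow> y \<le> b \<Longrightarrow> (h has_real_derivative h' y) (at y)"
    and D: "\<And>y. a \<le> y \<Longrightarrow> y \<le> b \<Longrightarrow> \<bar>h y\<bar> \<le> D \<and> \<bar>h' y\<bar> \<le> D"
  shows "gweight (D * C + D) (\<lambda>x. h (\<eta> x)) (\<lambda>e t. h' (on_edge G \<eta> e t) * \<eta>' e t)"
  unfolding gweight_def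
proof (intro conjI ballI allI impI)
  \<comment> \<open>The bounds at some point show that \<open>C\<close> and \<open>D\<close> are
    nonnegative.\<close>
  obtain x0 where x0: "x0 \<in> points G"
  proof -
    obtain e where e: "e \<in> edges G" using edges_nonempty by blast
    have "0 \<in> edge_dom G e" using e by (cases rule: edge_cases) auto
    then show ?thesis using that pt_points[OF e] by blast
  qed
  have "\<bar>\<eta> x0\<bar> \<le> C" using \<eta> x0 by (simp add: gweight_def)
  moreover have "\<bar>h (\<eta> x0)\<bar> \<le> D" using D[of "\<eta> x0"] r[OF x0] by blast
  ultimately have C: "0 \<le> C" "0 \<le> D" using abs_ge_zero order_trans by blast+
  have "continuous_on {a..b} h"
    using h by (intro DERIV_continuous_on[where D=h']) (auto intro: has_field_derivative_at_within)
  then show "continuous_map (gtopology G) euclideanreal (\<lambda>x. h (\<eta> x))"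
  proof (rule continuous_map_compose_real[rotated])
    show "continuous_map (gtopology G) euclideanreal \<eta>" using \<eta> unfolding gweight_def by blast
    show "\<eta> ` topspace (gtopology G) \<subseteq> {a..b}" using r by (auto simp del: abs_le_iff)
  qed
  show "\<bar>h (\<eta> x)\<bar> \<le> D * C + D" if "x \<in> points G" for x
  proof -
    have "\<bar>h (\<eta> x)\<bar> \<le> D" using D[of "\<eta> x"] r[OF that] by blast
    moreover have "0 \<le> D * C" using C by simp
    ultimately show ?thesis by linarith
  qed
  fix e assume e: "e \<in> edges G"
  have r': "a \<le> on_edge G \<eta> e t \<and> on_edge G \<eta> e t \<le> b" if "t \<in> edge_int G e" for t
    using r pt_int_points[OF e that] by (simp add: on_edge_def)
  show "\<bar>h' (on_edge G \<eta> e t) * \<eta>' e t\<bar> \<le> D * C + D" if t: "t \<in> edge_int G e" for t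
  proof -
    have "\<bar>h' (on_edge G \<eta> e t) * \<eta>' e t\<bar> \<le> D * C"
      unfolding abs_mult using D r'[OF t] gweight_bound(2)[OF \<eta> e t] C by (intro mult_mono) auto
    then show ?thesis using C by linarith
  qed
  obtain S where S: "finite S" "\<forall>t\<in>edge_int G e - S. (on_edge G \<eta> e has_real_derivative \<eta>' e t) (at t)"
    using \<eta> e unfolding gweight_def by blast
  have [simp]: "on_edge G (\<lambda>x. h (\<eta> x)) e = (\<lambda>t. h (on_edge G \<eta> e t))"
    by (simp add: on_edge_def)
  show "\<exists>S. finite S \<and> (\<forall>t\<in>edge_int G e - S. (on_edge G (\<lambda>x. h (\<eta> x)) e has_real_derivative
      h' (on_edge G \<eta> e t) * \<eta>' e t) (at t))"
    using S r' h by (intro exI[of _ S]) (auto intro!: DERIV_chain2[of h])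
qed

text \<open>At the corners of the distance function the value 0 keeps the bound 1 valid on the whole
  open edge, as \<open>gweight\<close> demands.\<close>

definition dist_deriv :: "('v, 'e) gpoint \<Rightarrow> 'e \<Rightarrow> real \<Rightarrow> real" where
  "dist_deriv x e t = (if (\<lambda>t. gdist G x (pt G e t)) differentiable (at t)
     then deriv (\<lambda>t. gdist G x (pt G e t)) t else 0)"

lemma dist_deriv_bound:
  assumes x: "x \<in> points G" and e: "e \<in> edges G" and t: "t \<in> edge_int G e"
  shows "\<bar>dist_deriv x e t\<bar> \<le> 1"
proof (cases "(\<lambda>t. gdist G x (pt G e t)) differentiable (at t)")
  case True
  then have "((\<lambda>t. gdist G x (pt G e t)) has_real_derivative dist_deriv x e t) (at t)"
    by (simp add: dist_deriv_def DERIV_deriv_iff_real_differentiable)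
  moreover have "\<bar>gdist G x (pt G e s) - gdist G x (pt G e t)\<bar> \<le> 1 * \<bar>s - t\<bar>" if "s \<in> edge_int G e" for s
    using gdist_Lipschitz[OF x, of "pt G e t" "pt G e s"] gdist_pt_le[OF e, of t s] that t
      pt_int_points[OF e] edge_int_subset_dom by fastforce
  ultimately show ?thesis by (rule Lipschitz_deriv_bound[OF _ edge_int_open t])
qed (simp add: dist_deriv_def)

lemma gweight_exp_dist:
  assumes x: "x \<in> points G" and \<alpha>: "\<alpha> > 0"
  shows "gweight (max 1 \<alpha>) (\<lambda>y. exp (- \<alpha> * gdist G x y)) (\<lambda>e t. - \<alpha> * dist_deriv x e t * exp (- \<alpha> * gdist G x (pt G e t)))"
  unfolding gweight_def
proof (intro conjI ballI allI impI)
  show "continuous_map (gtopology G) euclideanreal (\<lambda>y. exp (- \<alpha> * gdist G x y))"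
    by (rule continuous_map_compose_real[OF continuous_map_gdist[OF x], where K=UNIV]) (auto intro!: continuous_intros)
  show "\<bar>exp (- \<alpha> * gdist G x y)\<bar> \<le> max 1 \<alpha>" if "y \<in> points G" for y
    using \<alpha> gm.nonneg[of x y] by (simp add: le_max_iff_disj)
  fix e assume e: "e \<in> edges G"
  show "\<bar>- \<alpha> * dist_deriv x e t * exp (- \<alpha> * gdist G x (pt G e t))\<bar> \<le> max 1 \<alpha>" if t: "t \<in> edge_int G e" for t
  proof -
    have "\<bar>- \<alpha> * dist_deriv x e t * exp (- \<alpha> * gdist G x (pt G e t))\<bar> \<le> (\<alpha> * 1) * 1"
      unfolding abs_mult using \<alpha> dist_deriv_bound[OF x e t] by (intro mult_mono) auto
    then show ?thesis by simp
  qed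
  obtain S where S: "finite S" "\<forall>t\<in>edge_int G e - S. (\<lambda>t. gdist G x (pt G e t)) differentiable (at t)"
    using gdist_edge_differentiable[OF x e] by blast
  show "\<exists>S. finite S \<and> (\<forall>t\<in>edge_int G e - S. (on_edge G (\<lambda>y. exp (- \<alpha> * gdist G x y)) e has_real_derivative
      - \<alpha> * dist_deriv x e t * exp (- \<alpha> * gdist G x (pt G e t))) (at t))"
  proof (intro exI[of _ S] conjI ballI)
    fix t assume "t \<in> edge_int G e - S"
    then have "((\<lambda>t. gdist G x (pt G e t)) has_real_derivative dist_deriv x e t) (at t)"
      using S by (simp add: dist_deriv_def DERIV_deriv_iff_real_differentiable)
    then show "(on_edge G (\<lambda>y. exp (- \<alpha> * gdist G x y)) e has_real_derivative
      - \<alpha> * dist_deriv x e t * exp (- \<alpha> * gdist G x (pt G e t))) (at t)"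
      unfolding on_edge_def by (auto intro!: derivative_eq_intros)
  qed (use S in auto)
qed

text \<open>The condition \<open>h 0 = 0\<close> serves twice: it preserves the value zero outside
  \<open>points G\<close>, and with the bound on \<open>h'\<close> it gives
  \<open>\<bar>h y\<bar> \<le> D * \<bar>y\<bar>\<close>, hence square integrability on
  half-lines.\<close>

lemma gpair_compose:
  assumes \<phi>: "gpair \<phi> \<phi>'" and r: "\<And>x. x \<in> points G \<Longrightarrow> \<bar>\<phi> x\<bar> \<le> M"
    and h: "\<And>y. \<bar>y\<bar> \<le> M \<Longrightarrow> (h has_real_derivative h' y) (at y)" and h0: "h 0 = 0"
    and D: "\<And>y. \<bar>y\<bar> \<le> M \<Longrightarrow> \<bar>h' y\<bar> \<le> D" and c: "continuous_on {-M..M} h'"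
  shows "gpair (\<lambda>x. h (\<phi> x)) (\<lambda>e t. \<phi>' e t * h' (on_edge G \<phi> e t))"
  unfolding gpair_def
proof (intro conjI ballI allI impI)
  show "h (\<phi> x) = 0" if "x \<notin> points G" for x using \<phi> that h0 by (simp add: gpair_def)
  have ch: "continuous_on {-M..M} h"
    using h by (intro DERIV_continuous_on[where D=h']) (auto intro: has_field_derivative_at_within)
  show cm: "continuous_map (gtopology G) euclideanreal (\<lambda>x. h (\<phi> x))"
  proof (rule continuous_map_compose_real[OF _ ch])
    show "continuous_map (gtopology G) euclideanreal \<phi>" using \<phi> unfolding gpair_def by blast
    show "\<phi> ` topspace (gtopology G) \<subseteq> {-M..M}"
    proof clarsimp
      fix x assume "x \<in> points G"
      then show "- M \<le> \<phi> x \<and> \<phi> x \<le> M" using r[of x] by linarith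
    qed
  qed
  have hb: "\<bar>h y\<bar> \<le> D * \<bar>y\<bar>" if "\<bar>y\<bar> \<le> M" for y
  proof -
    have "norm (h y - h 0) \<le> D * norm (y - 0)"
      by (rule field_differentiable_bound[where S="{-M..M}" and f'=h'])
        (use h D that in \<open>auto intro: has_field_derivative_at_within\<close>)
    then show ?thesis using h0 by simp
  qed
  fix e assume e: "e \<in> edges G"
  have r': "\<bar>on_edge G \<phi> e t\<bar> \<le> M" if "t \<in> edge_int G e" for t
    using r pt_int_points[OF e that] by (simp add: on_edge_def)
  have [simp]: "on_edge G (\<lambda>x. h (\<phi> x)) e = (\<lambda>t. h (on_edge G \<phi> e t))"
    by (simp add: on_edge_def)
  have m: "(\<lambda>t. h (on_edge G \<phi> e t)) \<in> borel_measurable (edge_measure e)"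
    using on_edge_measurable[OF cm e] by simp
  have i: "integrable (edge_measure e) (\<lambda>t. D\<^sup>2 * (on_edge G \<phi> e t)\<^sup>2)"
    using gpair_L2[OF \<phi> e] by (auto simp: L2_on_lebesgue_on)
  have "integrable (edge_measure e) (\<lambda>t. (h (on_edge G \<phi> e t))\<^sup>2)"
  proof (rule Bochner_Integration.integrable_bound[OF i])
    show "AE t in edge_measure e. norm ((h (on_edge G \<phi> e t))\<^sup>2) \<le> norm (D\<^sup>2 * (on_edge G \<phi> e t)\<^sup>2)"
    proof (rule AE_I2)
      fix t assume "t \<in> space (edge_measure e)"
      then have "\<bar>h (on_edge G \<phi> e t)\<bar>\<^sup>2 \<le> (D * \<bar>on_edge G \<phi> e t\<bar>)\<^sup>2"
        using hb[OF r', of t] by (intro power_mono) auto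
      then show "norm ((h (on_edge G \<phi> e t))\<^sup>2) \<le> norm (D\<^sup>2 * (on_edge G \<phi> e t)\<^sup>2)"
        by (simp add: power_mult_distrib)
    qed
  qed (use m in simp)
  then show "on_edge G (\<lambda>x. h (\<phi> x)) e \<in> L2_on (edge_int G e)" using m by (simp add: L2_on_lebesgue_on)
  have "continuous_on (edge_int G e) (\<lambda>t. h' (on_edge G \<phi> e t))"
  proof (rule continuous_on_compose2[OF c])
    show "continuous_on (edge_int G e) (on_edge G \<phi> e)"
      using continuous_on_edge_int[OF _ e, of \<phi>] \<phi> unfolding gpair_def by blast
    show "on_edge G \<phi> e ` edge_int G e \<subseteq> {-M..M}"
    proof clarsimp
      fix t assume "t \<in> edge_int G e"
      then show "- M \<le> on_edge G \<phi> e t \<and> on_edge G \<phi> e t \<le> M" using r'[of t] by linarith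
    qed
  qed
  then have "(\<lambda>t. h' (on_edge G \<phi> e t)) \<in> borel_measurable (edge_measure e)"
    by (rule continuous_imp_measurable_on_sets_lebesgue) simp
  then show "(\<lambda>t. \<phi>' e t * h' (on_edge G \<phi> e t)) \<in> L2_on (edge_int G e)"
    using gpair_L2[OF \<phi> e] r' D by (intro L2_on_bounded_mult[where C=D]) auto
  obtain S where S: "finite S" "\<forall>t\<in>edge_int G e - S. (on_edge G \<phi> e has_real_derivative \<phi>' e t) (at t)"
    using \<phi> e unfolding gpair_def by blast
  show "\<exists>S. finite S \<and> (\<forall>t\<in>edge_int G e - S. (on_edge G (\<lambda>x. h (\<phi> x)) e has_real_derivative
      \<phi>' e t * h' (on_edge G \<phi> e t)) (at t))"
  proof (intro exI[of _ S] conjI ballI)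
    fix t assume t: "t \<in> edge_int G e - S"
    then have "((\<lambda>t. h (on_edge G \<phi> e t)) has_real_derivative h' (on_edge G \<phi> e t) * \<phi>' e t) (at t)"
      using S r' h by (intro DERIV_chain2[of h]) auto
    then show "(on_edge G (\<lambda>x. h (\<phi> x)) e has_real_derivative \<phi>' e t * h' (on_edge G \<phi> e t)) (at t)"
      by (simp add: mult.commute)
  qed (use S in auto)
qed

section \<open>Functions supported inside one edge\<close>

definition edge_fun :: "'e \<Rightarrow> (real \<Rightarrow> real) \<Rightarrow> ('v, 'e) gpoint \<Rightarrow> real" where
  "edge_fun e f x = (case x of Vertex v \<Rightarrow> 0 | Inner e' t \<Rightarrow> if e' = e \<and> t \<in> edge_int G e then f t else 0)"

lemma on_edge_edge_fun:
  assumes e: "e \<in> edges G" and sub: "{\<alpha>..\<beta>} \<subseteq> edge_int G e" and out: "\<And>t. t \<notin> {\<alpha>..\<beta>} \<Longrightarrow> f t = 0"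
    and t: "t \<in> edge_dom G e'"
  shows "on_edge G (edge_fun e f) e' t = (if e' = e then f t else 0)"
proof (cases "t \<in> edge_int G e'")
  case True
  then show ?thesis by (auto simp: on_edge_def edge_fun_def pt_Inner)
next
  case False
  then have "t = 0 \<or> len G e' = ereal t" using t by (cases "len G e'") (auto simp: edge_dom_def edge_int_def)
  moreover have "e' = e \<Longrightarrow> f t = 0" using False sub out by blast
  ultimately show ?thesis by (auto simp: on_edge_def edge_fun_def pt_def)
qed

text \<open>The support keeps away from the ends of the edge, so the extension by zero is Lipschitz
  along every edge and the vertices need no separate treatment.\<close>

lemma edge_fun_gpair:
  assumes e: "e \<in> edges G" and ab: "\<alpha> \<le> \<beta>" and sub: "{\<alpha>..\<beta>} \<subseteq> edge_int G e" and out: "\<And>t. t \<notin> {\<alpha>..\<beta>} \<Longrightarrow> f t = 0"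
    and out': "\<And>t. t \<notin> {\<alpha>..\<beta>} \<Longrightarrow> f' t = 0"
    and lip: "\<And>s t. \<bar>f t - f s\<bar> \<le> K * \<bar>t - s\<bar>"
    and S: "finite S" "\<And>t. t \<notin> S \<Longrightarrow> (f has_real_derivative f' t) (at t)" and b: "\<And>t. \<bar>f' t\<bar> \<le> B"
  shows "gpair (edge_fun e f) (\<lambda>e' t. if e' = e then f' t else 0)" "edge_fun e f \<in> Cc G"
proof -
  have oe: "on_edge G (edge_fun e f) e' t = (if e' = e then f t else 0)" if "t \<in> edge_dom G e'" for e' t
    using on_edge_edge_fun[OF e sub _ that] out by blast
  have z: "edge_fun e f x = 0" if "x \<notin> points G" for x
    using that e by (auto simp: edge_fun_def points_def split: gpoint.split)
  have cm: "continuous_map (gtopology G) euclideanreal (edge_fun e f)"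
  proof (rule Lipschitz_continuous_map[where K="\<bar>K\<bar> + 1"])
    fix x y assume xy: "x \<in> points G" "y \<in> points G"
    show "\<bar>edge_fun e f y - edge_fun e f x\<bar> \<le> (\<bar>K\<bar> + 1) * gdist G x y"
    proof (rule Lipschitz_on_edges[OF _ _ xy])
      fix e' s t assume "e' \<in> edges G" and st: "s \<in> edge_dom G e'" "t \<in> edge_dom G e'"
      have "\<bar>f t - f s\<bar> \<le> (\<bar>K\<bar> + 1) * \<bar>t - s\<bar>" 
        by (rule order_trans[OF lip]) (auto intro!: mult_right_mono)
      then show "\<bar>edge_fun e f (pt G e' t) - edge_fun e f (pt G e' s)\<bar> \<le> (\<bar>K\<bar> + 1) * \<bar>t - s\<bar>"
        using oe[OF st(1)] oe[OF st(2)] by (auto simp: on_edge_def)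
    qed simp
  qed
  have \<alpha>: "\<alpha> \<in> edge_int G e" using sub ab by auto
  show "edge_fun e f \<in> Cc G"
  proof (rule bounded_support_Cc[OF z cm pt_int_points[OF e \<alpha>]])
    fix y assume "y \<in> points G" "edge_fun e f y \<noteq> 0"
    then obtain t where t: "y = Inner e t" "t \<in> edge_int G e" "t \<in> {\<alpha>..\<beta>}"
      using out by (auto simp: edge_fun_def split: gpoint.splits if_splits)
    then show "gdist G (pt G e \<alpha>) y \<le> \<beta> - \<alpha>"
      using gdist_pt_le[OF e subsetD[OF edge_int_subset_dom \<alpha>] subsetD[OF edge_int_subset_dom t(2)]] \<alpha> by (simp add: pt_Inner)
  qed
  have cf: "continuous_on UNIV f"
  proof (rule lipschitz_on_continuous_on[where L="\<bar>K\<bar>"], rule lipschitz_onI)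
    show "dist (f t) (f s) \<le> \<bar>K\<bar> * dist t s" for s t
      unfolding dist_real_def by (rule order_trans[OF lip]) (auto intro!: mult_right_mono)
  qed simp
  show "gpair (edge_fun e f) (\<lambda>e' t. if e' = e then f' t else 0)"
    unfolding gpair_def
  proof (intro conjI ballI allI impI z cm)
    fix e' assume e': "e' \<in> edges G"
    have on: "on_edge G (edge_fun e f) e' t = (if e' = e then f t else 0)" if "t \<in> edge_int G e'" for t
      using oe that edge_int_subset_dom by blast
    have L2: "h \<in> L2_on (edge_int G e)" if h: "h \<in> borel_measurable (edge_measure e)" "\<And>t. \<bar>h t\<bar> \<le> D"
      "\<And>t. t \<notin> {\<alpha>..\<beta>} \<Longrightarrow> h t = 0" for h D
    proof -
      have "emeasure lebesgue {\<alpha>..\<beta>} < \<infinity>" by (simp add: emeasure_lborel_Icc_eq)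
      then have "integrable (edge_measure e) (\<lambda>t. D\<^sup>2 * indicator {\<alpha>..\<beta>} t)"
        using sub by (intro integrable_mult_right integrable_real_indicator)
          (auto simp: sets_restrict_space_iff emeasure_restrict_space)
      then have "integrable (edge_measure e) (\<lambda>t. (h t)\<^sup>2)"
      proof (rule Bochner_Integration.integrable_bound)
        show "AE t in edge_measure e. norm ((h t)\<^sup>2) \<le> norm (D\<^sup>2 * indicat_real {\<alpha>..\<beta>} t)"
        proof (rule AE_I2)
          fix t
          have "\<bar>h t\<bar>\<^sup>2 \<le> D\<^sup>2" using h(2) by (intro power_mono) auto
          then show "norm ((h t)\<^sup>2) \<le> norm (D\<^sup>2 * indicat_real {\<alpha>..\<beta>} t)"
            using h(3)[of t] by (auto simp: indicator_def)
        qed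
      qed (use h in simp)
      then show ?thesis using h by (simp add: L2_on_lebesgue_on)
    qed
    have "bounded (f ` {\<alpha>..\<beta>})" by (intro compact_imp_bounded compact_continuous_image continuous_on_subset[OF cf]) auto
    then obtain D where "\<forall>y\<in>f ` {\<alpha>..\<beta>}. norm y \<le> D" by (auto simp: bounded_iff)
    then have "\<bar>f t\<bar> \<le> max 0 D" for t using out[of t] by (cases "t \<in> {\<alpha>..\<beta>}") force+
    moreover have "f \<in> borel_measurable (edge_measure e)"
      by (intro continuous_imp_measurable_on_sets_lebesgue continuous_on_subset[OF cf]) auto
    ultimately have fL2: "f \<in> L2_on (edge_int G e)" using out by (intro L2)
    have "on_edge G (edge_fun e f) e' \<in> L2_on (edge_int G e') \<longleftrightarrow> (\<lambda>t. if e' = e then f t else 0) \<in> L2_on (edge_int G e')"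
      by (rule L2_on_cong) (rule on)
    then show "on_edge G (edge_fun e f) e' \<in> L2_on (edge_int G e')"
      using fL2 by (cases "e' = e") (simp_all add: L2_on_zero)
    have "f' \<in> borel_measurable (edge_measure e)"
      using S by (intro has_derivative_measurable[OF edge_int_open continuous_on_subset[OF cf]]) auto
    then have "f' \<in> L2_on (edge_int G e)" using b out' by (intro L2)
    then show "(\<lambda>t. if e' = e then f' t else 0) \<in> L2_on (edge_int G e')"
      by (cases "e' = e") (auto simp: L2_on_zero)
    show "\<exists>S. finite S \<and> (\<forall>t\<in>edge_int G e' - S. (on_edge G (edge_fun e f) e' has_real_derivative (if e' = e then f' t else 0)) (at t))"
    proof (intro exI[of _ S] conjI ballI S(1))
      fix t assume t: "t \<in> edge_int G e' - S"
      have "((\<lambda>t. if e' = e then f t else 0) has_real_derivative (if e' = e then f' t else 0)) (at t)"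
        using S t by auto
      then show "(on_edge G (edge_fun e f) e' has_real_derivative (if e' = e then f' t else 0)) (at t)"
        by (rule has_field_derivative_transform_within_open[OF _ edge_int_open[of e']]) (use t on in auto)
    qed
  qed
qed

text \<open>On an interval of length \<open>1 / \<kappa>\<close> with \<open>t\<close> as an end
  point, the minimum of \<open>f\<^sup>2\<close> is at most \<open>\<kappa>\<close> times its
  integral, and the increment from there to \<open>t\<close> is controlled by \<open>\<bar>2 * f *
  f'\<bar> \<le> \<kappa> * f\<^sup>2 + f'\<^sup>2 / \<kappa>\<close>. An edge longer than
  \<open>2 / \<kappa>\<close> has room for such an interval on one side of every inner point; end
  points follow by continuity.\<close>

lemma sobolev_edge:
  assumes \<phi>: "gpair \<phi> \<phi>'" and e: "e \<in> edges G" and \<kappa>: "\<kappa> > 0" "ereal (2 / \<kappa>) < len G e" and t: "t \<in> edge_dom G e"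
  shows "(on_edge G \<phi> e t)\<^sup>2 \<le> 2 * \<kappa> * integral\<^sup>L (edge_measure e) (\<lambda>t. (on_edge G \<phi> e t)\<^sup>2)
    + (1 / \<kappa>) * integral\<^sup>L (edge_measure e) (\<lambda>t. (\<phi>' e t)\<^sup>2)" (is "_ \<le> ?R")
proof -
  let ?f = "on_edge G \<phi> e"
  let ?P = "integral\<^sup>L (edge_measure e) (\<lambda>t. (?f t)\<^sup>2)" and ?Q = "integral\<^sup>L (edge_measure e) (\<lambda>t. (\<phi>' e t)\<^sup>2)"
  have cdom: "continuous_on (edge_dom G e) ?f" using \<phi> e continuous_on_edge by (auto simp: gpair_def)
  have i: "integrable (edge_measure e) (\<lambda>t. (?f t)\<^sup>2)" "integrable (edge_measure e) (\<lambda>t. (\<phi>' e t)\<^sup>2)"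
    using gpair_L2[OF \<phi> e] by (auto simp: L2_on_lebesgue_on)
  have main: "(?f t)\<^sup>2 \<le> ?R" if t: "t \<in> edge_int G e" for t
  proof -
    define d where "d = 1 / \<kappa>"
    have d: "d > 0" using \<kappa> by (simp add: d_def)
    obtain s0 where J: "{s0..s0 + d} \<subseteq> edge_int G e" "t \<in> {s0..s0 + d}"
    proof (cases "t + d \<in> edge_int G e")
      case True
      then show ?thesis using that[of t] interval_subset[OF edge_int_interval t True] d by auto
    next
      case False
      have "t - d \<in> edge_int G e"
        using e
      proof (cases rule: edge_cases)
        case 1 then show ?thesis using False t d by auto
      next
        case 2
        have "2 * d < elen e" using \<kappa>(2) 2(1) by (simp add: d_def)
        then show ?thesis using False t d 2 by auto
      qed
      then show ?thesis using that[of "t - d"] interval_subset[OF edge_int_interval _ t, of "t - d"] d by auto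
    qed
    have cJ: "continuous_on {s0..s0 + d} ?f" using cdom J(1) edge_int_subset_dom by (meson continuous_on_subset order_trans)
    obtain s where s: "s \<in> {s0..s0 + d}" "\<And>r. r \<in> {s0..s0 + d} \<Longrightarrow> (?f s)\<^sup>2 \<le> (?f r)\<^sup>2"
    proof -
      have "continuous_on {s0..s0 + d} (\<lambda>r. (?f r)\<^sup>2)" by (intro continuous_intros cJ)
      moreover have "{s0..s0 + d} \<noteq> {}" using d by simp
      ultimately show ?thesis using that continuous_attains_inf[OF compact_Icc] by blast
    qed
    have le_edge: "integral {x..y} F \<le> integral\<^sup>L (edge_measure e) F"
      if "integrable (edge_measure e) F" "\<And>t. t \<in> edge_int G e \<Longrightarrow> 0 \<le> F t" "{x..y} \<subseteq> edge_int G e" for F :: "real \<Rightarrow> real" and x y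
    proof -
      have iF: "set_integrable lebesgue (edge_int G e) F" using that(1) by (simp add: set_integrable_lebesgue_on)
      then have iF': "set_integrable lebesgue {x..y} F" using that by (rule_tac set_integrable_subset) auto
      have "integral {x..y} F = (LINT t:{x..y}|lebesgue. F t)" using iF' by (simp add: set_lebesgue_integral_eq_integral)
      also have "\<dots> \<le> (LINT t:edge_int G e|lebesgue. F t)"
        unfolding set_lebesgue_integral_def using iF iF' that by (intro integral_mono) (auto simp: set_integrable_def indicator_def)
      finally show ?thesis by (simp add: set_integral_lebesgue_on)
    qed
    have sP: "(?f s)\<^sup>2 \<le> \<kappa> * ?P"
    proof -
      have "integral {s0..s0 + d} (\<lambda>r. (?f s)\<^sup>2) \<le> integral {s0..s0 + d} (\<lambda>r. (?f r)\<^sup>2)"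
        using s cJ by (intro integral_le integrable_continuous_interval continuous_intros) auto
      also have "\<dots> \<le> ?P" by (rule le_edge[OF i(1) _ J(1)]) simp
      finally have "d * (?f s)\<^sup>2 \<le> ?P" using d by simp
      then show ?thesis using \<kappa> by (simp add: d_def field_simps)
    qed
    obtain S where S: "finite S" "\<forall>t\<in>edge_int G e - S. (?f has_real_derivative \<phi>' e t) (at t)"
      using \<phi> e unfolding gpair_def by blast
    define F where "F r = \<kappa> * (?f r)\<^sup>2 + (1 / \<kappa>) * (\<phi>' e r)\<^sup>2" for r
    have iF: "integrable (edge_measure e) F" unfolding F_def using i by simp
    have IF: "integral\<^sup>L (edge_measure e) F = \<kappa> * ?P + (1 / \<kappa>) * ?Q" unfolding F_def using i by simp
    have F0: "0 \<le> F r" for r unfolding F_def using \<kappa> by simp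
    have Fb: "\<bar>2 * ?f r * \<phi>' e r\<bar> \<le> F r" for r
    proof -
      have "0 \<le> (\<kappa> * \<bar>?f r\<bar> - \<bar>\<phi>' e r\<bar>)\<^sup>2 / \<kappa>" using \<kappa> by simp
      also have "\<dots> = F r - \<bar>2 * ?f r * \<phi>' e r\<bar>"
        using \<kappa> by (simp add: F_def power2_diff abs_mult power_mult_distrib field_simps power2_eq_square)
      finally show ?thesis by simp
    qed
    have diff: "\<bar>(?f y)\<^sup>2 - (?f x)\<^sup>2\<bar> \<le> integral\<^sup>L (edge_measure e) F" if xy: "x \<le> y" "{x..y} \<subseteq> edge_int G e" for x y
    proof -
      have "((\<lambda>r. 2 * ?f r * \<phi>' e r) has_integral ((?f y)\<^sup>2 - (?f x)\<^sup>2)) {x..y}"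
      proof (rule fundamental_theorem_of_calculus_strong[OF S(1) xy(1)])
        show "continuous_on {x..y} (\<lambda>r. (?f r)\<^sup>2)"
          using cdom xy edge_int_subset_dom by (intro continuous_intros) (meson continuous_on_subset order_trans)
        fix r assume "r \<in> {x..y} - S"
        then have "(?f has_real_derivative \<phi>' e r) (at r)" using S xy by blast
        then have "((\<lambda>r. (?f r)\<^sup>2) has_real_derivative 2 * ?f r * \<phi>' e r) (at r)"
          by (auto intro!: derivative_eq_intros)
        then show "((\<lambda>r. (?f r)\<^sup>2) has_vector_derivative 2 * ?f r * \<phi>' e r) (at r)"
          by (simp add: has_real_derivative_iff_has_vector_derivative)
      qed
      moreover have iF2: "set_integrable lebesgue (edge_int G e) F" using iF by (simp add: set_integrable_lebesgue_on)
      have "F absolutely_integrable_on {x..y}" by (rule set_integrable_subset[OF iF2 _ xy(2)]) simp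
      then have "F integrable_on {x..y}" unfolding absolutely_integrable_on_def by (rule conjunct1)
      ultimately have "norm (integral {x..y} (\<lambda>r. 2 * ?f r * \<phi>' e r)) \<le> integral {x..y} F"
        by (intro integral_norm_bound_integral) (blast intro: has_integral_integrable, blast, simp only: real_norm_def Fb)
      also have "\<dots> \<le> integral\<^sup>L (edge_measure e) F" by (rule le_edge[OF iF F0 xy(2)])
      finally show ?thesis using \<open>(_ has_integral _) {x..y}\<close> by (simp add: integral_unique)
    qed
    have sub': "{min s t..max s t} \<subseteq> edge_int G e"     proof -
      have "{min s t..max s t} \<subseteq> {s0..s0 + d}" using s(1) J(2) by (auto simp: min_def max_def split: if_splits)
      then show ?thesis using J(1) by blast
    qed
    have "(?f t)\<^sup>2 - (?f s)\<^sup>2 \<le> integral\<^sup>L (edge_measure e) F"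
      using diff[of "min s t" "max s t"] sub' by (cases "s \<le> t") (auto simp: min_def max_def)
    then show ?thesis using sP IF by (simp add: algebra_simps)
  qed
  have "edge_dom G e \<subseteq> closure (edge_int G e)"
    using e by (cases rule: edge_cases) (auto simp: closure_greaterThanLessThan)
  then show ?thesis
    using continuous_le_on_closure[of "edge_int G e" "\<lambda>t. (?f t)\<^sup>2" t ?R] main t
  proof -
    have cl: "closure (edge_int G e) = edge_dom G e"
      using e by (cases rule: edge_cases) (auto simp: closure_greaterThanLessThan)
    show ?thesis
      by (rule continuous_le_on_closure[of "edge_int G e" "\<lambda>t. (?f t)\<^sup>2" t ?R])
        (use main t cdom cl in \<open>auto intro!: continuous_intros\<close>)
  qed
qed

text \<open>For \<open>\<kappa> = sqrt lam\<close> the right side is \<open>1 / sqrt lam\<close>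
  times the integral of \<open>\<phi>'\<^sup>2 + 2 * lam * \<phi>\<^sup>2\<close>, which is how
  energy estimates turn into pointwise ones.\<close>

lemma sobolev:
  assumes \<phi>: "gpair \<phi> \<phi>'" and \<kappa>: "\<kappa> > 0" "\<And>e. e \<in> edges G \<Longrightarrow> ereal (2 / \<kappa>) < len G e" and x: "x \<in> points G"
  shows "(\<phi> x)\<^sup>2 \<le> 2 * \<kappa> * gint (\<lambda>e t. (on_edge G \<phi> e t)\<^sup>2) + (1 / \<kappa>) * gint (\<lambda>e t. (\<phi>' e t)\<^sup>2)"
proof -
  obtain e t where et: "e \<in> edges G" "t \<in> edge_dom G e" "x = pt G e t" using point_on_edge[OF x] by blast
  have "(\<phi> x)\<^sup>2 \<le> 2 * \<kappa> * integral\<^sup>L (edge_measure e) (\<lambda>t. (on_edge G \<phi> e t)\<^sup>2)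
    + (1 / \<kappa>) * integral\<^sup>L (edge_measure e) (\<lambda>t. (\<phi>' e t)\<^sup>2)"
    using sobolev_edge[OF \<phi> et(1) \<kappa>(1) \<kappa>(2)[OF et(1)] et(2)] et(3) by (simp add: on_edge_def)
  also have "\<dots> \<le> 2 * \<kappa> * gint (\<lambda>e t. (on_edge G \<phi> e t)\<^sup>2) + (1 / \<kappa>) * gint (\<lambda>e t. (\<phi>' e t)\<^sup>2)"
    using \<kappa> et edge_integral_le_gint[OF et(1), of "\<lambda>e t. (on_edge G \<phi> e t)\<^sup>2"] edge_integral_le_gint[OF et(1), of "\<lambda>e t. (\<phi>' e t)\<^sup>2"]
    by (intro add_mono mult_left_mono) auto
  finally show ?thesis .
qed

end

section \<open>Weak solutions\<close>

context fin_graph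
begin

text \<open>A substitute of bounded support for \<open>exp (- 2 * \<alpha> * gdist G x y)\<close>:
  subtracting \<open>c\<close> truncates it where the exponential falls below \<open>c\<close>, and
  the square makes the truncation \<open>C\<^sup>1\<close> as a function of the exponential.\<close>

definition cut :: "('v, 'e) gpoint \<Rightarrow> real \<Rightarrow> real \<Rightarrow> ('v, 'e) gpoint \<Rightarrow> real" where
  "cut x \<alpha> c y = (max 0 (exp (- \<alpha> * gdist G x y) - c))\<^sup>2"

definition cut_deriv :: "('v, 'e) gpoint \<Rightarrow> real \<Rightarrow> real \<Rightarrow> 'e \<Rightarrow> real \<Rightarrow> real" where
  "cut_deriv x \<alpha> c e t = 2 * max 0 (exp (- \<alpha> * gdist G x (pt G e t)) - c) *
     (- \<alpha> * dist_deriv x e t * exp (- \<alpha> * gdist G x (pt G e t)))"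

lemma exp_dist_le_1: "\<alpha> > 0 \<Longrightarrow> exp (- \<alpha> * gdist G x y) \<le> 1"
  using gm.nonneg[of x y] by simp

lemma cut_weight:
  assumes x: "x \<in> points G" and \<alpha>: "\<alpha> > 0" and c: "0 \<le> c"
  obtains C where "gweight C (cut x \<alpha> c) (cut_deriv x \<alpha> c)"
proof -
  let ?h = "\<lambda>z::real. (max 0 (z - c))\<^sup>2" and ?h' = "\<lambda>z::real. 2 * max 0 (z - c)"
  have d: "(?h has_real_derivative ?h' z) (at z)" for z
  proof -
    have s: "((\<lambda>z. z - c) has_real_derivative 1) (at z)" by (auto intro!: derivative_eq_intros)
    have "((\<lambda>z. 2 * ((max 0 (z - c))\<^sup>2 / 2)) has_real_derivative 2 * (1 * max 0 (z - c))) (at z)"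
      by (rule DERIV_cmult[OF DERIV_chain'[OF s has_derivative_sqr_pos_part, unfolded mult.commute[of _ 1]]])
    then show ?thesis by simp
  qed
  have "gweight (2 * max 1 \<alpha> + 2) (\<lambda>y. ?h (exp (- \<alpha> * gdist G x y)))
     (\<lambda>e t. ?h' (on_edge G (\<lambda>y. exp (- \<alpha> * gdist G x y)) e t) * (- \<alpha> * dist_deriv x e t * exp (- \<alpha> * gdist G x (pt G e t))))"
  proof (rule gweight_compose[OF gweight_exp_dist[OF x \<alpha>]])
    show "0 \<le> exp (- \<alpha> * gdist G x y) \<and> exp (- \<alpha> * gdist G x y) \<le> 1" for y
      using exp_dist_le_1[OF \<alpha>] by simp
    show "(?h has_real_derivative ?h' y) (at y)" for y by (rule d)
    fix y :: real assume y: "0 \<le> y" "y \<le> 1"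
    have "max 0 (y - c) \<le> 1" using y c by simp
    moreover from this have "(max 0 (y - c))\<^sup>2 \<le> 1" by (simp add: power_le_one)
    ultimately show "\<bar>(max 0 (y - c))\<^sup>2\<bar> \<le> 2 \<and> \<bar>2 * max 0 (y - c)\<bar> \<le> 2" by simp
  qed
  then have "gweight (2 * max 1 \<alpha> + 2) (cut x \<alpha> c) (cut_deriv x \<alpha> c)"
    by (simp add: cut_def[abs_def] cut_deriv_def[abs_def] on_edge_def)
  then show ?thesis by (rule that)
qed

lemma cut_bounds:
  assumes \<alpha>: "\<alpha> > 0" and c: "0 \<le> c"
  shows "0 \<le> cut x \<alpha> c y" "cut x \<alpha> c y \<le> 1"
proof -
  have "max 0 (exp (- \<alpha> * gdist G x y) - c) \<le> 1" using exp_dist_le_1[OF \<alpha>, of x y] c by linarith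
  then show "cut x \<alpha> c y \<le> 1" unfolding cut_def by (simp add: power_le_one)
qed (simp add: cut_def)

lemma cut_nonzero:
  assumes \<alpha>: "\<alpha> > 0" and c: "0 < c" and nz: "cut x \<alpha> c y \<noteq> 0"
  shows "gdist G x y < ln (1 / c) / \<alpha>"
proof -
  have "c < exp (- \<alpha> * gdist G x y)" using nz by (simp add: cut_def max_def split: if_splits)
  then have "ln c < - \<alpha> * gdist G x y" using c by (metis exp_gt_zero ln_exp ln_less_cancel_iff)
  then show ?thesis using \<alpha> c by (simp add: ln_div field_simps)
qed

lemma cut_Cc:
  assumes \<phi>: "gpair \<phi> \<phi>'" and x: "x \<in> points G" and \<alpha>: "\<alpha> > 0" and c: "0 < c"
  shows "(\<lambda>y. \<phi> y * cut x \<alpha> c y) \<in> Cc G"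
proof (rule bounded_support_Cc[OF _ _ x])
  obtain C where C: "gweight C (cut x \<alpha> c) (cut_deriv x \<alpha> c)" using cut_weight[OF x \<alpha>] c by (metis less_imp_le)
  have g: "gpair (\<lambda>y. \<phi> y * cut x \<alpha> c y) (\<lambda>e t. \<phi>' e t * on_edge G (cut x \<alpha> c) e t + on_edge G \<phi> e t * cut_deriv x \<alpha> c e t)"
    by (rule gpair_mult_gweight[OF \<phi> C])
  show "\<phi> y * cut x \<alpha> c y = 0" if "y \<notin> points G" for y using \<phi> that by (simp add: gpair_def)
  show "continuous_map (gtopology G) euclideanreal (\<lambda>y. \<phi> y * cut x \<alpha> c y)" using g unfolding gpair_def by blast
  fix y assume "\<phi> y * cut x \<alpha> c y \<noteq> 0"
  then show "gdist G x y \<le> ln (1 / c) / \<alpha>" using cut_nonzero[OF \<alpha> c, of x y] by simp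
qed

text \<open>The first bound retains the factor that vanishes at the edge of the support, so that the
  derivative can be compared with \<open>cut\<close> itself. The second is uniform and tends to zero
  with \<open>\<alpha>\<close>.\<close>

lemma cut_deriv_bound:
  assumes x: "x \<in> points G" and \<alpha>: "\<alpha> > 0" and c: "0 \<le> c" and e: "e \<in> edges G" and t: "t \<in> edge_int G e"
  shows "\<bar>cut_deriv x \<alpha> c e t\<bar> \<le> 2 * \<alpha> * (max 0 (exp (- \<alpha> * gdist G x (pt G e t)) - c) * exp (- \<alpha> * gdist G x (pt G e t)))"
    and "\<bar>cut_deriv x \<alpha> c e t\<bar> \<le> 2 * \<alpha>"
proof -
  let ?E = "exp (- \<alpha> * gdist G x (pt G e t))"
  have "\<bar>cut_deriv x \<alpha> c e t\<bar> = 2 * max 0 (?E - c) * (\<alpha> * \<bar>dist_deriv x e t\<bar> * ?E)"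
    using \<alpha> by (simp add: cut_deriv_def abs_mult)
  also have "\<dots> \<le> 2 * max 0 (?E - c) * (\<alpha> * 1 * ?E)"
    using \<alpha> dist_deriv_bound[OF x e t] by (intro mult_left_mono mult_right_mono) auto
  finally show 1: "\<bar>cut_deriv x \<alpha> c e t\<bar> \<le> 2 * \<alpha> * (max 0 (?E - c) * ?E)" by (simp add: mult_ac)
  have "max 0 (?E - c) * ?E \<le> 1 * 1"
  proof (rule mult_mono)
    show "max 0 (?E - c) \<le> 1" "?E \<le> 1" using exp_dist_le_1[OF \<alpha>, of x "pt G e t"] c by linarith+
  qed auto
  then have "2 * \<alpha> * (max 0 (?E - c) * ?E) \<le> 2 * \<alpha> * 1" using \<alpha> by (intro mult_left_mono) auto
  with 1 show "\<bar>cut_deriv x \<alpha> c e t\<bar> \<le> 2 * \<alpha>" by simp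
qed

end

section \<open>Regularity of a weak solution on the edges\<close>

locale graph_solution = fin_graph G for G :: "('v, 'e) metric_graph" +
  fixes p Wb b lam :: real and W \<rho> u :: "('v, 'e) gpoint \<Rightarrow> real"
  assumes p2: "p > 2" and W_Linf: "W \<in> Linf G" and \<rho>_Linf: "\<rho> \<in> Linf G"
    and W_bound: "AE_graph G (\<lambda>x. \<bar>W x\<bar> \<le> Wb)"
    and \<rho>_bound: "AE_graph G (\<lambda>x. 0 \<le> \<rho> x \<and> \<rho> x \<le> b)"
    and weak: "weak_solution G p W \<rho> lam u"
begin

lemma AE_edge_iff: "AE_edge G e P \<longleftrightarrow> (AE t in edge_measure e. P (pt G e t))"
  unfolding AE_edge_def by (rule AE_lebesgue_on) simp

lemma W_AE: "e \<in> edges G \<Longrightarrow> AE t in edge_measure e. \<bar>on_edge G W e t\<bar> \<le> Wb"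
  and \<rho>_AE: "e \<in> edges G \<Longrightarrow> AE t in edge_measure e. 0 \<le> on_edge G \<rho> e t \<and> on_edge G \<rho> e t \<le> b"
  using W_bound \<rho>_bound by (auto simp: AE_graph_def AE_edge_iff on_edge_def)

lemma W_measurable: "e \<in> edges G \<Longrightarrow> on_edge G W e \<in> borel_measurable (edge_measure e)"
  and \<rho>_measurable: "e \<in> edges G \<Longrightarrow> on_edge G \<rho> e \<in> borel_measurable (edge_measure e)"
  using W_Linf \<rho>_Linf by (auto simp: Linf_def set_borel_measurable_lebesgue_on)

lemma u_H1: "u \<in> H1 G" using weak by (simp add: weak_solution_def)

lemma u_cont: "continuous_map (gtopology G) euclideanreal u" and u_out: "x \<notin> points G \<Longrightarrow> u x = 0"
  using u_H1 by (auto simp: H1_def)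

lemma u_measurable: "e \<in> edges G \<Longrightarrow> on_edge G u e \<in> borel_measurable (edge_measure e)"
  by (rule on_edge_measurable[OF u_cont])

lemma u_edge:
  assumes e: "e \<in> edges G"
  shows "on_edge G u e \<in> L2_on (edge_int G e)" "gderiv G u e \<in> L2_on (edge_int G e)"
    "is_weak_deriv (edge_int G e) (on_edge G u e) (gderiv G u e)"
proof -
  obtain g where g: "on_edge G u e \<in> L2_on (edge_int G e)" "g \<in> L2_on (edge_int G e)" "is_weak_deriv (edge_int G e) (on_edge G u e) g"
    using u_H1 e unfolding H1_def H1_on_def by blast
  then show "on_edge G u e \<in> L2_on (edge_int G e)" "gderiv G u e \<in> L2_on (edge_int G e)"
    "is_weak_deriv (edge_int G e) (on_edge G u e) (gderiv G u e)"
    using wderiv_AE[OF continuous_on_edge_int[OF u_cont e] g(2,3)] unfolding gderiv_def by auto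
qed

text \<open>The equation reads \<open>u'' = force\<close> on the edges.\<close>

definition force :: "'e \<Rightarrow> real \<Rightarrow> real" where
  "force e t = on_edge G u e t * (on_edge G W e t + lam - on_edge G \<rho> e t * \<bar>on_edge G u e t\<bar> powr (p - 2))"

lemma force_measurable: "e \<in> edges G \<Longrightarrow> force e \<in> borel_measurable (edge_measure e)"
  unfolding force_def[abs_def] using u_measurable[of e] W_measurable[of e] \<rho>_measurable[of e] by measurable

text \<open>Replaces the chosen weak derivative of the test function by its classical one.
  Integrability of the force term is assumed here, because \<open>u\<close> is not yet known to be
  bounded.\<close>

lemma weak_eq_gderiv:
  assumes \<phi>: "gpair \<phi> \<phi>'" "\<phi> \<in> Cc G"
    and i: "gintble (\<lambda>e t. force e t * on_edge G \<phi> e t)"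
  shows "gint (\<lambda>e t. gderiv G u e t * \<phi>' e t + force e t * on_edge G \<phi> e t) = 0"
proof -
  have m: "gderiv G u e \<in> borel_measurable (edge_measure e)" "gderiv G \<phi> e \<in> borel_measurable (edge_measure e)"
    "on_edge G \<phi> e \<in> borel_measurable (edge_measure e)" "\<phi>' e \<in> borel_measurable (edge_measure e)" if "e \<in> edges G" for e
    using u_edge[OF that] gpair_gderiv[OF \<phi>(1) that] gpair_measurable[OF \<phi>(1) that] by (auto simp: L2_on_lebesgue_on)
  have i1: "gintble (\<lambda>e t. gderiv G u e t * \<phi>' e t)"
    using u_edge gpair_L2[OF \<phi>(1)] by (intro gintble_L2)
  have "gintble (\<lambda>e t. (on_edge G u e t * (on_edge G W e t + lam)) * on_edge G \<phi> e t)"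
  proof (rule gintble_L2)
    fix e assume e: "e \<in> edges G"
    show "(\<lambda>t. on_edge G u e t * (on_edge G W e t + lam)) \<in> L2_on (edge_int G e)"
    proof (rule L2_on_bounded_mult[where C="Wb + \<bar>lam\<bar>"])
      show "AE t in edge_measure e. \<bar>on_edge G W e t + lam\<bar> \<le> Wb + \<bar>lam\<bar>"
        using W_AE[OF e] by eventually_elim linarith
    qed (use u_edge[OF e] W_measurable[OF e] in auto)
  qed (use gpair_L2[OF \<phi>(1)] in auto)
  then have i2: "gintble (\<lambda>e t. (on_edge G W e t + lam) * on_edge G u e t * on_edge G \<phi> e t)"
    by (simp add: mult_ac)
  define A where "A e t = gderiv G u e t * \<phi>' e t + (on_edge G W e t + lam) * on_edge G u e t * on_edge G \<phi> e t" for e t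
  define R where "R e t = on_edge G \<rho> e t * \<bar>on_edge G u e t\<bar> powr (p - 2) * on_edge G u e t * on_edge G \<phi> e t" for e t
  have iA: "gintble A" unfolding A_def using i1 i2 by (rule gintble_add)
  have fAR: "gderiv G u e t * \<phi>' e t + force e t * on_edge G \<phi> e t = A e t - R e t" for e t
    by (simp add: A_def R_def force_def algebra_simps)
  have "gintble R"
  proof -
    have "R = (\<lambda>e t. A e t - (gderiv G u e t * \<phi>' e t + force e t * on_edge G \<phi> e t))"
      using fAR by (simp add: fun_eq_iff)
    then show ?thesis using iA i i1 by (simp add: gintble_diff gintble_add)
  qed
  have "gintegral G (\<lambda>e t. gderiv G u e t * gderiv G \<phi> e t + (on_edge G W e t + lam) * on_edge G u e t * on_edge G \<phi> e t) = gintegral G R"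
    using weak \<phi> gpair_H1[OF \<phi>(1)] unfolding weak_solution_def R_def by blast
  moreover have "gint (\<lambda>e t. gderiv G u e t * gderiv G \<phi> e t + (on_edge G W e t + lam) * on_edge G u e t * on_edge G \<phi> e t) = gint A"
  proof (rule gint_cong_AE)
    fix e assume e: "e \<in> edges G"
    note [measurable] = m[OF e] W_measurable[OF e] u_measurable[OF e]
    show "(\<lambda>t. gderiv G u e t * gderiv G \<phi> e t + (on_edge G W e t + lam) * on_edge G u e t * on_edge G \<phi> e t) \<in> borel_measurable (edge_measure e)"
      by measurable
    show "A e \<in> borel_measurable (edge_measure e)" unfolding A_def[abs_def] by measurable
    show "AE t in edge_measure e. gderiv G u e t * gderiv G \<phi> e t + (on_edge G W e t + lam) * on_edge G u e t * on_edge G \<phi> e t = A e t"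
      using gpair_gderiv(1)[OF \<phi>(1) e] by eventually_elim (simp add: A_def)
  qed
  ultimately have "gint A = gint R" by (simp add: gintegral_gint)
  then show ?thesis unfolding fAR using gint_diff[OF iA \<open>gintble R\<close>] by simp
qed

text \<open>The hat function has a piecewise constant derivative, so testing with it turns the
  gradient term into a difference of slopes of \<open>u\<close>. Up to a null set this is the
  hypothesis of \<open>hat_slope_regularity\<close> for the force.\<close>

lemma hat_test:
  fixes s m t :: real
  defines "hat \<equiv> \<lambda>r. (max 0 (t - r) - max 0 (m - r)) / (t - m) - (max 0 (m - r) - max 0 (s - r)) / (m - s)"
  assumes e: "e \<in> edges G" and smt: "s < m" "m < t" and sub: "{\<alpha>..\<beta>} \<subseteq> edge_int G e" "\<alpha> \<le> s" "t \<le> \<beta>"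
    and B: "AE r in edge_measure e. r \<in> {\<alpha>..\<beta>} \<longrightarrow> \<bar>force e r\<bar> \<le> B"
  shows "(on_edge G u e t - on_edge G u e m) / (t - m) - (on_edge G u e m - on_edge G u e s) / (m - s)
    = integral {\<alpha>..\<beta>} (\<lambda>r. force e r * hat r)"
proof -
  let ?u = "on_edge G u e"
  define hat' where "hat' r = (if s < r \<and> r < m then 1 / (m - s) else if m < r \<and> r < t then - 1 / (t - m) else 0)" for r
  have st: "{s..t} \<subseteq> edge_int G e" using sub by auto
  have out: "hat r = 0" if "r \<notin> {s..t}" for r
    using that smt by (auto simp: hat_def)
  have out': "hat' r = 0" if "r \<notin> {s..t}" for r using that smt by (auto simp: hat'_def)
  define K where "K = 2 / (t - m) + 2 / (m - s)"
  have lip: "\<bar>hat x - hat y\<bar> \<le> K * \<bar>x - y\<bar>" for x y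
  proof -
    have l: "\<bar>max 0 (z - x) - max 0 (z - y)\<bar> \<le> \<bar>x - y\<bar>" for z by linarith
    have l2: "\<bar>((max 0 (z - x) - max 0 (w - x)) - (max 0 (z - y) - max 0 (w - y))) / (z - w)\<bar> \<le> (2 * \<bar>x - y\<bar>) / (z - w)"
      if "w < z" for z w
    proof -
      have "\<bar>(max 0 (z - x) - max 0 (w - x)) - (max 0 (z - y) - max 0 (w - y))\<bar> \<le> 2 * \<bar>x - y\<bar>"
      proof -
        have "\<bar>(a - b) - (c - d)\<bar> \<le> 2 * q" if "\<bar>a - c\<bar> \<le> q" "\<bar>b - d\<bar> \<le> q" for a b c d q :: real
          using that by linarith
        from this[OF l[of z] l[of w]] show ?thesis .
      qed
      then show ?thesis using that by (simp add: abs_divide divide_right_mono)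
    qed
    define P where "P = ((max 0 (t - x) - max 0 (m - x)) - (max 0 (t - y) - max 0 (m - y))) / (t - m)"
    define Q where "Q = ((max 0 (m - x) - max 0 (s - x)) - (max 0 (m - y) - max 0 (s - y))) / (m - s)"
    have "hat x - hat y = P - Q"
      by (simp add: hat_def P_def Q_def diff_divide_distrib)
    then have "\<bar>hat x - hat y\<bar> \<le> \<bar>P\<bar> + \<bar>Q\<bar>" by simp
    also have "\<dots> \<le> (2 * \<bar>x - y\<bar>) / (t - m) + (2 * \<bar>x - y\<bar>) / (m - s)"
      unfolding P_def Q_def by (intro add_mono l2 smt)
    also have "\<dots> = K * \<bar>x - y\<bar>" by (simp add: K_def distrib_right)
    finally show ?thesis .
  qed
  have der: "(hat has_real_derivative hat' r) (at r)" if r: "r \<notin> {s, m, t}" for r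
  proof -
    consider "r < s" | "s < r" "r < m" | "m < r" "r < t" | "t < r" using r by fastforce
    then show ?thesis
    proof cases
      case 1
      show ?thesis
        by (rule has_field_derivative_transform_within_open[where f="\<lambda>_. 0" and S="{..<s}"])
          (use 1 smt out in \<open>auto simp: hat'_def\<close>)
    next
      case 2
      have "((\<lambda>r. 1 - (m - r) * (1 / (m - s))) has_real_derivative 1 / (m - s)) (at r)"
        by (rule derivative_eq_intros refl | simp)+
      then have "((\<lambda>r. 1 - (m - r) / (m - s)) has_real_derivative hat' r) (at r)"
        using 2 smt by (simp add: hat'_def)
      then show ?thesis
        by (rule has_field_derivative_transform_within_open[where S="{s<..<m}"]) (use 2 smt in \<open>auto simp: hat_def\<close>)
    next
      case 3
      have "((\<lambda>r. (t - r) * (1 / (t - m))) has_real_derivative - 1 / (t - m)) (at r)"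
        by (rule derivative_eq_intros refl | simp)+
      then have "((\<lambda>r. (t - r) / (t - m)) has_real_derivative hat' r) (at r)"
        using 3 smt by (simp add: hat'_def)
      then show ?thesis
        by (rule has_field_derivative_transform_within_open[where S="{m<..<t}"]) (use 3 smt in \<open>auto simp: hat_def\<close>)
    next
      case 4
      show ?thesis
        by (rule has_field_derivative_transform_within_open[where f="\<lambda>_. 0" and S="{t<..}"])
          (use 4 smt out in \<open>auto simp: hat'_def\<close>)
    qed
  qed
  have b: "\<bar>hat' r\<bar> \<le> K" for r
  proof -
    have K': "K = 2 * (1 / (t - m)) + 2 * (1 / (m - s))" by (simp add: K_def)
    have c: "0 < 1 / (t - m)" "0 < 1 / (m - s)" using smt by auto
    have "\<bar>hat' r\<bar> = 1 / (m - s) \<or> \<bar>hat' r\<bar> = 1 / (t - m) \<or> \<bar>hat' r\<bar> = 0"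
      using smt by (simp add: hat'_def)
    then show ?thesis using c K' by linarith
  qed
  have pair: "gpair (edge_fun e hat) (\<lambda>e' t. if e' = e then hat' t else 0)" and cc: "edge_fun e hat \<in> Cc G"
    by (rule edge_fun_gpair[where \<alpha>=s and \<beta>=t and f=hat and f'=hat' and S="{s, m, t}" and B=K and K=K, OF e _ st];
      use out out' lip der b smt in \<open>simp; fail | blast\<close>)+
  have on: "on_edge G (edge_fun e hat) e' r = (if e' = e then hat r else 0)" if "r \<in> edge_int G e'" for e' r
    using on_edge_edge_fun[OF e st _ subsetD[OF edge_int_subset_dom that]] out by blast
  have hatL2: "hat \<in> L2_on (edge_int G e)"
    using gpair_L2(1)[OF pair e] L2_on_cong[of "edge_int G e" "on_edge G (edge_fun e hat) e" hat] on by simp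
  have hat'L2: "hat' \<in> L2_on (edge_int G e)" using gpair_L2(2)[OF pair e] by simp
  have fi: "integrable (edge_measure e) (\<lambda>r. force e r * hat r)"
  proof -
    have hm: "hat \<in> borel_measurable (edge_measure e)" using hatL2 by (simp add: L2_on_lebesgue_on)
    have hai: "hat absolutely_integrable_on {\<alpha>..\<beta>}" by (rule L2_on_absolutely_integrable[OF _ hatL2 sub(1)]) simp
    have "set_integrable lebesgue (edge_int G e) (\<lambda>r. B * hat r)"
    proof -
      have "set_integrable lebesgue {\<alpha>..\<beta>} (\<lambda>r. B * hat r)" using hai by simp
      moreover have "(\<lambda>r. indicator (edge_int G e) r *\<^sub>R (B * hat r)) = (\<lambda>r. indicator {\<alpha>..\<beta>} r *\<^sub>R (B * hat r))"
      proof
        fix r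
        show "indicator (edge_int G e) r *\<^sub>R (B * hat r) = indicator {\<alpha>..\<beta>} r *\<^sub>R (B * hat r)"
          using out[of r] sub by (auto simp: indicator_def)
      qed
      ultimately show ?thesis unfolding set_integrable_def by (simp only:)
    qed
    then have iB: "integrable (edge_measure e) (\<lambda>r. B * hat r)" by (simp add: set_integrable_lebesgue_on)
    show ?thesis
    proof (rule Bochner_Integration.integrable_bound[OF iB])
      show "(\<lambda>r. force e r * hat r) \<in> borel_measurable (edge_measure e)" using force_measurable[OF e] hm by simp
      show "AE r in edge_measure e. norm (force e r * hat r) \<le> norm (B * hat r)"
        using B
      proof eventually_elim
        case (elim r)
        show ?case
        proof (cases "r \<in> {\<alpha>..\<beta>}")
          case True
          then have "\<bar>force e r\<bar> \<le> \<bar>B\<bar>" using elim by auto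
          then show ?thesis by (simp add: abs_mult mult_right_mono)
        next
          case False
          then have "hat r = 0" using out[of r] sub by auto
          then show ?thesis by simp
        qed
      qed
    qed
  qed
  have gb: "gintble (\<lambda>e' t. force e' t * on_edge G (edge_fun e hat) e' t)"
    unfolding gintble_def
  proof
    fix e' assume "e' \<in> edges G"
    have "integrable (edge_measure e') (\<lambda>t. force e' t * on_edge G (edge_fun e hat) e' t) \<longleftrightarrow>
      integrable (edge_measure e') (\<lambda>t. force e' t * (if e' = e then hat t else 0))"
      by (rule Bochner_Integration.integrable_cong) (use on in auto)
    then show "integrable (edge_measure e') (\<lambda>t. force e' t * on_edge G (edge_fun e hat) e' t)"
      using fi by (cases "e' = e") auto
  qed
  have di: "integrable (edge_measure e) (\<lambda>r. gderiv G u e r * hat' r)"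
    by (rule L2_on_mult_integrable[OF _ u_edge(2)[OF e] hat'L2]) simp
  have "0 = gint (\<lambda>e' r. gderiv G u e' r * (if e' = e then hat' r else 0) + force e' r * on_edge G (edge_fun e hat) e' r)"
    using weak_eq_gderiv[OF pair cc gb] by simp
  also have "\<dots> = gint (\<lambda>e' r. if e' = e then gderiv G u e r * hat' r + force e r * hat r else 0)"
    by (rule gint_cong) (use on in auto)
  also have "\<dots> = (\<Sum>e'\<in>edges G. if e' = e then integral\<^sup>L (edge_measure e) (\<lambda>r. gderiv G u e r * hat' r + force e r * hat r) else 0)"
    unfolding gint_def by (intro sum.cong) auto
  also have "\<dots> = integral\<^sup>L (edge_measure e) (\<lambda>r. gderiv G u e r * hat' r + force e r * hat r)"
    using e finite_edges by simp
  also have "\<dots> = integral\<^sup>L (edge_measure e) (\<lambda>r. gderiv G u e r * hat' r) + integral\<^sup>L (edge_measure e) (\<lambda>r. force e r * hat r)"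
    using di fi by simp
  finally have eq: "integral\<^sup>L (edge_measure e) (\<lambda>r. gderiv G u e r * hat' r) + integral\<^sup>L (edge_measure e) (\<lambda>r. force e r * hat r) = 0" by simp
  have toHK: "integral\<^sup>L (edge_measure e) F = integral {x..y} F"
    if "integrable (edge_measure e) F" "{x..y} \<subseteq> edge_int G e" "\<And>r. r \<notin> {x..y} \<Longrightarrow> F r = 0" for F :: "real \<Rightarrow> real" and x y
  proof -
    have iF: "set_integrable lebesgue (edge_int G e) F" using that(1) by (simp add: set_integrable_lebesgue_on)
    then have iF': "set_integrable lebesgue {x..y} F" by (rule set_integrable_subset) (use that in auto)
    have "integral\<^sup>L (edge_measure e) F = (LINT r:edge_int G e|lebesgue. F r)" by (simp add: set_integral_lebesgue_on)
    also have "\<dots> = (LINT r:{x..y}|lebesgue. F r)" by (rule set_integral_support) (use that in auto)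
    also have "\<dots> = integral {x..y} F" using iF' by (simp add: set_lebesgue_integral_eq_integral)
    finally show ?thesis .
  qed
  have I1: "integral\<^sup>L (edge_measure e) (\<lambda>r. force e r * hat r) = integral {\<alpha>..\<beta>} (\<lambda>r. force e r * hat r)"
    by (rule toHK[OF fi sub(1)]) (use out sub in auto)
  have "integral\<^sup>L (edge_measure e) (\<lambda>r. gderiv G u e r * hat' r) = integral {s..t} (\<lambda>r. gderiv G u e r * hat' r)"
    by (rule toHK[OF di st]) (use out' in auto)
  also have "\<dots> = (?u m - ?u s) / (m - s) - (?u t - ?u m) / (t - m)"
  proof (rule integral_unique)
    have mem: "s \<in> edge_int G e" "m \<in> edge_int G e" "t \<in> edge_int G e" using st smt by auto
    note FTC = weak_deriv_FTC[OF edge_int_open edge_int_interval continuous_on_edge_int[OF u_cont e] u_edge(2,3)[OF e]]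
    have h1: "((\<lambda>r. gderiv G u e r * hat' r) has_integral ((?u m - ?u s) * (1 / (m - s)))) {s..m}"
      by (rule has_integral_spike_finite[OF _ _ has_integral_mult_left[OF FTC[OF mem(1,2) smt(1)], of "1 / (m - s)"], where S="{s, m}"])
        (auto simp: hat'_def)
    have h2: "((\<lambda>r. gderiv G u e r * hat' r) has_integral ((?u t - ?u m) * (- 1 / (t - m)))) {m..t}"
      by (rule has_integral_spike_finite[OF _ _ has_integral_mult_left[OF FTC[OF mem(2,3) smt(2)], of "- 1 / (t - m)"], where S="{m, t}"])
        (auto simp: hat'_def)
    show "((\<lambda>r. gderiv G u e r * hat' r) has_integral ((?u m - ?u s) / (m - s) - (?u t - ?u m) / (t - m))) {s..t}"
      using has_integral_combine[OF _ _ h1 h2] smt by simp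
  qed
  finally show ?thesis using eq I1 by simp
qed

definition du :: "'e \<Rightarrow> real \<Rightarrow> real" where "du e t = deriv (on_edge G u e) t"

lemma ode:
  assumes e: "e \<in> edges G"
  shows "t \<in> edge_int G e \<Longrightarrow> (on_edge G u e has_real_derivative du e t) (at t)"
    and "s \<in> edge_int G e \<Longrightarrow> t \<in> edge_int G e \<Longrightarrow> s \<le> t \<Longrightarrow> (force e has_integral (du e t - du e s)) {s..t}"
proof -
  let ?u = "on_edge G u e"
  have main: "\<exists>g. (\<forall>t\<in>{\<alpha><..<\<beta>}. (?u has_real_derivative g t) (at t)) \<and>
    (\<forall>s t. \<alpha> \<le> s \<longrightarrow> s \<le> t \<longrightarrow> t \<le> \<beta> \<longrightarrow> (force e has_integral (g t - g s)) {s..t})"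
    if ab: "\<alpha> < \<beta>" "{\<alpha>..\<beta>} \<subseteq> edge_int G e" for \<alpha> \<beta>
  proof -
    have "continuous_on {\<alpha>..\<beta>} ?u" using continuous_on_edge_int[OF u_cont e] ab continuous_on_subset by blast
    then have "bounded (?u ` {\<alpha>..\<beta>})" by (intro compact_imp_bounded compact_continuous_image) auto
    then obtain M where "\<forall>r\<in>{\<alpha>..\<beta>}. \<bar>?u r\<bar> \<le> M" by (auto simp: bounded_iff)
    then have M: "\<bar>?u r\<bar> \<le> M" if "r \<in> {\<alpha>..\<beta>}" for r using that by blast
    define B where "B = \<bar>M\<bar> * (\<bar>Wb\<bar> + \<bar>lam\<bar> + \<bar>b\<bar> * \<bar>M\<bar> powr (p - 2))"
    have B0: "0 \<le> B" unfolding B_def by (intro mult_nonneg_nonneg add_nonneg_nonneg) auto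
    have B: "AE r in edge_measure e. r \<in> {\<alpha>..\<beta>} \<longrightarrow> \<bar>force e r\<bar> \<le> B"
      using W_AE[OF e] \<rho>_AE[OF e]
    proof eventually_elim
      case (elim r)
      show ?case
      proof
        assume r: "r \<in> {\<alpha>..\<beta>}"
        have "\<bar>?u r\<bar> \<le> \<bar>M\<bar>" using M[OF r] by simp
        then have "\<bar>?u r\<bar> powr (p - 2) \<le> \<bar>M\<bar> powr (p - 2)" using p2 by (intro powr_mono2) auto
        then have "on_edge G \<rho> e r * \<bar>?u r\<bar> powr (p - 2) \<le> \<bar>b\<bar> * \<bar>M\<bar> powr (p - 2)"
          using elim by (intro mult_mono) auto
        moreover have "0 \<le> on_edge G \<rho> e r * \<bar>?u r\<bar> powr (p - 2)" using elim by simp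
        ultimately have "\<bar>on_edge G W e r + lam - on_edge G \<rho> e r * \<bar>?u r\<bar> powr (p - 2)\<bar> \<le> \<bar>Wb\<bar> + \<bar>lam\<bar> + \<bar>b\<bar> * \<bar>M\<bar> powr (p - 2)"
          using elim by linarith
        then show "\<bar>force e r\<bar> \<le> B"
          unfolding force_def B_def abs_mult using \<open>\<bar>?u r\<bar> \<le> \<bar>M\<bar>\<close> by (intro mult_mono) auto
      qed
    qed
    \<comment> \<open>A version of the force that obeys the bound everywhere instead of almost
      everywhere.\<close>
    define k where "k r = (if r \<in> {\<alpha>..\<beta>} \<and> \<bar>force e r\<bar> \<le> B then force e r else 0)" for r
    have "AE r in lebesgue. r \<in> edge_int G e \<longrightarrow> r \<in> {\<alpha>..\<beta>} \<longrightarrow> \<bar>force e r\<bar> \<le> B"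
      using B by (subst (asm) AE_lebesgue_on[symmetric]) auto
    then obtain N where N: "N \<in> null_sets lebesgue" "{r. \<not> (r \<in> edge_int G e \<longrightarrow> r \<in> {\<alpha>..\<beta>} \<longrightarrow> \<bar>force e r\<bar> \<le> B)} \<subseteq> N"
      by (auto simp: eventually_ae_filter)
    have neg: "negligible N" using N by (simp add: negligible_iff_null_sets)
    have kf: "k r = force e r" if "r \<in> {\<alpha>..\<beta>} - N" for r using that N ab by (auto simp: k_def)
    have "k integrable_on {\<alpha>..\<beta>}"
    proof -
      have "force e \<in> borel_measurable (lebesgue_on {\<alpha>..\<beta>})"
        using force_measurable[OF e] ab(2) by (rule_tac measurable_restrict_mono) auto
      then have "k \<in> borel_measurable (lebesgue_on {\<alpha>..\<beta>})"
      proof -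
        assume [measurable]: "force e \<in> borel_measurable (lebesgue_on {\<alpha>..\<beta>})"
        have "(\<lambda>r. if \<bar>force e r\<bar> \<le> B then force e r else 0) \<in> borel_measurable (lebesgue_on {\<alpha>..\<beta>})" by measurable
        then show ?thesis by (subst measurable_cong[where g="\<lambda>r. if \<bar>force e r\<bar> \<le> B then force e r else 0"]) (auto simp: k_def)
      qed
      then show ?thesis
      proof (rule measurable_bounded_by_integrable_imp_integrable[where g="\<lambda>_. B"])
        show "(\<lambda>_. B) integrable_on {\<alpha>..\<beta>}" by (rule integrable_const_ivl)
        show "norm (k r) \<le> B" for r using B0 by (simp add: k_def)
      qed simp
    qed
    moreover have "\<bar>k r\<bar> \<le> B" if "r \<in> {\<alpha>..\<beta>}" for r using B0 by (simp add: k_def)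
    moreover have "(?u t - ?u m) / (t - m) - (?u m - ?u s) / (m - s) = integral {\<alpha>..\<beta>} (\<lambda>r. k r *
       ((max 0 (t - r) - max 0 (m - r)) / (t - m) - (max 0 (m - r) - max 0 (s - r)) / (m - s)))"
      if "\<alpha> \<le> s" "s < m" "m < t" "t \<le> \<beta>" for s m t
    proof -
      let ?h = "\<lambda>r. (max 0 (t - r) - max 0 (m - r)) / (t - m) - (max 0 (m - r) - max 0 (s - r)) / (m - s)"
      have "integral {\<alpha>..\<beta>} (\<lambda>r. force e r * ?h r) = integral {\<alpha>..\<beta>} (\<lambda>r. k r * ?h r)"
        by (rule integral_spike[OF neg]) (simp only: kf)
      then show ?thesis using hat_test[OF e that(2,3) ab(2) that(1,4) B] by (rule trans[rotated])
    qed
    ultimately obtain g where g: "\<And>t. t \<in> {\<alpha><..<\<beta>} \<Longrightarrow> (?u has_real_derivative g t) (at t)"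
      "\<And>s t. \<alpha> \<le> s \<Longrightarrow> s \<le> t \<Longrightarrow> t \<le> \<beta> \<Longrightarrow> (k has_integral (g t - g s)) {s..t}"
      using hat_slope_regularity[of \<alpha> \<beta> k B ?u] ab(1) by blast
    have "(force e has_integral (g t - g s)) {s..t}" if "\<alpha> \<le> s" "s \<le> t" "t \<le> \<beta>" for s t
      by (rule has_integral_spike[OF neg _ g(2)[OF that]]) (use kf that in auto)
    with g(1) show ?thesis by blast
  qed
  have nbhd: "\<exists>\<alpha> \<beta>. \<alpha> < s \<and> t < \<beta> \<and> {\<alpha>..\<beta>} \<subseteq> edge_int G e" if st: "s \<in> edge_int G e" "t \<in> edge_int G e" for s t
  proof -
    obtain d where d: "d > 0" "cball s d \<subseteq> edge_int G e" using edge_int_open st(1) open_contains_cball by blast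
    obtain d' where d': "d' > 0" "cball t d' \<subseteq> edge_int G e" using edge_int_open st(2) open_contains_cball by blast
    have "s - d \<in> edge_int G e" "t + d' \<in> edge_int G e" using d d' by (auto simp: subset_iff dist_real_def)
    then have "{s - d..t + d'} \<subseteq> edge_int G e" by (rule interval_subset[OF edge_int_interval])
    then show ?thesis using d d' by (intro exI[of _ "s - d"] exI[of _ "t + d'"]) auto
  qed
  show "(?u has_real_derivative du e t) (at t)" if t: "t \<in> edge_int G e" for t
  proof -
    obtain \<alpha> \<beta> where ab: "\<alpha> < t" "t < \<beta>" "{\<alpha>..\<beta>} \<subseteq> edge_int G e" using nbhd[OF t t] by blast
    from ab have "\<alpha> < \<beta>" "t \<in> {\<alpha><..<\<beta>}" by auto
    with main[OF _ ab(3)] obtain g where "(?u has_real_derivative g t) (at t)" by blast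
    then show ?thesis unfolding du_def by (metis DERIV_imp_deriv)
  qed
  show "(force e has_integral (du e t - du e s)) {s..t}" if st: "s \<in> edge_int G e" "t \<in> edge_int G e" "s \<le> t" for s t
  proof -
    obtain \<alpha> \<beta> where ab: "\<alpha> < s" "t < \<beta>" "{\<alpha>..\<beta>} \<subseteq> edge_int G e" using nbhd[OF st(1,2)] by blast
    from ab st have "\<alpha> < \<beta>" by simp
    from main[OF this ab(3)] obtain g where g: "\<And>t. t \<in> {\<alpha><..<\<beta>} \<Longrightarrow> (?u has_real_derivative g t) (at t)"
      "\<And>s t. \<alpha> \<le> s \<Longrightarrow> s \<le> t \<Longrightarrow> t \<le> \<beta> \<Longrightarrow> (force e has_integral (g t - g s)) {s..t}"
      by blast
    have "s \<in> {\<alpha><..<\<beta>}" "t \<in> {\<alpha><..<\<beta>}" using ab st by auto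
    then have "du e s = g s" "du e t = g t" unfolding du_def
      using g(1)[THEN DERIV_imp_deriv] by blast+
    then show ?thesis using g(2)[of s t] ab st by simp
  qed
qed

text \<open>\<open>du\<close> and \<open>gderiv G u\<close> have the same integrals over
  subintervals, namely the increments of \<open>u\<close>; so they agree almost everywhere and share
  square integrability.\<close>

lemma du_L2: "e \<in> edges G \<Longrightarrow> du e \<in> L2_on (edge_int G e)"
  and du_gderiv: "e \<in> edges G \<Longrightarrow> AE t in edge_measure e. gderiv G u e t = du e t"
proof -
  assume e: "e \<in> edges G"
  have m: "du e \<in> borel_measurable (edge_measure e)"
    by (rule has_derivative_measurable[OF edge_int_open continuous_on_edge_int[OF u_cont e], where S="{}"]) (use ode(1)[OF e] in auto)
  have "AE t in edge_measure e. gderiv G u e t - du e t = 0"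
  proof (rule integral_zero_imp_AE_zero[OF edge_int_open edge_int_interval])
    have hd: "(du e has_integral (on_edge G u e t - on_edge G u e s)) {s..t}" if "{s..t} \<subseteq> edge_int G e" "s \<le> t" for s t
    proof (rule fundamental_theorem_of_calculus[OF that(2)])
      fix x assume "x \<in> {s..t}"
      then have "x \<in> edge_int G e" using that(1) by blast
      from has_vector_derivative_at_within[OF ode(1)[OF e this, unfolded has_real_derivative_iff_has_vector_derivative]]
      show "(on_edge G u e has_vector_derivative du e x) (at x within {s..t})" .
    qed
    have hg: "gderiv G u e absolutely_integrable_on {s..t}" if "{s..t} \<subseteq> edge_int G e" for s t
      by (rule L2_on_absolutely_integrable[OF _ u_edge(2)[OF e] that]) simp
    show "(\<lambda>t. gderiv G u e t - du e t) integrable_on {s..t}" if "{s..t} \<subseteq> edge_int G e" for s t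
    proof (cases "s \<le> t")
      case True
      then show ?thesis using hd[OF that True] hg[OF that]
        by (auto simp: absolutely_integrable_on_def intro!: integrable_diff)
    qed auto
    fix s t assume st: "s \<in> edge_int G e" "t \<in> edge_int G e" "s < t"
    have "(gderiv G u e has_integral (on_edge G u e t - on_edge G u e s)) {s..t}"
      by (rule weak_deriv_FTC[OF edge_int_open edge_int_interval continuous_on_edge_int[OF u_cont e] u_edge(2,3)[OF e] st])
    from has_integral_diff[OF this hd[OF interval_subset[OF edge_int_interval st(1,2)]]] st
    show "integral {s..t} (\<lambda>t. gderiv G u e t - du e t) = 0" by (simp add: integral_unique)
  qed
  then show ae: "AE t in edge_measure e. gderiv G u e t = du e t" by simp
  have gm: "gderiv G u e \<in> borel_measurable (edge_measure e)" and gi: "integrable (edge_measure e) (\<lambda>t. (gderiv G u e t)\<^sup>2)"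
    using u_edge(2)[OF e] by (auto simp: L2_on_lebesgue_on)
  have "integrable (edge_measure e) (\<lambda>t. (du e t)\<^sup>2)"
    by (rule integrable_cong_AE_imp[OF gi]) (use m ae in auto)
  then show "du e \<in> L2_on (edge_int G e)" using m by (simp add: L2_on_lebesgue_on)
qed

lemma gpair_u: "gpair u du"
  unfolding gpair_def using u_out u_cont u_edge(1) du_L2 ode(1) by (intro conjI ballI exI[of _ "{}"]) auto

text \<open>The Sobolev inequality at the scale of the shortest edge,
  \<open>\<kappa> = 2 / l\<close>. This bound is only qualitative: it depends on the norm of
  \<open>u\<close>.\<close>

lemma u_bounded: obtains M where "M > 0" "\<And>x. x \<in> points G \<Longrightarrow> \<bar>u x\<bar> \<le> M"
proof -
  obtain l where l: "l > 0" "\<And>e. e \<in> edges G \<Longrightarrow> ereal l < len G e" using length_lower_bound by blast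
  define \<kappa> where "\<kappa> = 2 / l"
  define N where "N = 2 * \<kappa> * gint (\<lambda>e t. (on_edge G u e t)\<^sup>2) + (1 / \<kappa>) * gint (\<lambda>e t. (du e t)\<^sup>2)"
  have "\<kappa> > 0" "2 / \<kappa> = l" using l by (auto simp: \<kappa>_def)
  then have "(u x)\<^sup>2 \<le> N" if "x \<in> points G" for x
    unfolding N_def using l that by (intro sobolev[OF gpair_u]) auto
  then have "\<bar>u x\<bar> \<le> sqrt N" if "x \<in> points G" for x using that by (metis real_le_rsqrt power2_abs)
  then show ?thesis using that[of "max 1 (sqrt N)"] by (simp add: le_max_iff_disj)
qed

lemma force_L2:
  assumes e: "e \<in> edges G" shows "force e \<in> L2_on (edge_int G e)"
proof -
  obtain M where M: "M > 0" "\<And>x. x \<in> points G \<Longrightarrow> \<bar>u x\<bar> \<le> M" using u_bounded by blast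
  show ?thesis
    unfolding force_def[abs_def]
  proof (rule L2_on_bounded_mult[OF _ u_edge(1)[OF e], where C="Wb + \<bar>lam\<bar> + b * M powr (p - 2)"])
    show "(\<lambda>t. on_edge G W e t + lam - on_edge G \<rho> e t * \<bar>on_edge G u e t\<bar> powr (p - 2)) \<in> borel_measurable (edge_measure e)"
      using u_measurable[OF e] W_measurable[OF e] \<rho>_measurable[OF e] by measurable
    have "AE t in edge_measure e. t \<in> edge_int G e" by (rule AE_I2) simp
    then show "AE t in edge_measure e. \<bar>on_edge G W e t + lam - on_edge G \<rho> e t * \<bar>on_edge G u e t\<bar> powr (p - 2)\<bar> \<le> Wb + \<bar>lam\<bar> + b * M powr (p - 2)"
      using W_AE[OF e] \<rho>_AE[OF e]
    proof eventually_elim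
      case (elim t)
      have "\<bar>on_edge G u e t\<bar> \<le> M" using M(2)[OF pt_int_points[OF e]] elim by (simp add: on_edge_def)
      then have "\<bar>on_edge G u e t\<bar> powr (p - 2) \<le> M powr (p - 2)" using p2 by (intro powr_mono2) auto
      then have "on_edge G \<rho> e t * \<bar>on_edge G u e t\<bar> powr (p - 2) \<le> b * M powr (p - 2)"
        using elim by (intro mult_mono) auto
      moreover have "0 \<le> on_edge G \<rho> e t * \<bar>on_edge G u e t\<bar> powr (p - 2)" using elim by simp
      ultimately show ?case using elim by linarith
    qed
  qed simp
qed

section \<open>Enlarging the class of test functions\<close>

lemma gintble_test:
  assumes "gpair \<phi> \<phi>'"
  shows "gintble (\<lambda>e t. du e t * \<phi>' e t)" "gintble (\<lambda>e t. force e t * on_edge G \<phi> e t)"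
  using assms du_L2 force_L2 gpair_L2 by (auto intro!: gintble_L2)

lemma weak_eq_Cc:
  assumes \<phi>: "gpair \<phi> \<phi>'" "\<phi> \<in> Cc G"
  shows "gint (\<lambda>e t. du e t * \<phi>' e t + force e t * on_edge G \<phi> e t) = 0"
proof -
  have "gint (\<lambda>e t. gderiv G u e t * \<phi>' e t + force e t * on_edge G \<phi> e t) = gint (\<lambda>e t. du e t * \<phi>' e t + force e t * on_edge G \<phi> e t)"
  proof (rule gint_cong_AE)
    fix e assume e: "e \<in> edges G"
    have [measurable]: "gderiv G u e \<in> borel_measurable (edge_measure e)" "du e \<in> borel_measurable (edge_measure e)"
      using u_edge(2)[OF e] du_L2[OF e] by (auto simp: L2_on_lebesgue_on)
    note [measurable] = gpair_measurable[OF \<phi>(1) e] force_measurable[OF e]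
    show "(\<lambda>t. gderiv G u e t * \<phi>' e t + force e t * on_edge G \<phi> e t) \<in> borel_measurable (edge_measure e)"
      "(\<lambda>t. du e t * \<phi>' e t + force e t * on_edge G \<phi> e t) \<in> borel_measurable (edge_measure e)"
      by measurable
    show "AE t in edge_measure e. gderiv G u e t * \<phi>' e t + force e t * on_edge G \<phi> e t = du e t * \<phi>' e t + force e t * on_edge G \<phi> e t"
      using du_gderiv[OF e] by eventually_elim simp
  qed
  then show ?thesis using weak_eq_gderiv[OF \<phi> gintble_test(2)[OF \<phi>(1)]] by simp
qed

lemma exists_point: obtains x where "x \<in> points G"
proof -
  obtain e where e: "e \<in> edges G" using edges_nonempty by blast
  have "0 \<in> edge_dom G e" using e by (cases rule: edge_cases) auto
  then show ?thesis using that pt_points[OF e] by blast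
qed

text \<open>Compact support is removed by multiplying with cut-offs whose rate
  \<open>\<alpha> n\<close> and level \<open>c n\<close> tend to zero. They converge to one
  pointwise and their derivatives to zero uniformly; since \<open>du\<close>, \<open>force\<close>
  and the test function are square integrable, dominated convergence applies. This admits
  \<open>u\<close> times any weight, including weights that do not decay.\<close>

lemma weak_eq:
  assumes \<phi>: "gpair \<phi> \<phi>'"
  shows "gint (\<lambda>e t. du e t * \<phi>' e t + force e t * on_edge G \<phi> e t) = 0"
proof -
  obtain x where x: "x \<in> points G" by (rule exists_point)
  define \<alpha> where "\<alpha> n = 1 / real (Suc n)" for n
  define c where "c n = exp (- real (Suc n))" for n
  have \<alpha>: "\<alpha> n > 0" "\<alpha> n \<le> 1" for n by (auto simp: \<alpha>_def)
  have c: "c n > 0" "0 \<le> c n" for n by (auto simp: c_def)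
  define \<theta> where "\<theta> n = cut x (\<alpha> n) (c n)" for n
  define \<theta>' where "\<theta>' n = cut_deriv x (\<alpha> n) (c n)" for n
  define F where "F n e t = du e t * (\<phi>' e t * on_edge G (\<theta> n) e t + on_edge G \<phi> e t * \<theta>' n e t)
     + force e t * (on_edge G \<phi> e t * on_edge G (\<theta> n) e t)" for n e t
  have F0: "gint (F n) = 0" for n
  proof -
    obtain C where C: "gweight C (\<theta> n) (\<theta>' n)" unfolding \<theta>_def \<theta>'_def using cut_weight[OF x \<alpha>(1) c(2)] by blast
    have "gint (\<lambda>e t. du e t * (\<phi>' e t * on_edge G (\<theta> n) e t + on_edge G \<phi> e t * \<theta>' n e t)
      + force e t * on_edge G (\<lambda>y. \<phi> y * \<theta> n y) e t) = 0"
      by (rule weak_eq_Cc[OF gpair_mult_gweight[OF \<phi> C]]) (unfold \<theta>_def, rule cut_Cc[OF \<phi> x \<alpha>(1) c(1)])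
    then show ?thesis by (simp add: F_def[abs_def] on_edge_def)
  qed
  have lim\<alpha>: "\<alpha> \<longlonglongrightarrow> 0" unfolding \<alpha>_def by real_asymp
  have limc: "c \<longlonglongrightarrow> 0" unfolding c_def by real_asymp
  have lim\<theta>: "(\<lambda>n. \<theta> n y) \<longlonglongrightarrow> 1" for y
  proof -
    have "(\<lambda>n. (max 0 (exp (- \<alpha> n * gdist G x y) - c n))\<^sup>2) \<longlonglongrightarrow> (max 0 (exp (- 0 * gdist G x y) - 0))\<^sup>2"
      by (intro tendsto_intros lim\<alpha> limc)
    then show ?thesis by (simp add: \<theta>_def cut_def)
  qed
  have lim\<theta>': "(\<lambda>n. \<theta>' n e t) \<longlonglongrightarrow> 0" if "e \<in> edges G" "t \<in> edge_int G e" for e t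
  proof (rule Lim_null_comparison)
    show "\<forall>\<^sub>F n in sequentially. norm (\<theta>' n e t) \<le> 2 * \<alpha> n"
      using cut_deriv_bound(2)[OF x \<alpha>(1) c(2) that] by (simp add: \<theta>'_def)
    show "(\<lambda>n. 2 * \<alpha> n) \<longlonglongrightarrow> 0" using tendsto_mult_right_zero[OF lim\<alpha>] by simp
  qed
  have "(\<lambda>n. integral\<^sup>L (edge_measure e) (F n e)) \<longlonglongrightarrow> integral\<^sup>L (edge_measure e) (\<lambda>t. du e t * \<phi>' e t + force e t * on_edge G \<phi> e t)"
    if e: "e \<in> edges G" for e
  proof (rule integral_dominated_convergence[where w="\<lambda>t. \<bar>du e t * \<phi>' e t\<bar> + 2 * \<bar>du e t * on_edge G \<phi> e t\<bar> + \<bar>force e t * on_edge G \<phi> e t\<bar>"])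
    have i: "integrable (edge_measure e) (\<lambda>t. du e t * \<phi>' e t)" "integrable (edge_measure e) (\<lambda>t. force e t * on_edge G \<phi> e t)"
      "integrable (edge_measure e) (\<lambda>t. du e t * on_edge G \<phi> e t)"
      using gintble_test[OF \<phi>] e L2_on_mult_integrable[OF _ du_L2[OF e] gpair_L2(1)[OF \<phi> e]] by (auto simp: gintble_def)
    show "integrable (edge_measure e) (\<lambda>t. \<bar>du e t * \<phi>' e t\<bar> + 2 * \<bar>du e t * on_edge G \<phi> e t\<bar> + \<bar>force e t * on_edge G \<phi> e t\<bar>)"
      using i by (intro Bochner_Integration.integrable_add integrable_mult_right integrable_abs)
    show "(\<lambda>t. du e t * \<phi>' e t + force e t * on_edge G \<phi> e t) \<in> borel_measurable (edge_measure e)"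
      using i by (intro borel_measurable_add) auto
    fix n
    obtain C where C: "gweight C (\<theta> n) (\<theta>' n)" unfolding \<theta>_def \<theta>'_def using cut_weight[OF x \<alpha>(1) c(2)] by blast
    have [measurable]: "du e \<in> borel_measurable (edge_measure e)" using du_L2[OF e] by (auto simp: L2_on_lebesgue_on)
    note [measurable] = gpair_measurable[OF \<phi> e] force_measurable[OF e] gweight_measurable[OF C e]
    show "F n e \<in> borel_measurable (edge_measure e)" unfolding F_def[abs_def] by measurable
    show "AE t in edge_measure e. norm (F n e t) \<le> \<bar>du e t * \<phi>' e t\<bar> + 2 * \<bar>du e t * on_edge G \<phi> e t\<bar> + \<bar>force e t * on_edge G \<phi> e t\<bar>"
    proof (rule AE_I2)
      fix t assume "t \<in> space (edge_measure e)"
      then have t: "t \<in> edge_int G e" by simp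
      have X: "\<bar>on_edge G (\<theta> n) e t\<bar> \<le> 1" using cut_bounds[OF \<alpha>(1) c(2), of x n n] by (simp add: \<theta>_def on_edge_def)
      have X': "\<bar>\<theta>' n e t\<bar> \<le> 2" using cut_deriv_bound(2)[OF x \<alpha>(1) c(2) e t, of n n] \<alpha>(2)[of n] by (simp add: \<theta>'_def)
      have "F n e t = (du e t * \<phi>' e t) * on_edge G (\<theta> n) e t + (du e t * on_edge G \<phi> e t) * \<theta>' n e t
        + (force e t * on_edge G \<phi> e t) * on_edge G (\<theta> n) e t"
        by (simp add: F_def algebra_simps)
      moreover have "\<bar>(du e t * \<phi>' e t) * on_edge G (\<theta> n) e t\<bar> \<le> \<bar>du e t * \<phi>' e t\<bar> * 1"
        "\<bar>(force e t * on_edge G \<phi> e t) * on_edge G (\<theta> n) e t\<bar> \<le> \<bar>force e t * on_edge G \<phi> e t\<bar> * 1"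
        "\<bar>(du e t * on_edge G \<phi> e t) * \<theta>' n e t\<bar> \<le> \<bar>du e t * on_edge G \<phi> e t\<bar> * 2"
        unfolding abs_mult[of _ "on_edge G (\<theta> n) e t"] abs_mult[of _ "\<theta>' n e t"] by (intro mult_left_mono X X' abs_ge_zero)+
      ultimately show "norm (F n e t) \<le> \<bar>du e t * \<phi>' e t\<bar> + 2 * \<bar>du e t * on_edge G \<phi> e t\<bar> + \<bar>force e t * on_edge G \<phi> e t\<bar>"
        unfolding real_norm_def by linarith
    qed
    show "AE t in edge_measure e. (\<lambda>n. F n e t) \<longlonglongrightarrow> du e t * \<phi>' e t + force e t * on_edge G \<phi> e t"
    proof (rule AE_I2)
      fix t assume "t \<in> space (edge_measure e)"
      then have t: "t \<in> edge_int G e" by simp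
      have "(\<lambda>n. F n e t) \<longlonglongrightarrow> du e t * (\<phi>' e t * 1 + on_edge G \<phi> e t * 0) + force e t * (on_edge G \<phi> e t * 1)"
        unfolding F_def by (intro tendsto_intros lim\<theta>'[OF e t]) (use lim\<theta> in \<open>simp_all add: on_edge_def\<close>)
      then show "(\<lambda>n. F n e t) \<longlonglongrightarrow> du e t * \<phi>' e t + force e t * on_edge G \<phi> e t" by simp
    qed
  qed
  then have "(\<lambda>n. gint (F n)) \<longlonglongrightarrow> gint (\<lambda>e t. du e t * \<phi>' e t + force e t * on_edge G \<phi> e t)"
    unfolding gint_def by (intro tendsto_sum)
  then show ?thesis unfolding F0 by (simp add: LIMSEQ_const_iff)
qed

text \<open>Testing with \<open>u \<eta>\<^sup>2\<close>.\<close>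

lemma weighted_identity:
  assumes \<eta>: "gweight C \<eta> \<eta>'"
  shows "gint (\<lambda>e t. (du e t * on_edge G \<eta> e t + on_edge G u e t * \<eta>' e t)\<^sup>2
      + force e t * on_edge G u e t * (on_edge G \<eta> e t)\<^sup>2 - (on_edge G u e t)\<^sup>2 * (\<eta>' e t)\<^sup>2) = 0"
proof -
  let ?d = "\<lambda>e t. du e t * on_edge G \<eta> e t + on_edge G u e t * \<eta>' e t"
  have 1: "gpair (\<lambda>x. u x * \<eta> x) ?d" by (rule gpair_mult_gweight[OF gpair_u \<eta>])
  have 2: "gpair (\<lambda>x. u x * \<eta> x * \<eta> x) (\<lambda>e t. ?d e t * on_edge G \<eta> e t + on_edge G (\<lambda>x. u x * \<eta> x) e t * \<eta>' e t)"
    by (rule gpair_mult_gweight[OF 1 \<eta>])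
  have "gint (\<lambda>e t. du e t * (?d e t * on_edge G \<eta> e t + on_edge G (\<lambda>x. u x * \<eta> x) e t * \<eta>' e t)
     + force e t * on_edge G (\<lambda>x. u x * \<eta> x * \<eta> x) e t) = 0" by (rule weak_eq[OF 2])
  \<comment> \<open>This is \<open>u' (u \<eta>\<^sup>2)' = ((u \<eta>)')\<^sup>2 - u\<^sup>2
    \<eta>'\<^sup>2\<close>, with \<open>?d\<close> for \<open>(u \<eta>)'\<close>.\<close>
  also have "(\<lambda>e t. du e t * (?d e t * on_edge G \<eta> e t + on_edge G (\<lambda>x. u x * \<eta> x) e t * \<eta>' e t)
     + force e t * on_edge G (\<lambda>x. u x * \<eta> x * \<eta> x) e t) = (\<lambda>e t. (du e t * on_edge G \<eta> e t + on_edge G u e t * \<eta>' e t)\<^sup>2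
      + force e t * on_edge G u e t * (on_edge G \<eta> e t)\<^sup>2 - (on_edge G u e t)\<^sup>2 * (\<eta>' e t)\<^sup>2)"
    by (simp add: fun_eq_iff on_edge_def power2_eq_square algebra_simps)
  finally show ?thesis .
qed

end

section \<open>Negative directions and the Morse index\<close>

lemma sum_fun_apply: "(\<Sum>i\<in>A. f i) x = (\<Sum>i\<in>A. f i x)"
  by (induction A rule: infinite_finite_induct) (auto simp: plus_fun_def zero_fun_def)

lemma continuous_AE_zero:
  fixes I :: "real set" and f :: "real \<Rightarrow> real"
  assumes I: "open I" and f: "continuous_on I f" and z: "AE t in lebesgue_on I. f t = 0" and t: "t \<in> I"
  shows "f t = 0"
proof -
  have "AE t in lebesgue. t \<in> I \<longrightarrow> f t = 0" using z I by (subst AE_lebesgue_on) auto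
  then obtain N where N: "N \<in> null_sets lebesgue" "{t. \<not> (t \<in> I \<longrightarrow> f t = 0)} \<subseteq> N"
    by (auto simp: eventually_ae_filter)
  have "open {t \<in> I. f t \<noteq> 0}"
  proof -
    have "open (I \<inter> f -` (- {0}))" using I f by (intro continuous_open_preimage) auto
    then show ?thesis by (simp add: Int_def vimage_def)
  qed
  moreover have "negligible {t \<in> I. f t \<noteq> 0}"
  proof (rule negligible_subset)
    show "negligible N" using N(1) by (simp add: negligible_iff_null_sets)
    show "{t \<in> I. f t \<noteq> 0} \<subseteq> N" using N(2) by blast
  qed
  ultimately have "{t \<in> I. f t \<noteq> 0} = {}" using open_not_negligible by blast
  then show ?thesis using t by blast
qed

lemma (in fin_graph) edge_closure: "e \<in> edges G \<Longrightarrow> closure (edge_int G e) = edge_dom G e"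
  by (cases rule: edge_cases) (auto simp: closure_greaterThanLessThan)

lemma (in fin_graph) edge_bound_closure:
  assumes f: "continuous_map (gtopology G) euclideanreal f" and e: "e \<in> edges G"
    and b: "\<And>t. t \<in> edge_int G e \<Longrightarrow> \<bar>f (pt G e t)\<bar> \<le> k" and t: "t \<in> edge_dom G e"
  shows "\<bar>f (pt G e t)\<bar> \<le> k"
proof -
  have "continuous_on (closure (edge_int G e)) (\<lambda>t. \<bar>f (pt G e t)\<bar>)"
    unfolding edge_closure[OF e] using continuous_on_edge[OF f e] by (intro continuous_intros) (simp add: on_edge_def)
  from continuous_le_on_closure[OF this, of t k] show ?thesis using b t edge_closure[OF e] by blast
qed

context graph_solution
begin

section \<open>The quadratic form of the linearised operator\<close>

definition nonlin :: "'e \<Rightarrow> real \<Rightarrow> real" where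
  "nonlin e t = on_edge G \<rho> e t * \<bar>on_edge G u e t\<bar> powr (p - 2)"

definition pot :: "'e \<Rightarrow> real \<Rightarrow> real" where
  "pot e t = on_edge G W e t + lam"

lemma force_alt: "force e t = on_edge G u e t * (pot e t - nonlin e t)"
  by (simp add: force_def pot_def nonlin_def)

lemma pot_measurable: "e \<in> edges G \<Longrightarrow> pot e \<in> borel_measurable (edge_measure e)"
  and nonlin_measurable: "e \<in> edges G \<Longrightarrow> nonlin e \<in> borel_measurable (edge_measure e)"
  unfolding pot_def[abs_def] nonlin_def[abs_def]
  using W_measurable[of e] \<rho>_measurable[of e] u_measurable[of e] by measurable

lemma pot_AE: "e \<in> edges G \<Longrightarrow> AE t in edge_measure e. lam - Wb \<le> pot e t \<and> pot e t \<le> lam + Wb"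
  unfolding pot_def by (rule eventually_mono[OF W_AE]) linarith+

lemma nonlin_AE:
  assumes e: "e \<in> edges G"
  shows "AE t in edge_measure e. 0 \<le> nonlin e t \<and> nonlin e t \<le> b * \<bar>on_edge G u e t\<bar> powr (p - 2)"
  using \<rho>_AE[OF e] by eventually_elim (auto simp: nonlin_def intro: mult_right_mono)

lemma nonlin_bounded: obtains D where "\<And>e. e \<in> edges G \<Longrightarrow> AE t in edge_measure e. \<bar>nonlin e t\<bar> \<le> D"
proof -
  obtain M where M: "M > 0" "\<And>x. x \<in> points G \<Longrightarrow> \<bar>u x\<bar> \<le> M" using u_bounded by blast
  have "AE t in edge_measure e. \<bar>nonlin e t\<bar> \<le> \<bar>b\<bar> * M powr (p - 2)" if e: "e \<in> edges G" for e
  proof -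
    have "AE t in edge_measure e. t \<in> edge_int G e" by (rule AE_I2) simp
    then show ?thesis using nonlin_AE[OF e]
    proof eventually_elim
      case (elim t)
      have "\<bar>on_edge G u e t\<bar> \<le> M" using M(2)[OF pt_int_points[OF e elim(1)]] by (simp add: on_edge_def)
      then have "\<bar>on_edge G u e t\<bar> powr (p - 2) \<le> M powr (p - 2)" using p2 by (intro powr_mono2) auto
      then have "\<bar>b\<bar> * \<bar>on_edge G u e t\<bar> powr (p - 2) \<le> \<bar>b\<bar> * M powr (p - 2)" by (intro mult_left_mono) auto
      moreover have "b * \<bar>on_edge G u e t\<bar> powr (p - 2) \<le> \<bar>b\<bar> * \<bar>on_edge G u e t\<bar> powr (p - 2)" by (intro mult_right_mono) auto
      ultimately show ?case using elim by linarith
    qed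
  qed
  then show ?thesis using that by blast
qed

lemma gintble_coeff:
  assumes \<phi>: "gpair \<phi> \<phi>'" and \<psi>: "gpair \<psi> \<psi>'"
  shows "gintble (\<lambda>e t. \<phi>' e t * \<psi>' e t)" "gintble (\<lambda>e t. on_edge G \<phi> e t * on_edge G \<psi> e t)"
    "gintble (\<lambda>e t. pot e t * (on_edge G \<phi> e t * on_edge G \<psi> e t))"
    "gintble (\<lambda>e t. nonlin e t * (on_edge G \<phi> e t * on_edge G \<psi> e t))"
proof -
  show "gintble (\<lambda>e t. \<phi>' e t * \<psi>' e t)" "gintble (\<lambda>e t. on_edge G \<phi> e t * on_edge G \<psi> e t)"
    using gpair_L2[OF \<phi>] gpair_L2[OF \<psi>] by (auto intro!: gintble_L2)
  obtain D where D: "\<And>e. e \<in> edges G \<Longrightarrow> AE t in edge_measure e. \<bar>nonlin e t\<bar> \<le> D" using nonlin_bounded by blast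
  have "gintble (\<lambda>e t. (on_edge G \<phi> e t * nonlin e t) * on_edge G \<psi> e t)"
    by (intro gintble_L2 gpair_L2(1)[OF \<psi>] L2_on_bounded_mult[OF _ gpair_L2(1)[OF \<phi>] nonlin_measurable D]) auto
  then show "gintble (\<lambda>e t. nonlin e t * (on_edge G \<phi> e t * on_edge G \<psi> e t))" by (simp add: mult_ac)
  have P: "AE t in edge_measure e. \<bar>pot e t\<bar> \<le> \<bar>lam\<bar> + \<bar>Wb\<bar>" if "e \<in> edges G" for e
    using pot_AE[OF that] by eventually_elim linarith
  have "gintble (\<lambda>e t. (on_edge G \<phi> e t * pot e t) * on_edge G \<psi> e t)"
    by (intro gintble_L2 gpair_L2(1)[OF \<psi>] L2_on_bounded_mult[OF _ gpair_L2(1)[OF \<phi>] pot_measurable P]) auto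
  then show "gintble (\<lambda>e t. pot e t * (on_edge G \<phi> e t * on_edge G \<psi> e t))" by (simp add: mult_ac)
qed

definition qform :: "(('v, 'e) gpoint \<Rightarrow> real) \<Rightarrow> ('e \<Rightarrow> real \<Rightarrow> real) \<Rightarrow> 'e \<Rightarrow> real \<Rightarrow> real" where
  "qform \<phi> \<phi>' e t = (\<phi>' e t)\<^sup>2 + pot e t * (on_edge G \<phi> e t)\<^sup>2 - (p - 1) * (nonlin e t * (on_edge G \<phi> e t)\<^sup>2)"

lemma qform_gintble: "gpair \<phi> \<phi>' \<Longrightarrow> gintble (qform \<phi> \<phi>')"
  unfolding qform_def[abs_def] power2_eq_square
  by (intro gintble_diff gintble_add gintble_cmult gintble_coeff)

lemma morse_form_gpair:
  assumes \<phi>: "gpair \<phi> \<phi>'"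
  shows "morse_form G p W \<rho> lam u \<phi> = gint (qform \<phi> \<phi>')"
  unfolding morse_form_def gintegral_gint
proof (rule gint_cong_AE)
  fix e assume e: "e \<in> edges G"
  note [measurable] = gpair_gderiv(2)[OF \<phi> e] gpair_measurable[OF \<phi> e] W_measurable[OF e] \<rho>_measurable[OF e] u_measurable[OF e]
    pot_measurable[OF e] nonlin_measurable[OF e]
  show "(\<lambda>t. (gderiv G \<phi> e t)\<^sup>2 + (on_edge G W e t + lam) * (on_edge G \<phi> e t)\<^sup>2
        - (p - 1) * on_edge G \<rho> e t * \<bar>on_edge G u e t\<bar> powr (p - 2) * (on_edge G \<phi> e t)\<^sup>2) \<in> borel_measurable (edge_measure e)"
    by measurable
  show "qform \<phi> \<phi>' e \<in> borel_measurable (edge_measure e)" unfolding qform_def[abs_def] by measurable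
  show "AE t in edge_measure e. (gderiv G \<phi> e t)\<^sup>2 + (on_edge G W e t + lam) * (on_edge G \<phi> e t)\<^sup>2
        - (p - 1) * on_edge G \<rho> e t * \<bar>on_edge G u e t\<bar> powr (p - 2) * (on_edge G \<phi> e t)\<^sup>2 = qform \<phi> \<phi>' e t"
    using gpair_gderiv(1)[OF \<phi> e] by eventually_elim (simp add: qform_def pot_def nonlin_def mult_ac)
qed

lemma sum_square_disjoint:
  fixes x :: "nat \<Rightarrow> real"
  assumes "finite A" "\<And>i j. i \<in> A \<Longrightarrow> j \<in> A \<Longrightarrow> i \<noteq> j \<Longrightarrow> x i * x j = 0"
  shows "(\<Sum>i\<in>A. c i * x i)\<^sup>2 = (\<Sum>i\<in>A. (c i)\<^sup>2 * (x i)\<^sup>2)"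
proof -
  have "(\<Sum>i\<in>A. c i * x i)\<^sup>2 = (\<Sum>i\<in>A. \<Sum>j\<in>A. (c i * x i) * (c j * x j))"
    by (simp add: power2_eq_square sum_product)
  also have "\<dots> = (\<Sum>i\<in>A. \<Sum>j\<in>A. if j = i then (c i)\<^sup>2 * (x i)\<^sup>2 else 0)"
  proof (intro sum.cong refl)
    fix i j assume ij: "i \<in> A" "j \<in> A"
    show "(c i * x i) * (c j * x j) = (if j = i then (c i)\<^sup>2 * (x i)\<^sup>2 else 0)"
    proof (cases "j = i")
      case False
      then have "x i * x j = 0" using assms(2) ij by blast
      then show ?thesis using False by auto
    qed (simp add: power2_eq_square)
  qed
  also have "\<dots> = (\<Sum>i\<in>A. (c i)\<^sup>2 * (x i)\<^sup>2)" using assms(1) by simp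
  finally show ?thesis .
qed

text \<open>Disjoint supports remove the mixed terms, so the form is negative on every nonzero
  combination; evaluation at points \<open>w i\<close> with \<open>\<phi> i (w i) \<noteq> 0\<close>
  gives linear independence. Disjointness of the derivatives is a separate hypothesis because
  \<open>\<phi>'\<close> is arbitrary at the exceptional points. Each support may be bounded around
  its own centre; one ball about \<open>x0\<close> contains them all.\<close>

lemma morse_index_lower:
  fixes \<phi> :: "nat \<Rightarrow> ('v, 'e) gpoint \<Rightarrow> real"
  assumes A: "finite A" and \<phi>: "\<And>i. i \<in> A \<Longrightarrow> gpair (\<phi> i) (\<phi>' i)"
    and supp: "\<And>i. i \<in> A \<Longrightarrow> \<exists>x\<in>points G. \<exists>r. \<forall>y\<in>points G. \<phi> i y \<noteq> 0 \<longrightarrow> gdist G x y \<le> r"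
    and disj: "\<And>i j y. i \<in> A \<Longrightarrow> j \<in> A \<Longrightarrow> i \<noteq> j \<Longrightarrow> \<phi> i y * \<phi> j y = 0"
    and disj': "\<And>i j e t. i \<in> A \<Longrightarrow> j \<in> A \<Longrightarrow> i \<noteq> j \<Longrightarrow> e \<in> edges G \<Longrightarrow> t \<in> edge_int G e \<Longrightarrow> \<phi>' i e t * \<phi>' j e t = 0"
    and neg: "\<And>i. i \<in> A \<Longrightarrow> gint (qform (\<phi> i) (\<phi>' i)) < 0"
  shows "enat (card A) \<le> morse_index G p W \<rho> lam u"
proof -
  define comb where "comb c x = (\<Sum>i\<in>A. c i * \<phi> i x)" for c :: "nat \<Rightarrow> real" and x
  have pair: "gpair (comb c) (\<lambda>e t. \<Sum>i\<in>A. c i * \<phi>' i e t)" for c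
    unfolding comb_def[abs_def] by (rule gpair_sum[OF A \<phi>])
  have form: "morse_form G p W \<rho> lam u (comb c) = (\<Sum>i\<in>A. (c i)\<^sup>2 * gint (qform (\<phi> i) (\<phi>' i)))" for c
  proof -
    have "morse_form G p W \<rho> lam u (comb c) = gint (\<lambda>e t. \<Sum>i\<in>A. (c i)\<^sup>2 * qform (\<phi> i) (\<phi>' i) e t)"
      unfolding morse_form_gpair[OF pair]
    proof (rule gint_cong)
      fix e t assume et: "e \<in> edges G" "t \<in> edge_int G e"
      have 1: "(\<Sum>i\<in>A. c i * \<phi>' i e t)\<^sup>2 = (\<Sum>i\<in>A. (c i)\<^sup>2 * (\<phi>' i e t)\<^sup>2)"
        by (rule sum_square_disjoint[OF A]) (use disj' et in blast)
      have 2: "(on_edge G (comb c) e t)\<^sup>2 = (\<Sum>i\<in>A. (c i)\<^sup>2 * (on_edge G (\<phi> i) e t)\<^sup>2)"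
        unfolding on_edge_def comb_def by (rule sum_square_disjoint[OF A]) (use disj in blast)
      show "qform (comb c) (\<lambda>e t. \<Sum>i\<in>A. c i * \<phi>' i e t) e t = (\<Sum>i\<in>A. (c i)\<^sup>2 * qform (\<phi> i) (\<phi>' i) e t)"
        unfolding qform_def 1 2
        by (simp add: sum_distrib_left sum.distrib[symmetric] sum_subtractf[symmetric] algebra_simps)
    qed
    also have "\<dots> = (\<Sum>i\<in>A. (c i)\<^sup>2 * gint (qform (\<phi> i) (\<phi>' i)))"
    proof -
      have ib: "integrable (edge_measure e) (qform (\<phi> i) (\<phi>' i) e)" if "i \<in> A" "e \<in> edges G" for i e
        using qform_gintble[OF \<phi>[OF that(1)]] that by (simp add: gintble_def)
      have "gint (\<lambda>e t. \<Sum>i\<in>A. (c i)\<^sup>2 * qform (\<phi> i) (\<phi>' i) e t)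
        = (\<Sum>e\<in>edges G. \<Sum>i\<in>A. (c i)\<^sup>2 * integral\<^sup>L (edge_measure e) (qform (\<phi> i) (\<phi>' i) e))"
        unfolding gint_def
      proof (intro sum.cong refl)
        fix e assume e: "e \<in> edges G"
        have "integral\<^sup>L (edge_measure e) (\<lambda>t. \<Sum>i\<in>A. (c i)\<^sup>2 * qform (\<phi> i) (\<phi>' i) e t)
          = (\<Sum>i\<in>A. integral\<^sup>L (edge_measure e) (\<lambda>t. (c i)\<^sup>2 * qform (\<phi> i) (\<phi>' i) e t))"
          by (rule Bochner_Integration.integral_sum) (use ib e in auto)
        then show "integral\<^sup>L (edge_measure e) (\<lambda>t. \<Sum>i\<in>A. (c i)\<^sup>2 * qform (\<phi> i) (\<phi>' i) e t)
          = (\<Sum>i\<in>A. (c i)\<^sup>2 * integral\<^sup>L (edge_measure e) (qform (\<phi> i) (\<phi>' i) e))" by simp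
      qed
      also have "\<dots> = (\<Sum>i\<in>A. \<Sum>e\<in>edges G. (c i)\<^sup>2 * integral\<^sup>L (edge_measure e) (qform (\<phi> i) (\<phi>' i) e))"
        by (rule sum.swap)
      finally show ?thesis by (simp add: gint_def sum_distrib_left)
    qed
    finally show ?thesis .
  qed
  have zero: "morse_form G p W \<rho> lam u (\<lambda>x. 0) = 0"
  proof -
    have "comb (\<lambda>_. 0) = (\<lambda>x. 0)" by (simp add: comb_def[abs_def])
    then show ?thesis using form[of "\<lambda>_. 0"] by simp
  qed
  have single: "comb (\<lambda>j. if j = i then 1 else 0) = \<phi> i" if "i \<in> A" for i
  proof
    fix x
    have "comb (\<lambda>j. if j = i then 1 else 0) x = (\<Sum>j\<in>A. if j = i then \<phi> j x else 0)"
      unfolding comb_def by (intro sum.cong) auto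
    then show "comb (\<lambda>j. if j = i then 1 else 0) x = \<phi> i x" using A that by simp
  qed
  have nz: "\<exists>x. \<phi> i x \<noteq> 0" if i: "i \<in> A" for i
  proof (rule ccontr)
    assume "\<not> ?thesis"
    then have "\<phi> i = (\<lambda>x. 0)" by auto
    then show False using zero neg[OF i] morse_form_gpair[OF \<phi>[OF i]] by simp
  qed
  obtain w where w: "\<And>i. i \<in> A \<Longrightarrow> \<phi> i (w i) \<noteq> 0" using nz by metis
  have comb_w: "comb c (w i) = c i * \<phi> i (w i)" if i: "i \<in> A" for c i
  proof -
    have "comb c (w i) = (\<Sum>j\<in>A. if j = i then c i * \<phi> i (w i) else 0)"
      unfolding comb_def
    proof (intro sum.cong refl)
      fix j assume j: "j \<in> A"
      show "c j * \<phi> j (w i) = (if j = i then c i * \<phi> i (w i) else 0)"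
        using disj[OF j i, of "w i"] w[OF i] by auto
    qed
    then show ?thesis using A i by simp
  qed
  have inj: "inj_on \<phi> A"
  proof (rule inj_onI)
    fix i j assume ij: "i \<in> A" "j \<in> A" "\<phi> i = \<phi> j"
    show "i = j"
    proof (rule ccontr)
      assume "i \<noteq> j"
      then have "\<phi> i (w i) * \<phi> j (w i) = 0" using disj ij by blast
      then show False using ij w[OF ij(1)] by simp
    qed
  qed
  define B where "B = \<phi> ` A"
  have finB: "finite B" and cardB: "card B = card A" unfolding B_def using A inj by (auto simp: card_image)
  have reindex: "(\<Sum>v\<in>B. k v *\<^sub>R v) = comb (\<lambda>i. k (\<phi> i))" for k
  proof
    fix x
    have "(\<Sum>v\<in>B. k v *\<^sub>R v) x = (\<Sum>v\<in>B. k v * v x)"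
      by (simp add: sum_fun_apply scaleR_fun_def)
    also have "\<dots> = comb (\<lambda>i. k (\<phi> i)) x"
      unfolding B_def comb_def by (subst sum.reindex[OF inj]) simp
    finally show "(\<Sum>v\<in>B. k v *\<^sub>R v) x = comb (\<lambda>i. k (\<phi> i)) x" .
  qed
  have indep: "independent B"
    unfolding independent_explicit_finite_subsets
  proof (intro allI impI ballI)
    fix S k v assume S: "S \<subseteq> B" "finite S" "(\<Sum>v\<in>S. k v *\<^sub>R v) = 0" "v \<in> S"
    define k' where "k' v = (if v \<in> S then k v else 0)" for v
    have "(\<Sum>v\<in>B. k' v *\<^sub>R v) = (\<Sum>v\<in>S. k' v *\<^sub>R v)"
      by (rule sum.mono_neutral_right[OF finB S(1)]) (auto simp: k'_def)
    also have "\<dots> = (\<Sum>v\<in>S. k v *\<^sub>R v)" by (intro sum.cong) (auto simp: k'_def)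
    finally have z: "comb (\<lambda>i. k' (\<phi> i)) = (\<lambda>x. 0)" using S(3) unfolding reindex by (simp add: zero_fun_def)
    obtain i where i: "i \<in> A" "v = \<phi> i" using S by (auto simp: B_def)
    have "k' (\<phi> i) * \<phi> i (w i) = 0" using comb_w[OF i(1), of "\<lambda>i. k' (\<phi> i)"] z by simp
    then show "k v = 0" using w[OF i(1)] i S(4) by (simp add: k'_def)
  qed
  have spanB: "\<psi> \<in> span B \<Longrightarrow> \<exists>c. \<psi> = comb c" for \<psi>
    unfolding span_finite[OF finB] reindex by blast
  obtain x0 where x0: "x0 \<in> points G" by (rule exists_point)
  have "\<exists>r. \<forall>y\<in>points G. \<phi> i y \<noteq> 0 \<longrightarrow> gdist G x0 y \<le> r" if i: "i \<in> A" for i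
  proof -
    obtain x r where xr: "x \<in> points G" "\<forall>y\<in>points G. \<phi> i y \<noteq> 0 \<longrightarrow> gdist G x y \<le> r" using supp[OF i] by blast
    have "\<forall>y\<in>points G. \<phi> i y \<noteq> 0 \<longrightarrow> gdist G x0 y \<le> gdist G x0 x + r"
      using gm.triangle[OF x0 xr(1)] xr(2) by (meson add_left_mono order_trans)
    then show ?thesis by blast
  qed
  then obtain r where r: "\<And>i y. i \<in> A \<Longrightarrow> y \<in> points G \<Longrightarrow> \<phi> i y \<noteq> 0 \<Longrightarrow> gdist G x0 y \<le> r i" by metis
  have Cc: "comb c \<in> Cc G" for c
  proof (rule bounded_support_Cc[OF _ _ x0])
    show "comb c y = 0" if "y \<notin> points G" for y using pair[of c] that unfolding gpair_def by blast
    show "continuous_map (gtopology G) euclideanreal (comb c)" using pair[of c] unfolding gpair_def by blast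
    fix y assume y: "y \<in> points G" "comb c y \<noteq> 0"
    then obtain i where i: "i \<in> A" "c i * \<phi> i y \<noteq> 0" unfolding comb_def by (meson sum.neutral)
    then have "gdist G x0 y \<le> r i" using r[OF i(1) y(1)] by simp
    also have "\<dots> \<le> (\<Sum>i\<in>A. \<bar>r i\<bar>)"
      using member_le_sum[OF i(1), of "\<lambda>i. \<bar>r i\<bar>"] A by simp
    finally show "gdist G x0 y \<le> (\<Sum>i\<in>A. \<bar>r i\<bar>)" .
  qed
  have sub: "span B \<subseteq> H1 G \<inter> Cc G"
    using spanB Cc gpair_H1[OF pair] by blast
  have negative: "morse_form G p W \<rho> lam u \<psi> < 0" if psi: "\<psi> \<in> span B - {0}" for \<psi>
  proof -
    obtain c where c: "\<psi> = comb c" using spanB psi by blast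
    have "\<exists>i\<in>A. c i \<noteq> 0"
    proof (rule ccontr)
      assume "\<not> ?thesis"
      then have "comb c = (\<lambda>x. 0)" by (simp add: comb_def[abs_def])
      then show False using psi c by (simp add: zero_fun_def)
    qed
    then obtain i where i: "i \<in> A" "c i \<noteq> 0" by blast
    have le: "(c j)\<^sup>2 * gint (qform (\<phi> j) (\<phi>' j)) \<le> 0" if "j \<in> A" for j
      using neg[OF that] by (intro mult_nonneg_nonpos) auto
    have "(c i)\<^sup>2 * gint (qform (\<phi> i) (\<phi>' i)) < 0" using neg[OF i(1)] i(2) by (intro mult_pos_neg) auto
    then have "(\<Sum>i\<in>A. (c i)\<^sup>2 * gint (qform (\<phi> i) (\<phi>' i))) < (\<Sum>i\<in>A. 0)"
      using le i(1) A by (intro sum_strict_mono_ex1) auto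
    then show ?thesis unfolding c form by simp
  qed
  show ?thesis
    unfolding morse_index_def
    by (rule Sup_upper) (use sub finB indep cardB negative in blast)
qed

text \<open>A lower bound \<open>lam / 4\<close> for the effective potential, up to an error \<open>H\<close>, turns the identity for \<open>u \<eta>\<close> into
  a pointwise bound.\<close>

lemma energy_sup:
  assumes \<eta>: "gweight C \<eta> \<eta>'" and lam: "lam > 0" and len: "\<And>e. e \<in> edges G \<Longrightarrow> ereal (2 / sqrt lam) < len G e"
    and H: "gintble H" and K: "gint (\<lambda>e t. (du e t * on_edge G \<eta> e t + on_edge G u e t * \<eta>' e t)\<^sup>2)
       + lam / 4 * gint (\<lambda>e t. (on_edge G (\<lambda>x. u x * \<eta> x) e t)\<^sup>2) \<le> gint H"
    and x: "x \<in> points G"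
  shows "(u x * \<eta> x)\<^sup>2 \<le> 8 * gint H / sqrt lam"
proof -
  have pair: "gpair (\<lambda>x. u x * \<eta> x) (\<lambda>e t. du e t * on_edge G \<eta> e t + on_edge G u e t * \<eta>' e t)"
    by (rule gpair_mult_gweight[OF gpair_u \<eta>])
  let ?P = "gint (\<lambda>e t. (on_edge G (\<lambda>x. u x * \<eta> x) e t)\<^sup>2)"
  let ?Q = "gint (\<lambda>e t. (du e t * on_edge G \<eta> e t + on_edge G u e t * \<eta>' e t)\<^sup>2)"
  have PQ: "0 \<le> ?P" "0 \<le> ?Q" by (auto intro!: gint_nonneg)
  define k where "k = sqrt lam"
  have k: "k > 0" "lam = k * k" using lam by (auto simp: k_def)
  have "(u x * \<eta> x)\<^sup>2 \<le> 2 * k * ?P + (1 / k) * ?Q"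
    unfolding k_def by (rule sobolev[OF pair _ len x]) (use lam in simp)
  \<comment> \<open>The factor 8 comes from the mass term:
    \<open>8 / k * (lam / 4) = 2 * k\<close>.\<close>
  also have "\<dots> \<le> (8 / k) * (?Q + lam / 4 * ?P)"
  proof -
    have "(8 / k) * (?Q + lam / 4 * ?P) = 8 * (1 / k) * ?Q + 2 * k * ?P"
      using k by (simp add: field_simps)
    moreover have "(1 / k) * ?Q \<le> 8 * (1 / k) * ?Q" using k PQ by (simp add: divide_right_mono)
    ultimately show ?thesis by linarith
  qed
  also have "\<dots> \<le> (8 / k) * gint H" using K k by (intro mult_left_mono) auto
  finally show ?thesis by (simp add: k_def)
qed

text \<open>\<open>weighted_identity\<close> with the lower bound \<open>V\<close> inserted. The
  error \<open>H\<close> pays for the region where the effective potential is too small or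
  negative.\<close>

lemma energy_bound:
  assumes \<eta>: "gweight C \<eta> \<eta>'" and H: "gintble H"
    and V: "\<And>e. e \<in> edges G \<Longrightarrow> AE t in edge_measure e. lam / 4 * (on_edge G u e t * on_edge G \<eta> e t)\<^sup>2 - H e t
       \<le> (pot e t - nonlin e t) * (on_edge G u e t * on_edge G \<eta> e t)\<^sup>2 - (on_edge G u e t)\<^sup>2 * (\<eta>' e t)\<^sup>2"
  shows "gint (\<lambda>e t. (du e t * on_edge G \<eta> e t + on_edge G u e t * \<eta>' e t)\<^sup>2)
       + lam / 4 * gint (\<lambda>e t. (on_edge G (\<lambda>x. u x * \<eta> x) e t)\<^sup>2) \<le> gint H"
proof -
  have pair: "gpair (\<lambda>x. u x * \<eta> x) (\<lambda>e t. du e t * on_edge G \<eta> e t + on_edge G u e t * \<eta>' e t)"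
    by (rule gpair_mult_gweight[OF gpair_u \<eta>])
  define Q where "Q e t = (du e t * on_edge G \<eta> e t + on_edge G u e t * \<eta>' e t)\<^sup>2" for e t
  define P where "P e t = (on_edge G (\<lambda>x. u x * \<eta> x) e t)\<^sup>2" for e t
  define N where "N e t = (on_edge G u e t)\<^sup>2 * (\<eta>' e t)\<^sup>2" for e t
  have P_alt: "P e t = (on_edge G u e t * on_edge G \<eta> e t)\<^sup>2" for e t by (simp add: P_def on_edge_def)
  have iQ: "gintble Q" and iP: "gintble P"
    unfolding Q_def P_def using gintble_coeff(1,2)[OF pair pair] by (auto simp: power2_eq_square)
  have iN: "gintble N"
  proof -
    have "(\<lambda>t. on_edge G u e t * \<eta>' e t) \<in> L2_on (edge_int G e)" if e: "e \<in> edges G" for e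
      by (rule L2_on_bounded_mult[OF _ u_edge(1)[OF e] gweight_measurable(2)[OF \<eta> e], where C=C])
        (use gweight_bound(2)[OF \<eta> e] in auto)
    from gintble_L2[OF this this] show ?thesis unfolding N_def by (simp add: power2_eq_square mult_ac)
  qed
  have iV: "gintble (\<lambda>e t. (pot e t - nonlin e t) * P e t)"
    using gintble_diff[OF gintble_coeff(3)[OF pair pair] gintble_coeff(4)[OF pair pair]]
    unfolding P_def by (simp add: power2_eq_square left_diff_distrib)
  have id: "gint (\<lambda>e t. Q e t + ((pot e t - nonlin e t) * P e t - N e t)) = 0"
    using weighted_identity[OF \<eta>] unfolding Q_def N_def P_alt force_alt
    by (simp add: power2_eq_square algebra_simps)
  have "gint (\<lambda>e t. lam / 4 * P e t - H e t) \<le> gint (\<lambda>e t. (pot e t - nonlin e t) * P e t - N e t)"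
    by (intro gint_mono_AE gintble_diff gintble_cmult iP H iV iN) (use V in \<open>simp add: P_alt N_def\<close>)
  then have "lam / 4 * gint P - gint H \<le> gint (\<lambda>e t. (pot e t - nonlin e t) * P e t - N e t)"
    using gint_diff[OF gintble_cmult[OF iP, of "lam / 4"] H] gint_cmult[of "lam / 4" P] by linarith
  moreover have "gint Q + gint (\<lambda>e t. (pot e t - nonlin e t) * P e t - N e t) = 0"
    using id gint_add[OF iQ gintble_diff[OF iV iN]] by simp
  ultimately have "gint Q + lam / 4 * gint P \<le> gint H" by linarith
  then show ?thesis unfolding Q_def P_def .
qed

text \<open>With weight one and no error the energy is nonpositive, because the nonlinear
  coefficient takes at most half of the potential. The contrapositive provides a high point of every
  nontrivial solution.\<close>

lemma small_imp_zero:
  assumes lam: "lam > 0" "Wb \<le> lam / 4" and len: "\<And>e. e \<in> edges G \<Longrightarrow> ereal (2 / sqrt lam) < len G e"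
    and small: "\<And>x. x \<in> points G \<Longrightarrow> b * \<bar>u x\<bar> powr (p - 2) \<le> lam / 2"
  shows "u = (\<lambda>x. 0)"
proof
  fix x
  show "u x = 0"
  proof (cases "x \<in> points G")
    case True
    have \<eta>: "gweight \<bar>1\<bar> (\<lambda>x. 1) (\<lambda>e t. 0)" by (rule gweight_const)
    have H: "gintble (\<lambda>e t. 0)" by (simp add: gintble_def)
    have "gint (\<lambda>e t. (du e t * on_edge G (\<lambda>x. 1) e t + on_edge G u e t * 0)\<^sup>2)
       + lam / 4 * gint (\<lambda>e t. (on_edge G (\<lambda>x. u x * 1) e t)\<^sup>2) \<le> gint (\<lambda>e t. 0)"
    proof (rule energy_bound[OF \<eta> H])
      fix e assume e: "e \<in> edges G"
      have "AE t in edge_measure e. t \<in> edge_int G e" by (rule AE_I2) simp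
      then show "AE t in edge_measure e. lam / 4 * (on_edge G u e t * on_edge G (\<lambda>x. 1) e t)\<^sup>2 - 0
        \<le> (pot e t - nonlin e t) * (on_edge G u e t * on_edge G (\<lambda>x. 1) e t)\<^sup>2 - (on_edge G u e t)\<^sup>2 * 0\<^sup>2"
        using pot_AE[OF e] nonlin_AE[OF e]
      proof eventually_elim
        case (elim t)
        have "nonlin e t \<le> lam / 2" using small[OF pt_int_points[OF e elim(1)]] elim by (simp add: on_edge_def)
        then have "lam / 4 \<le> pot e t - nonlin e t" using elim lam by linarith
        then have "lam / 4 * (on_edge G u e t)\<^sup>2 \<le> (pot e t - nonlin e t) * (on_edge G u e t)\<^sup>2" by (intro mult_right_mono) auto
        then show ?case by (simp add: on_edge_def)
      qed
    qed
    from energy_sup[OF \<eta> lam(1) len H this True] have "(u x)\<^sup>2 \<le> 0" by (simp add: gint_def)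
    then show ?thesis by simp
  qed (rule u_out)
qed

text \<open>With weight one the entire nonlinear term is moved into the error. Applied at a high
  point, it bounds the integral of \<open>\<bar>u\<bar> powr p\<close> from below.\<close>

lemma sup_le_Lp:
  assumes lam: "lam > 0" "Wb \<le> lam / 4" and len: "\<And>e. e \<in> edges G \<Longrightarrow> ereal (2 / sqrt lam) < len G e"
    and H: "gintble (\<lambda>e t. b * \<bar>on_edge G u e t\<bar> powr p)" and x: "x \<in> points G"
  shows "(u x)\<^sup>2 \<le> 8 * gint (\<lambda>e t. b * \<bar>on_edge G u e t\<bar> powr p) / sqrt lam"
proof -
  have \<eta>: "gweight \<bar>1\<bar> (\<lambda>x. 1) (\<lambda>e t. 0)" by (rule gweight_const)
  have "gint (\<lambda>e t. (du e t * on_edge G (\<lambda>x. 1) e t + on_edge G u e t * 0)\<^sup>2)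
     + lam / 4 * gint (\<lambda>e t. (on_edge G (\<lambda>x. u x * 1) e t)\<^sup>2) \<le> gint (\<lambda>e t. b * \<bar>on_edge G u e t\<bar> powr p)"
  proof (rule energy_bound[OF \<eta> H])
    fix e assume e: "e \<in> edges G"
    show "AE t in edge_measure e. lam / 4 * (on_edge G u e t * on_edge G (\<lambda>x. 1) e t)\<^sup>2 - b * \<bar>on_edge G u e t\<bar> powr p
      \<le> (pot e t - nonlin e t) * (on_edge G u e t * on_edge G (\<lambda>x. 1) e t)\<^sup>2 - (on_edge G u e t)\<^sup>2 * 0\<^sup>2"
      using pot_AE[OF e] nonlin_AE[OF e]
    proof eventually_elim
      case (elim t)
      let ?u = "on_edge G u e t"
      have "lam / 4 * ?u\<^sup>2 \<le> pot e t * ?u\<^sup>2" using elim lam by (intro mult_right_mono) auto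
      moreover have "nonlin e t * ?u\<^sup>2 \<le> b * \<bar>?u\<bar> powr p"
      proof -
        have e1: "\<bar>?u\<bar> powr p = \<bar>?u\<bar> powr (p - 2) * \<bar>?u\<bar> powr 2"
          using powr_add[of "\<bar>?u\<bar>" "p - 2" 2] by (simp only: diff_add_cancel)
        have e2: "\<bar>?u\<bar> powr 2 = ?u\<^sup>2" by (cases "?u = 0") (simp_all add: powr_numeral)
        have e: "\<bar>?u\<bar> powr p = \<bar>?u\<bar> powr (p - 2) * ?u\<^sup>2" using e1 unfolding e2 .
        have "nonlin e t * ?u\<^sup>2 \<le> (b * \<bar>?u\<bar> powr (p - 2)) * ?u\<^sup>2"
          using elim by (intro mult_right_mono) auto
        also have "\<dots> = b * \<bar>?u\<bar> powr p" unfolding e by simp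
        finally show ?thesis .
      qed
      ultimately show ?case by (simp add: on_edge_def left_diff_distrib)
    qed
  qed
  from energy_sup[OF \<eta> lam(1) len H this x] show ?thesis by simp
qed

text \<open>By \<open>weighted_identity\<close> the form at \<open>u \<eta>\<close> equals the
  integral of \<open>u\<^sup>2 \<eta>'\<^sup>2\<close> minus \<open>p - 2\<close> times that of
  \<open>nonlin (u \<eta>)\<^sup>2\<close>. Were it nonnegative, gradient and potential energy of
  \<open>u \<eta>\<close> together would be at most \<open>k\<close> times the integral of
  \<open>u\<^sup>2 \<eta>'\<^sup>2\<close>. The slow rate of the cut-off lets the potential absorb
  this, except for a truncation error of order \<open>c\<^sup>2\<close>; then
  \<open>energy_sup\<close> makes \<open>u \<eta>\<close> too small at the centre.\<close>

lemma negative_direction: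
  fixes c M \<delta> :: real
  defines "k \<equiv> (p - 1) / (p - 2)"
  defines "\<alpha> \<equiv> 1 / (4 * sqrt k)"
  assumes lam: "lam > 0" "Wb \<le> lam / 4" and len: "\<And>e. e \<in> edges G \<Longrightarrow> ereal (2 / sqrt lam) < len G e"
    and M: "\<And>y. y \<in> points G \<Longrightarrow> \<bar>u y\<bar> \<le> M" and x: "x \<in> points G" and \<delta>: "\<delta> \<le> \<bar>u x\<bar>" "0 < \<delta>"
    and c: "0 < c" "c \<le> 1 / 2" "24 * real (card (edges G)) * c\<^sup>2 * M\<^sup>2 / \<alpha> < \<delta>\<^sup>2 / 16"
  shows "gint (qform (\<lambda>y. u y * cut x (\<alpha> * sqrt lam) c y)
    (\<lambda>e t. du e t * on_edge G (cut x (\<alpha> * sqrt lam) c) e t + on_edge G u e t * cut_deriv x (\<alpha> * sqrt lam) c e t)) < 0"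
proof (rule ccontr)
  have k: "k > 0" "1 + 1 / (p - 2) = k" using p2 by (auto simp: k_def field_simps)
  \<comment> \<open>The rate is fixed by \<open>8 * k * \<alpha>\<^sup>2 = 1 / 2\<close>: the
    derivative of the weight then costs \<open>lam / 2\<close>, out of the
    \<open>3 * lam / 4\<close> that the potential offers.\<close>
  have \<alpha>: "\<alpha> > 0" and \<alpha>2: "8 * k * \<alpha>\<^sup>2 = 1 / 2" using k(1) by (auto simp: \<alpha>_def power_divide power_mult_distrib)
  define s where "s = \<alpha> * sqrt lam"
  have s: "s > 0" "s\<^sup>2 = \<alpha>\<^sup>2 * lam" using \<alpha> lam by (auto simp: s_def power_mult_distrib)
  define \<eta> where "\<eta> = cut x s c"
  define \<eta>' where "\<eta>' = cut_deriv x s c"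
  obtain C where \<eta>: "gweight C \<eta> \<eta>'" unfolding \<eta>_def \<eta>'_def using cut_weight[OF x s(1)] c(1) by (metis less_imp_le)
  let ?\<phi> = "\<lambda>y. u y * \<eta> y" and ?\<phi>' = "\<lambda>e t. du e t * on_edge G \<eta> e t + on_edge G u e t * \<eta>' e t"
  assume "\<not> ?thesis"
  then have ge: "0 \<le> gint (qform ?\<phi> ?\<phi>')" by (simp add: s_def \<eta>_def \<eta>'_def)
  have pair: "gpair ?\<phi> ?\<phi>'" by (rule gpair_mult_gweight[OF gpair_u \<eta>])
  define Q where "Q e t = (?\<phi>' e t)\<^sup>2" for e t
  define P where "P e t = (on_edge G ?\<phi> e t)\<^sup>2" for e t
  define N where "N e t = (on_edge G u e t)\<^sup>2 * (\<eta>' e t)\<^sup>2" for e t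
  define E where "E e t = exp (- s * gdist G x (pt G e t))" for e t
  have P_alt: "P e t = (on_edge G u e t * on_edge G \<eta> e t)\<^sup>2" for e t by (simp add: P_def on_edge_def)
  have iQ: "gintble Q" and iP: "gintble P"
    unfolding Q_def P_def using gintble_coeff(1,2)[OF pair pair] by (auto simp: power2_eq_square)
  have iN: "gintble N"
  proof -
    have "(\<lambda>t. on_edge G u e t * \<eta>' e t) \<in> L2_on (edge_int G e)" if e: "e \<in> edges G" for e
      by (rule L2_on_bounded_mult[OF _ u_edge(1)[OF e] gweight_measurable(2)[OF \<eta> e], where C=C])
        (use gweight_bound(2)[OF \<eta> e] in auto)
    from gintble_L2[OF this this] show ?thesis unfolding N_def by (simp add: power2_eq_square mult_ac)
  qed
  have ip: "gintble (\<lambda>e t. pot e t * P e t)" and inl: "gintble (\<lambda>e t. nonlin e t * P e t)"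
    using gintble_coeff(3,4)[OF pair pair] unfolding P_def by (simp_all add: power2_eq_square)
  have "gint (\<lambda>e t. Q e t + (pot e t * P e t - nonlin e t * P e t - N e t)) = 0"
    using weighted_identity[OF \<eta>] unfolding Q_def N_def P_alt force_alt
    by (simp add: power2_eq_square algebra_simps)
  then have id: "gint Q + (gint (\<lambda>e t. pot e t * P e t) - gint (\<lambda>e t. nonlin e t * P e t) - gint N) = 0"
    using gint_add[OF iQ gintble_diff[OF gintble_diff[OF ip inl] iN]] gint_diff[OF gintble_diff[OF ip inl] iN] gint_diff[OF ip inl]
    by simp
  have "gint (qform ?\<phi> ?\<phi>') = gint (\<lambda>e t. Q e t + pot e t * P e t - (p - 1) * (nonlin e t * P e t))"
    by (simp add: qform_def[abs_def] Q_def P_def)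
  also have "\<dots> = gint Q + gint (\<lambda>e t. pot e t * P e t) - (p - 1) * gint (\<lambda>e t. nonlin e t * P e t)"
    using gint_diff[OF gintble_add[OF iQ ip] gintble_cmult[OF inl, of "p - 1"]] gint_add[OF iQ ip] by (simp add: gint_cmult)
  finally have "(p - 2) * gint (\<lambda>e t. nonlin e t * P e t) \<le> gint N" using ge id by (simp add: algebra_simps)
  then have "gint (\<lambda>e t. nonlin e t * P e t) \<le> 1 / (p - 2) * gint N" using p2 by (simp add: field_simps)
  then have QN: "gint Q + gint (\<lambda>e t. pot e t * P e t) \<le> k * gint N"
    using id unfolding k(2)[symmetric] by (simp add: distrib_right)
  have iE: "gintble E" unfolding gintble_def E_def using edge_exp_integral(1)[OF x _ s(1)] by blast
  have gE: "gint E \<le> real (card (edges G)) * (6 / s)"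
    unfolding gint_def E_def using edge_exp_integral(2)[OF x _ s(1)] by (intro sum_bounded_above) blast
  have M0: "0 \<le> M" using M[OF x] by (meson abs_ge_zero order_trans)
  have Nb: "k * N e t \<le> lam / 2 * P e t + lam / 2 * c\<^sup>2 * M\<^sup>2 * E e t" if e: "e \<in> edges G" and t: "t \<in> edge_int G e" for e t
  proof -
    define w where "w = max 0 (E e t - c)"
    have E1: "0 < E e t" "E e t \<le> 1" unfolding E_def using exp_dist_le_1[OF s(1)] by auto
    have w: "0 \<le> w" "w \<le> E e t" "w \<le> 1" "w * E e t \<le> w * (w + c)"
    proof -
      show "0 \<le> w" "w \<le> E e t" "w \<le> 1" using E1 c by (auto simp: w_def)
      show "w * E e t \<le> w * (w + c)" by (intro mult_left_mono) (auto simp: w_def)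
    qed
    have w2: "w\<^sup>2 \<le> E e t"
    proof -
      have "w * w \<le> E e t * 1" using w E1 by (intro mult_mono) auto
      then show ?thesis by (simp add: power2_eq_square)
    qed
    have on: "on_edge G \<eta> e t = w\<^sup>2" by (simp add: on_edge_def \<eta>_def cut_def w_def E_def)
    have "\<bar>\<eta>' e t\<bar> \<le> 2 * s * (w * E e t)"
      using cut_deriv_bound(1)[OF x s(1) _ e t, of c] c by (simp add: \<eta>'_def w_def E_def)
    also have "\<dots> \<le> 2 * s * (w * (w + c))" by (intro mult_left_mono w(4)) (use s in auto)
    finally have "\<bar>\<eta>' e t\<bar>\<^sup>2 \<le> (2 * s * (w * (w + c)))\<^sup>2" by (intro power_mono) auto
    also have "\<dots> = 4 * s\<^sup>2 * w\<^sup>2 * (w + c)\<^sup>2" by (simp add: power_mult_distrib)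
    \<comment> \<open>Splitting \<open>w + c\<close> separates a term comparable with the square of
      the weight \<open>w\<^sup>2\<close> from an error of order \<open>c\<^sup>2\<close>.\<close>
    also have "\<dots> \<le> 4 * s\<^sup>2 * w\<^sup>2 * (2 * (w\<^sup>2 + c\<^sup>2))"
      using sum_squares_bound[of w c] by (intro mult_left_mono) (auto simp: power2_sum)
    also have "\<dots> = 8 * s\<^sup>2 * ((w\<^sup>2)\<^sup>2 + c\<^sup>2 * w\<^sup>2)" by (simp add: power2_eq_square algebra_simps)
    also have "\<dots> \<le> 8 * s\<^sup>2 * ((w\<^sup>2)\<^sup>2 + c\<^sup>2 * E e t)" using w2 by (intro mult_left_mono add_left_mono) auto
    finally have \<eta>2: "(\<eta>' e t)\<^sup>2 \<le> 8 * s\<^sup>2 * ((w\<^sup>2)\<^sup>2 + c\<^sup>2 * E e t)" by simp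
    have u2: "(on_edge G u e t)\<^sup>2 \<le> M\<^sup>2"
      using M[OF pt_int_points[OF e t]] M0 by (simp add: on_edge_def abs_le_square_iff[symmetric])
    have "k * N e t \<le> k * ((on_edge G u e t)\<^sup>2 * (8 * s\<^sup>2 * ((w\<^sup>2)\<^sup>2 + c\<^sup>2 * E e t)))"
      unfolding N_def using \<eta>2 k by (intro mult_left_mono) auto
    also have "\<dots> = (8 * k * \<alpha>\<^sup>2) * lam * ((on_edge G u e t)\<^sup>2 * (w\<^sup>2)\<^sup>2) + (8 * k * \<alpha>\<^sup>2) * lam * c\<^sup>2 * E e t * (on_edge G u e t)\<^sup>2"
      unfolding s(2) by (simp add: algebra_simps)
    also have "\<dots> = lam / 2 * P e t + lam / 2 * c\<^sup>2 * E e t * (on_edge G u e t)\<^sup>2"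
      unfolding \<alpha>2 P_alt on by (simp add: power_mult_distrib)
    also have "\<dots> \<le> lam / 2 * P e t + lam / 2 * c\<^sup>2 * E e t * M\<^sup>2"
      using u2 lam E1 by (intro add_left_mono mult_left_mono) auto
    finally show ?thesis by (simp add: mult_ac)
  qed
  define H where "H e t = lam / 2 * c\<^sup>2 * M\<^sup>2 * E e t" for e t
  have iH: "gintble H" unfolding H_def by (rule gintble_cmult[OF iE])
  have QPH: "gint Q + lam / 4 * gint P \<le> gint H"
  proof -
    have "gint (\<lambda>e t. k * N e t) \<le> gint (\<lambda>e t. lam / 2 * P e t + H e t)"
      using Nb by (intro gint_mono_AE gintble_cmult gintble_add iN iP iH) (auto simp: H_def)
    then have 1: "k * gint N \<le> lam / 2 * gint P + gint H"
      using gint_add[OF gintble_cmult[OF iP, of "lam / 2"] iH] gint_cmult[of "lam / 2" P] gint_cmult[of k N] by linarith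
    have "gint (\<lambda>e t. 3 * lam / 4 * P e t) \<le> gint (\<lambda>e t. pot e t * P e t)"
    proof (rule gint_mono_AE[OF gintble_cmult[OF iP] ip])
      fix e assume "e \<in> edges G"
      from pot_AE[OF this] show "AE t in edge_measure e. 3 * lam / 4 * P e t \<le> pot e t * P e t"
      proof eventually_elim
        case (elim t)
        then have "3 * lam / 4 \<le> pot e t" using lam by linarith
        then show ?case by (intro mult_right_mono) (simp_all add: P_def)
      qed
    qed
    then have 2: "3 * lam / 4 * gint P \<le> gint (\<lambda>e t. pot e t * P e t)" using gint_cmult[of "3 * lam / 4" P] by linarith
    have "3 * lam / 4 * gint P = lam / 4 * gint P + lam / 2 * gint P" by (simp add: field_simps)
    then show ?thesis using 1 2 QN by linarith
  qed
  have "(u x * \<eta> x)\<^sup>2 \<le> 8 * gint H / sqrt lam"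
    by (rule energy_sup[OF \<eta> lam(1) len iH QPH[unfolded Q_def[abs_def] P_def[abs_def]] x])
  also have "\<dots> \<le> 24 * real (card (edges G)) * c\<^sup>2 * M\<^sup>2 / \<alpha>"
  proof -
    have "gint H = lam / 2 * c\<^sup>2 * M\<^sup>2 * gint E" unfolding H_def by (rule gint_cmult)
    also have "\<dots> \<le> lam / 2 * c\<^sup>2 * M\<^sup>2 * (real (card (edges G)) * (6 / s))"
      using gE lam by (intro mult_left_mono) auto
    finally have "8 * gint H / sqrt lam \<le> 8 * (lam / 2 * c\<^sup>2 * M\<^sup>2 * (real (card (edges G)) * (6 / s))) / sqrt lam"
      using lam by (intro divide_right_mono) auto
    also have "\<dots> = 24 * real (card (edges G)) * c\<^sup>2 * M\<^sup>2 / \<alpha>"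
    proof -
      define q where "q = sqrt lam"
      have q: "q > 0" "lam = q * q" using lam by (auto simp: q_def)
      show ?thesis unfolding s_def q_def[symmetric] using q(1) \<alpha> by (simp add: q(2))
    qed
    finally show ?thesis .
  qed
  also have "\<dots> < \<delta>\<^sup>2 / 16" by (rule c(3))
  finally have lt: "(u x * \<eta> x)\<^sup>2 < \<delta>\<^sup>2 / 16" .
  \<comment> \<open>At its centre the cut-off is at least 1/4; the 16 in the hypothesis on
    \<open>c\<close> is the square of this.\<close>
  have "\<eta> x = (1 - c)\<^sup>2" using x c by (simp add: \<eta>_def cut_def)
  moreover have "(1/2)\<^sup>2 \<le> (1 - c)\<^sup>2" using c by (intro power_mono) auto
  ultimately have "1 / 4 \<le> \<eta> x" by (simp add: power2_eq_square)
  then have "\<delta> * (1 / 4) \<le> \<bar>u x\<bar> * \<eta> x" using \<delta> by (intro mult_mono) auto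
  then have "(\<delta> * (1 / 4))\<^sup>2 \<le> (\<bar>u x\<bar> * \<eta> x)\<^sup>2" using \<delta> by (intro power_mono) auto
  then show False using lt by (simp add: power_mult_distrib power_divide)
qed

text \<open>The test function \<open>((u - k)\<^sub>+)\<^sup>2 - ((- u - k)\<^sub>+)\<^sup>2\<close>, squared in order to be \<open>C\<^sup>1\<close> in \<open>u\<close>, vanishes off the
  edges where \<open>\<rho> = 0\<close>.\<close>

lemma maximum_principle:
  assumes lam: "Wb < lam" and k: "0 \<le> k"
    and e0: "\<And>e. e \<in> edges G \<Longrightarrow> AE_edge G e (\<lambda>x. \<rho> x = 0) \<or> (\<forall>t\<in>edge_int G e. \<bar>u (pt G e t)\<bar> \<le> k)"
    and x: "x \<in> points G"
  shows "\<bar>u x\<bar> \<le> k"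
proof -
  obtain M where M: "M > 0" "\<And>x. x \<in> points G \<Longrightarrow> \<bar>u x\<bar> \<le> M" using u_bounded by blast
  define h where "h y = (max 0 (y - k))\<^sup>2 - (max 0 (- y - k))\<^sup>2" for y :: real
  define h' where "h' y = 2 * max 0 (y - k) + 2 * max 0 (- y - k)" for y :: real
  have hd: "(h has_real_derivative h' y) (at y)" for y
  proof -
    have s1: "((\<lambda>z. z - k) has_real_derivative 1) (at y)" and s2: "((\<lambda>z. - z - k) has_real_derivative -1) (at y)"
      by (auto intro!: derivative_eq_intros)
    have 1: "((\<lambda>z. (max 0 (z - k))\<^sup>2 / 2) has_real_derivative max 0 (y - k)) (at y)"
      using DERIV_chain2[OF has_derivative_sqr_pos_part s1] by simp
    have 2: "((\<lambda>z. (max 0 (- z - k))\<^sup>2 / 2) has_real_derivative max 0 (- y - k) * -1) (at y)"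
      by (rule DERIV_chain2[OF has_derivative_sqr_pos_part s2])
    have "((\<lambda>z. 2 * ((max 0 (z - k))\<^sup>2 / 2) - 2 * ((max 0 (- z - k))\<^sup>2 / 2)) has_real_derivative
       2 * max 0 (y - k) - 2 * (max 0 (- y - k) * -1)) (at y)"
      by (intro DERIV_diff DERIV_cmult 1 2)
    then show ?thesis by (simp add: h_def[abs_def] h'_def)
  qed
  have h'b: "0 \<le> h' y" for y by (simp add: h'_def)
  have pair: "gpair (\<lambda>x. h (u x)) (\<lambda>e t. du e t * h' (on_edge G u e t))"
  proof (rule gpair_compose[OF gpair_u M(2) hd])
    show "h 0 = 0" using k by (simp add: h_def)
    show "\<bar>h' y\<bar> \<le> 4 * M" if "\<bar>y\<bar> \<le> M" for y
    proof -
      have "max 0 (y - k) \<le> M" "max 0 (- y - k) \<le> M" using that k M(1) by auto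
      moreover have "2 * A + 2 * B \<le> 4 * M" if "A \<le> M" "B \<le> M" for A B :: real using that by linarith
      ultimately have "h' y \<le> 4 * M" unfolding h'_def by blast
      then show ?thesis using h'b[of y] by simp
    qed
    show "continuous_on {-M..M} h'" unfolding h'_def by (intro continuous_intros)
  qed
  have uh: "0 \<le> y * h y" for y
  proof (cases "y \<ge> 0")
    case True
    then have "max 0 (- y - k) = 0" using k by simp
    then show ?thesis using True by (simp add: h_def)
  next
    case False
    then have "max 0 (y - k) = 0" using k by simp
    then show ?thesis using False by (simp add: h_def mult_nonpos_nonneg)
  qed
  have small: "h y = 0" if "\<bar>y\<bar> \<le> k" for y
  proof -
    have "max 0 (y - k) = 0" "max 0 (- y - k) = 0" using that by auto
    then show ?thesis by (simp add: h_def)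
  qed
  define F where "F e t = on_edge G u e t * on_edge G (\<lambda>x. h (u x)) e t" for e t
  have F0: "0 \<le> F e t" for e t using uh by (simp add: F_def on_edge_def)
  have iF: "gintble F" unfolding F_def by (rule gintble_coeff(2)[OF gpair_u pair])
  have "gint (\<lambda>e t. (lam - Wb) * F e t) \<le> gint (\<lambda>e t. du e t * (du e t * h' (on_edge G u e t)) + force e t * on_edge G (\<lambda>x. h (u x)) e t)"
  proof (rule gint_mono_AE)
    show "gintble (\<lambda>e t. (lam - Wb) * F e t)" by (rule gintble_cmult[OF iF])
    show "gintble (\<lambda>e t. du e t * (du e t * h' (on_edge G u e t)) + force e t * on_edge G (\<lambda>x. h (u x)) e t)"
      by (intro gintble_add gintble_test[OF pair])
    fix e assume e: "e \<in> edges G"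
    have "AE t in edge_measure e. nonlin e t = 0 \<or> on_edge G (\<lambda>x. h (u x)) e t = 0"
      using e0[OF e]
    proof
      assume "AE_edge G e (\<lambda>x. \<rho> x = 0)"
      then show ?thesis unfolding AE_edge_iff
        by (rule eventually_mono) (simp add: nonlin_def on_edge_def)
    next
      assume "\<forall>t\<in>edge_int G e. \<bar>u (pt G e t)\<bar> \<le> k"
      then show ?thesis using small by (intro AE_I2) (simp add: on_edge_def)
    qed
    then show "AE t in edge_measure e. (lam - Wb) * F e t \<le> du e t * (du e t * h' (on_edge G u e t)) + force e t * on_edge G (\<lambda>x. h (u x)) e t"
      using pot_AE[OF e]
    proof eventually_elim
      case (elim t)
      have "force e t * on_edge G (\<lambda>x. h (u x)) e t = (pot e t - nonlin e t) * F e t" by (simp add: force_alt F_def)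
      also have "\<dots> = pot e t * F e t" using elim(1) by (auto simp: F_def)
      also have "\<dots> \<ge> (lam - Wb) * F e t" using elim F0 by (intro mult_right_mono) auto
      finally have "(lam - Wb) * F e t \<le> force e t * on_edge G (\<lambda>x. h (u x)) e t" .
      moreover have "0 \<le> du e t * (du e t * h' (on_edge G u e t))"
        using h'b by (simp add: mult.assoc[symmetric])
      ultimately show ?case by linarith
    qed
  qed
  then have "(lam - Wb) * gint F \<le> 0" using weak_eq[OF pair] by (simp add: gint_cmult)
  then have gF: "gint F \<le> 0" using lam by (simp add: mult_le_0_iff)
  have zero: "F e t = 0" if e: "e \<in> edges G" and t: "t \<in> edge_int G e" for e t
  proof -
    have i: "integrable (edge_measure e) (F e)" using iF e by (simp add: gintble_def)
    have "integral\<^sup>L (edge_measure e) (F e) \<le> 0"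
      using edge_integral_le_gint[OF e, of F] F0 gF by simp
    moreover have "0 \<le> integral\<^sup>L (edge_measure e) (F e)" using F0 by simp
    ultimately have "integral\<^sup>L (edge_measure e) (F e) = 0" by simp
    then have ae: "AE t in edge_measure e. F e t = 0"
      using integral_nonneg_eq_0_iff_AE[OF i] F0 by simp
    have "continuous_on (edge_int G e) (F e)"
      unfolding F_def using continuous_on_edge_int[OF u_cont e] continuous_on_edge_int[OF _ e, of "\<lambda>x. h (u x)"] pair
      by (intro continuous_intros) (auto simp: gpair_def)
    from continuous_AE_zero[OF edge_int_open this ae t] show ?thesis .
  qed
  have "\<bar>u (pt G e t)\<bar> \<le> k" if "e \<in> edges G" "t \<in> edge_int G e" for e t
  proof -
    let ?y = "u (pt G e t)"
    have z: "?y * h ?y = 0" using zero[OF that] by (simp add: F_def on_edge_def)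
    show ?thesis
    proof (rule ccontr)
      assume "\<not> \<bar>?y\<bar> \<le> k"
      then consider "?y > k" | "?y < - k" using k by linarith
      then show False
      proof cases
        case 1
        then have "h ?y = (?y - k)\<^sup>2" using k by (simp add: h_def)
        then show False using z 1 k by simp
      next
        case 2
        then have "max 0 (?y - k) = 0" "max 0 (- ?y - k) = - ?y - k" using k by auto
        then have "h ?y = - (- ?y - k)\<^sup>2" by (simp add: h_def)
        then show False using z 2 k by simp
      qed
    qed
  qed
  then show ?thesis using edge_bound_closure[OF u_cont] x by (metis point_on_edge)
qed

end

section \<open>The uniform bound\<close>

text \<open>Coefficient bounds hold almost everywhere, whereas increments of \<open>du\<close> are
  given by \<open>has_integral\<close>; this carries bounds from the former to the latter.\<close>

lemma has_integral_le_AE: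
  fixes F :: "real \<Rightarrow> real"
  assumes F: "(F has_integral I) {x..y}" and ae: "AE r in lebesgue. r \<in> {x..y} \<longrightarrow> F r \<le> C" and xy: "x \<le> y"
  shows "I \<le> C * (y - x)"
proof -
  obtain N where N: "N \<in> null_sets lebesgue" "{r. \<not> (r \<in> {x..y} \<longrightarrow> F r \<le> C)} \<subseteq> N"
    using ae by (auto simp: eventually_ae_filter)
  have neg: "negligible N" using N(1) by (simp add: negligible_iff_null_sets)
  have "((\<lambda>r. if r \<in> N then C else F r) has_integral I) {x..y}"
    by (rule has_integral_spike[OF neg _ F]) simp
  moreover have "((\<lambda>r. C) has_integral C * (y - x)) {x..y}"
    using has_integral_const_real[of C x y] xy by (simp add: mult.commute)
  ultimately show ?thesis
  proof (rule has_integral_le)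
    fix r assume "r \<in> {x..y}"
    then show "(if r \<in> N then C else F r) \<le> C" using N(2) by auto
  qed
qed

context graph_solution
begin

section \<open>Nodal pieces as negative directions\<close>

lemma edge_int_nonempty:
  assumes "e \<in> edges G" shows "edge_int G e \<noteq> {}"
  using assms by (cases rule: edge_cases) simp_all

lemma edge_AE_subinterval:
  assumes "AE r in edge_measure e. P r" "{x..y} \<subseteq> edge_int G e"
  shows "AE r in lebesgue. r \<in> {x..y} \<longrightarrow> P r"
proof -
  have "AE r in lebesgue. r \<in> edge_int G e \<longrightarrow> P r" using assms(1) by (subst AE_lebesgue_on) simp_all
  then show ?thesis by (rule eventually_mono) (use assms(2) in blast)
qed

text \<open>The derivative is an indefinite integral of the force, hence continuous and bounded on a
  compact part of the edge.\<close>

lemma du_continuous: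
  assumes e: "e \<in> edges G" and J: "{\<alpha>..\<beta>} \<subseteq> edge_int G e"
  obtains B where "\<And>t. t \<in> {\<alpha>..\<beta>} \<Longrightarrow> \<bar>du e t\<bar> \<le> B"
proof (cases "\<alpha> \<le> \<beta>")
  case True
  have a: "\<alpha> \<in> edge_int G e" "\<beta> \<in> edge_int G e" using J True by auto
  have fi: "force e integrable_on {\<alpha>..\<beta>}" using ode(2)[OF e a True] by blast
  have "continuous_on {\<alpha>..\<beta>} (\<lambda>t. integral {\<alpha>..t} (force e))" by (rule indefinite_integral_continuous_1[OF fi])
  then have "bounded ((\<lambda>t. integral {\<alpha>..t} (force e)) ` {\<alpha>..\<beta>})" by (intro compact_imp_bounded compact_continuous_image) auto
  then obtain D where D: "\<forall>t\<in>{\<alpha>..\<beta>}. \<bar>integral {\<alpha>..t} (force e)\<bar> \<le> D" by (auto simp: bounded_iff)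
  have "\<bar>du e t\<bar> \<le> D + \<bar>du e \<alpha>\<bar>" if t: "t \<in> {\<alpha>..\<beta>}" for t
  proof -
    have "t \<in> edge_int G e" using J t by blast
    then have "integral {\<alpha>..t} (force e) = du e t - du e \<alpha>" using ode(2)[OF e a(1)] t by (intro integral_unique) auto
    then show ?thesis using bspec[OF D t] by linarith
  qed
  then show ?thesis using that by blast
next
  case False
  then show ?thesis using that by auto
qed

text \<open>The hypotheses \<open>sq\<close> express that \<open>\<phi>\<close> is \<open>u\<close>
  cut off at zeros. Testing the equation with \<open>\<phi>\<close> itself equates gradient plus
  potential energy with the nonlinear term, so that the factor \<open>1 - (p - 1)\<close>
  remains.\<close>

lemma nodal_form:
  assumes \<phi>: "gpair \<phi> \<phi>'" "\<phi> \<in> Cc G"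
    and sq: "\<And>e t. e \<in> edges G \<Longrightarrow> t \<in> edge_int G e \<Longrightarrow> on_edge G u e t * on_edge G \<phi> e t = (on_edge G \<phi> e t)\<^sup>2"
      "\<And>e t. e \<in> edges G \<Longrightarrow> t \<in> edge_int G e \<Longrightarrow> du e t * \<phi>' e t = (\<phi>' e t)\<^sup>2"
  shows "gint (qform \<phi> \<phi>') = - (p - 2) * gint (\<lambda>e t. nonlin e t * (on_edge G \<phi> e t)\<^sup>2)"
proof -
  define D where "D e t = (\<phi>' e t)\<^sup>2 + pot e t * (on_edge G \<phi> e t)\<^sup>2" for e t
  define N where "N e t = nonlin e t * (on_edge G \<phi> e t)\<^sup>2" for e t
  have iD: "gintble D" and iN: "gintble N"
    unfolding D_def N_def power2_eq_square by (intro gintble_add gintble_coeff[OF \<phi>(1) \<phi>(1)])+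
  have "gint (\<lambda>e t. D e t - N e t) = gint (\<lambda>e t. du e t * \<phi>' e t + force e t * on_edge G \<phi> e t)"
  proof (rule gint_cong)
    fix e t assume et: "e \<in> edges G" "t \<in> edge_int G e"
    have "force e t * on_edge G \<phi> e t = (pot e t - nonlin e t) * (on_edge G u e t * on_edge G \<phi> e t)"
      by (simp add: force_alt mult_ac)
    then show "D e t - N e t = du e t * \<phi>' e t + force e t * on_edge G \<phi> e t"
      unfolding sq(1)[OF et] sq(2)[OF et] by (simp add: D_def N_def algebra_simps)
  qed
  then have "gint D = gint N" using weak_eq_Cc[OF \<phi>] gint_diff[OF iD iN] by simp
  moreover have "gint (qform \<phi> \<phi>') = gint D - (p - 1) * gint N"
    using gint_diff[OF iD gintble_cmult[OF iN, of "p - 1"]] gint_cmult[of "p - 1" N]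
    by (simp add: qform_def[abs_def] D_def N_def)
  ultimately show ?thesis unfolding N_def by (simp add: algebra_simps)
qed

text \<open>Cutting at two zeros of \<open>u\<close> keeps the function Lipschitz, hence admissible.
  Its form is negative because \<open>\<rho> \<ge> a > 0\<close> on the edge and \<open>u\<close>
  does not vanish identically between the zeros; further zeros in between are allowed.\<close>

lemma nodal_piece:
  fixes a \<alpha> \<beta> :: real
  defines "f \<equiv> \<lambda>e t. if \<alpha> \<le> t \<and> t \<le> \<beta> then on_edge G u e t else 0"
    and "f' \<equiv> \<lambda>e t. if \<alpha> < t \<and> t < \<beta> then du e t else 0"
  assumes e: "e \<in> edges G" and J: "{\<alpha>..\<beta>} \<subseteq> edge_int G e" and ab: "\<alpha> < \<beta>"
    and z: "on_edge G u e \<alpha> = 0" "on_edge G u e \<beta> = 0" and y: "y \<in> {\<alpha><..<\<beta>}" "on_edge G u e y \<noteq> 0"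
    and a: "a > 0" "AE_edge G e (\<lambda>x. a \<le> \<rho> x)"
  shows "gpair (edge_fun e (f e)) (\<lambda>e' t. if e' = e then f' e t else 0)"
    and "\<exists>x\<in>points G. \<exists>r. \<forall>y\<in>points G. edge_fun e (f e) y \<noteq> 0 \<longrightarrow> gdist G x y \<le> r"
    and "gint (qform (edge_fun e (f e)) (\<lambda>e' t. if e' = e then f' e t else 0)) < 0"
proof -
  let ?u = "on_edge G u e"
  obtain B where B: "\<And>t. t \<in> {\<alpha>..\<beta>} \<Longrightarrow> \<bar>du e t\<bar> \<le> B" using du_continuous[OF e J] by blast
  have B0: "0 \<le> B" using B[of \<alpha>] ab by (meson abs_ge_zero atLeastAtMost_iff less_imp_le order_refl order_trans)
  have der: "(?u has_real_derivative du e t) (at t)" if "t \<in> {\<alpha>..\<beta>}" for t using ode(1)[OF e] J that by blast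
  have lipu: "\<bar>?u x - ?u w\<bar> \<le> B * \<bar>x - w\<bar>" if "x \<in> {\<alpha>..\<beta>}" "w \<in> {\<alpha>..\<beta>}" for x w
  proof -
    have "norm (?u x - ?u w) \<le> B * norm (x - w)"
    proof (rule field_differentiable_bound[where S="{\<alpha>..\<beta>}" and f'="du e"])
      fix t assume "t \<in> {\<alpha>..\<beta>}"
      from der[OF this] show "(?u has_field_derivative du e t) (at t within {\<alpha>..\<beta>})" by (rule has_field_derivative_at_within)
      show "norm (du e t) \<le> B" using B \<open>t \<in> {\<alpha>..\<beta>}\<close> by simp
    qed (use that in auto)
    then show ?thesis by simp
  qed
  \<comment> \<open>As \<open>u\<close> vanishes at both ends, cutting it off equals freezing the
    argument at the ends, and clamping does not increase distances.\<close>
  define cl where "cl t = max \<alpha> (min \<beta> t)" for t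
  have cl: "cl t \<in> {\<alpha>..\<beta>}" for t using ab by (simp add: cl_def)
  have fcl: "f e t = ?u (cl t)" for t
    using ab z unfolding f_def cl_def by (cases "t < \<alpha>"; cases "t > \<beta>") (auto simp: max_def min_def)
  have lip: "\<bar>f e x - f e w\<bar> \<le> B * \<bar>x - w\<bar>" for x w
  proof -
    have "\<bar>cl x - cl w\<bar> \<le> \<bar>x - w\<bar>" unfolding cl_def by linarith
    then have "B * \<bar>cl x - cl w\<bar> \<le> B * \<bar>x - w\<bar>" using B0 by (rule mult_left_mono)
    then show ?thesis unfolding fcl using lipu[OF cl cl, of x w] by linarith
  qed
  have out: "f e t = 0" if "t \<notin> {\<alpha>..\<beta>}" for t using that by (auto simp: f_def)
  have out': "f' e t = 0" if "t \<notin> {\<alpha>..\<beta>}" for t using that by (auto simp: f'_def)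
  have fd: "(f e has_real_derivative f' e t) (at t)" if t: "t \<notin> {\<alpha>, \<beta>}" for t
  proof (cases "t \<in> {\<alpha><..<\<beta>}")
    case True
    have "(?u has_real_derivative f' e t) (at t)" using der[of t] True by (simp add: f'_def)
    then show ?thesis
      by (rule has_field_derivative_transform_within_open[where S="{\<alpha><..<\<beta>}"]) (use True in \<open>auto simp: f_def\<close>)
  next
    case False
    then have t': "t \<in> - {\<alpha>..\<beta>}" using t by auto
    have "((\<lambda>_. 0) has_real_derivative f' e t) (at t)" using False by (auto simp: f'_def)
    then show ?thesis
      by (rule has_field_derivative_transform_within_open[where S="- {\<alpha>..\<beta>}"]) (use t' out in auto)
  qed
  have f'b: "\<bar>f' e t\<bar> \<le> B" for t using B[of t] B0 by (simp add: f'_def)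
  have abl: "\<alpha> \<le> \<beta>" using ab by simp
  have fin: "finite {\<alpha>, \<beta>}" by simp
  note pieces = edge_fun_gpair[where f="f e" and f'="f' e" and S="{\<alpha>, \<beta>}" and B=B and K=B, OF e abl J out out' lip fin fd f'b]
  show pair: "gpair (edge_fun e (f e)) (\<lambda>e' t. if e' = e then f' e t else 0)" by (rule pieces(1))
  have cc: "edge_fun e (f e) \<in> Cc G" by (rule pieces(2))
  have aI: "\<alpha> \<in> edge_int G e" using J ab by auto
  show "\<exists>x\<in>points G. \<exists>r. \<forall>y\<in>points G. edge_fun e (f e) y \<noteq> 0 \<longrightarrow> gdist G x y \<le> r"
  proof (intro bexI[of _ "pt G e \<alpha>"] exI[of _ "\<beta> - \<alpha>"] ballI impI)
    fix y assume "y \<in> points G" "edge_fun e (f e) y \<noteq> 0"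
    then obtain t where t: "y = Inner e t" "t \<in> edge_int G e" "f e t \<noteq> 0"
      by (cases y) (auto simp: edge_fun_def split: if_splits)
    then have t2: "t \<in> {\<alpha>..\<beta>}" using out by blast
    show "gdist G (pt G e \<alpha>) y \<le> \<beta> - \<alpha>"
      using gdist_pt_le[OF e subsetD[OF edge_int_subset_dom aI] subsetD[OF edge_int_subset_dom t(2)]] t(1,2) t2
      by (simp add: pt_Inner)
  qed (rule pt_int_points[OF e aI])
  have on: "on_edge G (edge_fun e (f e)) e' t = (if e' = e then f e t else 0)" if "t \<in> edge_int G e'" for e' t
    by (rule on_edge_edge_fun[OF e J _ subsetD[OF edge_int_subset_dom that]]) (rule out)
  have form: "gint (qform (edge_fun e (f e)) (\<lambda>e' t. if e' = e then f' e t else 0))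
    = - (p - 2) * gint (\<lambda>e' t. nonlin e' t * (on_edge G (edge_fun e (f e)) e' t)\<^sup>2)"
  proof (rule nodal_form[OF pair cc])
    fix e' t assume t: "t \<in> edge_int G e'"
    show "on_edge G u e' t * on_edge G (edge_fun e (f e)) e' t = (on_edge G (edge_fun e (f e)) e' t)\<^sup>2"
      unfolding on[OF t] by (simp add: f_def power2_eq_square)
    show "du e' t * (if e' = e then f' e t else 0) = (if e' = e then f' e t else 0)\<^sup>2"
      by (simp add: f'_def power2_eq_square)
  qed
  define N where "N e' t = nonlin e' t * (on_edge G (edge_fun e (f e)) e' t)\<^sup>2" for e' t
  have iN: "gintble N" unfolding N_def power2_eq_square by (rule gintble_coeff(4)[OF pair pair])
  have N0: "AE t in edge_measure e'. 0 \<le> N e' t" if "e' \<in> edges G" for e'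
    using nonlin_AE[OF that] by eventually_elim (simp add: N_def)
  have "gint N > 0"
  proof (rule ccontr)
    assume "\<not> gint N > 0"
    moreover have pos: "0 \<le> integral\<^sup>L (edge_measure e') (N e')" if "e' \<in> edges G" for e'
      using N0[OF that] by (rule integral_nonneg_AE)
    moreover have "integral\<^sup>L (edge_measure e) (N e) \<le> gint N"
      unfolding gint_def using pos e finite_edges by (intro member_le_sum) auto
    ultimately have "integral\<^sup>L (edge_measure e) (N e) = 0" using pos[OF e] by linarith
    then have "AE t in edge_measure e. N e t = 0"
      using integral_nonneg_eq_0_iff_AE[of "edge_measure e" "N e"] N0[OF e] iN e by (simp add: gintble_def)
    moreover have "AE t in edge_measure e. a \<le> on_edge G \<rho> e t" using a(2) by (simp add: AE_edge_iff on_edge_def)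
    moreover have "AE t in edge_measure e. t \<in> edge_int G e" by (rule AE_I2) simp
    ultimately have ae: "AE t in edge_measure e. f e t = 0"
    proof eventually_elim
      case (elim t)
      then show ?case using on[of t e] a(1) by (auto simp: N_def nonlin_def f_def)
    qed
    have "continuous_on (edge_int G e) (f e)"
    proof (rule lipschitz_on_continuous_on[OF lipschitz_onI])
      show "dist (f e x) (f e w) \<le> B * dist x w" for x w unfolding dist_real_def by (rule lip)
    qed (rule B0)
    moreover have "y \<in> edge_int G e" using y(1) J by auto
    ultimately have "f e y = 0" using continuous_AE_zero[OF edge_int_open _ ae] by blast
    then show False using y by (simp add: f_def)
  qed
  then show "gint (qform (edge_fun e (f e)) (\<lambda>e' t. if e' = e then f' e t else 0)) < 0"
    unfolding form N_def[symmetric] using p2 by (simp add: mult_neg_pos)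
qed

end

text \<open>The direction \<open>\<sigma>\<close> is the one in which the edge leaves enough room around an almost maximal point.\<close>

lemma (in graph_solution) rescaled_osc_system:
  fixes \<mu> \<epsilon> a \<sigma> t0 X :: real
  defines "\<kappa> \<equiv> \<mu> powr ((p - 2) / 2)"
  assumes e: "e \<in> edges G" and \<mu>: "\<mu> > 0" "\<And>x. x \<in> points G \<Longrightarrow> \<bar>u x\<bar> \<le> \<mu>"
    and a: "a > 0" "AE_edge G e (\<lambda>x. a \<le> \<rho> x)" and \<epsilon>: "\<epsilon> \<le> 1" "lam + Wb \<le> \<epsilon> * \<mu> powr (p - 2)" and lam: "Wb \<le> lam"
    and \<sigma>: "\<sigma> \<in> {-1, 1}" and room: "\<And>y. y \<in> {0..X} \<Longrightarrow> t0 + \<sigma> * y / \<kappa> \<in> edge_int G e"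
  shows "osc_system a p (b + 1) \<epsilon> X (\<lambda>y. on_edge G u e (t0 + \<sigma> * y / \<kappa>) / \<mu>)
    (\<lambda>y. \<sigma> * du e (t0 + \<sigma> * y / \<kappa>) / (\<kappa> * \<mu>))"
proof -
  let ?u = "on_edge G u e"
  \<comment> \<open>The length unit \<open>1 / \<kappa>\<close> satisfies
    \<open>\<kappa>\<^sup>2 * \<mu> = \<mu> powr (p - 1)\<close>, which gives the rescaled nonlinear
    term size of order one and leaves the potential at most \<open>\<epsilon>\<close>.\<close>
  have \<kappa>: "\<kappa> > 0" using \<mu> by (simp add: \<kappa>_def)
  have \<kappa>2: "\<kappa> * \<kappa> = \<mu> powr (p - 2)" by (simp add: \<kappa>_def powr_add[symmetric])
  have \<mu>p: "\<mu> powr (p - 1) = \<mu> powr (p - 2) * \<mu>" using powr_add[of \<mu> "p - 2" 1] \<mu> by simp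
  define \<tau> where "\<tau> y = t0 + \<sigma> * y / \<kappa>" for y
  have ub: "\<bar>?u t\<bar> \<le> \<mu>" if "t \<in> edge_int G e" for t using \<mu>(2)[OF pt_int_points[OF e that]] by (simp add: on_edge_def)
  \<comment> \<open>For \<open>\<sigma> = -1\<close> the parametrisation runs backwards, so the
    integration interval is reversed and the sign \<open>\<sigma>\<close> turns the increment of
    \<open>du\<close> around as well.\<close>
  have inc: "\<exists>x w. x \<le> w \<and> {x..w} \<subseteq> \<tau> ` {s..t} \<and> {x..w} \<subseteq> edge_int G e \<and> w - x = (t - s) / \<kappa> \<and>
      (force e has_integral (\<sigma> * (du e (\<tau> t) - du e (\<tau> s)))) {x..w}" if st: "s \<in> {0..X}" "t \<in> {s..X}" for s t
  proof -
    have mem: "\<tau> s \<in> edge_int G e" "\<tau> t \<in> edge_int G e" using room[of s] room[of t] st unfolding \<tau>_def by auto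
    have le: "s / \<kappa> \<le> t / \<kappa>" using st \<kappa> by (simp add: divide_right_mono)
    have img: "{min (\<tau> s) (\<tau> t)..max (\<tau> s) (\<tau> t)} \<subseteq> \<tau> ` {s..t}"
    proof
      fix r assume r: "r \<in> {min (\<tau> s) (\<tau> t)..max (\<tau> s) (\<tau> t)}"
      define y where "y = \<sigma> * (r - t0) * \<kappa>"
      have "\<tau> y = r" using \<sigma> \<kappa> by (auto simp: \<tau>_def y_def)
      moreover have "s \<le> y \<and> y \<le> t"
      proof (cases "\<sigma> = 1")
        case True
        then have "s / \<kappa> \<le> r - t0" "r - t0 \<le> t / \<kappa>" using r le by (auto simp: \<tau>_def min_def max_def split: if_splits)
        then show ?thesis using \<kappa> True by (simp add: y_def pos_divide_le_eq pos_le_divide_eq)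
      next
        case False
        then have s1: "\<sigma> = -1" using \<sigma> by simp
        then have "s / \<kappa> \<le> t0 - r" "t0 - r \<le> t / \<kappa>" using r le by (auto simp: \<tau>_def min_def max_def split: if_splits)
        then have "s \<le> (t0 - r) * \<kappa>" "(t0 - r) * \<kappa> \<le> t" using \<kappa> by (simp_all add: pos_divide_le_eq pos_le_divide_eq)
        then show ?thesis using s1 by (simp add: y_def)
      qed
      ultimately show "r \<in> \<tau> ` {s..t}" by force
    qed
    have sub: "{min (\<tau> s) (\<tau> t)..max (\<tau> s) (\<tau> t)} \<subseteq> edge_int G e"
      by (rule interval_subset[OF edge_int_interval]) (use mem in \<open>auto simp: min_def max_def\<close>)
    show ?thesis
    proof (cases "\<sigma> = 1")
      case True
      then have o: "\<tau> s \<le> \<tau> t" "\<tau> t - \<tau> s = (t - s) / \<kappa>" using le by (auto simp: \<tau>_def diff_divide_distrib)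
      then show ?thesis using img sub ode(2)[OF e mem o(1)] True
        by (intro exI[of _ "\<tau> s"] exI[of _ "\<tau> t"]) (simp add: min_def max_def split: if_splits)
    next
      case False
      then have s1: "\<sigma> = -1" using \<sigma> by simp
      then have o: "\<tau> t \<le> \<tau> s" "\<tau> s - \<tau> t = (t - s) / \<kappa>" using le by (auto simp: \<tau>_def diff_divide_distrib)
      then have mm: "min (\<tau> s) (\<tau> t) = \<tau> t" "max (\<tau> s) (\<tau> t) = \<tau> s" by auto
      show ?thesis using img sub ode(2)[OF e mem(2,1) o(1)] s1 o unfolding mm
        by (intro exI[of _ "\<tau> t"] exI[of _ "\<tau> s"]) simp
    qed
  qed
  have coef: "AE r in edge_measure e. a \<le> on_edge G \<rho> e r \<and> on_edge G \<rho> e r \<le> b \<and> 0 \<le> pot e r \<and> pot e r \<le> \<epsilon> * \<mu> powr (p - 2)"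
  proof -
    have "AE r in edge_measure e. a \<le> on_edge G \<rho> e r" using a(2) by (simp add: AE_edge_iff on_edge_def)
    then show ?thesis using \<rho>_AE[OF e] pot_AE[OF e] by eventually_elim (use \<epsilon> lam in linarith)
  qed
  have e0: "0 \<le> \<epsilon>"
  proof -
    have "0 \<le> \<epsilon> * \<mu> powr (p - 2)" if "0 \<le> lam + Wb" using \<epsilon>(2) that by linarith
    moreover have "0 \<le> lam + Wb"
    proof (rule ccontr)
      assume neg: "\<not> ?thesis"
      have "AE r in edge_measure e. False" using pot_AE[OF e] by eventually_elim (use lam neg in linarith)
      then have "AE r in lebesgue. r \<in> edge_int G e \<longrightarrow> False" by (subst AE_lebesgue_on) simp_all
      then obtain N where "N \<in> null_sets lebesgue" "edge_int G e \<subseteq> N" by (auto simp: eventually_ae_filter)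
      then have "negligible (edge_int G e)" using negligible_subset negligible_iff_null_sets by blast
      then have "edge_int G e = {}" using open_not_negligible[OF edge_int_open] by blast
      then show False using edge_int_nonempty[OF e] by simp
    qed
    ultimately show ?thesis using \<mu> by (simp add: zero_le_mult_iff)
  qed
  \<comment> \<open>A nonempty open interval is not a null set, so
    \<open>a \<le> \<rho> \<le> b\<close> holds at some point of the edge.\<close>
  have b0: "0 < b"
  proof (rule ccontr)
    assume "\<not> 0 < b"
    then have "AE r in edge_measure e. False" using coef by (rule_tac eventually_mono) (use a(1) in \<open>auto\<close>)
    then have "AE r in lebesgue. r \<in> edge_int G e \<longrightarrow> False" by (subst AE_lebesgue_on) simp_all
    then obtain N where "N \<in> null_sets lebesgue" "edge_int G e \<subseteq> N" by (auto simp: eventually_ae_filter)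
    then have "negligible (edge_int G e)" using negligible_subset negligible_iff_null_sets by blast
    then have "edge_int G e = {}" using open_not_negligible[OF edge_int_open] by blast
    then show False using edge_int_nonempty[OF e] by simp
  qed
  have nl: "0 \<le> \<bar>?u r\<bar> powr (p - 2)" "\<bar>?u r\<bar> powr (p - 2) \<le> \<mu> powr (p - 2)" if "r \<in> edge_int G e" for r
    using ub[OF that] p2 by (auto intro: powr_mono2)
  have fb: "AE r in edge_measure e. \<bar>force e r\<bar> \<le> (b + 1) * \<mu> powr (p - 1)"
  proof -
    have "AE r in edge_measure e. r \<in> edge_int G e" by (rule AE_I2) simp
    then show ?thesis using coef
    proof eventually_elim
      case (elim r)
      have n: "0 \<le> nonlin e r" "nonlin e r \<le> b * \<mu> powr (p - 2)"
        unfolding nonlin_def using elim nl[OF elim(1)] a(1) b0 by (auto intro!: mult_mono)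
      have "pot e r \<le> 1 * \<mu> powr (p - 2)" using elim \<epsilon>(1) by (meson mult_right_mono order_trans powr_ge_zero)
      then have "\<bar>pot e r - nonlin e r\<bar> \<le> b * \<mu> powr (p - 2) + \<mu> powr (p - 2)" using n elim b0 by (simp add: abs_le_iff)
      then have "\<bar>?u r\<bar> * \<bar>pot e r - nonlin e r\<bar> \<le> \<mu> * (b * \<mu> powr (p - 2) + \<mu> powr (p - 2))"
        using ub[OF elim(1)] \<mu> by (intro mult_mono) auto
      then show ?case unfolding force_alt abs_mult \<mu>p by (simp add: algebra_simps)
    qed
  qed
  have scale: "\<sigma> * du e (\<tau> t) / (\<kappa> * \<mu>) - \<sigma> * du e (\<tau> s) / (\<kappa> * \<mu>) = \<sigma> * (du e (\<tau> t) - du e (\<tau> s)) / (\<kappa> * \<mu>)" for s t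
    by (simp add: diff_divide_distrib right_diff_distrib)
  \<comment> \<open>Change of units: a force of size \<open>C * \<mu> powr (p - 1)\<close> acting
    over the length \<open>d / \<kappa>\<close> changes the rescaled derivative by
    \<open>C * d\<close>.\<close>
  have conv: "C * \<mu> powr (p - 1) * (d / \<kappa>) / (\<kappa> * \<mu>) = C * d" for C d
  proof -
    have "C * \<mu> powr (p - 1) * (d / \<kappa>) / (\<kappa> * \<mu>) = C * d * (\<mu> powr (p - 2) * \<mu>) / ((\<kappa> * \<kappa>) * \<mu>)"
      unfolding \<mu>p by simp
    then show ?thesis unfolding \<kappa>2 using \<mu> by simp
  qed
  have km: "0 < \<kappa> * \<mu>" using \<kappa> \<mu> by simp
  show ?thesis
    unfolding osc_system_def \<tau>_def[symmetric]
  proof (intro conjI ballI allI impI)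
    fix y assume y: "y \<in> {0..X}"
    have t: "\<tau> y \<in> edge_int G e" using room[OF y] by (simp add: \<tau>_def)
    have "((\<lambda>y. t0 + \<sigma> * y / \<kappa>) has_real_derivative 0 + \<sigma> * 1 / \<kappa>) (at y)"
      by (intro DERIV_add DERIV_const DERIV_cdivide DERIV_cmult DERIV_ident)
    then have "(\<tau> has_real_derivative \<sigma> / \<kappa>) (at y)" by (simp add: \<tau>_def[abs_def])
    from DERIV_chain2[OF ode(1)[OF e t] this]
    have "((\<lambda>y. ?u (\<tau> y) / \<mu>) has_real_derivative du e (\<tau> y) * (\<sigma> / \<kappa>) / \<mu>) (at y)" by (rule DERIV_cdivide)
    then show "((\<lambda>y. ?u (\<tau> y) / \<mu>) has_real_derivative \<sigma> * du e (\<tau> y) / (\<kappa> * \<mu>)) (at y)" by (simp add: mult.commute)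
    show "\<bar>?u (\<tau> y) / \<mu>\<bar> \<le> 1" using ub[OF t] \<mu> by (simp add: abs_divide)
  next
    fix s t assume st: "s \<in> {0..X}" "t \<in> {s..X}"
    obtain x w where xw: "x \<le> w" "{x..w} \<subseteq> edge_int G e" "w - x = (t - s) / \<kappa>"
      "(force e has_integral (\<sigma> * (du e (\<tau> t) - du e (\<tau> s)))) {x..w}" using inc[OF st] by blast
    have "AE r in edge_measure e. force e r \<le> (b + 1) * \<mu> powr (p - 1)" using fb by eventually_elim linarith
    from has_integral_le_AE[OF xw(4) edge_AE_subinterval[OF this xw(2)] xw(1)]
    have 1: "\<sigma> * (du e (\<tau> t) - du e (\<tau> s)) \<le> (b + 1) * \<mu> powr (p - 1) * ((t - s) / \<kappa>)" unfolding xw(3) .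
    have "AE r in edge_measure e. - force e r \<le> (b + 1) * \<mu> powr (p - 1)" using fb by eventually_elim linarith
    from has_integral_le_AE[OF has_integral_neg[OF xw(4)] edge_AE_subinterval[OF this xw(2)] xw(1)]
    have 2: "- (\<sigma> * (du e (\<tau> t) - du e (\<tau> s))) \<le> (b + 1) * \<mu> powr (p - 1) * ((t - s) / \<kappa>)" unfolding xw(3) .
    have "\<bar>\<sigma> * (du e (\<tau> t) - du e (\<tau> s))\<bar> / (\<kappa> * \<mu>) \<le> (b + 1) * \<mu> powr (p - 1) * ((t - s) / \<kappa>) / (\<kappa> * \<mu>)"
      using 1 2 km by (intro divide_right_mono) auto
    also have "\<dots> = (b + 1) * (t - s)" by (rule conv)
    finally show "\<bar>\<sigma> * du e (\<tau> t) / (\<kappa> * \<mu>) - \<sigma> * du e (\<tau> s) / (\<kappa> * \<mu>)\<bar> \<le> (b + 1) * (t - s)"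
      unfolding scale using km by (simp add: abs_divide)
  next
    fix s t \<theta> \<sigma>' :: real
    assume st: "s \<in> {0..X}" "t \<in> {s..X}" and th: "0 \<le> \<theta>" and s': "\<sigma>' \<in> {-1, 1}"
      and ge: "\<forall>y\<in>{s..t}. \<theta> \<le> \<sigma>' * (?u (\<tau> y) / \<mu>)"
    obtain x w where xw: "x \<le> w" "{x..w} \<subseteq> \<tau> ` {s..t}" "{x..w} \<subseteq> edge_int G e" "w - x = (t - s) / \<kappa>"
      "(force e has_integral (\<sigma> * (du e (\<tau> t) - du e (\<tau> s)))) {x..w}" using inc[OF st] by blast
    let ?C = "(\<epsilon> - a * \<theta> powr (p - 1)) * \<mu> powr (p - 1)"
    have "AE r in lebesgue. r \<in> {x..w} \<longrightarrow> \<sigma>' * force e r \<le> ?C"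
      using edge_AE_subinterval[OF coef xw(3)]
    proof (rule eventually_mono, intro impI)
      fix r assume c: "r \<in> {x..w} \<longrightarrow> a \<le> on_edge G \<rho> e r \<and> on_edge G \<rho> e r \<le> b \<and> 0 \<le> pot e r \<and> pot e r \<le> \<epsilon> * \<mu> powr (p - 2)"
        and r: "r \<in> {x..w}"
      have rI: "r \<in> edge_int G e" using xw(3) r by blast
      obtain y where y: "y \<in> {s..t}" "r = \<tau> y" using xw(2) r by blast
      have "\<theta> \<le> \<sigma>' * ?u r / \<mu>" using ge y by auto
      then have th2: "\<theta> * \<mu> \<le> \<sigma>' * ?u r" using \<mu> by (simp add: pos_le_divide_eq)
      then have "0 \<le> \<sigma>' * ?u r" using th \<mu> by (meson mult_nonneg_nonneg less_imp_le order_trans)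
      then have su: "\<sigma>' * ?u r = \<bar>?u r\<bar>" using s' by auto
      have A: "\<bar>?u r\<bar> * pot e r \<le> \<mu> * (\<epsilon> * \<mu> powr (p - 2))"
        using ub[OF rI] c r \<mu> by (intro mult_mono) auto
      have B: "a * (\<theta> * \<mu>) powr (p - 1) \<le> on_edge G \<rho> e r * \<bar>?u r\<bar> powr (p - 1)"
        using th2 su th \<mu> c r a(1) p2 by (intro mult_mono powr_mono2) auto
      have p1: "\<bar>?u r\<bar> * \<bar>?u r\<bar> powr (p - 2) = \<bar>?u r\<bar> powr (p - 1)"
        using powr_mult_base[of "\<bar>?u r\<bar>" "p - 2"] by simp
      have "\<sigma>' * force e r = (\<sigma>' * ?u r) * (pot e r - nonlin e r)" by (simp add: force_alt)
      also have "\<dots> = \<bar>?u r\<bar> * pot e r - on_edge G \<rho> e r * (\<bar>?u r\<bar> * \<bar>?u r\<bar> powr (p - 2))"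
        unfolding su nonlin_def by (simp add: algebra_simps)
      also have "\<dots> \<le> \<mu> * (\<epsilon> * \<mu> powr (p - 2)) - a * (\<theta> * \<mu>) powr (p - 1)"
        unfolding p1 using A B by linarith
      also have "\<dots> = ?C" using th \<mu> by (simp add: powr_mult \<mu>p algebra_simps)
      finally show "\<sigma>' * force e r \<le> ?C" .
    qed
    from has_integral_le_AE[OF has_integral_mult_right[OF xw(5), of \<sigma>'] this xw(1)]
    have "\<sigma>' * (\<sigma> * (du e (\<tau> t) - du e (\<tau> s))) \<le> ?C * ((t - s) / \<kappa>)" unfolding xw(4) .
    then have "\<sigma>' * (\<sigma> * (du e (\<tau> t) - du e (\<tau> s))) / (\<kappa> * \<mu>) \<le> ?C * ((t - s) / \<kappa>) / (\<kappa> * \<mu>)"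
      using km by (intro divide_right_mono) auto
    also have "\<dots> = (\<epsilon> - a * \<theta> powr (p - 1)) * (t - s)" by (rule conv)
    finally show "\<sigma>' * (\<sigma> * du e (\<tau> t) / (\<kappa> * \<mu>) - \<sigma> * du e (\<tau> s) / (\<kappa> * \<mu>)) \<le> (\<epsilon> - a * \<theta> powr (p - 1)) * (t - s)"
      unfolding scale by simp
  qed
qed

text \<open>The oscillation result enters as the hypothesis \<open>osc\<close>, so that
  \<open>\<epsilon>\<close> and \<open>T\<close> are fixed independently of the solution. The
  supremum \<open>\<mu>\<close> need not be attained: the maximum principle at level
  \<open>\<mu> / 2\<close> finds a point above this level on an edge with
  \<open>\<rho> \<ge> a\<close>, and after rescaling its value is at least 1/2. The bound
  \<open>m0\<close> makes the rescaled edge longer than \<open>2 * T\<close>, which leaves the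
  length \<open>T\<close> on one side.\<close>

lemma (in graph_solution) sup_bound:
  fixes a \<epsilon> T m0 :: real and N :: nat
  assumes a: "a > 0" "\<And>e. e \<in> edges G \<Longrightarrow> AE_edge G e (\<lambda>x. a \<le> \<rho> x) \<or> AE_edge G e (\<lambda>x. \<rho> x = 0)"
    and osc: "\<And>v g X y0. osc_system a p (b + 1) \<epsilon> X v g \<Longrightarrow> 0 \<le> y0 \<Longrightarrow> y0 + T \<le> X \<Longrightarrow> 1 / 2 \<le> \<bar>v y0\<bar> \<Longrightarrow>
      (\<exists>z::nat \<Rightarrow> real. (\<forall>i\<le>N. y0 < z i \<and> z i \<le> y0 + T \<and> v (z i) = 0) \<and> (\<forall>i<N. \<exists>y. z i < y \<and> y < z (Suc i) \<and> v y \<noteq> 0))"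
    and \<epsilon>: "0 \<le> \<epsilon>" "\<epsilon> \<le> 1" and T: "T > 0" and N: "morse_index G p W \<rho> lam u < enat N" and lam: "Wb < lam"
    and m0: "m0 > 0" "lam + Wb \<le> \<epsilon> * m0 powr (p - 2)" "\<And>e. e \<in> edges G \<Longrightarrow> ereal (2 * T / m0 powr ((p - 2) / 2)) < len G e"
    and x: "x \<in> points G"
  shows "\<bar>u x\<bar> \<le> m0"
proof (rule ccontr)
  assume big: "\<not> \<bar>u x\<bar> \<le> m0"
  obtain M where M: "M > 0" "\<And>x. x \<in> points G \<Longrightarrow> \<bar>u x\<bar> \<le> M" using u_bounded by blast
  define \<mu> where "\<mu> = (SUP x\<in>points G. \<bar>u x\<bar>)"
  have bdd: "bdd_above ((\<lambda>x. \<bar>u x\<bar>) ` points G)" using M(2) by (auto intro: bdd_aboveI[of _ M])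
  have \<mu>b: "\<bar>u y\<bar> \<le> \<mu>" if "y \<in> points G" for y unfolding \<mu>_def by (rule cSUP_upper[OF that bdd])
  have \<mu>: "\<mu> > m0" "\<mu> > 0" using \<mu>b[OF x] big m0(1) by linarith+
  have "\<exists>e\<in>edges G. \<not> AE_edge G e (\<lambda>x. \<rho> x = 0) \<and> (\<exists>t\<in>edge_int G e. \<mu> / 2 < \<bar>u (pt G e t)\<bar>)"
  proof (rule ccontr)
    assume c: "\<not> ?thesis"
    have "\<bar>u y\<bar> \<le> \<mu> / 2" if "y \<in> points G" for y
    proof (rule maximum_principle[OF lam _ _ that])
      show "0 \<le> \<mu> / 2" using \<mu> by simp
      show "AE_edge G e (\<lambda>x. \<rho> x = 0) \<or> (\<forall>t\<in>edge_int G e. \<bar>u (pt G e t)\<bar> \<le> \<mu> / 2)" if "e \<in> edges G" for e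
        using c that by (meson not_le)
    qed
    then have "\<mu> \<le> \<mu> / 2" unfolding \<mu>_def using x by (intro cSUP_least) auto
    then show False using \<mu> by simp
  qed
  then obtain e t0 where e: "e \<in> edges G" "\<not> AE_edge G e (\<lambda>x. \<rho> x = 0)" and t0: "t0 \<in> edge_int G e" "\<mu> / 2 < \<bar>u (pt G e t0)\<bar>"
    by blast
  have ae: "AE_edge G e (\<lambda>x. a \<le> \<rho> x)" using a(2) e by blast
  define \<kappa> where "\<kappa> = \<mu> powr ((p - 2) / 2)"
  have \<kappa>: "\<kappa> > 0" "m0 powr ((p - 2) / 2) \<le> \<kappa>" using \<mu> m0(1) p2 by (auto simp: \<kappa>_def intro: powr_mono2)
  have room0: "\<exists>\<sigma>\<in>{-1, 1}. t0 + \<sigma> * T / \<kappa> \<in> edge_int G e"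
  proof -
    have "2 * T / \<kappa> \<le> 2 * T / m0 powr ((p - 2) / 2)" using \<kappa> T m0(1) by (intro divide_left_mono) auto
    then have "ereal (2 * T / \<kappa>) \<le> ereal (2 * T / m0 powr ((p - 2) / 2))" by simp
    then have l: "ereal (2 * T / \<kappa>) < len G e" using m0(3)[OF e(1)] by (rule le_less_trans)
    have pos: "T / \<kappa> > 0" using T \<kappa> by simp
    show ?thesis
      using e(1)
    proof (cases rule: edge_cases)
      case 1
      then show ?thesis using t0(1) pos by (intro bexI[of _ 1]) auto
    next
      case 2
      then have l2: "2 * (T / \<kappa>) < elen e" using l by simp
      show ?thesis
      proof (cases "t0 + T / \<kappa> < elen e")
        case True then show ?thesis using t0(1) pos 2 by (intro bexI[of _ 1]) auto
      next
        case False then show ?thesis using t0(1) pos 2 l2 by (intro bexI[of _ "-1"]) auto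
      qed
    qed
  qed
  then obtain \<sigma> where \<sigma>: "\<sigma> \<in> {-1, 1}" "t0 + \<sigma> * T / \<kappa> \<in> edge_int G e" by blast
  have room: "t0 + \<sigma> * y / \<kappa> \<in> edge_int G e" if y: "y \<in> {0..T}" for y
  proof -
    have "y / \<kappa> \<le> T / \<kappa>" "0 \<le> y / \<kappa>" using y \<kappa> by (auto intro: divide_right_mono)
    then have "t0 + \<sigma> * y / \<kappa> \<in> {min t0 (t0 + \<sigma> * T / \<kappa>)..max t0 (t0 + \<sigma> * T / \<kappa>)}"
      using \<sigma>(1) by (auto simp: min_def max_def)
    moreover have "{min t0 (t0 + \<sigma> * T / \<kappa>)..max t0 (t0 + \<sigma> * T / \<kappa>)} \<subseteq> edge_int G e"
      by (rule interval_subset[OF edge_int_interval]) (use t0 \<sigma> in \<open>auto simp: min_def max_def\<close>)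
    ultimately show ?thesis by blast
  qed
  have "m0 powr (p - 2) \<le> \<mu> powr (p - 2)" using \<mu> m0(1) p2 by (intro powr_mono2) auto
  then have "\<epsilon> * m0 powr (p - 2) \<le> \<epsilon> * \<mu> powr (p - 2)" using \<epsilon> by (intro mult_left_mono)
  then have lw: "lam + Wb \<le> \<epsilon> * \<mu> powr (p - 2)" using m0(2) by linarith
  define v where "v y = on_edge G u e (t0 + \<sigma> * y / \<kappa>) / \<mu>" for y
  have sys: "osc_system a p (b + 1) \<epsilon> T v (\<lambda>y. \<sigma> * du e (t0 + \<sigma> * y / \<kappa>) / (\<kappa> * \<mu>))"
    unfolding v_def \<kappa>_def
    by (rule rescaled_osc_system[OF e(1) \<mu>(2) \<mu>b a(1) ae \<epsilon>(2) lw less_imp_le[OF lam] \<sigma>(1)]) (use room in \<open>auto simp: \<kappa>_def\<close>)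
  have "1 / 2 \<le> \<bar>v 0\<bar>" using t0(2) \<mu>(2) by (simp add: v_def on_edge_def abs_divide field_simps)
  then obtain z where z: "\<And>i. i \<le> N \<Longrightarrow> 0 < z i \<and> z i \<le> T \<and> v (z i) = 0" "\<And>i. i < N \<Longrightarrow> \<exists>y. z i < y \<and> y < z (Suc i) \<and> v y \<noteq> 0"
    using osc[OF sys, of 0] by auto
  define q where "q y = t0 + \<sigma> * y / \<kappa>" for y
  \<comment> \<open>If the edge is traversed backwards, the zeros appear in reverse order; minimum
    and maximum restore the orientation.\<close>
  define l where "l i = min (q (z i)) (q (z (Suc i)))" for i
  define r where "r i = max (q (z i)) (q (z (Suc i)))" for i
  have zinc: "z i < z (Suc i)" if "i < N" for i using z(2)[OF that] by (meson less_trans)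
  have zmono: "z (Suc i) \<le> z j" if "i < j" "j \<le> N" for i j
    using that
  proof (induction j)
    case (Suc j)
    show ?case
    proof (cases "i = j")
      case False
      then have "z (Suc i) \<le> z j" using Suc by auto
      then show ?thesis using zinc[of j] Suc by auto
    qed simp
  qed simp
  have qmono: "q x < q y \<longleftrightarrow> (if \<sigma> = 1 then x < y else y < x)" for x y
    using \<sigma>(1) \<kappa> by (auto simp: q_def divide_less_cancel)
  have qle: "q x \<le> q y \<longleftrightarrow> (if \<sigma> = 1 then x \<le> y else y \<le> x)" for x y
    using \<sigma>(1) \<kappa> by (auto simp: q_def divide_le_cancel)
  have lr: "l i < r i" if "i < N" for i
    using zinc[OF that] qmono[of "z i" "z (Suc i)"] qmono[of "z (Suc i)" "z i"] by (auto simp: l_def r_def min_def max_def)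
  have qI: "q (z i) \<in> edge_int G e" if "i \<le> N" for i using room[of "z i"] z(1)[OF that] by (simp add: q_def)
  have J: "{l i..r i} \<subseteq> edge_int G e" if "i < N" for i
    by (rule interval_subset[OF edge_int_interval]) (use qI[of i] qI[of "Suc i"] that in \<open>auto simp: l_def r_def min_def max_def\<close>)
  have uq: "on_edge G u e (q (z i)) = 0" if "i \<le> N" for i using z(1)[OF that] \<mu> by (simp add: v_def q_def)
  have ulr: "on_edge G u e (l i) = 0" "on_edge G u e (r i) = 0" if "i < N" for i
    using uq[of i] uq[of "Suc i"] that by (auto simp: l_def r_def min_def max_def)
  have mid: "\<exists>y\<in>{l i<..<r i}. on_edge G u e y \<noteq> 0" if i: "i < N" for i
  proof -
    obtain y where y: "z i < y" "y < z (Suc i)" "v y \<noteq> 0" using z(2)[OF i] by blast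
    have "q y \<in> {l i<..<r i}"
      using y(1,2) qmono[of "z i" y] qmono[of y "z (Suc i)"] qmono[of "z (Suc i)" y] qmono[of y "z i"]
      by (auto simp: l_def r_def min_less_iff_disj less_max_iff_disj split: if_splits)
    moreover have "on_edge G u e (q y) \<noteq> 0" using y(3) by (simp add: v_def q_def)
    ultimately show ?thesis by blast
  qed
  define f where "f i t = (if l i \<le> t \<and> t \<le> r i then on_edge G u e t else 0)" for i t
  define f' where "f' i t = (if l i < t \<and> t < r i then du e t else 0)" for i t
  have sep: "r i \<le> l j \<or> r j \<le> l i" if "i < j" "j < N" for i j
  proof -
    have o: "z i < z (Suc i)" "z (Suc i) \<le> z j" "z j < z (Suc j)" using zinc zmono that by auto
    show ?thesis
    proof (cases "\<sigma> = 1")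
      case True
      then have "r i = q (z (Suc i))" "l j = q (z j)" using o qle by (auto simp: r_def l_def max_def min_def)
      then show ?thesis using o qle True by simp
    next
      case False
      then have "l i = q (z (Suc i))" "r j = q (z j)" using o qle by (auto simp: r_def l_def max_def min_def)
      then show ?thesis using o qle False by simp
    qed
  qed
  \<comment> \<open>Neighbouring pieces may share an end point. There \<open>u\<close> is zero, and
    \<open>f'\<close> was defined with strict inequalities so as to vanish too.\<close>
  have fdisj: "f i t * f j t = 0 \<and> f' i t * f' j t = 0" if "i < j" "j < N" for i j t
  proof -
    have "i < N" using that by simp
    note u0 = ulr[OF this] ulr[OF that(2)]
    show ?thesis
    proof (cases "l i \<le> t \<and> t \<le> r i \<and> l j \<le> t \<and> t \<le> r j")
      case True
      then have "t = r i \<or> t = r j" using sep[OF that] by linarith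
      then show ?thesis using u0 True by (auto simp: f_def f'_def)
    qed (auto simp: f_def f'_def)
  qed
  have fdisj': "f i t * f j t = 0 \<and> f' i t * f' j t = 0" if "i < N" "j < N" "i \<noteq> j" for i j t
    using fdisj[of i j t] fdisj[of j i t] that by (cases "i < j") (auto simp: mult.commute)
  have fe: "f i = (\<lambda>t. if l i \<le> t \<and> t \<le> r i then on_edge G u e t else 0)" "f' i = (\<lambda>t. if l i < t \<and> t < r i then du e t else 0)" for i
    by (auto simp: f_def f'_def)
  have piece: "gpair (edge_fun e (f i)) (\<lambda>e' t. if e' = e then f' i t else 0) \<and>
      (\<exists>x\<in>points G. \<exists>R. \<forall>y\<in>points G. edge_fun e (f i) y \<noteq> 0 \<longrightarrow> gdist G x y \<le> R) \<and>
      gint (qform (edge_fun e (f i)) (\<lambda>e' t. if e' = e then f' i t else 0)) < 0" if i: "i < N" for i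
  proof -
    obtain y where y: "y \<in> {l i<..<r i}" "on_edge G u e y \<noteq> 0" using mid[OF i] by blast
    from nodal_piece[OF e(1) J[OF i] lr[OF i] ulr[OF i] y a(1) ae] show ?thesis unfolding fe by blast
  qed
  have "enat (card {..<N}) \<le> morse_index G p W \<rho> lam u"
  proof (rule morse_index_lower[where \<phi>="\<lambda>i. edge_fun e (f i)" and \<phi>'="\<lambda>i e' t. if e' = e then f' i t else 0"])
    fix i j y assume "i \<in> {..<N}" "j \<in> {..<N}" "i \<noteq> j"
    then show "edge_fun e (f i) y * edge_fun e (f j) y = 0" using fdisj' by (cases y) (simp_all add: edge_fun_def)
  next
    fix i j e' t assume "i \<in> {..<N}" "j \<in> {..<N}" "i \<noteq> j"
    then show "(if e' = e then f' i t else 0) * (if e' = e then f' j t else 0) = 0" using fdisj' by simp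
  qed (use piece in auto)
  then show False using N by (simp add: not_le[symmetric])
qed

section \<open>Exponential decay\<close>

context graph_solution
begin

text \<open>A sum of exponentials of rate \<open>\<alpha>\<close> still satisfies
  \<open>\<bar>S'\<bar> \<le> \<alpha> * S\<close>, so \<open>\<eta>\<close> has logarithmic
  derivative at most \<open>\<alpha> = sqrt lam / 2\<close> for any number of centres. Where
  \<open>\<bar>u\<bar>\<close> is below \<open>\<delta>\<close> the hypotheses leave enough
  potential; elsewhere a centre is near, \<open>\<eta>\<close> is at most
  \<open>exp (R / 2)\<close>, and the deficit goes into \<open>H\<close>. The 48 is the 8 of
  \<open>energy_sup\<close> times the 6 of \<open>edge_exp_integral\<close>.\<close>

lemma decay_sum:
  fixes x :: "nat \<Rightarrow> ('v, 'e) gpoint" and M \<delta> K R :: real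
  assumes lam: "lam > 0" "Wb \<le> lam / 4" and len: "\<And>e. e \<in> edges G \<Longrightarrow> ereal (2 / sqrt lam) < len G e"
    and A: "finite A" "\<And>i. i \<in> A \<Longrightarrow> x i \<in> points G"
    and M: "\<And>y. y \<in> points G \<Longrightarrow> \<bar>u y\<bar> \<le> M" "b * M powr (p - 2) \<le> K * lam"
    and b: "0 \<le> b" and K: "0 \<le> K" and R: "0 \<le> R"
    and \<delta>: "0 \<le> \<delta>" "b * \<delta> powr (p - 2) \<le> lam / 4"
    and cover: "\<And>y. y \<in> points G \<Longrightarrow> \<delta> \<le> \<bar>u y\<bar> \<Longrightarrow> \<exists>i\<in>A. sqrt lam * gdist G (x i) y \<le> R"
    and y: "y \<in> points G"
  shows "\<bar>u y\<bar> \<le> M * sqrt (48 * K * exp (2 * R) * real (card A) * real (card (edges G))) *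
    (\<Sum>i\<in>A. exp (- (sqrt lam / 2) * gdist G (x i) y))"
proof -
  define \<alpha> where "\<alpha> = sqrt lam / 2"
  have \<alpha>: "\<alpha> > 0" "\<alpha>\<^sup>2 = lam / 4" using lam by (auto simp: \<alpha>_def power_divide)
  define S where "S z = (\<Sum>i\<in>A. exp (- \<alpha> * gdist G (x i) z))" for z
  define D where "D = sqrt (48 * K * exp (2 * R) * real (card A) * real (card (edges G)))"
  have M0: "0 \<le> M" using M(1)[OF y] by (meson abs_ge_zero order_trans)
  have S0: "0 \<le> S z" "S z \<le> real (card A)" for z
  proof -
    show "0 \<le> S z" unfolding S_def by (rule sum_nonneg) simp
    show "S z \<le> real (card A)"
      unfolding S_def using sum_bounded_above[of A "\<lambda>i. exp (- \<alpha> * gdist G (x i) z)" 1] exp_dist_le_1[OF \<alpha>(1)] by simp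
  qed
  have main: "\<bar>u y\<bar> \<le> M * D * (\<kappa> + S y)" if \<kappa>: "\<kappa> > 0" for \<kappa> :: real
  proof -
    \<comment> \<open>The summand \<open>\<kappa>\<close> keeps the weight bounded along half-lines,
      where \<open>S\<close> tends to zero.\<close>
    define \<eta> where "\<eta> z = 1 / (\<kappa> + S z)" for z
    define S' where "S' e t = (\<Sum>i\<in>A. - \<alpha> * dist_deriv (x i) e t * exp (- \<alpha> * gdist G (x i) (pt G e t)))" for e t
    define \<eta>' where "\<eta>' e t = - 1 / (\<kappa> + on_edge G S e t)\<^sup>2 * S' e t" for e t
    have wS: "gweight (\<Sum>i\<in>A. max 1 \<alpha>) S S'"
      unfolding S_def[abs_def] S'_def[abs_def] by (rule gweight_sum[OF A(1) gweight_exp_dist[OF A(2) \<alpha>(1)]])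
    have "\<exists>C. gweight C \<eta> \<eta>'"
    proof -
      define B where "B = max (1 / \<kappa>) (1 / \<kappa>\<^sup>2)"
      have "gweight (B * (\<Sum>i\<in>A. max 1 \<alpha>) + B) (\<lambda>z. 1 / (\<kappa> + S z)) (\<lambda>e t. (- 1 / (\<kappa> + on_edge G S e t)\<^sup>2) * S' e t)"
      proof (rule gweight_compose[OF wS, where h="\<lambda>s. 1 / (\<kappa> + s)" and h'="\<lambda>s. - 1 / (\<kappa> + s)\<^sup>2"])
        show "0 \<le> S z \<and> S z \<le> real (card A)" for z using S0 by blast
        fix s :: real assume s: "0 \<le> s"
        then have pos: "0 < \<kappa> + s" "\<kappa> \<le> \<kappa> + s" using \<kappa> by auto
        show "((\<lambda>s. 1 / (\<kappa> + s)) has_real_derivative - 1 / (\<kappa> + s)\<^sup>2) (at s)"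
          using pos by (auto intro!: derivative_eq_intros simp: power2_eq_square)
        have "1 / (\<kappa> + s) \<le> 1 / \<kappa>" using pos \<kappa> by (intro divide_left_mono) auto
        moreover have "1 / (\<kappa> + s)\<^sup>2 \<le> 1 / \<kappa>\<^sup>2" using pos \<kappa> by (intro divide_left_mono power_mono) auto
        ultimately show "\<bar>1 / (\<kappa> + s)\<bar> \<le> B \<and> \<bar>- 1 / (\<kappa> + s)\<^sup>2\<bar> \<le> B" using pos by (simp add: B_def le_max_iff_disj)
      qed
      then show ?thesis unfolding \<eta>_def[abs_def] \<eta>'_def[abs_def] by blast
    qed
    then obtain C where \<eta>: "gweight C \<eta> \<eta>'" by blast
    have \<eta>pos: "0 < \<eta> z" for z using S0(1)[of z] \<kappa> by (simp add: \<eta>_def)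
    have \<eta>'b: "(\<eta>' e t)\<^sup>2 \<le> lam / 4 * (on_edge G \<eta> e t)\<^sup>2" if e: "e \<in> edges G" and t: "t \<in> edge_int G e" for e t
    proof -
      have "\<bar>S' e t\<bar> \<le> (\<Sum>i\<in>A. \<alpha> * exp (- \<alpha> * gdist G (x i) (pt G e t)))"
        unfolding S'_def
      proof (rule order_trans[OF sum_abs sum_mono])
        fix i assume "i \<in> A"
        from dist_deriv_bound[OF A(2)[OF this] e t]
        have "\<bar>- \<alpha> * dist_deriv (x i) e t * exp (- \<alpha> * gdist G (x i) (pt G e t))\<bar> \<le> \<alpha> * 1 * exp (- \<alpha> * gdist G (x i) (pt G e t))"
          unfolding abs_mult using \<alpha>(1) by (intro mult_mono) auto
        then show "\<bar>- \<alpha> * dist_deriv (x i) e t * exp (- \<alpha> * gdist G (x i) (pt G e t))\<bar> \<le> \<alpha> * exp (- \<alpha> * gdist G (x i) (pt G e t))"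
          by simp
      qed
      also have "\<dots> = \<alpha> * S (pt G e t)" by (simp add: S_def sum_distrib_left)
      also have "\<dots> \<le> \<alpha> * (\<kappa> + S (pt G e t))" using \<alpha>(1) \<kappa> by simp
      finally have S'b: "\<bar>S' e t\<bar> \<le> \<alpha> * (\<kappa> + S (pt G e t))" .
      define q where "q = \<kappa> + S (pt G e t)"
      have q: "q > 0" using S0(1)[of "pt G e t"] \<kappa> by (simp add: q_def)
      have "\<bar>\<eta>' e t\<bar> = 1 / q\<^sup>2 * \<bar>S' e t\<bar>" by (simp add: \<eta>'_def q_def on_edge_def abs_mult)
      also have "\<dots> \<le> 1 / q\<^sup>2 * (\<alpha> * q)" using S'b by (intro mult_left_mono) (auto simp: q_def)
      also have "\<dots> = \<alpha> * on_edge G \<eta> e t" using q by (simp add: on_edge_def \<eta>_def q_def power2_eq_square)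
      finally have "\<bar>\<eta>' e t\<bar>\<^sup>2 \<le> (\<alpha> * on_edge G \<eta> e t)\<^sup>2" by (intro power_mono) auto
      then show ?thesis by (simp add: power_mult_distrib \<alpha>(2))
    qed
    \<comment> \<open>An exponential of rate \<open>sqrt lam\<close> stands in for the indicator of
      the balls of rescaled radius \<open>R\<close>. One factor \<open>exp R\<close> bounds
      \<open>\<eta>\<^sup>2\<close> there, the other compensates the exponential at distance
      \<open>R\<close>.\<close>
    define H where "H e t = K * lam * M\<^sup>2 * exp (2 * R) * (\<Sum>i\<in>A. exp (- sqrt lam * gdist G (x i) (pt G e t)))" for e t
    have sl: "sqrt lam > 0" using lam by simp
    have iEi: "integrable (edge_measure e) (\<lambda>t. exp (- sqrt lam * gdist G (x i) (pt G e t)))" if "i \<in> A" "e \<in> edges G" for i e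
      by (rule edge_exp_integral(1)[OF A(2)[OF that(1)] that(2) sl])
    have iH: "gintble H" unfolding gintble_def H_def using iEi by (intro ballI integrable_mult_right Bochner_Integration.integrable_sum) auto
    have gH: "gint H \<le> K * lam * M\<^sup>2 * exp (2 * R) * (real (card A) * real (card (edges G)) * (6 / sqrt lam))"
    proof -
      have "integral\<^sup>L (edge_measure e) (\<lambda>t. \<Sum>i\<in>A. exp (- sqrt lam * gdist G (x i) (pt G e t))) \<le> real (card A) * (6 / sqrt lam)"
        if e: "e \<in> edges G" for e
      proof -
        have "integral\<^sup>L (edge_measure e) (\<lambda>t. \<Sum>i\<in>A. exp (- sqrt lam * gdist G (x i) (pt G e t)))
          = (\<Sum>i\<in>A. integral\<^sup>L (edge_measure e) (\<lambda>t. exp (- sqrt lam * gdist G (x i) (pt G e t))))"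
          by (rule Bochner_Integration.integral_sum) (rule iEi[OF _ e])
        also have "\<dots> \<le> real (card A) * (6 / sqrt lam)"
          by (rule sum_bounded_above) (rule edge_exp_integral(2)[OF A(2) e sl])
        finally show ?thesis .
      qed
      then have "gint (\<lambda>e t. \<Sum>i\<in>A. exp (- sqrt lam * gdist G (x i) (pt G e t))) \<le> real (card (edges G)) * (real (card A) * (6 / sqrt lam))"
        unfolding gint_def by (intro sum_bounded_above)
      then have "K * lam * M\<^sup>2 * exp (2 * R) * gint (\<lambda>e t. \<Sum>i\<in>A. exp (- sqrt lam * gdist G (x i) (pt G e t)))
        \<le> K * lam * M\<^sup>2 * exp (2 * R) * (real (card (edges G)) * (real (card A) * (6 / sqrt lam)))"
        using K lam by (intro mult_left_mono) auto
      then show ?thesis unfolding H_def gint_cmult by (simp add: mult_ac)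
    qed
    have "gint (\<lambda>e t. (du e t * on_edge G \<eta> e t + on_edge G u e t * \<eta>' e t)\<^sup>2)
       + lam / 4 * gint (\<lambda>e t. (on_edge G (\<lambda>x. u x * \<eta> x) e t)\<^sup>2) \<le> gint H"
    proof (rule energy_bound[OF \<eta> iH])
      fix e assume e: "e \<in> edges G"
      have "AE t in edge_measure e. t \<in> edge_int G e" by (rule AE_I2) simp
      then show "AE t in edge_measure e. lam / 4 * (on_edge G u e t * on_edge G \<eta> e t)\<^sup>2 - H e t
        \<le> (pot e t - nonlin e t) * (on_edge G u e t * on_edge G \<eta> e t)\<^sup>2 - (on_edge G u e t)\<^sup>2 * (\<eta>' e t)\<^sup>2"
        using pot_AE[OF e] nonlin_AE[OF e]
      proof eventually_elim
        case (elim t)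
        let ?z = "pt G e t"
        define X where "X = (on_edge G u e t * on_edge G \<eta> e t)\<^sup>2"
        have X0: "0 \<le> X" by (simp add: X_def)
        have zp: "?z \<in> points G" by (rule pt_int_points[OF e elim(1)])
        have "(on_edge G u e t)\<^sup>2 * (\<eta>' e t)\<^sup>2 \<le> (on_edge G u e t)\<^sup>2 * (lam / 4 * (on_edge G \<eta> e t)\<^sup>2)"
          by (intro mult_left_mono \<eta>'b[OF e elim(1)]) simp
        also have "\<dots> = lam / 4 * X" by (simp add: X_def power_mult_distrib)
        finally have g: "(on_edge G u e t)\<^sup>2 * (\<eta>' e t)\<^sup>2 \<le> lam / 4 * X" .
        have H0: "0 \<le> H e t" unfolding H_def using K lam by (intro mult_nonneg_nonneg sum_nonneg) auto
        have "lam / 4 * X - H e t \<le> (pot e t - nonlin e t) * X - lam / 4 * X"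
        proof (cases "\<delta> \<le> \<bar>u ?z\<bar>")
          case False
          then have "\<bar>u ?z\<bar> powr (p - 2) \<le> \<delta> powr (p - 2)" using p2 by (intro powr_mono2) auto
          then have "b * \<bar>u ?z\<bar> powr (p - 2) \<le> b * \<delta> powr (p - 2)" using b by (intro mult_left_mono)
          then have "nonlin e t \<le> lam / 4" using elim \<delta>(2) by (simp add: on_edge_def)
          then have "lam / 2 \<le> pot e t - nonlin e t" using elim lam by linarith
          then have "lam / 2 * X \<le> (pot e t - nonlin e t) * X" using X0 by (rule mult_right_mono)
          moreover have "lam / 2 * X = lam / 4 * X + lam / 4 * X" by (simp add: field_simps)
          ultimately show ?thesis using H0 by linarith
        next
          case True
          then obtain i where i: "i \<in> A" "sqrt lam * gdist G (x i) ?z \<le> R" using cover[OF zp] by blast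
          have "\<bar>u ?z\<bar> powr (p - 2) \<le> M powr (p - 2)" using M(1)[OF zp] p2 by (intro powr_mono2) auto
          then have "b * \<bar>u ?z\<bar> powr (p - 2) \<le> b * M powr (p - 2)" using b by (intro mult_left_mono)
          then have "nonlin e t \<le> K * lam" using elim M(2) by (simp add: on_edge_def)
          then have "lam / 2 - K * lam \<le> pot e t - nonlin e t" using elim lam by linarith
          then have 1: "(lam / 2 - K * lam) * X \<le> (pot e t - nonlin e t) * X" using X0 by (rule mult_right_mono)
          have "exp (- R / 2) \<le> exp (- \<alpha> * gdist G (x i) ?z)" using i(2) by (simp add: \<alpha>_def)
          also have "\<dots> \<le> S ?z" unfolding S_def using A(1) i(1) by (intro member_le_sum) auto
          also have "\<dots> \<le> \<kappa> + S ?z" using \<kappa> by simp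
          finally have le: "exp (- R / 2) \<le> \<kappa> + S ?z" .
          have "0 < \<kappa> + S ?z" using S0(1)[of ?z] \<kappa> by linarith
          then have "\<eta> ?z \<le> 1 / exp (- R / 2)" unfolding \<eta>_def
            using divide_left_mono[OF le, of 1] by simp
          then have e1: "\<eta> ?z \<le> exp (R / 2)" by (simp add: exp_minus inverse_eq_divide)
          have "\<bar>u ?z\<bar> * \<eta> ?z \<le> M * exp (R / 2)"
            using M(1)[OF zp] e1 \<eta>pos[of ?z] M0 by (intro mult_mono) auto
          then have "(\<bar>u ?z\<bar> * \<eta> ?z)\<^sup>2 \<le> (M * exp (R / 2))\<^sup>2" using \<eta>pos[of ?z] by (intro power_mono) (auto intro: less_imp_le)
          then have Xb: "X \<le> M\<^sup>2 * exp R"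
            by (simp add: X_def on_edge_def power_mult_distrib power2_eq_square[of "exp (R / 2)"] mult_exp_exp)
          have "exp (- R) \<le> exp (- sqrt lam * gdist G (x i) ?z)" using i(2) by simp
          also have "\<dots> \<le> (\<Sum>i\<in>A. exp (- sqrt lam * gdist G (x i) ?z))" using A(1) i(1) by (intro member_le_sum) auto
          finally have "exp (- R) \<le> (\<Sum>i\<in>A. exp (- sqrt lam * gdist G (x i) ?z))" .
          then have "K * lam * M\<^sup>2 * exp (2 * R) * exp (- R) \<le> H e t"
            unfolding H_def using K lam by (intro mult_left_mono) auto
          moreover have "K * lam * M\<^sup>2 * exp (2 * R) * exp (- R) = K * lam * (M\<^sup>2 * exp R)"
            by (simp add: mult.assoc mult_exp_exp)
          moreover have "K * lam * X \<le> K * lam * (M\<^sup>2 * exp R)" using Xb K lam by (intro mult_left_mono) auto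
          ultimately have 2: "K * lam * X \<le> H e t" by linarith
          have "(lam / 2 - K * lam) * X = lam / 4 * X + lam / 4 * X - K * lam * X" by (simp add: field_simps)
          then show ?thesis using 1 2 by linarith
        qed
        then show ?case using g unfolding X_def by linarith
      qed
    qed
    from energy_sup[OF \<eta> lam(1) len iH this y] have "(u y * \<eta> y)\<^sup>2 \<le> 8 * gint H / sqrt lam" .
    also have "\<dots> \<le> 8 * (K * lam * M\<^sup>2 * exp (2 * R) * (real (card A) * real (card (edges G)) * (6 / sqrt lam))) / sqrt lam"
      using gH sl by (intro divide_right_mono mult_left_mono) auto
    also have "\<dots> = M\<^sup>2 * (48 * K * exp (2 * R) * real (card A) * real (card (edges G)))"
    proof -
      define q where "q = sqrt lam"
      have q: "q > 0" "lam = q * q" using lam by (auto simp: q_def)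
      show ?thesis unfolding q_def[symmetric] using q(1) by (simp add: q(2))
    qed
    also have "\<dots> = (M * D)\<^sup>2" unfolding D_def power_mult_distrib using K by simp
    finally have "\<bar>u y * \<eta> y\<bar> \<le> \<bar>M * D\<bar>" by (simp add: abs_le_square_iff)
    then have "\<bar>u y\<bar> * \<eta> y \<le> M * D" using M0 K \<eta>pos[of y] by (simp add: abs_mult D_def)
    then show ?thesis using S0(1)[of y] \<kappa> by (simp add: \<eta>_def pos_divide_le_eq add_pos_nonneg)
  qed
  have "\<bar>u y\<bar> \<le> M * D * S y"
  proof (rule field_le_epsilon)
    fix \<epsilon> :: real assume \<epsilon>: "0 < \<epsilon>"
    have MD: "0 \<le> M * D" using M0 K by (simp add: D_def)
    define \<kappa> where "\<kappa> = \<epsilon> / (M * D + 1)"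
    have \<kappa>: "\<kappa> > 0" using \<epsilon> MD by (simp add: \<kappa>_def)
    have "M * D * \<kappa> \<le> (M * D + 1) * \<kappa>" using \<kappa> by (intro mult_right_mono) auto
    also have "\<dots> = \<epsilon>" using MD by (simp add: \<kappa>_def)
    finally show "\<bar>u y\<bar> \<le> M * D * S y + \<epsilon>" using main[OF \<kappa>] by (simp add: distrib_left)
  qed
  then show ?thesis by (simp add: D_def S_def \<alpha>_def)
qed

lemma decay:
  fixes x :: "nat \<Rightarrow> ('v, 'e) gpoint" and M \<delta> K R :: real
  assumes lam: "lam > 0" "Wb \<le> lam / 4" and len: "\<And>e. e \<in> edges G \<Longrightarrow> ereal (2 / sqrt lam) < len G e"
    and A: "finite A" "A \<noteq> {}" "\<And>i. i \<in> A \<Longrightarrow> x i \<in> points G"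
    and M: "\<And>y. y \<in> points G \<Longrightarrow> \<bar>u y\<bar> \<le> M" "b * M powr (p - 2) \<le> K * lam"
    and b: "0 \<le> b" and K: "0 \<le> K" and R: "0 \<le> R"
    and \<delta>: "0 \<le> \<delta>" "b * \<delta> powr (p - 2) \<le> lam / 4"
    and cover: "\<And>y. y \<in> points G \<Longrightarrow> \<delta> \<le> \<bar>u y\<bar> \<Longrightarrow> \<exists>i\<in>A. sqrt lam * gdist G (x i) y \<le> R"
    and y: "y \<in> points G"
  shows "\<bar>u y\<bar> \<le> M * (sqrt (48 * K * exp (2 * R) * real (card A) * real (card (edges G))) * real (card A)) *
    exp (- (sqrt lam / 2) * (MIN i\<in>A. gdist G (x i) y))"
proof -
  let ?C = "sqrt (48 * K * exp (2 * R) * real (card A) * real (card (edges G)))"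
  have M0: "0 \<le> M" using M(1)[OF y] by (meson abs_ge_zero order_trans)
  have "(\<Sum>i\<in>A. exp (- (sqrt lam / 2) * gdist G (x i) y)) \<le> real (card A) * exp (- (sqrt lam / 2) * (MIN i\<in>A. gdist G (x i) y))"
  proof (rule sum_bounded_above)
    fix i assume i: "i \<in> A"
    have "(MIN i\<in>A. gdist G (x i) y) \<le> gdist G (x i) y" using A(1) i by simp
    then show "exp (- (sqrt lam / 2) * gdist G (x i) y) \<le> exp (- (sqrt lam / 2) * (MIN i\<in>A. gdist G (x i) y))"
      using lam(1) by (simp add: mult_left_mono)
  qed
  then have "M * ?C * (\<Sum>i\<in>A. exp (- (sqrt lam / 2) * gdist G (x i) y))
    \<le> M * ?C * (real (card A) * exp (- (sqrt lam / 2) * (MIN i\<in>A. gdist G (x i) y)))"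
    using M0 K by (intro mult_left_mono) auto
  with decay_sum[OF lam len A(1,3) M b K R \<delta> cover y] show ?thesis by (simp add: mult.assoc)
qed

text \<open>The cut-off around a peak has rescaled radius \<open>ln (1 / c) / \<alpha>\<close>, so
  twice this separation makes the supports disjoint and the negative directions add up in the Morse
  index.\<close>

lemma separated_peaks:
  fixes c M \<delta> :: real and x :: "nat \<Rightarrow> ('v, 'e) gpoint"
  defines "\<alpha> \<equiv> 1 / (4 * sqrt ((p - 1) / (p - 2)))"
  assumes lam: "lam > 0" "Wb \<le> lam / 4" and len: "\<And>e. e \<in> edges G \<Longrightarrow> ereal (2 / sqrt lam) < len G e"
    and M: "\<And>y. y \<in> points G \<Longrightarrow> \<bar>u y\<bar> \<le> M"
    and A: "finite A" "\<And>i. i \<in> A \<Longrightarrow> x i \<in> points G \<and> \<delta> \<le> \<bar>u (x i)\<bar>" and \<delta>: "0 < \<delta>"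
    and c: "0 < c" "c \<le> 1 / 2" "24 * real (card (edges G)) * c\<^sup>2 * M\<^sup>2 / \<alpha> < \<delta>\<^sup>2 / 16"
    and sep: "\<And>i j. i \<in> A \<Longrightarrow> j \<in> A \<Longrightarrow> i \<noteq> j \<Longrightarrow> 2 * ln (1 / c) / \<alpha> \<le> sqrt lam * gdist G (x i) (x j)"
  shows "enat (card A) \<le> morse_index G p W \<rho> lam u"
proof -
  have "(p - 1) / (p - 2) > 0" using p2 by simp
  then have \<alpha>: "\<alpha> > 0" by (simp add: \<alpha>_def)
  define s where "s = \<alpha> * sqrt lam"
  have s: "s > 0" using \<alpha> lam by (simp add: s_def)
  define \<eta> where "\<eta> i = cut (x i) s c" for i
  define \<eta>' where "\<eta>' i = cut_deriv (x i) s c" for i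
  have far: "\<eta> i y = 0 \<or> \<eta> j y = 0" if ij: "i \<in> A" "j \<in> A" "i \<noteq> j" and y: "y \<in> points G" for i j y
  proof (rule ccontr)
    assume "\<not> ?thesis"
    then have "gdist G (x i) y < ln (1 / c) / s" "gdist G (x j) y < ln (1 / c) / s"
      unfolding \<eta>_def using cut_nonzero[OF s c(1)] by blast+
    moreover have "gdist G (x i) (x j) \<le> gdist G (x i) y + gdist G (x j) y"
      using gm.triangle[of "x i" y "x j"] A(2) ij y gm.commute[of y "x j"] by simp
    ultimately have "gdist G (x i) (x j) < 2 * ln (1 / c) / s" by simp
    then have "sqrt lam * gdist G (x i) (x j) < sqrt lam * (2 * ln (1 / c) / s)" using lam by (intro mult_strict_left_mono) auto
    also have "\<dots> = 2 * ln (1 / c) / \<alpha>" using lam by (simp add: s_def)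
    finally show False using sep[OF ij] by simp
  qed
  \<comment> \<open>The derivative of the cut-off carries the same positive part as a factor, so it
    vanishes wherever the cut-off does, including the boundary of the support.\<close>
  have der0: "\<eta>' i e t = 0" if "on_edge G (\<eta> i) e t = 0" for i e t
    using that by (simp add: \<eta>_def \<eta>'_def cut_def cut_deriv_def on_edge_def)
  show ?thesis
  proof (rule morse_index_lower[OF A(1), where \<phi>="\<lambda>i y. u y * \<eta> i y" and
      \<phi>'="\<lambda>i e t. du e t * on_edge G (\<eta> i) e t + on_edge G u e t * \<eta>' i e t"])
    fix i assume i: "i \<in> A"
    have xi: "x i \<in> points G" using A(2)[OF i] by blast
    obtain C where C: "gweight C (\<eta> i) (\<eta>' i)" unfolding \<eta>_def \<eta>'_def using cut_weight[OF xi s] c(1) by (metis less_imp_le)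
    show "gpair (\<lambda>y. u y * \<eta> i y) (\<lambda>e t. du e t * on_edge G (\<eta> i) e t + on_edge G u e t * \<eta>' i e t)"
      by (rule gpair_mult_gweight[OF gpair_u C])
    show "\<exists>x\<in>points G. \<exists>r. \<forall>y\<in>points G. u y * \<eta> i y \<noteq> 0 \<longrightarrow> gdist G x y \<le> r"
    proof (rule bexI[OF _ xi], rule exI[of _ "ln (1 / c) / s"], intro ballI impI)
      fix y assume "u y * \<eta> i y \<noteq> 0"
      then show "gdist G (x i) y \<le> ln (1 / c) / s"
        using cut_nonzero[OF s c(1), of "x i" y] unfolding \<eta>_def by simp
    qed
    have di: "\<delta> \<le> \<bar>u (x i)\<bar>" using A(2)[OF i] by blast
    show "gint (qform (\<lambda>y. u y * \<eta> i y) (\<lambda>e t. du e t * on_edge G (\<eta> i) e t + on_edge G u e t * \<eta>' i e t)) < 0"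
      using negative_direction[OF lam len M xi di \<delta> c(1,2) c(3)[unfolded \<alpha>_def]] unfolding \<eta>_def \<eta>'_def s_def \<alpha>_def by blast
  next
    fix i j y assume "i \<in> A" "j \<in> A" "i \<noteq> j"
    then show "u y * \<eta> i y * (u y * \<eta> j y) = 0" using far[of i j y] u_out[of y] by (cases "y \<in> points G") auto
  next
    fix i j e t assume ij: "i \<in> A" "j \<in> A" "i \<noteq> j" and et: "e \<in> edges G" "t \<in> edge_int G e"
    have "on_edge G (\<eta> i) e t = 0 \<or> on_edge G (\<eta> j) e t = 0"
      using far[OF ij pt_int_points[OF et]] by (simp add: on_edge_def)
    then show "(du e t * on_edge G (\<eta> i) e t + on_edge G u e t * \<eta>' i e t) * (du e t * on_edge G (\<eta> j) e t + on_edge G u e t * \<eta>' j e t) = 0"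
      using der0 by auto
  qed
qed

end

section \<open>Convergence of the \<open>L\<^sup>q\<close> integrals\<close>

text \<open>The difference is \<open>w powr q * (1 - w powr (r - q))\<close>, which is at most
  \<open>w * (r - q) * (- ln w)\<close>, and \<open>- ln w \<le> 2 / sqrt w\<close>. The logarithm
  thus costs half a power, and one majorant \<open>w powr (1 / 2)\<close> works for all
  exponents.\<close>

lemma powr_diff_bound:
  fixes w q r :: real
  assumes w: "0 \<le> w" "w \<le> 1" and q: "1 \<le> q" "q \<le> r"
  shows "0 \<le> w powr q - w powr r" "w powr q - w powr r \<le> 2 * (r - q) * w powr (1 / 2)"
proof -
  show "0 \<le> w powr q - w powr r" using powr_mono'[OF q(2) w] by simp
  show "w powr q - w powr r \<le> 2 * (r - q) * w powr (1 / 2)"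
  proof (cases "w = 0")
    case False
    then have w0: "w > 0" using w by simp
    have "1 + (r - q) * ln w \<le> exp ((r - q) * ln w)" by (rule exp_ge_add_one_self)
    moreover have "w powr (r - q) = exp ((r - q) * ln w)" using w0 by (simp add: powr_def)
    ultimately have 1: "1 - w powr (r - q) \<le> (r - q) * (- ln w)" unfolding mult_minus_right by linarith
    have "- ln (w powr (1/2)) = ln (1 / w powr (1/2))" using w0 by (simp add: ln_div)
    also have "\<dots> \<le> 1 / w powr (1/2) - 1" using w0 by (intro ln_le_minus_one) simp
    finally have "- ln w \<le> 2 / w powr (1/2)" using w0 by (simp add: ln_powr)
    then have 2: "(r - q) * (- ln w) \<le> (r - q) * (2 / w powr (1/2))" using q by (intro mult_left_mono) auto
    have "w powr q - w powr r = w powr q * (1 - w powr (r - q))"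
      using w0 by (simp add: right_diff_distrib powr_add[symmetric])
    also have "\<dots> \<le> w powr 1 * ((r - q) * (2 / w powr (1/2)))"
    proof (rule mult_mono)
      show "w powr q \<le> w powr 1" by (rule powr_mono'[OF q(1) w])
      show "1 - w powr (r - q) \<le> (r - q) * (2 / w powr (1/2))" using 1 2 by linarith
      show "0 \<le> 1 - w powr (r - q)" using powr_mono'[of 0 "r - q" w] w w0 q by simp
    qed simp
    also have "\<dots> = 2 * (r - q) * (w powr 1 / w powr (1/2))" by simp
    also have "w powr 1 / w powr (1/2) = w powr (1/2)" using powr_diff[of w 1 "1/2"] w0 by simp
    finally show ?thesis .
  qed simp
qed

text \<open>Below the level \<open>\<tau>\<close> the surplus power is small; above it
  \<open>w powr r \<le> 1 \<le> (w / \<tau>) powr q\<close>. For small \<open>\<tau>\<close> a lower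
  bound on the integral of exponent \<open>r\<close> and an upper bound for exponent 1/2 yield a
  lower bound for exponent \<open>q\<close>.\<close>

lemma powr_split_bound:
  fixes w q r \<tau> :: real
  assumes w: "0 \<le> w" "w \<le> 1" and q: "0 \<le> q" and r: "1 \<le> r" and \<tau>: "0 < \<tau>"
  shows "w powr r \<le> \<tau> powr (r - 1 / 2) * w powr (1 / 2) + \<tau> powr (- q) * w powr q"
proof (cases "w \<le> \<tau>")
  case True
  have "w powr r = w powr (r - 1/2) * w powr (1/2)" by (simp add: powr_add[symmetric])
  also have "\<dots> \<le> \<tau> powr (r - 1/2) * w powr (1/2)"
    using True w r by (intro mult_right_mono powr_mono2) auto
  finally show ?thesis by (simp add: add_increasing2)
next
  case False
  then have "w powr r \<le> 1" using w r \<tau> by (intro powr_le1) auto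
  also have "1 = \<tau> powr (- q) * \<tau> powr q" using \<tau> by (simp add: powr_add[symmetric])
  also have "\<dots> \<le> \<tau> powr (- q) * w powr q" using False \<tau> q by (intro mult_left_mono powr_mono2) auto
  finally show ?thesis by (simp add: add_increasing)
qed

context fin_graph
begin

text \<open>The single bound at exponent 1/2 has two uses: as \<open>w n \<le> 1\<close> it
  majorises the integrals for all \<open>q \<ge> 1\<close>, and through
  \<open>powr_diff_bound\<close> it gives the Lipschitz constant \<open>2 * C0\<close> in
  \<open>q\<close>, independent of \<open>n\<close>. One exponent \<open>r\<close> with a positive
  lower bound then suffices for all.\<close>

lemma powr_integrals_converge:
  fixes w :: "nat \<Rightarrow> ('v, 'e) gpoint \<Rightarrow> real" and s :: "nat \<Rightarrow> real"
  assumes w: "\<And>n. continuous_map (gtopology G) euclideanreal (w n)" "\<And>n x. x \<in> points G \<Longrightarrow> 0 \<le> w n x \<and> w n x \<le> 1"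
    and s: "\<And>n. s n > 0" and half: "\<And>n. gintble (\<lambda>e t. on_edge G (w n) e t powr (1 / 2))"
    and C0: "\<And>n. s n * gint (\<lambda>e t. on_edge G (w n) e t powr (1 / 2)) \<le> C0"
    and r: "r \<ge> 1" and c: "c > 0" "\<And>n. c \<le> s n * gint (\<lambda>e t. on_edge G (w n) e t powr r)"
  shows "\<And>n q. 1 \<le> q \<Longrightarrow> gintble (\<lambda>e t. on_edge G (w n) e t powr q)"
    and "\<exists>k. strict_mono (k :: nat \<Rightarrow> nat) \<and> (\<forall>q\<ge>1. \<exists>L>0. (\<lambda>n. s (k n) * gint (\<lambda>e t. on_edge G (w (k n)) e t powr q)) \<longlonglongrightarrow> L)"
proof -
  define J where "J n q = s n * gint (\<lambda>e t. on_edge G (w n) e t powr q)" for n and q :: real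
  have we: "0 \<le> on_edge G (w n) e t \<and> on_edge G (w n) e t \<le> 1" if "e \<in> edges G" "t \<in> edge_int G e" for n e t
    using w(2)[OF pt_int_points[OF that]] by (simp add: on_edge_def)
  show int: "gintble (\<lambda>e t. on_edge G (w n) e t powr q)" if q: "1 \<le> q" for n q
  proof (rule gintble_bound[OF half])
    fix e assume e: "e \<in> edges G"
    show "(\<lambda>t. on_edge G (w n) e t powr q) \<in> borel_measurable (edge_measure e)"
      using on_edge_measurable[OF w(1) e] by measurable
    show "AE t in edge_measure e. \<bar>on_edge G (w n) e t powr q\<bar> \<le> on_edge G (w n) e t powr (1 / 2)"
      by (rule AE_I2) (use we[OF e] q in \<open>auto intro!: powr_mono'\<close>)
  qed
  have J0: "0 \<le> J n q" for n q unfolding J_def by (rule mult_nonneg_nonneg[OF less_imp_le[OF s] gint_nonneg]) simp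
  have C00: "0 \<le> C0" using J0[of 0 "1/2"] C0[of 0] by (simp add: J_def)
  have mono: "J n q \<le> C0" if q: "1 \<le> q" for n q
  proof -
    have "gint (\<lambda>e t. on_edge G (w n) e t powr q) \<le> gint (\<lambda>e t. on_edge G (w n) e t powr (1 / 2))"
      using we q by (intro gint_mono_AE int[OF q] half AE_I2) (auto intro!: powr_mono')
    then have "J n q \<le> s n * gint (\<lambda>e t. on_edge G (w n) e t powr (1 / 2))"
      unfolding J_def using s[of n] by (intro mult_left_mono) auto
    then show ?thesis using C0[of n] by linarith
  qed
  have lip: "\<bar>J n q - J n q'\<bar> \<le> 2 * C0 * \<bar>q - q'\<bar>" if q: "1 \<le> q" "1 \<le> q'" for n q q'
  proof -
    have *: "\<bar>J n q - J n q'\<bar> \<le> 2 * C0 * (q' - q)" if q: "1 \<le> q" "q \<le> q'" for q q'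
    proof -
      have q': "1 \<le> q'" using q by simp
      define D where "D = gint (\<lambda>e t. on_edge G (w n) e t powr q - on_edge G (w n) e t powr q')"
      have D: "J n q - J n q' = s n * D"
        unfolding D_def J_def gint_diff[OF int[OF q(1)] int[OF q']] by (simp add: right_diff_distrib)
      have "0 \<le> D" unfolding D_def by (rule gint_nonneg) (use powr_diff_bound(1) we q in blast)
      have "D \<le> gint (\<lambda>e t. 2 * (q' - q) * on_edge G (w n) e t powr (1 / 2))"
        unfolding D_def
        by (intro gint_mono_AE gintble_diff gintble_cmult int q q' half AE_I2) (use powr_diff_bound(2) we q in auto)
      then have "s n * D \<le> s n * (2 * (q' - q) * gint (\<lambda>e t. on_edge G (w n) e t powr (1 / 2)))"
        unfolding gint_cmult using s[of n] by (intro mult_left_mono) auto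
      also have "\<dots> = 2 * (q' - q) * (s n * gint (\<lambda>e t. on_edge G (w n) e t powr (1 / 2)))" by simp
      also have "\<dots> \<le> 2 * (q' - q) * C0" using C0[of n] q by (intro mult_left_mono) auto
      finally show ?thesis unfolding D using \<open>0 \<le> D\<close> s[of n] by (simp add: abs_mult mult_ac)
    qed
    show ?thesis
    proof (cases "q \<le> q'")
      case True then show ?thesis using *[OF q(1) True] by simp
    next
      case False then show ?thesis using *[OF q(2), of q] by (simp add: abs_minus_commute)
    qed
  qed
  have lower: "\<exists>d>0. \<forall>n. d \<le> J n q" if q: "1 \<le> q" for q
  proof -
    \<comment> \<open>Chosen so that the first term of \<open>powr_split_bound\<close> uses up at
      most \<open>c / 2\<close> of the lower bound \<open>c\<close>.\<close>
    define \<tau> where "\<tau> = (c / (2 * (C0 + 1))) powr (1 / (r - 1 / 2))"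
    have \<tau>: "\<tau> > 0" using c(1) C00 by (simp add: \<tau>_def)
    have \<tau>r: "\<tau> powr (r - 1 / 2) = c / (2 * (C0 + 1))" using r c(1) C00 by (simp add: \<tau>_def powr_powr)
    have "c / 2 \<le> \<tau> powr (- q) * J n q" for n
    proof -
      have "gint (\<lambda>e t. on_edge G (w n) e t powr r) \<le>
        gint (\<lambda>e t. \<tau> powr (r - 1 / 2) * on_edge G (w n) e t powr (1 / 2) + \<tau> powr (- q) * on_edge G (w n) e t powr q)"
        by (intro gint_mono_AE gintble_add gintble_cmult int r q half AE_I2) (use powr_split_bound we q r \<tau> in auto)
      also have "\<dots> = \<tau> powr (r - 1 / 2) * gint (\<lambda>e t. on_edge G (w n) e t powr (1 / 2)) + \<tau> powr (- q) * gint (\<lambda>e t. on_edge G (w n) e t powr q)"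
        using gint_add[OF gintble_cmult[OF half, of "\<tau> powr (r - 1/2)"] gintble_cmult[OF int[OF q], of "\<tau> powr (- q)"]]
        by (simp only: gint_cmult)
      finally have "s n * gint (\<lambda>e t. on_edge G (w n) e t powr r) \<le> s n * (\<tau> powr (r - 1 / 2) * gint (\<lambda>e t. on_edge G (w n) e t powr (1 / 2))
          + \<tau> powr (- q) * gint (\<lambda>e t. on_edge G (w n) e t powr q))"
        using s[of n] by (intro mult_left_mono) auto
      also have "\<dots> = \<tau> powr (r - 1 / 2) * (s n * gint (\<lambda>e t. on_edge G (w n) e t powr (1 / 2))) + \<tau> powr (- q) * J n q"
        by (simp add: J_def algebra_simps)
      also have "\<tau> powr (r - 1 / 2) * (s n * gint (\<lambda>e t. on_edge G (w n) e t powr (1 / 2))) \<le> c / (2 * (C0 + 1)) * (C0 + 1)"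
        unfolding \<tau>r using C0[of n] C00 c(1) by (intro mult_left_mono) auto
      also have "\<dots> = c / 2"
      proof -
        have "c / (2 * X) * X = c / 2" if "0 < X" for X using that by simp
        from this[of "C0 + 1"] C00 show ?thesis by linarith
      qed
      finally show ?thesis using c(2)[of n] by linarith
    qed
    then have "c / 2 / \<tau> powr (- q) \<le> J n q" for n using \<tau> by (simp add: pos_divide_le_eq mult_ac)
    then show ?thesis using c(1) \<tau> by (intro exI[of _ "c / 2 / \<tau> powr (- q)"]) auto
  qed
  \<comment> \<open>Only countably many exponents can be treated by the diagonal choice;
    \<open>lip\<close> carries the Cauchy property from rational exponents to the others.\<close>
  obtain k where k: "strict_mono (k :: nat \<Rightarrow> nat)" "\<And>q. q \<in> {q \<in> \<rat>. 1 \<le> q} \<Longrightarrow> \<exists>l. (\<lambda>n. J (k n) q) \<longlonglongrightarrow> l"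
  proof (rule function_convergent_subsequence[of "{q \<in> \<rat>. 1 \<le> q}" J C0])
    show "countable {q \<in> \<rat>. 1 \<le> (q::real)}" using countable_rat by (rule countable_subset[rotated]) auto
    show "norm (J n q) \<le> C0" if "q \<in> {q \<in> \<rat>. 1 \<le> q}" for n q using that mono J0 by auto
  qed blast
  have "\<exists>L>0. (\<lambda>n. J (k n) q) \<longlonglongrightarrow> L" if q: "1 \<le> q" for q
  proof -
    have "Cauchy (\<lambda>n. J (k n) q)"
    proof (rule metric_CauchyI)
      fix \<epsilon> :: real assume \<epsilon>: "0 < \<epsilon>"
      define h where "h = \<epsilon> / (8 * (C0 + 1))"
      have h: "h > 0" using \<epsilon> C00 by (simp add: h_def)
      obtain q' where q': "q' \<in> \<rat>" "q < q'" "q' < q + h" using Rats_dense_in_real[of q "q + h"] h by auto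
      then obtain l where "(\<lambda>n. J (k n) q') \<longlonglongrightarrow> l" using k(2)[of q'] q by auto
      then have "Cauchy (\<lambda>n. J (k n) q')" by (rule LIMSEQ_imp_Cauchy)
      then obtain N where N: "\<And>m n. m \<ge> N \<Longrightarrow> n \<ge> N \<Longrightarrow> dist (J (k m) q') (J (k n) q') < \<epsilon> / 4"
        using metric_CauchyD[of "\<lambda>n. J (k n) q'" "\<epsilon> / 4"] \<epsilon> by (meson divide_pos_pos zero_less_numeral)
      have near: "\<bar>J n q - J n q'\<bar> \<le> \<epsilon> / 4" for n
      proof -
        have "\<bar>J n q - J n q'\<bar> \<le> 2 * C0 * \<bar>q - q'\<bar>" by (rule lip) (use q q' in auto)
        also have "\<dots> \<le> 2 * (C0 + 1) * h" using q' C00 h by (intro mult_mono) auto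
        also have "\<dots> = \<epsilon> / 4"
        proof -
          have "2 * X * (\<epsilon> / (8 * X)) = \<epsilon> / 4" if "0 < X" for X using that by simp
          from this[of "C0 + 1"] C00 show ?thesis unfolding h_def by linarith
        qed
        finally show ?thesis .
      qed
      show "\<exists>M. \<forall>m\<ge>M. \<forall>n\<ge>M. dist (J (k m) q) (J (k n) q) < \<epsilon>"
      proof (intro exI[of _ N] allI impI)
        fix m n assume "m \<ge> N" "n \<ge> N"
        from N[OF this] show "dist (J (k m) q) (J (k n) q) < \<epsilon>"
          using near[of "k m"] near[of "k n"] \<epsilon> unfolding dist_real_def by linarith
      qed
    qed
    then obtain L where L: "(\<lambda>n. J (k n) q) \<longlonglongrightarrow> L" using Cauchy_convergent convergent_def by blast
    obtain d where d: "d > 0" "\<And>n. d \<le> J n q" using lower[OF q] by blast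
    have "d \<le> L" using L d(2) by (intro tendsto_lowerbound[OF L]) auto
    then show ?thesis using L d(1) by (intro exI[of _ L]) auto
  qed
  then show "\<exists>k. strict_mono (k :: nat \<Rightarrow> nat) \<and> (\<forall>q\<ge>1. \<exists>L>0. (\<lambda>n. s (k n) * gint (\<lambda>e t. on_edge G (w (k n)) e t powr q)) \<longlonglongrightarrow> L)"
    using k(1) unfolding J_def by blast
qed

text \<open>The square root halves the rate to \<open>s / 4\<close>, and the exponential at the
  nearest centre is bounded by the sum over all centres. The 24 is the 6 of
  \<open>edge_exp_integral\<close> divided by 1/4.\<close>

lemma exp_bound_sqrt_integral:
  fixes f :: "('v, 'e) gpoint \<Rightarrow> real" and x :: "nat \<Rightarrow> ('v, 'e) gpoint"
  assumes f: "continuous_map (gtopology G) euclideanreal f" "\<And>y. y \<in> points G \<Longrightarrow> 0 \<le> f y"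
    and A: "finite A" "A \<noteq> {}" "\<And>i. i \<in> A \<Longrightarrow> x i \<in> points G" and s: "s > 0" and D: "D \<ge> 0"
    and b: "\<And>y. y \<in> points G \<Longrightarrow> f y \<le> D * exp (- (s / 2) * (MIN i\<in>A. gdist G (x i) y))"
  shows "gintble (\<lambda>e t. on_edge G f e t powr (1 / 2))"
    and "s * gint (\<lambda>e t. on_edge G f e t powr (1 / 2)) \<le> 24 * sqrt D * real (card A) * real (card (edges G))"
proof -
  define H where "H e t = sqrt D * (\<Sum>i\<in>A. exp (- (s / 4) * gdist G (x i) (pt G e t)))" for e t
  have s4: "s / 4 > 0" using s by simp
  have iEi: "integrable (edge_measure e) (\<lambda>t. exp (- (s / 4) * gdist G (x i) (pt G e t)))" if "i \<in> A" "e \<in> edges G" for i e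
    by (rule edge_exp_integral(1)[OF A(3)[OF that(1)] that(2) s4])
  have iH: "gintble H" unfolding gintble_def H_def using iEi by (intro ballI integrable_mult_right Bochner_Integration.integrable_sum) auto
  have le: "on_edge G f e t powr (1 / 2) \<le> H e t" if e: "e \<in> edges G" and t: "t \<in> edge_int G e" for e t
  proof -
    let ?z = "pt G e t"
    have zp: "?z \<in> points G" by (rule pt_int_points[OF e t])
    have "(MIN i\<in>A. gdist G (x i) ?z) \<in> (\<lambda>i. gdist G (x i) ?z) ` A" using A by (intro Min_in) auto
    then obtain i where i: "i \<in> A" "(MIN i\<in>A. gdist G (x i) ?z) = gdist G (x i) ?z" by blast
    have "f ?z powr (1/2) \<le> (D * exp (- (s / 2) * gdist G (x i) ?z)) powr (1/2)"
      using b[OF zp] f(2)[OF zp] unfolding i(2) by (intro powr_mono2) auto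
    also have "\<dots> = sqrt D * exp (- (s / 4) * gdist G (x i) ?z)"
      using D by (simp add: powr_mult powr_half_sqrt powr_def[of "exp _"])
    also have "exp (- (s / 4) * gdist G (x i) ?z) \<le> (\<Sum>i\<in>A. exp (- (s / 4) * gdist G (x i) ?z))"
      using A(1) i(1) by (intro member_le_sum) auto
    finally show ?thesis using D by (simp add: H_def on_edge_def mult_left_mono)
  qed
  show int: "gintble (\<lambda>e t. on_edge G f e t powr (1 / 2))"
  proof (rule gintble_bound[OF iH])
    fix e assume e: "e \<in> edges G"
    show "(\<lambda>t. on_edge G f e t powr (1 / 2)) \<in> borel_measurable (edge_measure e)"
      using on_edge_measurable[OF f(1) e] by measurable
    show "AE t in edge_measure e. \<bar>on_edge G f e t powr (1 / 2)\<bar> \<le> H e t" using le[OF e] by (intro AE_I2) simp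
  qed
  have "gint (\<lambda>e t. on_edge G f e t powr (1 / 2)) \<le> gint H"
    using le by (intro gint_mono_AE int iH AE_I2) simp
  also have "\<dots> \<le> sqrt D * (real (card (edges G)) * (real (card A) * (24 / s)))"
  proof -
    have "integral\<^sup>L (edge_measure e) (\<lambda>t. \<Sum>i\<in>A. exp (- (s / 4) * gdist G (x i) (pt G e t))) \<le> real (card A) * (24 / s)"
      if e: "e \<in> edges G" for e
    proof -
      have "integral\<^sup>L (edge_measure e) (\<lambda>t. \<Sum>i\<in>A. exp (- (s / 4) * gdist G (x i) (pt G e t)))
        = (\<Sum>i\<in>A. integral\<^sup>L (edge_measure e) (\<lambda>t. exp (- (s / 4) * gdist G (x i) (pt G e t))))"
        by (rule Bochner_Integration.integral_sum) (rule iEi[OF _ e])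
      also have "\<dots> \<le> real (card A) * (6 / (s / 4))"
        by (rule sum_bounded_above) (rule edge_exp_integral(2)[OF A(3) e s4])
      finally show ?thesis by simp
    qed
    then have "gint (\<lambda>e t. \<Sum>i\<in>A. exp (- (s / 4) * gdist G (x i) (pt G e t))) \<le> real (card (edges G)) * (real (card A) * (24 / s))"
      unfolding gint_def by (intro sum_bounded_above)
    then show ?thesis unfolding H_def gint_cmult using D by (intro mult_left_mono) auto
  qed
  finally have "s * gint (\<lambda>e t. on_edge G f e t powr (1 / 2)) \<le> s * (sqrt D * (real (card (edges G)) * (real (card A) * (24 / s))))"
    using s by (intro mult_left_mono) auto
  then show "s * gint (\<lambda>e t. on_edge G f e t powr (1 / 2)) \<le> 24 * sqrt D * real (card A) * real (card (edges G))"
    using s by (simp add: mult_ac)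
qed

lemma max_on_closed_ball:
  assumes f: "continuous_map (gtopology G) euclideanreal f" and x: "x \<in> points G" and r: "0 \<le> r"
  obtains z where "z \<in> points G" "gdist G x z \<le> r" "\<And>y. y \<in> points G \<Longrightarrow> gdist G x y \<le> r \<Longrightarrow> \<bar>f y\<bar> \<le> \<bar>f z\<bar>"
proof -
  let ?B = "{y \<in> points G. gdist G x y \<le> r}"
  have "continuous_map (gtopology G) euclideanreal (\<lambda>y. \<bar>f y\<bar>)"
    by (rule continuous_map_compose_real[OF f, where K=UNIV]) (auto intro!: continuous_intros)
  from image_compactin[OF compact_closed_ball[OF x] this] have "compact ((\<lambda>y. \<bar>f y\<bar>) ` ?B)" by simp
  moreover have "(\<lambda>y. \<bar>f y\<bar>) ` ?B \<noteq> {}" using x r gm.mdist_zero[OF x] by auto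
  ultimately obtain m where m: "m \<in> (\<lambda>y. \<bar>f y\<bar>) ` ?B" "\<forall>v\<in>(\<lambda>y. \<bar>f y\<bar>) ` ?B. v \<le> m" using compact_attains_sup by blast
  then obtain z where "z \<in> ?B" "m = \<bar>f z\<bar>" by blast
  then show ?thesis using that[of z] m(2) by auto
qed

end

section \<open>Selection of the concentration points\<close>

text \<open>The number \<open>m\<close> is the last one reached from 1 for which \<open>m\<close>
  high points of arbitrarily large rescaled separation occur at arbitrarily late indices. Failure
  for \<open>m + 1\<close> yields one radius \<open>K\<close> that works for all late indices: every
  high point is within \<open>K\<close> of the family. Moving each point to a maximum of its
  \<open>K\<close>-ball shifts it by at most \<open>K\<close>, so an initial separation
  \<open>2 * K + n + 1\<close> leaves \<open>n + 1\<close>, and the covering radius becomes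
  \<open>2 * K\<close>.\<close>

lemma (in fin_graph) select_peaks:
  fixes f :: "nat \<Rightarrow> ('v, 'e) gpoint \<Rightarrow> real" and s \<delta> :: "nat \<Rightarrow> real" and N :: nat
  assumes f: "\<And>n. continuous_map (gtopology G) euclideanreal (f n)" and s: "\<And>n. n \<ge> n0 \<Longrightarrow> s n > 0"
    and one: "\<And>n. n \<ge> n0 \<Longrightarrow> \<exists>x\<in>points G. \<delta> n \<le> \<bar>f n x\<bar>"
    and few: "\<And>n (y :: nat \<Rightarrow> ('v, 'e) gpoint). n \<ge> n0 \<Longrightarrow> (\<And>i. i \<in> {1..Suc N} \<Longrightarrow> y i \<in> points G \<and> \<delta> n \<le> \<bar>f n (y i)\<bar>) \<Longrightarrow>
      (\<And>i j. i \<in> {1..Suc N} \<Longrightarrow> j \<in> {1..Suc N} \<Longrightarrow> i \<noteq> j \<Longrightarrow> r0 \<le> s n * gdist G (y i) (y j)) \<Longrightarrow> False"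
  obtains r :: "nat \<Rightarrow> nat" and m :: nat and x :: "nat \<Rightarrow> nat \<Rightarrow> ('v, 'e) gpoint" and K :: real
  where "strict_mono r" "\<And>n. r n \<ge> n0" "m \<in> {1..N}" "0 \<le> K"
    "\<And>i n. i \<in> {1..m} \<Longrightarrow> x i n \<in> points G \<and> \<delta> (r n) \<le> \<bar>f (r n) (x i n)\<bar>"
    "\<And>i j n. i \<in> {1..m} \<Longrightarrow> j \<in> {1..m} \<Longrightarrow> i \<noteq> j \<Longrightarrow> real n + 1 \<le> s (r n) * gdist G (x i n) (x j n)"
    "\<And>i n y. i \<in> {1..m} \<Longrightarrow> y \<in> points G \<Longrightarrow> s (r n) * gdist G (x i n) y < real n + 1 \<Longrightarrow> \<bar>f (r n) y\<bar> \<le> \<bar>f (r n) (x i n)\<bar>"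
    "\<And>n y. y \<in> points G \<Longrightarrow> \<delta> (r n) \<le> \<bar>f (r n) y\<bar> \<Longrightarrow> \<exists>i\<in>{1..m}. s (r n) * gdist G (x i n) y \<le> K"
proof -
  define sep where "sep m K n y \<longleftrightarrow> (\<forall>i\<in>{1..m}. y i \<in> points G \<and> \<delta> n \<le> \<bar>f n (y i)\<bar>) \<and>
     (\<forall>i\<in>{1..m}. \<forall>j\<in>{1..m}. i \<noteq> j \<longrightarrow> K \<le> s n * gdist G (y i) (y j))" for m K n and y :: "nat \<Rightarrow> ('v, 'e) gpoint"
  define P where "P m \<longleftrightarrow> (\<forall>K k. \<exists>n\<ge>k. \<exists>y. sep m K n y)" for m
  have P1: "P 1"
    unfolding P_def
  proof (intro allI)
    fix K :: real and k :: nat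
    obtain x where x: "x \<in> points G" "\<delta> (max k n0) \<le> \<bar>f (max k n0) x\<bar>" using one[of "max k n0"] by auto
    then have "sep 1 K (max k n0) (\<lambda>_. x)" by (auto simp: sep_def)
    then show "\<exists>n\<ge>k. \<exists>y. sep 1 K n y" by (meson max.cobounded1)
  qed
  have PN: "\<not> P (Suc N)"
  proof
    assume "P (Suc N)"
    then obtain n y where n: "n \<ge> n0" and y: "sep (Suc N) r0 n y" unfolding P_def by blast
    show False
    proof (rule few[OF n])
      show "y i \<in> points G \<and> \<delta> n \<le> \<bar>f n (y i)\<bar>" if "i \<in> {1..Suc N}" for i
        using y that unfolding sep_def by blast
      show "r0 \<le> s n * gdist G (y i) (y j)" if "i \<in> {1..Suc N}" "j \<in> {1..Suc N}" "i \<noteq> j" for i j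
        using y that unfolding sep_def by blast
    qed
  qed
  obtain m where m: "m \<in> {1..N}" "P m" "\<not> P (Suc m)"
  proof -
    have "\<exists>m. 1 \<le> m \<and> m \<le> k \<and> P m \<and> \<not> P (Suc m)" if "\<not> P (Suc k)" for k
      using that
    proof (induction k)
      case 0 then show ?case using P1 by simp
    next
      case (Suc k)
      show ?case
      proof (cases "P (Suc k)")
        case True then show ?thesis using Suc.prems by (intro exI[of _ "Suc k"]) simp
      next
        case False
        from Suc.IH[OF this] show ?thesis by (meson le_SucI)
      qed
    qed
    from this[OF PN] show ?thesis using that by auto
  qed
  obtain K1 k1 where K1: "\<And>n y. n \<ge> k1 \<Longrightarrow> \<not> sep (Suc m) K1 n y" using m(3) unfolding P_def by blast
  \<comment> \<open>Excluding separation \<open>K1\<close> excludes every larger separation, so the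
    radius may be taken nonnegative.\<close>
  define K where "K = max 0 K1"
  have K0: "0 \<le> K" by (simp add: K_def)
  have noK: "\<not> sep (Suc m) K n y" if "n \<ge> k1" for n y
  proof
    assume "sep (Suc m) K n y"
    then have "sep (Suc m) K1 n y" unfolding sep_def K_def by (meson max.boundedE)
    then show False using K1[OF that] by blast
  qed
  \<comment> \<open>The separation demanded at stage \<open>n\<close> grows with \<open>n\<close>,
    which gives divergence along the chosen indices with the explicit rate
    \<open>n + 1\<close>.\<close>
  have "\<exists>r. \<forall>n. (r n \<ge> max n0 k1 \<and> (\<exists>y. sep m (2 * K + real n + 1) (r n) y)) \<and> r n < r (Suc n)"
  proof (rule dependent_nat_choice)
    show "\<exists>x\<ge>max n0 k1. \<exists>y. sep m (2 * K + real 0 + 1) x y" using m(2) unfolding P_def by blast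
    fix x n
    obtain n' where "n' \<ge> max (max n0 k1) (Suc x)" "\<exists>y. sep m (2 * K + real (Suc n) + 1) n' y"
      using m(2) unfolding P_def by blast
    then show "\<exists>y. (y \<ge> max n0 k1 \<and> (\<exists>ya. sep m (2 * K + real (Suc n) + 1) y ya)) \<and> x < y" by (intro exI[of _ n']) auto
  qed
  then obtain r where r: "\<And>n. r n \<ge> max n0 k1" "\<And>n. \<exists>y. sep m (2 * K + real n + 1) (r n) y" "\<And>n. r n < r (Suc n)" by blast
  then obtain y where y: "\<And>n. sep m (2 * K + real n + 1) (r n) (y n)" by metis
  have yp: "y n i \<in> points G" "\<delta> (r n) \<le> \<bar>f (r n) (y n i)\<bar>" if "i \<in> {1..m}" for n i
    using y[of n] that unfolding sep_def by blast+
  have ysep: "2 * K + real n + 1 \<le> s (r n) * gdist G (y n i) (y n j)" if "i \<in> {1..m}" "j \<in> {1..m}" "i \<noteq> j" for n i j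
    using y[of n] that unfolding sep_def by blast
  have sr: "s (r n) > 0" for n using s[of "r n"] r(1)[of n] by simp
  have cover: "\<exists>i\<in>{1..m}. s (r n) * gdist G (y n i) z < K" if z: "z \<in> points G" "\<delta> (r n) \<le> \<bar>f (r n) z\<bar>" for n z
  proof (rule ccontr)
    assume "\<not> ?thesis"
    then have far: "K \<le> s (r n) * gdist G (y n i) z" if "i \<in> {1..m}" for i using that by (meson not_le)
    \<comment> \<open>A high point far from all peaks would be peak number
      \<open>m + 1\<close>.\<close>
    define y' where "y' i = (if i = Suc m then z else y n i)" for i
    have "sep (Suc m) K (r n) y'"
      unfolding sep_def
    proof (intro conjI ballI impI)
      fix i assume "i \<in> {1..Suc m}"
      then have "i = Suc m \<or> i \<in> {1..m}" by auto
      then show "y' i \<in> points G" "\<delta> (r n) \<le> \<bar>f (r n) (y' i)\<bar>" using z yp by (auto simp: y'_def)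
    next
      fix i j assume "i \<in> {1..Suc m}" "j \<in> {1..Suc m}" "i \<noteq> j"
      then consider "i = Suc m" "j \<in> {1..m}" | "j = Suc m" "i \<in> {1..m}" | "i \<in> {1..m}" "j \<in> {1..m}" "i \<noteq> j" by force
      then show "K \<le> s (r n) * gdist G (y' i) (y' j)"
      proof cases
        case 1 then show ?thesis using far[of j] gm.commute[of z "y n j"] by (auto simp: y'_def)
      next
        case 2 then show ?thesis using far[of i] by (auto simp: y'_def)
      next
        case 3 then show ?thesis using ysep[OF 3, of n] K0 by (auto simp: y'_def)
      qed
    qed
    then show False using noK r(1)[of n] by simp
  qed
  have "\<exists>x. x \<in> points G \<and> gdist G (y n i) x \<le> K / s (r n) \<and> (\<forall>z\<in>points G. gdist G (y n i) z \<le> K / s (r n) \<longrightarrow> \<bar>f (r n) z\<bar> \<le> \<bar>f (r n) x\<bar>)"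
    if "i \<in> {1..m}" for i n
  proof -
    have "0 \<le> K / s (r n)" using K0 sr[of n] by simp
    from max_on_closed_ball[OF f[of "r n"] yp(1)[OF that] this] show ?thesis by metis
  qed
  then obtain x where x: "\<And>i n. i \<in> {1..m} \<Longrightarrow> x i n \<in> points G" "\<And>i n. i \<in> {1..m} \<Longrightarrow> gdist G (y n i) (x i n) \<le> K / s (r n)"
     "\<And>i n z. i \<in> {1..m} \<Longrightarrow> z \<in> points G \<Longrightarrow> gdist G (y n i) z \<le> K / s (r n) \<Longrightarrow> \<bar>f (r n) z\<bar> \<le> \<bar>f (r n) (x i n)\<bar>"
    by metis
  have xd: "s (r n) * gdist G (y n i) (x i n) \<le> K" if "i \<in> {1..m}" for i n
    using x(2)[OF that, of n] sr[of n] by (simp add: pos_le_divide_eq mult.commute)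
  have xv: "\<bar>f (r n) (y n i)\<bar> \<le> \<bar>f (r n) (x i n)\<bar>" if "i \<in> {1..m}" for i n
  proof (rule x(3)[OF that yp(1)[OF that]])
    show "gdist G (y n i) (y n i) \<le> K / s (r n)" using gm.mdist_zero[OF yp(1)[OF that]] K0 sr[of n] by simp
  qed
  have tri: "s (r n) * gdist G a c \<le> s (r n) * gdist G a b + s (r n) * gdist G b c"
    if "a \<in> points G" "b \<in> points G" "c \<in> points G" for a b c n
    using gm.triangle[OF that] sr[of n] by (simp add: distrib_left[symmetric])
  show ?thesis
  proof (rule that[of r m "2 * K" x])
    show "strict_mono r" using r(3) by (simp add: strict_mono_Suc_iff)
    show "r n \<ge> n0" for n using r(1)[of n] by simp
    show "m \<in> {1..N}" by (rule m(1))
    show "0 \<le> 2 * K" using K0 by simp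
    show "x i n \<in> points G \<and> \<delta> (r n) \<le> \<bar>f (r n) (x i n)\<bar>" if "i \<in> {1..m}" for i n
      using x(1)[OF that] xv[OF that, of n] yp(2)[OF that, of n] by auto
    show "real n + 1 \<le> s (r n) * gdist G (x i n) (x j n)" if ij: "i \<in> {1..m}" "j \<in> {1..m}" "i \<noteq> j" for i j n
    proof -
      have "s (r n) * gdist G (y n i) (y n j) \<le> s (r n) * gdist G (y n i) (x i n) + s (r n) * gdist G (x i n) (y n j)"
        by (rule tri[OF yp(1)[OF ij(1)] x(1)[OF ij(1)] yp(1)[OF ij(2)]])
      moreover have "s (r n) * gdist G (x i n) (y n j) \<le> s (r n) * gdist G (x i n) (x j n) + s (r n) * gdist G (x j n) (y n j)"
        by (rule tri[OF x(1)[OF ij(1)] x(1)[OF ij(2)] yp(1)[OF ij(2)]])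
      moreover have "s (r n) * gdist G (x j n) (y n j) \<le> K" using xd[OF ij(2), of n] gm.commute[of "x j n" "y n j"] by simp
      ultimately show ?thesis using xd[OF ij(1), of n] ysep[OF ij, of n] by linarith
    qed
    \<comment> \<open>A high point in the ball of rescaled radius \<open>n + 1\<close> about
      \<open>x i n\<close> lies within \<open>K\<close> of some \<open>y n j\<close>. The separation
      forces \<open>j = i\<close>, and on that \<open>K\<close>-ball \<open>x i n\<close> is a
      maximum. A point that is not high is beaten by the height of \<open>x i n\<close>
      anyway.\<close>
    show "\<bar>f (r n) z\<bar> \<le> \<bar>f (r n) (x i n)\<bar>" if i: "i \<in> {1..m}" and z: "z \<in> points G" "s (r n) * gdist G (x i n) z < real n + 1" for i n z
    proof (cases "\<delta> (r n) \<le> \<bar>f (r n) z\<bar>")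
      case True
      obtain j where j: "j \<in> {1..m}" "s (r n) * gdist G (y n j) z < K" using cover[OF z(1) True] by blast
      have "j = i"
      proof (rule ccontr)
        assume "j \<noteq> i"
        then have "2 * K + real n + 1 \<le> s (r n) * gdist G (y n i) (y n j)" using ysep[OF i j(1)] by blast
        also have "\<dots> \<le> s (r n) * gdist G (y n i) (x i n) + s (r n) * gdist G (x i n) (y n j)"
          by (rule tri[OF yp(1)[OF i] x(1)[OF i] yp(1)[OF j(1)]])
        also have "s (r n) * gdist G (x i n) (y n j) \<le> s (r n) * gdist G (x i n) z + s (r n) * gdist G z (y n j)"
          by (rule tri[OF x(1)[OF i] z(1) yp(1)[OF j(1)]])
        finally show False using xd[OF i, of n] z(2) j(2) gm.commute[of z "y n j"] by simp
      qed
      then have "gdist G (y n i) z \<le> K / s (r n)" using j(2) sr[of n] by (simp add: pos_le_divide_eq mult.commute)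
      then show ?thesis by (rule x(3)[OF i z(1)])
    next
      case False
      then show ?thesis using xv[OF i, of n] yp(2)[OF i, of n] by linarith
    qed
    show "\<exists>i\<in>{1..m}. s (r n) * gdist G (x i n) z \<le> 2 * K" if z: "z \<in> points G" "\<delta> (r n) \<le> \<bar>f (r n) z\<bar>" for n z
    proof -
      obtain i where i: "i \<in> {1..m}" "s (r n) * gdist G (y n i) z < K" using cover[OF z] by blast
      have "s (r n) * gdist G (x i n) z \<le> s (r n) * gdist G (x i n) (y n i) + s (r n) * gdist G (y n i) z"
        by (rule tri[OF x(1)[OF i(1)] yp(1)[OF i(1)] z(1)])
      then have "s (r n) * gdist G (x i n) z \<le> 2 * K" using xd[OF i(1), of n] i(2) gm.commute[of "x i n" "y n i"] by simp
      then show ?thesis using i(1) by blast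
    qed
  qed
qed

theorem theorem1p3:
  fixes G :: "('v, 'e) metric_graph"
    and p Wbar a b :: real
    and W \<rho> u :: "nat \<Rightarrow> ('v, 'e) gpoint \<Rightarrow> real"
    and lam :: "nat \<Rightarrow> real"
    and mstar :: nat
  assumes "class_G_fin G"
    and "p > 2"
    and "\<And>n. W n \<in> Linf G"
    and "\<And>n. \<rho> n \<in> Linf G"
    and "\<And>n. AE_graph G (\<lambda>x. \<bar>W n x\<bar> \<le> Wbar)"
    and "b > 0"
    and "\<And>n. AE_graph G (\<lambda>x. 0 \<le> \<rho> n x \<and> \<rho> n x \<le> b)"
    and "0 < a" and "a < b"
    and "\<And>e. e \<in> edges G \<Longrightarrow>
           (\<forall>n. AE_edge G e (\<lambda>x. a \<le> \<rho> n x)) \<or> (\<forall>n. AE_edge G e (\<lambda>x. \<rho> n x = 0))"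
    and "\<And>n. u n \<in> H1 G - {0}"
    and "\<And>n. weak_solution G p (W n) (\<rho> n) (lam n) (u n)"
    and "filterlim lam at_top sequentially"
    and "\<And>n. morse_index G p (W n) (\<rho> n) (lam n) (u n) \<le> enat mstar"
  shows "\<exists>r :: nat \<Rightarrow> nat. strict_mono r \<and> (\<forall>n. lam (r n) > 0) \<and>
    (\<exists>m\<in>{1..mstar}. \<exists>(x :: nat \<Rightarrow> nat \<Rightarrow> ('v, 'e) gpoint) (R :: nat \<Rightarrow> nat \<Rightarrow> real).
       (\<forall>i\<in>{1..m}. (\<forall>n. x i n \<in> points G \<and> R i n > 0) \<and> filterlim (R i) at_top sequentially)
     \<and> (\<forall>i\<in>{1..m}. \<forall>j\<in>{1..m}. i \<noteq> j \<longrightarrow>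
          filterlim (\<lambda>n. sqrt (lam (r n)) * gdist G (x i n) (x j n)) at_top sequentially)
     \<and> (\<forall>i\<in>{1..m}.
          (\<forall>n. is_arg_max (\<lambda>y. \<bar>u (r n) y\<bar>)
                 (\<lambda>y. y \<in> gball G (x i n) (R i n / sqrt (lam (r n)))) (x i n))
        \<and> filterlim (\<lambda>n. \<bar>u (r n) (x i n)\<bar>) at_top sequentially)
     \<and> (\<exists>C>0. \<forall>n. \<forall>y\<in>points G.
          \<bar>u (r n) y\<bar> \<le> C * lam (r n) powr (1 / (p - 2))
             * exp (- (1 / 2) * sqrt (lam (r n)) * (MIN i\<in>{1..m}. gdist G y (x i n))))
     \<and> (\<forall>q::real. q \<ge> 1 \<longrightarrow>
          (\<forall>n. gintegrable G (\<lambda>e t. \<bar>on_edge G (u (r n)) e t\<bar> powr q))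
        \<and> (\<exists>L>0. (\<lambda>n. lam (r n) powr (1 / 2 - q / (p - 2))
               * gintegral G (\<lambda>e t. \<bar>on_edge G (u (r n)) e t\<bar> powr q)) \<longlonglongrightarrow> L)))"
proof -
  interpret fin_graph G by unfold_locales (rule assms(1))
  have sol: "graph_solution G p Wbar b (lam n) (W n) (\<rho> n) (u n)" for n
    by unfold_locales (rule assms)+
  note p2 = \<open>p > 2\<close> and b = \<open>b > 0\<close> and a = \<open>0 < a\<close>
  \<comment> \<open>The natural height of a solution is \<open>lam powr \<theta>\<close>: its power
    \<open>p - 2\<close> is \<open>lam\<close>, so potential and nonlinear term balance.\<close>
  define \<theta> where "\<theta> = 1 / (p - 2)"
  have \<theta>: "\<theta> > 0" "\<theta> * (p - 2) = 1" using p2 by (auto simp: \<theta>_def)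
  have scale: "(A * lam n powr \<theta>) powr (p - 2) = A powr (p - 2) * lam n" if "A \<ge> 0" "lam n > 0" for A n
    using that \<theta> by (simp add: powr_mult powr_powr)
  \<comment> \<open>One more direction than the Morse index allows.\<close>
  define N where "N = Suc mstar"
  obtain l0 where l0: "l0 > 0" "\<And>e. e \<in> edges G \<Longrightarrow> ereal l0 < len G e" using length_lower_bound by blast
  have b1: "b + 1 \<ge> 1" using b by simp
  obtain T \<epsilon>0 where T: "T > 0" and \<epsilon>0: "\<epsilon>0 > 0" and osc: "\<And>v g X \<epsilon> y0. osc_system a p (b + 1) \<epsilon> X v g \<Longrightarrow> 0 \<le> \<epsilon> \<Longrightarrow> \<epsilon> \<le> \<epsilon>0 \<Longrightarrow> 0 \<le> y0 \<Longrightarrow>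
     y0 + T \<le> X \<Longrightarrow> 1 / 2 \<le> \<bar>v y0\<bar> \<Longrightarrow> (\<exists>z::nat \<Rightarrow> real. (\<forall>i\<le>N. y0 < z i \<and> z i \<le> y0 + T \<and> v (z i) = 0) \<and>
       (\<forall>i<N. \<exists>y. z i < y \<and> y < z (Suc i) \<and> v y \<noteq> 0))"
    using osc_many_zeros[OF a b1, of "1 / 2" p N] by auto
  \<comment> \<open>The cap at 1 is required by the rescaling, where it bounds the potential by the
    size of the nonlinear term.\<close>
  define \<epsilon> where "\<epsilon> = min \<epsilon>0 1"
  have \<epsilon>: "0 < \<epsilon>" "0 \<le> \<epsilon>" "\<epsilon> \<le> 1" "\<epsilon> \<le> \<epsilon>0" using \<epsilon>0 by (auto simp: \<epsilon>_def)
  \<comment> \<open>The value gives \<open>\<epsilon> * (M * lam n powr \<theta>) powr (p - 2) = 2 *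
    lam n\<close>, which exceeds \<open>lam n + Wbar\<close> once \<open>lam n\<close> is
    large.\<close>
  define M where "M = (2 / \<epsilon>) powr \<theta>"
  have M: "M > 0" "M powr (p - 2) = 2 / \<epsilon>" using \<epsilon> \<theta> by (auto simp: M_def powr_powr)
  \<comment> \<open>Below the height \<open>\<delta> * lam n powr \<theta>\<close> the nonlinear
    coefficient is at most \<open>lam n / 4\<close>.\<close>
  define \<delta> where "\<delta> = (1 / (4 * b)) powr \<theta>"
  have \<delta>: "\<delta> > 0" "b * \<delta> powr (p - 2) = 1 / 4" using b \<theta> by (auto simp: \<delta>_def powr_powr)
  define \<alpha> where "\<alpha> = 1 / (4 * sqrt ((p - 1) / (p - 2)))"
  have \<alpha>: "\<alpha> > 0" using p2 by (simp add: \<alpha>_def)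
  \<comment> \<open>The condition on \<open>c\<close> is homogeneous: replacing \<open>M\<close> and
    \<open>\<delta>\<close> by their multiples with \<open>lam n powr \<theta>\<close> multiplies
    both sides by the same factor, so one \<open>c\<close> serves all \<open>n\<close>.\<close>
  obtain c where c: "0 < c" "c \<le> 1 / 2" "24 * real (card (edges G)) * c\<^sup>2 * M\<^sup>2 / \<alpha> < \<delta>\<^sup>2 / 16"
  proof -
    have "((\<lambda>c. 24 * real (card (edges G)) * c\<^sup>2 * M\<^sup>2 / \<alpha>) \<longlongrightarrow> 24 * real (card (edges G)) * 0\<^sup>2 * M\<^sup>2 / \<alpha>) (at_right 0)"
      using \<alpha> by (intro tendsto_intros) auto
    then have "\<forall>\<^sub>F c in at_right 0. 24 * real (card (edges G)) * c\<^sup>2 * M\<^sup>2 / \<alpha> < \<delta>\<^sup>2 / 16"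
      using \<delta>(1) by (intro order_tendstoD(2)) auto
    moreover have "\<forall>\<^sub>F c in at_right (0::real). c \<in> {0<..<1/2}" by (rule eventually_at_right_real) simp
    ultimately have "\<forall>\<^sub>F c in at_right (0::real). 0 < c \<and> c \<le> 1/2 \<and> 24 * real (card (edges G)) * c\<^sup>2 * M\<^sup>2 / \<alpha> < \<delta>\<^sup>2 / 16"
      by eventually_elim auto
    from eventually_happens'[OF _ this] show ?thesis using that by auto
  qed
  have "\<forall>\<^sub>F n in sequentially. lam n \<ge> L" for L using assms(13) by (simp add: filterlim_at_top)
  \<comment> \<open>Each summand meets one demand: \<open>lam n \<ge> 1\<close>, a perturbation
    \<open>Wbar\<close> of at most a quarter of \<open>lam n\<close>, edges longer than
    \<open>2 / sqrt (lam n)\<close>, and edges with rescaled room \<open>2 * T\<close>. The factor 3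
    in place of 2 makes the last two strict.\<close>
  then have "\<forall>\<^sub>F n in sequentially. lam n \<ge> 1 + 4 * \<bar>Wbar\<bar> + (3 / l0)\<^sup>2 + (3 * T / (l0 * M powr ((p - 2) / 2)))\<^sup>2" by blast
  then obtain n0 where n0: "\<And>n. n \<ge> n0 \<Longrightarrow> lam n \<ge> 1 + 4 * \<bar>Wbar\<bar> + (3 / l0)\<^sup>2 + (3 * T / (l0 * M powr ((p - 2) / 2)))\<^sup>2"
    unfolding eventually_sequentially by blast
  have Mp: "M powr ((p - 2) / 2) > 0" using M(1) by simp
  have large: "lam n > 0" "lam n \<ge> 1" "Wbar \<le> lam n / 4" "Wbar < lam n"
    "\<And>e. e \<in> edges G \<Longrightarrow> ereal (2 / sqrt (lam n)) < len G e"
    "\<And>e. e \<in> edges G \<Longrightarrow> ereal (2 * T / (M * lam n powr \<theta>) powr ((p - 2) / 2)) < len G e" if n: "n \<ge> n0" for n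
  proof -
    have pos: "0 \<le> (3 / l0)\<^sup>2" "0 \<le> (3 * T / (l0 * M powr ((p - 2) / 2)))\<^sup>2" by auto
    show l1: "lam n \<ge> 1" using n0[OF n] pos by linarith
    then show "lam n > 0" by simp
    then show "Wbar \<le> lam n / 4" "Wbar < lam n" using n0[OF n] pos by linarith+
    have sq: "sqrt (lam n) > 0" using l1 by simp
    have "(3 / l0)\<^sup>2 \<le> lam n" using n0[OF n] pos by linarith
    then have "3 / l0 \<le> sqrt (lam n)" using l0 by (intro real_le_rsqrt)
    then have "2 / sqrt (lam n) < l0" using l0(1) sq by (simp add: field_simps)
    then show "ereal (2 / sqrt (lam n)) < len G e" if "e \<in> edges G" for e
      using l0(2)[OF that] by (meson less_ereal.simps(1) less_trans)
    have "(3 * T / (l0 * M powr ((p - 2) / 2)))\<^sup>2 \<le> lam n" using n0[OF n] pos by linarith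
    then have "3 * T / (l0 * M powr ((p - 2) / 2)) \<le> sqrt (lam n)" by (rule real_le_rsqrt)
    then have "3 * T \<le> l0 * (M powr ((p - 2) / 2) * sqrt (lam n))" using l0(1) Mp by (simp add: pos_divide_le_eq mult_ac)
    then have "2 * T < l0 * (M powr ((p - 2) / 2) * sqrt (lam n))" using T by linarith
    then have lt: "2 * T / (M powr ((p - 2) / 2) * sqrt (lam n)) < l0" using Mp sq by (simp add: pos_divide_less_eq mult_ac)
    have "(M * lam n powr \<theta>) powr ((p - 2) / 2) = M powr ((p - 2) / 2) * lam n powr (\<theta> * ((p - 2) / 2))"
      using M(1) l1 by (simp add: powr_mult powr_powr)
    also have "\<theta> * ((p - 2) / 2) = 1 / 2" using \<theta>(2) by simp
    also have "lam n powr (1 / 2) = sqrt (lam n)" using l1 by (simp add: powr_half_sqrt)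
    finally have "2 * T / (M * lam n powr \<theta>) powr ((p - 2) / 2) < l0" using lt by simp
    then show "ereal (2 * T / (M * lam n powr \<theta>) powr ((p - 2) / 2)) < len G e" if "e \<in> edges G" for e
      using l0(2)[OF that] by (meson less_ereal.simps(1) less_trans)
  qed
  have cont: "continuous_map (gtopology G) euclideanreal (u n)" for n using assms(11)[of n] by (simp add: H1_def)
  have ubound: "\<bar>u n x\<bar> \<le> M * lam n powr \<theta>" if n: "n \<ge> n0" and x: "x \<in> points G" for n x
  proof (rule graph_solution.sup_bound[OF sol a _ _ \<epsilon>(2,3) T _ large(4)[OF n] _ _ large(6)[OF n] x, where N=N])
    show "AE_edge G e (\<lambda>x. a \<le> \<rho> n x) \<or> AE_edge G e (\<lambda>x. \<rho> n x = 0)" if "e \<in> edges G" for e using assms(10)[OF that] by blast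
    show "\<exists>z::nat \<Rightarrow> real. (\<forall>i\<le>N. y0 < z i \<and> z i \<le> y0 + T \<and> v (z i) = 0) \<and> (\<forall>i<N. \<exists>y. z i < y \<and> y < z (Suc i) \<and> v y \<noteq> 0)"
      if "osc_system a p (b + 1) \<epsilon> X v g" "0 \<le> y0" "y0 + T \<le> X" "1 / 2 \<le> \<bar>v y0\<bar>" for v g X y0
      using osc[OF that(1) \<epsilon>(2,4) that(2-4)] .
    show "morse_index G p (W n) (\<rho> n) (lam n) (u n) < enat N"
      using assms(14)[of n] by (rule le_less_trans) (simp add: N_def)
    show "M * lam n powr \<theta> > 0" using M(1) large(1)[OF n] by simp
    have "\<epsilon> * (M * lam n powr \<theta>) powr (p - 2) = 2 * lam n"
      using scale[of M n] M large(1)[OF n] \<epsilon>(1) by simp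
    then show "lam n + Wbar \<le> \<epsilon> * (M * lam n powr \<theta>) powr (p - 2)" using large(4)[OF n] by linarith
  qed
  have \<delta>scale: "b * (\<delta> * lam n powr \<theta>) powr (p - 2) = lam n / 4" if "n \<ge> n0" for n
    using scale[of \<delta> n] \<delta> large(1)[OF that] by (simp add: mult.assoc[symmetric])
  have nontrivial: "\<exists>x\<in>points G. \<delta> * lam n powr \<theta> \<le> \<bar>u n x\<bar>" if n: "n \<ge> n0" for n
  proof (rule ccontr)
    assume c: "\<not> ?thesis"
    have "u n = (\<lambda>x. 0)"
    proof (rule graph_solution.small_imp_zero[OF sol large(1,3,5)[OF n]])
      fix x assume "x \<in> points G"
      then have "\<bar>u n x\<bar> \<le> \<delta> * lam n powr \<theta>" using c by force
      then have "\<bar>u n x\<bar> powr (p - 2) \<le> (\<delta> * lam n powr \<theta>) powr (p - 2)" using p2 by (intro powr_mono2) auto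
      then have "b * \<bar>u n x\<bar> powr (p - 2) \<le> b * (\<delta> * lam n powr \<theta>) powr (p - 2)" using b by (intro mult_left_mono) auto
      then show "b * \<bar>u n x\<bar> powr (p - 2) \<le> lam n / 2" using \<delta>scale[OF n] large(1)[OF n] by linarith
    qed
    then show False using assms(11)[of n] by (simp add: zero_fun_def)
  qed
  obtain r m x K where r: "strict_mono r" "\<And>n. r n \<ge> n0" and m: "m \<in> {1..mstar}" and K: "0 \<le> K"
    and x: "\<And>i n. i \<in> {1..m} \<Longrightarrow> x i n \<in> points G \<and> \<delta> * lam (r n) powr \<theta> \<le> \<bar>u (r n) (x i n)\<bar>"
    and xsep: "\<And>i j n. i \<in> {1..m} \<Longrightarrow> j \<in> {1..m} \<Longrightarrow> i \<noteq> j \<Longrightarrow> real n + 1 \<le> sqrt (lam (r n)) * gdist G (x i n) (x j n)"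
    and xmax: "\<And>i n y. i \<in> {1..m} \<Longrightarrow> y \<in> points G \<Longrightarrow> sqrt (lam (r n)) * gdist G (x i n) y < real n + 1 \<Longrightarrow> \<bar>u (r n) y\<bar> \<le> \<bar>u (r n) (x i n)\<bar>"
    and cover: "\<And>n y. y \<in> points G \<Longrightarrow> \<delta> * lam (r n) powr \<theta> \<le> \<bar>u (r n) y\<bar> \<Longrightarrow> \<exists>i\<in>{1..m}. sqrt (lam (r n)) * gdist G (x i n) y \<le> K"
  proof (rule select_peaks[where f=u and s="\<lambda>n. sqrt (lam n)" and \<delta>="\<lambda>n. \<delta> * lam n powr \<theta>" and N=mstar and ?r0.0="2 * ln (1 / c) / \<alpha>" and ?n0.0=n0])
    show "continuous_map (gtopology G) euclideanreal (u n)" for n by (rule cont)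
    show "sqrt (lam n) > 0" if "n \<ge> n0" for n using large(1)[OF that] by simp
    show "\<exists>x\<in>points G. \<delta> * lam n powr \<theta> \<le> \<bar>u n x\<bar>" if "n \<ge> n0" for n by (rule nontrivial[OF that])
    fix n and y :: "nat \<Rightarrow> ('v, 'e) gpoint"
    assume n: "n \<ge> n0" and y: "\<And>i. i \<in> {1..Suc mstar} \<Longrightarrow> y i \<in> points G \<and> \<delta> * lam n powr \<theta> \<le> \<bar>u n (y i)\<bar>"
      and sep: "\<And>i j. i \<in> {1..Suc mstar} \<Longrightarrow> j \<in> {1..Suc mstar} \<Longrightarrow> i \<noteq> j \<Longrightarrow> 2 * ln (1 / c) / \<alpha> \<le> sqrt (lam n) * gdist G (y i) (y j)"
    have "enat (card {1..Suc mstar}) \<le> morse_index G p (W n) (\<rho> n) (lam n) (u n)"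
    proof (rule graph_solution.separated_peaks[OF sol large(1,3,5)[OF n] ubound[OF n] _ y _ c(1,2)])
      show "0 < \<delta> * lam n powr \<theta>" using \<delta>(1) large(1)[OF n] by simp
      have "24 * real (card (edges G)) * c\<^sup>2 * M\<^sup>2 / \<alpha> * (lam n powr \<theta>)\<^sup>2 < \<delta>\<^sup>2 / 16 * (lam n powr \<theta>)\<^sup>2"
        using c(3) large(1)[OF n] by (intro mult_strict_right_mono) auto
      then show "24 * real (card (edges G)) * c\<^sup>2 * (M * lam n powr \<theta>)\<^sup>2 / (1 / (4 * sqrt ((p - 1) / (p - 2)))) < (\<delta> * lam n powr \<theta>)\<^sup>2 / 16"
        unfolding \<alpha>_def[symmetric] by (simp add: power_mult_distrib)
    qed (use sep in \<open>auto simp: \<alpha>_def\<close>)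
    from order_trans[OF this assms(14)[of n]] show False by simp
  qed blast
  have rl: "lam (r n) > 0" "lam (r n) \<ge> 1" for n using large(1,2)[OF r(2)] by auto
  \<comment> \<open>The nonlinear coefficient is at most \<open>Kb * lam (r n)\<close>, because
    \<open>\<bar>u (r n)\<bar> \<le> M * lam (r n) powr \<theta>\<close>.\<close>
  define Kb where "Kb = b * M powr (p - 2)"
  have Kb: "0 \<le> Kb" using b by (simp add: Kb_def)
  define Cd where "Cd = sqrt (48 * Kb * exp (2 * K) * real m * real (card (edges G))) * real m"
  have Cd: "0 \<le> Cd" using Kb by (simp add: Cd_def)
  have ne: "{1..m} \<noteq> {}" using m by simp
  have dec: "\<bar>u (r n) y\<bar> \<le> M * lam (r n) powr \<theta> * Cd * exp (- (sqrt (lam (r n)) / 2) * (MIN i\<in>{1..m}. gdist G (x i n) y))"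
    if y: "y \<in> points G" for n y
  proof -
    have "\<bar>u (r n) y\<bar> \<le> M * lam (r n) powr \<theta> * (sqrt (48 * Kb * exp (2 * K) * real (card {1..m}) * real (card (edges G))) * real (card {1..m})) *
      exp (- (sqrt (lam (r n)) / 2) * (MIN i\<in>{1..m}. gdist G (x i n) y))"
    proof (rule graph_solution.decay[OF sol large(1,3,5)[OF r(2)] _ ne _ ubound[OF r(2)] _ less_imp_le[OF b] Kb K, where \<delta>="\<delta> * lam (r n) powr \<theta>"])
      show "b * (M * lam (r n) powr \<theta>) powr (p - 2) \<le> Kb * lam (r n)"
        using scale[of M "r n"] M(1) rl(1)[of n] by (simp add: Kb_def)
      show "0 \<le> \<delta> * lam (r n) powr \<theta>" using \<delta>(1) by simp
      show "b * (\<delta> * lam (r n) powr \<theta>) powr (p - 2) \<le> lam (r n) / 4" using \<delta>scale[OF r(2)] by simp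
    qed (use x cover y in auto)
    then show ?thesis by (simp add: Cd_def)
  qed
  \<comment> \<open>Normalisation to values in \<open>[0, 1]\<close>, where powers decrease in the
    exponent.\<close>
  define w where "w n y = \<bar>u (r n) y\<bar> / (M * lam (r n) powr \<theta>)" for n y
  have ml: "M * lam (r n) powr \<theta> > 0" for n using M(1) rl(1)[of n] by simp
  have wc: "continuous_map (gtopology G) euclideanreal (w n)" for n
    unfolding w_def by (rule continuous_map_compose_real[OF cont, where K=UNIV]) (auto intro!: continuous_intros less_imp_neq[OF ml, symmetric])
  have w01: "0 \<le> w n y \<and> w n y \<le> 1" if "y \<in> points G" for n y
    using ubound[OF r(2) that, of n] ml[of n] by (simp add: w_def)
  have wd: "w n y \<le> Cd * exp (- (sqrt (lam (r n)) / 2) * (MIN i\<in>{1..m}. gdist G (x i n) y))" if "y \<in> points G" for n y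
    using dec[OF that, of n] ml[of n] by (simp add: w_def pos_divide_le_eq mult_ac)
  have sl: "sqrt (lam (r n)) > 0" for n using rl(1)[of n] by simp
  have xp: "x i n \<in> points G" if "i \<in> {1..m}" for i n using x[OF that] by blast
  have w0: "0 \<le> w n y" if "y \<in> points G" for n y using w01[OF that] by blast
  note half = exp_bound_sqrt_integral[OF wc w0 finite_atLeastAtMost ne xp sl Cd wd]
  define C0 where "C0 = 24 * sqrt Cd * real (card {1..m}) * real (card (edges G))"
  have onw: "on_edge G (w n) e t = \<bar>on_edge G (u (r n)) e t\<bar> / (M * lam (r n) powr \<theta>)" for n e t by (simp add: w_def on_edge_def)
  have upow: "\<bar>on_edge G (u (r n)) e t\<bar> powr q = (M * lam (r n) powr \<theta>) powr q * on_edge G (w n) e t powr q" for n e t q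
    unfolding onw using M(1) rl(1)[of n] by (auto simp: powr_divide)
  have wint: "gintble (\<lambda>e t. on_edge G (w n) e t powr q)" if q: "1 \<le> q" for n q
  proof (rule gintble_bound[OF half(1)[of n]])
    fix e assume e: "e \<in> edges G"
    show "(\<lambda>t. on_edge G (w n) e t powr q) \<in> borel_measurable (edge_measure e)"
      using on_edge_measurable[OF wc e] by measurable
    show "AE t in edge_measure e. \<bar>on_edge G (w n) e t powr q\<bar> \<le> on_edge G (w n) e t powr (1 / 2)"
    proof (rule AE_I2)
      fix t assume "t \<in> space (edge_measure e)"
      then have "0 \<le> on_edge G (w n) e t \<and> on_edge G (w n) e t \<le> 1" using w01[OF pt_int_points[OF e]] by (simp add: on_edge_def)
      then show "\<bar>on_edge G (w n) e t powr q\<bar> \<le> on_edge G (w n) e t powr (1 / 2)" using q by (auto intro!: powr_mono')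
    qed
  qed
  have uint: "gintble (\<lambda>e t. \<bar>on_edge G (u (r n)) e t\<bar> powr q)" if "1 \<le> q" for n q
    unfolding upow by (rule gintble_cmult[OF wint[OF that]])
  \<comment> \<open>Comes from \<open>sup_le_Lp\<close> at a point of height at least
    \<open>\<delta> * lam (r n) powr \<theta>\<close>: the powers of \<open>lam (r n)\<close> cancel
    up to one factor \<open>sqrt (lam (r n))\<close>, because
    \<open>\<theta> * p = 2 * \<theta> + 1\<close>.\<close>
  define cp where "cp = \<delta>\<^sup>2 / (8 * b * M powr p)"
  have cp: "cp > 0" using \<delta> b M(1) by (simp add: cp_def)
  have lower: "cp \<le> sqrt (lam (r n)) * gint (\<lambda>e t. on_edge G (w n) e t powr p)" for n
  proof -
    define L where "L = lam (r n)"
    define Jp where "Jp = gint (\<lambda>e t. on_edge G (w n) e t powr p)"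
    have L: "L > 0" using rl(1) by (simp add: L_def)
    obtain y where y: "y \<in> points G" "\<delta> * L powr \<theta> \<le> \<bar>u (r n) y\<bar>" using nontrivial[OF r(2)] unfolding L_def by blast
    have p1: "1 \<le> p" using p2 by simp
    have "(\<delta> * L powr \<theta>)\<^sup>2 \<le> \<bar>u (r n) y\<bar>\<^sup>2" using y(2) \<delta>(1) by (intro power_mono) auto
    also have "\<dots> = (u (r n) y)\<^sup>2" by simp
    also have "\<dots> \<le> 8 * gint (\<lambda>e t. b * \<bar>on_edge G (u (r n)) e t\<bar> powr p) / sqrt L"
      unfolding L_def by (rule graph_solution.sup_le_Lp[OF sol large(1,3,5)[OF r(2)] gintble_cmult[OF uint[OF p1]] y(1)])
    also have "gint (\<lambda>e t. b * \<bar>on_edge G (u (r n)) e t\<bar> powr p) = b * ((M * L powr \<theta>) powr p * Jp)"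
      unfolding upow gint_cmult Jp_def L_def by simp
    finally have "\<delta>\<^sup>2 * (L powr \<theta>)\<^sup>2 \<le> 8 * b * (M * L powr \<theta>) powr p * Jp / sqrt L" by (simp add: power_mult_distrib mult_ac)
    also have "(M * L powr \<theta>) powr p = M powr p * ((L powr \<theta>)\<^sup>2 * L)"
    proof -
      have "\<theta> * p = \<theta> * (p - 2) + 2 * \<theta>" by (simp add: algebra_simps)
      then have "\<theta> * p = 2 * \<theta> + 1" using \<theta>(2) by simp
      moreover have "L powr (2 * \<theta> + 1) = (L powr \<theta>)\<^sup>2 * L" using L powr_add[of L \<theta> \<theta>] by (simp add: powr_add power2_eq_square)
      ultimately show ?thesis using M(1) L by (simp add: powr_mult powr_powr)
    qed
    finally have "\<delta>\<^sup>2 * (L powr \<theta>)\<^sup>2 \<le> (8 * b * M powr p * (L / sqrt L) * Jp) * (L powr \<theta>)\<^sup>2" by (simp add: mult_ac)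
    then have "\<delta>\<^sup>2 \<le> 8 * b * M powr p * (L / sqrt L) * Jp" using L by (subst (asm) mult_le_cancel_right_pos) auto
    then have "\<delta>\<^sup>2 \<le> (8 * b * M powr p) * (sqrt L * Jp)" using L by (simp add: real_div_sqrt mult_ac)
    then show ?thesis unfolding cp_def Jp_def L_def using b M(1) by (simp add: pos_divide_le_eq mult_ac)
  qed
  have C0b: "sqrt (lam (r n)) * gint (\<lambda>e t. on_edge G (w n) e t powr (1 / 2)) \<le> C0" for n
    unfolding C0_def by (rule half(2))
  have p1: "1 \<le> p" using p2 by simp
  \<comment> \<open>A second extraction is made for the integrals; the peaks are carried along, and
    their separation and radii stay at least \<open>n + 1\<close> because
    \<open>k n \<ge> n\<close>.\<close>
  from powr_integrals_converge(2)[OF wc w01 sl half(1) C0b p1 cp lower]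
  obtain k where k0: "strict_mono (k :: nat \<Rightarrow> nat) \<and>
    (\<forall>q\<ge>1. \<exists>L>0. (\<lambda>n. sqrt (lam (r (k n))) * gint (\<lambda>e t. on_edge G (w (k n)) e t powr q)) \<longlonglongrightarrow> L)"
    by (rule exE)
  note k = conjunct1[OF k0] conjunct2[OF k0, rule_format]
  have klim: "filterlim k at_top sequentially" by (rule filterlim_subseq[OF k(1)])
  have linear: "filterlim (\<lambda>n. real (k n) + 1) at_top sequentially"
    by (rule filterlim_compose[OF _ klim]) real_asymp
  have lamk: "filterlim (\<lambda>n. lam (r (k n))) at_top sequentially"
    by (rule filterlim_compose[OF assms(13) filterlim_compose[OF filterlim_subseq[OF r(1)] klim]])
  show ?thesis
  proof (rule exI[of _ "\<lambda>n. r (k n)"], intro conjI)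
    show "strict_mono (\<lambda>n. r (k n))" using strict_mono_o[OF r(1) k(1)] by (simp add: o_def)
    show "\<forall>n. lam (r (k n)) > 0" using rl(1) by blast
    show "\<exists>m\<in>{1..mstar}. \<exists>(x :: nat \<Rightarrow> nat \<Rightarrow> ('v, 'e) gpoint) (R :: nat \<Rightarrow> nat \<Rightarrow> real).
       (\<forall>i\<in>{1..m}. (\<forall>n. x i n \<in> points G \<and> R i n > 0) \<and> filterlim (R i) at_top sequentially)
     \<and> (\<forall>i\<in>{1..m}. \<forall>j\<in>{1..m}. i \<noteq> j \<longrightarrow>
          filterlim (\<lambda>n. sqrt (lam (r (k n))) * gdist G (x i n) (x j n)) at_top sequentially)
     \<and> (\<forall>i\<in>{1..m}.
          (\<forall>n. is_arg_max (\<lambda>y. \<bar>u (r (k n)) y\<bar>)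
                 (\<lambda>y. y \<in> gball G (x i n) (R i n / sqrt (lam (r (k n))))) (x i n))
        \<and> filterlim (\<lambda>n. \<bar>u (r (k n)) (x i n)\<bar>) at_top sequentially)
     \<and> (\<exists>C>0. \<forall>n. \<forall>y\<in>points G.
          \<bar>u (r (k n)) y\<bar> \<le> C * lam (r (k n)) powr (1 / (p - 2))
             * exp (- (1 / 2) * sqrt (lam (r (k n))) * (MIN i\<in>{1..m}. gdist G y (x i n))))
     \<and> (\<forall>q::real. q \<ge> 1 \<longrightarrow>
          (\<forall>n. gintegrable G (\<lambda>e t. \<bar>on_edge G (u (r (k n))) e t\<bar> powr q))
        \<and> (\<exists>L>0. (\<lambda>n. lam (r (k n)) powr (1 / 2 - q / (p - 2))
               * gintegral G (\<lambda>e t. \<bar>on_edge G (u (r (k n))) e t\<bar> powr q)) \<longlonglongrightarrow> L))"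
    \<comment> \<open>The radii are those on which \<open>select_peaks\<close> provides maxima, read
      along the second subsequence.\<close>
    proof (rule bexI[OF _ m], rule exI[of _ "\<lambda>i n. x i (k n)"], rule exI[of _ "\<lambda>i n. real (k n) + 1"], intro conjI ballI allI impI)
      fix i n assume i: "i \<in> {1..m}"
      show "x i (k n) \<in> points G" using x[OF i] by blast
      show "0 < real (k n) + 1" by simp
      show "filterlim (\<lambda>n. real (k n) + 1) at_top sequentially" by (rule linear)
    next
      fix i j assume ij: "i \<in> {1..m}" "j \<in> {1..m}" "i \<noteq> j"
      show "filterlim (\<lambda>n. sqrt (lam (r (k n))) * gdist G (x i (k n)) (x j (k n))) at_top sequentially"
        by (rule filterlim_at_top_mono[OF linear]) (use xsep[OF ij] in simp)
    next
      fix i n assume i: "i \<in> {1..m}"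
      have xi: "x i (k n) \<in> points G" using x[OF i] by blast
      show "is_arg_max (\<lambda>y. \<bar>u (r (k n)) y\<bar>) (\<lambda>y. y \<in> gball G (x i (k n)) ((real (k n) + 1) / sqrt (lam (r (k n))))) (x i (k n))"
        unfolding is_arg_max_def
      proof (intro conjI notI)
        show "x i (k n) \<in> gball G (x i (k n)) ((real (k n) + 1) / sqrt (lam (r (k n))))"
          using xi sl[of "k n"] by (simp add: gm.in_mball)
        assume "\<exists>y. y \<in> gball G (x i (k n)) ((real (k n) + 1) / sqrt (lam (r (k n)))) \<and> \<bar>u (r (k n)) (x i (k n))\<bar> < \<bar>u (r (k n)) y\<bar>"
        then obtain y where y: "y \<in> points G" "gdist G (x i (k n)) y < (real (k n) + 1) / sqrt (lam (r (k n)))"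
          "\<bar>u (r (k n)) (x i (k n))\<bar> < \<bar>u (r (k n)) y\<bar>" by (auto simp: gm.in_mball)
        have "sqrt (lam (r (k n))) * gdist G (x i (k n)) y < real (k n) + 1" using y(2) sl[of "k n"] by (simp add: pos_less_divide_eq mult.commute)
        from xmax[OF i y(1) this] show False using y(3) by simp
      qed
    next
      fix i assume i: "i \<in> {1..m}"
      have "filterlim (\<lambda>l. \<delta> * l powr \<theta>) at_top (at_top :: real filter)" using \<delta>(1) \<theta>(1) by real_asymp
      then have "filterlim (\<lambda>n. \<delta> * lam (r (k n)) powr \<theta>) at_top sequentially" by (rule filterlim_compose[OF _ lamk])
      then show "filterlim (\<lambda>n. \<bar>u (r (k n)) (x i (k n))\<bar>) at_top sequentially"
        by (rule filterlim_at_top_mono) (use x[OF i] in simp)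
    next
      show "\<exists>C>0. \<forall>n. \<forall>y\<in>points G. \<bar>u (r (k n)) y\<bar> \<le> C * lam (r (k n)) powr (1 / (p - 2))
             * exp (- (1 / 2) * sqrt (lam (r (k n))) * (MIN i\<in>{1..m}. gdist G y (x i (k n))))"
      \<comment> \<open>Adding 1 gives a positive constant without asking whether \<open>Cd\<close>
        is positive.\<close>
      proof (rule exI[of _ "M * Cd + 1"], intro conjI allI ballI)
        show "0 < M * Cd + 1" using M(1) Cd by (simp add: add_nonneg_pos)
        fix n y assume y: "y \<in> points G"
        have "(\<lambda>i. gdist G (x i (k n)) y) = (\<lambda>i. gdist G y (x i (k n)))" using gm.commute by blast
        then have "\<bar>u (r (k n)) y\<bar> \<le> M * lam (r (k n)) powr \<theta> * Cd * exp (- (sqrt (lam (r (k n))) / 2) * (MIN i\<in>{1..m}. gdist G y (x i (k n))))"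
          using dec[OF y, of "k n"] by (simp only:)
        also have "\<dots> = (M * Cd) * (lam (r (k n)) powr \<theta> * exp (- (1 / 2) * sqrt (lam (r (k n))) * (MIN i\<in>{1..m}. gdist G y (x i (k n)))))"
          by simp
        also have "\<dots> \<le> (M * Cd + 1) * (lam (r (k n)) powr \<theta> * exp (- (1 / 2) * sqrt (lam (r (k n))) * (MIN i\<in>{1..m}. gdist G y (x i (k n)))))"
          by (intro mult_right_mono) auto
        finally show "\<bar>u (r (k n)) y\<bar> \<le> (M * Cd + 1) * lam (r (k n)) powr (1 / (p - 2))
             * exp (- (1 / 2) * sqrt (lam (r (k n))) * (MIN i\<in>{1..m}. gdist G y (x i (k n))))"
          by (simp add: \<theta>_def mult.assoc)
      qed
    next
      fix q :: real and n assume q: "1 \<le> q"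
      show "gintegrable G (\<lambda>e t. \<bar>on_edge G (u (r (k n))) e t\<bar> powr q)" unfolding gintegrable_gintble by (rule uint[OF q])
    next
      fix q :: real assume q: "1 \<le> q"
      obtain L where L: "L > 0" "(\<lambda>n. sqrt (lam (r (k n))) * gint (\<lambda>e t. on_edge G (w (k n)) e t powr q)) \<longlonglongrightarrow> L" using k(2)[OF q] by blast
      \<comment> \<open>Undoing the normalisation gives the factor
        \<open>lam powr (\<theta> * q)\<close>, which cancels the \<open>q\<close>-dependent part of
        the prefactor and leaves \<open>sqrt lam\<close>.\<close>
      have eq: "lam (r (k n)) powr (1 / 2 - q / (p - 2)) * gintegral G (\<lambda>e t. \<bar>on_edge G (u (r (k n))) e t\<bar> powr q)
        = M powr q * (sqrt (lam (r (k n))) * gint (\<lambda>e t. on_edge G (w (k n)) e t powr q))" for n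
      proof -
        have "lam (r (k n)) powr (1 / 2 - q / (p - 2)) * (M * lam (r (k n)) powr \<theta>) powr q = M powr q * (lam (r (k n)) powr (1 / 2 - q / (p - 2)) * lam (r (k n)) powr (\<theta> * q))"
          using M(1) rl(1)[of "k n"] by (simp add: powr_mult powr_powr)
        also have "lam (r (k n)) powr (1 / 2 - q / (p - 2)) * lam (r (k n)) powr (\<theta> * q) = lam (r (k n)) powr (1 / 2)"
          by (simp add: powr_add[symmetric] \<theta>_def)
        also have "\<dots> = sqrt (lam (r (k n)))" using rl(1)[of "k n"] by (simp add: powr_half_sqrt)
        finally have "lam (r (k n)) powr (1 / 2 - q / (p - 2)) * (M * lam (r (k n)) powr \<theta>) powr q = M powr q * sqrt (lam (r (k n)))" .
        then show ?thesis unfolding gintegral_gint upow gint_cmult by (simp add: mult.assoc[symmetric])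
      qed
      have "(\<lambda>n. M powr q * (sqrt (lam (r (k n))) * gint (\<lambda>e t. on_edge G (w (k n)) e t powr q))) \<longlonglongrightarrow> M powr q * L"
        by (intro tendsto_mult tendsto_const L(2))
      then show "\<exists>L>0. (\<lambda>n. lam (r (k n)) powr (1 / 2 - q / (p - 2)) * gintegral G (\<lambda>e t. \<bar>on_edge G (u (r (k n))) e t\<bar> powr q)) \<longlonglongrightarrow> L"
        unfolding eq using L(1) M(1) by (intro exI[of _ "M powr q * L"]) simp
    qed
  qed
qed

end
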